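(* Let $P(x,y)$ be a polynomial over $\mathbb{C}$ in noncommuting elements $x$ and $y$ such that $P(0,0)=0$. Let $P_1(x):=P(x,0)$ and $Q_1(y):=P(0,y)$. Let $r,s\in\mathbb{N}$ and let $$A=\mathrm{diag}(\alpha_1,\dots,\alpha_r,0,\dots,0),\qquad B=\mathrm{diag}(\beta_1,\dots,\beta_s,0,\dots,0)$$ be $N\times N$ matrices with fixed $\alpha_i,\beta_j\in\mathbb{C}\setminus\{0\}$ for all $i\in[r]$, $j\in[s]$. Let $U=U^{(N)}=(u^{(N)}_{i,j})_{i,j\in[N]}$ be an $N\times N$ Haar unitary random matrix. Then the $r+s$ nontrivial eigenvalues (defined in the context) of the random matrix $P(A,UBU^* )$ converge almost surely, as $N\to\infty$, to $\{P_1(\alpha_i)\}_{i=1}^r$ and $\{Q_1(\beta_j)\}_{j=1}^s$. If these $r+s$ limiting values are all distinct, then the nontrivial eigenvalues of $P(A,UBU^* )$ are of the forms $$P_1(\alpha_i)+\frac1N\sum_{j\in[s]}p_{i,j}\left|\sqrt N u^{(N)}_{i,j}\right|^2+\frac{\xi_i^{(N)}}{N^{3/2}},\quad i\in[r],$$ and $$Q_1(\beta_j)+\frac1N\sum_{i\in[r]}q_{i,j}\left|\sqrt N u^{(N)}_{i,j}\right|^2+\frac{\zeta_j^{(N)}}{N^{3/2}},\quad j\in[s],$$ where $\xi_i^{(N)},\zeta_j^{(N)}$ are random variables that converge in law to $\mathbb{C}$-valued random variables as $N\to\infty$, and $p_{i,j},q_{i,j}$ are the explicit complex constants $$p_{i,j}=P_2(\alpha_i,\beta_j)+P_3(\alpha_i,\beta_j)+\frac{[P_1(\alpha_i)+P_2(\alpha_i,\beta_j)]\,[Q_1(\beta_j)+Q_2(\alpha_i,\beta_j)]}{P_1(\alpha_i)-Q_1(\beta_j)},$$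 $$q_{i,j}=Q_2(\alpha_i,\beta_j)+Q_3(\alpha_i,\beta_j)-\frac{[P_1(\alpha_i)+P_2(\alpha_i,\beta_j)]\,[Q_1(\beta_j)+Q_2(\alpha_i,\beta_j)]}{P_1(\alpha_i)-Q_1(\beta_j)},$$ with $P_2,P_3,Q_2,Q_3$ defined from $P$ in the context. The random variables $\{|\sqrt N u^{(N)}_{i,j}|^2\mid i\in[r],j\in[s]\}$ converge (jointly) in law to i.i.d. standard exponential random variables.
   Context: $r,s$ are fixed, $N$ is taken sufficiently large (in particular $N\ge r+s$), and the random matrices $U^{(N)}$, for all $N$, are defined on a common probability space. $[n]=\{1,\dots,n\}$. Eigenvalues are counted with algebraic multiplicity; the nontrivial eigenvalues are labeled suitably. Nontrivial eigenvalues. Let $u_j$ be the $j$-th column of $U^{(N)}$, $e_i$ the $i$-th standard basis vector of $\mathbb{C}^N$, $\widehat U=(u^{(N)}_{i,j})_{i\in[r],j\in[s]}$, $\widehat A=\mathrm{diag}(\alpha_1,\dots,\alpha_r)$, $\widehat B=\mathrm{diag}(\beta_1,\dots,\beta_s)$. Almost surely $(e_1,\dots,e_r,u_1,\dots,u_s,e_{r+1},\dots,e_{N-s})$ is a basis of $\mathbb{C}^N$. With respect to it, $P(A,UBU^* )$ is represented by a matrix whose last $N-r-s$ rows vanish. The nontrivial eigenvalues of $P(A,UBU^* )$ are the $r+s$ eigenvalues of the upper-left $(r+s)\times(r+s)$ block of this representing matrix; this block equals $P(a,b)$ with $$a=\begin{pmatrix}\widehat A&\widehat A\widehat U\\0&0\end{pmatrix},\qquad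 b=\begin{pmatrix}0&0\\ \widehat B\widehat U^*&\widehat B\end{pmatrix}.$$ Decomposition of $P$. Write uniquely $$P(x,y)=P_1(x)+Q_1(y)+P_2(x,y)+Q_2(x,y)+P_3(x,y)+Q_3(x,y)+R(x,y),$$ $$P_2=\sum_{k,\ell\ge1}a_{k,\ell}x^ky^\ell,\quad Q_2=\sum_{k,\ell\ge1}b_{k,\ell}y^\ell x^k,\quad P_3=\sum_{k,\ell,m\ge1}c_{k,\ell,m}x^ky^\ell x^m,\quad Q_3=\sum_{k,\ell,m\ge1}d_{k,\ell,m}y^\ell x^ky^m,$$ with complex coefficients (finite sums), where $R$ is a linear combination of monomials of length larger than three, each maximal power $x^k$ or $y^\ell$ in a monomial counting as length one. In the formulas for $p_{i,j},q_{i,j}$ these polynomials are evaluated at the scalars $x=\alpha_i$, $y=\beta_j$. *)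

theory Defs
  imports
    "HOL-Probability.Probability"
    "HOL-Library.Poly_Mapping"
    "Jordan_Normal_Form.Schur_Decomposition"
    "Jordan_Normal_Form.Gauss_Jordan_Elimination"
begin

section \<open>Polynomials in two noncommuting variables\<close>

datatype letter = LX | LY

text \<open>An element of the free algebra on \<open>x\<close> and \<open>y\<close> over the complex numbers: a finitely
  supported assignment of coefficients to words. The empty word carries the constant term.\<close>

type_synonym nc_poly = "letter list \<Rightarrow>\<^sub>0 complex"

fun letter_val :: "'a \<Rightarrow> 'a \<Rightarrow> letter \<Rightarrow> 'a" where
  "letter_val a b LX = a"
| "letter_val a b LY = b"

definition nc_eval :: "nc_poly \<Rightarrow> complex \<Rightarrow> complex \<Rightarrow> complex" where
  "nc_eval P x y = (\<Sum>w\<in>Poly_Mapping.keys P. Poly_Mapping.lookup P w * prod_list (map (letter_val x y) w))"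

primrec nc_word_mat :: "nat \<Rightarrow> complex mat \<Rightarrow> complex mat \<Rightarrow> letter list \<Rightarrow> complex mat" where
  "nc_word_mat n a b [] = 1\<^sub>m n"
| "nc_word_mat n a b (l # w) = letter_val a b l * nc_word_mat n a b w"

text \<open>The value at two matrices of size \<open>n\<close>; matrices of fixed size are not a type, so the
  linear combination of the words is taken entrywise.\<close>

definition nc_eval_mat :: "nat \<Rightarrow> nc_poly \<Rightarrow> complex mat \<Rightarrow> complex mat \<Rightarrow> complex mat" where
  "nc_eval_mat n P a b =
     Matrix.mat n n (\<lambda>ij. \<Sum>w\<in>Poly_Mapping.keys P. Poly_Mapping.lookup P w * nc_word_mat n a b w $$ ij)"

definition nc_P1 :: "nc_poly \<Rightarrow> complex \<Rightarrow> complex" where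
  "nc_P1 P x = nc_eval P x 0"

definition nc_Q1 :: "nc_poly \<Rightarrow> complex \<Rightarrow> complex" where
  "nc_Q1 P y = nc_eval P 0 y"

text \<open>The words \<open>x\<^sup>k y\<^sup>l\<close>, \<open>y\<^sup>l x\<^sup>k\<close>, \<open>x\<^sup>k y\<^sup>l x\<^sup>m\<close>, \<open>y\<^sup>l x\<^sup>k y\<^sup>m\<close>.\<close>

definition word_xy :: "nat \<Rightarrow> nat \<Rightarrow> letter list" where
  "word_xy k l = replicate k LX @ replicate l LY"

definition word_yx :: "nat \<Rightarrow> nat \<Rightarrow> letter list" where
  "word_yx k l = replicate l LY @ replicate k LX"

definition word_xyx :: "nat \<Rightarrow> nat \<Rightarrow> nat \<Rightarrow> letter list" where
  "word_xyx k l m = replicate k LX @ replicate l LY @ replicate m LX"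

definition word_yxy :: "nat \<Rightarrow> nat \<Rightarrow> nat \<Rightarrow> letter list" where
  "word_yxy k l m = replicate l LY @ replicate k LX @ replicate m LY"

text \<open>The components \<open>P\<^sub>2, Q\<^sub>2, P\<^sub>3, Q\<^sub>3\<close> of \<open>P\<close>, evaluated at scalars. The index sets are cut down
  to the support of \<open>P\<close> because a sum over an infinite set would be \<open>0\<close> by convention.\<close>

definition nc_P2 :: "nc_poly \<Rightarrow> complex \<Rightarrow> complex \<Rightarrow> complex" where
  "nc_P2 P x y =
     (\<Sum>(k, l)\<in>{(k, l). 1 \<le> k \<and> 1 \<le> l \<and> word_xy k l \<in> Poly_Mapping.keys P}.
        Poly_Mapping.lookup P (word_xy k l) * x ^ k * y ^ l)"

definition nc_Q2 :: "nc_poly \<Rightarrow> complex \<Rightarrow> complex \<Rightarrow> complex" where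
  "nc_Q2 P x y =
     (\<Sum>(k, l)\<in>{(k, l). 1 \<le> k \<and> 1 \<le> l \<and> word_yx k l \<in> Poly_Mapping.keys P}.
        Poly_Mapping.lookup P (word_yx k l) * y ^ l * x ^ k)"

definition nc_P3 :: "nc_poly \<Rightarrow> complex \<Rightarrow> complex \<Rightarrow> complex" where
  "nc_P3 P x y =
     (\<Sum>(k, l, m)\<in>{(k, l, m). 1 \<le> k \<and> 1 \<le> l \<and> 1 \<le> m \<and> word_xyx k l m \<in> Poly_Mapping.keys P}.
        Poly_Mapping.lookup P (word_xyx k l m) * x ^ k * y ^ l * x ^ m)"

definition nc_Q3 :: "nc_poly \<Rightarrow> complex \<Rightarrow> complex \<Rightarrow> complex" where
  "nc_Q3 P x y =
     (\<Sum>(k, l, m)\<in>{(k, l, m). 1 \<le> k \<and> 1 \<le> l \<and> 1 \<le> m \<and> word_yxy k l m \<in> Poly_Mapping.keys P}.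
        Poly_Mapping.lookup P (word_yxy k l m) * y ^ l * x ^ k * y ^ m)"

lemma finite_bounded_words:
  "\<exists>n. \<forall>w\<in>Poly_Mapping.keys (P :: nc_poly). length w \<le> n"
  by (rule exI[of _ "Max (length ` Poly_Mapping.keys P)"]) auto

lemma finite_nc_index_sets:
  fixes P :: nc_poly
  shows "finite {(k, l). 1 \<le> k \<and> 1 \<le> l \<and> word_xy k l \<in> Poly_Mapping.keys P}"
    and "finite {(k, l). 1 \<le> k \<and> 1 \<le> l \<and> word_yx k l \<in> Poly_Mapping.keys P}"
    and "finite {(k, l, m). 1 \<le> k \<and> 1 \<le> l \<and> 1 \<le> m \<and> word_xyx k l m \<in> Poly_Mapping.keys P}"
    and "finite {(k, l, m). 1 \<le> k \<and> 1 \<le> l \<and> 1 \<le> m \<and> word_yxy k l m \<in> Poly_Mapping.keys P}"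
proof -
  obtain n where n: "\<And>w. w \<in> Poly_Mapping.keys P \<Longrightarrow> length w \<le> n"
    using finite_bounded_words by blast
  show "finite {(k, l). 1 \<le> k \<and> 1 \<le> l \<and> word_xy k l \<in> Poly_Mapping.keys P}"
    by (rule finite_subset[of _ "{..n} \<times> {..n}"]) (auto simp: word_xy_def dest!: n)
  show "finite {(k, l). 1 \<le> k \<and> 1 \<le> l \<and> word_yx k l \<in> Poly_Mapping.keys P}"
    by (rule finite_subset[of _ "{..n} \<times> {..n}"]) (auto simp: word_yx_def dest!: n)
  show "finite {(k, l, m). 1 \<le> k \<and> 1 \<le> l \<and> 1 \<le> m \<and> word_xyx k l m \<in> Poly_Mapping.keys P}"
    by (rule finite_subset[of _ "{..n} \<times> {..n} \<times> {..n}"]) (auto simp: word_xyx_def dest!: n)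
  show "finite {(k, l, m). 1 \<le> k \<and> 1 \<le> l \<and> 1 \<le> m \<and> word_yxy k l m \<in> Poly_Mapping.keys P}"
    by (rule finite_subset[of _ "{..n} \<times> {..n} \<times> {..n}"]) (auto simp: word_yxy_def dest!: n)
qed

text \<open>The constants \<open>p\<^sub>i\<^sub>j\<close> and \<open>q\<^sub>i\<^sub>j\<close>, as functions of \<open>x = \<alpha>\<^sub>i\<close> and \<open>y = \<beta>\<^sub>j\<close>.\<close>

definition coef_p :: "nc_poly \<Rightarrow> complex \<Rightarrow> complex \<Rightarrow> complex" where
  "coef_p P x y = nc_P2 P x y + nc_P3 P x y +
     (nc_P1 P x + nc_P2 P x y) * (nc_Q1 P y + nc_Q2 P x y) / (nc_P1 P x - nc_Q1 P y)"

definition coef_q :: "nc_poly \<Rightarrow> complex \<Rightarrow> complex \<Rightarrow> complex" where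
  "coef_q P x y = nc_Q2 P x y + nc_Q3 P x y -
     (nc_P1 P x + nc_P2 P x y) * (nc_Q1 P y + nc_Q2 P x y) / (nc_P1 P x - nc_Q1 P y)"


section \<open>Haar unitary random matrices\<close>

definition unitary_group :: "nat \<Rightarrow> complex mat set" where
  "unitary_group n =
     {A \<in> carrier_mat n n. A * mat_adjoint A = 1\<^sub>m n \<and> mat_adjoint A * A = 1\<^sub>m n}"

text \<open>The Borel sigma algebra of the unitary group, induced by the matrix entries.\<close>

definition unitary_borel :: "nat \<Rightarrow> complex mat measure" where
  "unitary_borel n =
     vimage_algebra (unitary_group n) (\<lambda>A. \<lambda>ij\<in>{..<n} \<times> {..<n}. A $$ ij)
       (Pi\<^sub>M ({..<n} \<times> {..<n}) (\<lambda>_. borel))"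

definition is_haar_measure :: "nat \<Rightarrow> complex mat measure \<Rightarrow> bool" where
  "is_haar_measure n \<mu> \<longleftrightarrow> prob_space \<mu> \<and> sets \<mu> = sets (unitary_borel n) \<and>
     (\<forall>V\<in>unitary_group n. distr \<mu> (unitary_borel n) (\<lambda>A. V * A) = \<mu>)"

definition haar_unitary :: "'w measure \<Rightarrow> nat \<Rightarrow> ('w \<Rightarrow> complex mat) \<Rightarrow> bool" where
  "haar_unitary M n U \<longleftrightarrow> U \<in> M \<rightarrow>\<^sub>M unitary_borel n \<and>
     is_haar_measure n (distr M (unitary_borel n) U)"


section \<open>Nontrivial eigenvalues\<close>

definition padded_diag :: "nat \<Rightarrow> nat \<Rightarrow> (nat \<Rightarrow> complex) \<Rightarrow> complex mat" where
  "padded_diag N r \<alpha> = mat_diag N (\<lambda>i. if i < r then \<alpha> i else 0)"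

definition model_mat ::
  "nc_poly \<Rightarrow> nat \<Rightarrow> nat \<Rightarrow> (nat \<Rightarrow> complex) \<Rightarrow> (nat \<Rightarrow> complex) \<Rightarrow> nat \<Rightarrow> complex mat \<Rightarrow> complex mat"
  where "model_mat P r s \<alpha> \<beta> N U =
     nc_eval_mat N P (padded_diag N r \<alpha>) (U * padded_diag N s \<beta> * mat_adjoint U)"

text \<open>The matrix with columns \<open>e\<^sub>1, \<dots>, e\<^sub>r, u\<^sub>1, \<dots>, u\<^sub>s, e\<^sub>r\<^sub>+\<^sub>1, \<dots>, e\<^sub>N\<^sub>-\<^sub>s\<close> (indices start at \<open>0\<close>
  here), used for \<open>N \<ge> r + s\<close>.\<close>

definition basis_mat :: "nat \<Rightarrow> nat \<Rightarrow> nat \<Rightarrow> complex mat \<Rightarrow> complex mat" where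
  "basis_mat r s N U = mat_of_cols N
     (map (unit_vec N) [0..<r] @ map (col U) [0..<s] @ map (unit_vec N) [r..<N - s])"

text \<open>The matrix representing \<open>L\<close> with respect to the columns of \<open>S\<close>. It is meaningful only for
  invertible \<open>S\<close>: otherwise \<^const>\<open>mat_inverse\<close> returns \<open>None\<close> and the result is unspecified.\<close>

definition represent_mat :: "complex mat \<Rightarrow> complex mat \<Rightarrow> complex mat" where
  "represent_mat S L = the (mat_inverse S) * L * S"

definition upper_left_block :: "nat \<Rightarrow> complex mat \<Rightarrow> complex mat" where
  "upper_left_block m T = Matrix.mat m m (\<lambda>ij. T $$ ij)"

text \<open>The multiset of nontrivial eigenvalues, with algebraic multiplicities.\<close>

definition nontrivial_eigenvalues ::
  "nc_poly \<Rightarrow> nat \<Rightarrow> nat \<Rightarrow> (nat \<Rightarrow> complex) \<Rightarrow> (nat \<Rightarrow> complex) \<Rightarrow> nat \<Rightarrow> complex mat \<Rightarrow>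
     complex multiset"
  where "nontrivial_eigenvalues P r s \<alpha> \<beta> N U =
     proots (char_poly (upper_left_block (r + s)
       (represent_mat (basis_mat r s N U) (model_mat P r s \<alpha> \<beta> N U))))"


section \<open>Convergence in law\<close>

text \<open>Weak convergence of a sequence of laws on a topological space. (The library's
  \<^const>\<open>weak_conv_m\<close> covers the real line only.)\<close>

definition conv_in_law :: "'a topology \<Rightarrow> (nat \<Rightarrow> 'a measure) \<Rightarrow> 'a measure \<Rightarrow> bool" where
  "conv_in_law T \<mu> \<nu> \<longleftrightarrow>
     (\<forall>f :: 'a \<Rightarrow> real. continuous_map T euclideanreal f \<longrightarrow> bounded (f ` topspace T) \<longrightarrow>
        (\<lambda>n. integral\<^sup>L (\<mu> n) f) \<longlonglongrightarrow> integral\<^sup>L \<nu> f)"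

definition exponential_law :: "real measure" where
  "exponential_law = density lborel (\<lambda>x. ennreal (exponential_density 1 x))"

end

theory Submission
  imports Defs "HOL-Library.Landau_Symbols" "HOL-Real_Asymp.Real_Asymp"
begin

text \<open>
  The nontrivial eigenvalues are the roots of the characteristic polynomial of \<open>P(a, b)\<close>
  (\<open>nontrivial_eigenvalues_eq_proots_corner\<close>), and this matrix depends on the \<open>r \<times> s\<close> corner \<open>X\<close> of
  \<open>U\<close> only. So the theorem splits into a deterministic statement about small corners and a
  probabilistic statement about the corner of a Haar unitary.

  \<^emph>\<open>The deterministic part.\<close> For \<open>X = 0\<close> the matrix \<open>P(a, b)\<close> is diagonal with entries \<open>P\<^sub>1(\<alpha>\<^sub>i)\<close>
  and \<open>Q\<^sub>1(\<beta>\<^sub>j)\<close>, and roots depend continuously on coefficients. For the second order term let \<open>e\<close>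
  be a norm of \<open>X\<close> and put \<open>Y = X / e\<close>, which stays bounded. Conjugation by \<open>diag(1, e)\<close> replaces
  \<open>X\<close> by \<open>e\<^sup>2 Y\<close> in \<open>a\<close> and by \<open>Y\<close> in \<open>b\<close> (\<open>corner_char_poly_rescale\<close>). The characteristic
  polynomial is therefore governed by the parameter \<open>d = e\<^sup>2\<close> instead of \<open>e\<close>: the eigenvalues have
  no terms of odd order in \<open>X\<close>, and the error after the quadratic term is \<open>O(e\<^sup>4)\<close> and not merely
  \<open>O(e\<^sup>3)\<close>. A recursion along the letters of a word gives the first order expansion in \<open>d\<close> of every
  block of \<open>P(a, b)\<close>, with leading coefficients made of \<open>P\<^sub>1\<close>, \<open>P\<^sub>2\<close>, \<open>P\<^sub>3\<close>, \<open>Q\<^sub>1\<close>, \<open>Q\<^sub>2\<close>, \<open>Q\<^sub>3\<close>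
  (\<open>eval_first_order_expansion\<close>). The only off-diagonal block that does not vanish with \<open>d\<close> is the
  lower left one; a shear removes it, which is possible because \<open>P\<^sub>1(\<alpha>\<^sub>i) \<noteq> Q\<^sub>1(\<beta>\<^sub>j)\<close> and which
  produces the quotients in \<open>p\<^sub>i\<^sub>j\<close> and \<open>q\<^sub>i\<^sub>j\<close> (\<open>sheared_expansion\<close>). Now all off-diagonal entries
  are \<open>O(d)\<close>, so the characteristic polynomial is \<open>O(d\<^sup>2)\<close> at the predicted second order value.
  Dividing by the factors that belong to the other, well separated eigenvalues gives
  \<open>corner_eigenvalue_second_order\<close>.

  The eigenvalues have to be labelled by random variables. The label at a limiting value \<open>t\<close> is the
  root nearest to \<open>t\<close>, with ties broken lexicographically; this root is then divided out and the
  process is repeated. Such labels are measurable, and they converge to the limiting values because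
  a monic polynomial of degree \<open>n\<close> has a root within distance \<open>\<bar>p(t)\<bar>\<^bsup>1/n\<^esup>\<close> of \<open>t\<close>
  (\<open>nearest_root_power_le\<close>).

  \<^emph>\<open>The probabilistic part.\<close> Everything follows from left invariance of the law of \<open>U\<close>. Rotations of
  two rows give the fourth moment \<open>2 / (N (N + 1))\<close> of an entry (\<open>fourth_moment\<close>). These moments are
  summable in \<open>N\<close>, so the corner tends to \<open>0\<close> almost surely (\<open>AE_haar_entry_tendsto_0\<close>), and by
  Markov's inequality an error of order \<open>e\<^sup>4\<close>, multiplied by \<open>N\<^bsup>3/2\<^esup>\<close>, tends to \<open>0\<close> in probability.
  Hence \<open>\<xi>\<close> and \<open>\<zeta>\<close> converge in law, with the point mass at \<open>0\<close> as limit. The same rotations show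
  that minors are almost surely nonzero (\<open>AE_minor_nonzero\<close>), hence that the columns
  \<open>e\<^sub>1, \<dots>, u\<^sub>s, \<dots>\<close> form a basis.

  For the exponential limit, multiply \<open>U\<close> from the left by the Fourier matrix times a diagonal
  matrix of independent random fourth roots of unity. The entries of \<open>\<surd>N U\<close> in the corner turn into
  sums of \<open>N\<close> small terms with independent phases, so their joint characteristic function is close
  to that of independent complex Gaussians (\<open>char_gauss_bound\<close>). The Laplace transform of the
  squared moduli is a Gaussian mixture of these characteristic functions and therefore converges to
  that of independent exponentials (\<open>haar_laplace_limit\<close>); convergence in law follows from the
  Stone-Weierstrass theorem (\<open>conv_in_law_laplace\<close>).
\<close>

unbundle no vec_syntax

section \<open>The corner of the representing matrix\<close>

lemma mat_mult_entry:
  assumes "A \<in> carrier_mat n m" "B \<in> carrier_mat m p" "i < n" "j < p"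
  shows "(A * B) $$ (i, j) = (\<Sum>k<m. A $$ (i, k) * B $$ (k, j))"
  using assms by (auto simp: scalar_prod_def lessThan_atLeast0 intro!: sum.cong)

lemma mat_adjoint_carrier [intro]: "A \<in> carrier_mat n m \<Longrightarrow> mat_adjoint A \<in> carrier_mat m n"
  by (auto simp: mat_adjoint_def mat_of_rows_def)

lemma mat_adjoint_entry:
  "A \<in> carrier_mat n m \<Longrightarrow> i < m \<Longrightarrow> j < n \<Longrightarrow> mat_adjoint A $$ (i, j) = cnj (A $$ (j, i))"
  by (auto simp: mat_adjoint_def mat_of_rows_def)

lemma nc_word_mat_carrier [intro]:
  "A \<in> carrier_mat n n \<Longrightarrow> B \<in> carrier_mat n n \<Longrightarrow> nc_word_mat n A B w \<in> carrier_mat n n"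
proof (induction w)
  case (Cons l w)
  then show ?case by (cases l) auto
qed auto

lemma nc_eval_mat_carrier [intro]: "nc_eval_mat n P A B \<in> carrier_mat n n"
  by (simp add: nc_eval_mat_def)

lemma nc_eval_mat_entry:
  "i < n \<Longrightarrow> j < n \<Longrightarrow> nc_eval_mat n P A B $$ (i, j) =
     (\<Sum>w\<in>Poly_Mapping.keys P. Poly_Mapping.lookup P w * nc_word_mat n A B w $$ (i, j))"
  by (simp add: nc_eval_mat_def)

text \<open>Intertwining, unlike conjugation, needs no inverse of \<open>S\<close>, so it is used both for the basis change
  below and for the rescaling of the corner.\<close>

lemma nc_word_mat_intertwine:
  assumes "A \<in> carrier_mat n n" "A' \<in> carrier_mat n n" "B \<in> carrier_mat n n" "B' \<in> carrier_mat n n"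
    and S: "S \<in> carrier_mat n n" and "A * S = S * A'" "B * S = S * B'"
  shows "nc_word_mat n A B w * S = S * nc_word_mat n A' B' w"
proof (induction w)
  case Nil
  then show ?case using S by simp
next
  case (Cons l w)
  let ?W = "nc_word_mat n A B w" and ?W' = "nc_word_mat n A' B' w"
  let ?L = "letter_val A B l" and ?L' = "letter_val A' B' l"
  have c: "?W \<in> carrier_mat n n" "?W' \<in> carrier_mat n n" "?L \<in> carrier_mat n n" "?L' \<in> carrier_mat n n"
    using assms by (auto, (cases l; auto)+)
  have L: "?L * S = S * ?L'" using assms by (cases l) auto
  have "?L * ?W * S = ?L * (?W * S)" using c S by simp
  also have "\<dots> = ?L * S * ?W'" using c S Cons by simp
  also have "\<dots> = S * (?L' * ?W')" using c S L by simp
  finally show ?case by simp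
qed

lemma nc_eval_mat_intertwine:
  assumes c: "A \<in> carrier_mat n n" "A' \<in> carrier_mat n n" "B \<in> carrier_mat n n" "B' \<in> carrier_mat n n"
    and S: "S \<in> carrier_mat n n" and AS: "A * S = S * A'" "B * S = S * B'"
  shows "nc_eval_mat n P A B * S = S * nc_eval_mat n P A' B'"
proof (rule eq_matI)
  fix i j assume "i < dim_row (S * nc_eval_mat n P A' B')" "j < dim_col (S * nc_eval_mat n P A' B')"
  then have ij: "i < n" "j < n" using S by (auto simp: nc_eval_mat_def)
  let ?c = "Poly_Mapping.lookup P" and ?K = "Poly_Mapping.keys P"
  have "(nc_eval_mat n P A B * S) $$ (i, j) = (\<Sum>k<n. (\<Sum>w\<in>?K. ?c w * nc_word_mat n A B w $$ (i, k)) * S $$ (k, j))"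
    using ij S by (subst mat_mult_entry[where n=n and m=n and p=n]) (auto simp: nc_eval_mat_entry)
  also have "\<dots> = (\<Sum>w\<in>?K. ?c w * (\<Sum>k<n. nc_word_mat n A B w $$ (i, k) * S $$ (k, j)))"
    by (simp add: sum_distrib_left sum_distrib_right mult.assoc) (rule sum.swap)
  also have "\<dots> = (\<Sum>w\<in>?K. ?c w * (nc_word_mat n A B w * S) $$ (i, j))"
    using ij S c by (intro sum.cong refl) (subst mat_mult_entry[where n=n and m=n and p=n], auto)
  also have "\<dots> = (\<Sum>w\<in>?K. ?c w * (S * nc_word_mat n A' B' w) $$ (i, j))"
    using nc_word_mat_intertwine[OF c S AS] by simp
  also have "\<dots> = (\<Sum>w\<in>?K. ?c w * (\<Sum>k<n. S $$ (i, k) * nc_word_mat n A' B' w $$ (k, j)))"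
    using ij S c by (intro sum.cong refl) (subst mat_mult_entry[where n=n and m=n and p=n], auto)
  also have "\<dots> = (\<Sum>k<n. S $$ (i, k) * (\<Sum>w\<in>?K. ?c w * nc_word_mat n A' B' w $$ (k, j)))"
    by (simp add: sum_distrib_left mult.left_commute) (rule sum.swap)
  also have "\<dots> = (S * nc_eval_mat n P A' B') $$ (i, j)"
    using ij S by (subst mat_mult_entry[where n=n and m=n and p=n]) (auto simp: nc_eval_mat_entry)
  finally show "(nc_eval_mat n P A B * S) $$ (i, j) = (S * nc_eval_mat n P A' B') $$ (i, j)" .
qed (use S in \<open>auto simp: nc_eval_mat_def\<close>)

definition lower_left_zero :: "nat \<Rightarrow> complex mat \<Rightarrow> bool" where
  "lower_left_zero m T \<longleftrightarrow> (\<forall>i<dim_row T. \<forall>j<m. m \<le> i \<longrightarrow> T $$ (i, j) = 0)"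

lemma sum_lessThan_split:
  fixes f :: "nat \<Rightarrow> 'a::comm_monoid_add"
  shows "(\<Sum>p<r + s. f p) = (\<Sum>i<r. f i) + (\<Sum>j<s. f (r + j))"
  by (induction s) (auto simp: add.assoc)

text \<open>Matrices that leave the span of the first \<open>m\<close> basis vectors invariant form an algebra, and
  restriction to this span is multiplicative. This is why the upper left block of \<open>P\<close> of two such
  matrices is \<open>P\<close> of their blocks.\<close>

lemma block_mult_lower_left_zero:
  assumes A: "A \<in> carrier_mat N N" and B: "B \<in> carrier_mat N N" and m: "m \<le> N"
    and zA: "lower_left_zero m A" and zB: "lower_left_zero m B"
  shows "upper_left_block m (A * B) = upper_left_block m A * upper_left_block m B"
    and "lower_left_zero m (A * B)"
proof -
  obtain d where N: "N = m + d" using m by (metis le_Suc_ex)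
  have zB': "B $$ (i, j) = 0" if "m \<le> i" "i < N" "j < m" for i j
    using zB B that by (auto simp: lower_left_zero_def)
  have zA': "A $$ (i, j) = 0" if "m \<le> i" "i < N" "j < m" for i j
    using zA A that by (auto simp: lower_left_zero_def)
  have *: "(A * B) $$ (i, j) = (\<Sum>k<m. A $$ (i, k) * B $$ (k, j))" if "i < N" "j < m" for i j
  proof -
    have "(A * B) $$ (i, j) = (\<Sum>k<m + d. A $$ (i, k) * B $$ (k, j))"
      using that A B m N by (subst mat_mult_entry[where n=N and m=N and p=N]) auto
    also have "\<dots> = (\<Sum>k<m. A $$ (i, k) * B $$ (k, j))"
      unfolding sum_lessThan_split using zB' that N by (simp add: sum.neutral)
    finally show ?thesis .
  qed
  show "lower_left_zero m (A * B)"
    using A B * zA' m by (auto simp: lower_left_zero_def)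
  show "upper_left_block m (A * B) = upper_left_block m A * upper_left_block m B"
  proof (rule eq_matI)
    fix i j assume "i < dim_row (upper_left_block m A * upper_left_block m B)"
      "j < dim_col (upper_left_block m A * upper_left_block m B)"
    then have ij: "i < m" "j < m" by (auto simp: upper_left_block_def)
    show "upper_left_block m (A * B) $$ (i, j) = (upper_left_block m A * upper_left_block m B) $$ (i, j)"
      using ij m * by (subst mat_mult_entry[where n=m and m=m and p=m]) (auto simp: upper_left_block_def)
  qed (auto simp: upper_left_block_def)
qed

lemma upper_left_block_word:
  assumes A: "A \<in> carrier_mat N N" and B: "B \<in> carrier_mat N N" and m: "m \<le> N"
    and zA: "lower_left_zero m A" and zB: "lower_left_zero m B"
  shows "upper_left_block m (nc_word_mat N A B w) =
           nc_word_mat m (upper_left_block m A) (upper_left_block m B) w \<and>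
         lower_left_zero m (nc_word_mat N A B w)"
proof (induction w)
  case Nil
  then show ?case using m by (auto simp: upper_left_block_def lower_left_zero_def)
next
  case (Cons l w)
  let ?L = "letter_val A B l"
  have L: "?L \<in> carrier_mat N N" "lower_left_zero m ?L"
    "upper_left_block m ?L = letter_val (upper_left_block m A) (upper_left_block m B) l"
    using A B zA zB by (cases l; auto)+
  have W: "nc_word_mat N A B w \<in> carrier_mat N N" using A B by auto
  show ?case
    using block_mult_lower_left_zero[OF L(1) W m L(2)] Cons L(3) by simp
qed

lemma upper_left_block_eval:
  assumes "A \<in> carrier_mat N N" "B \<in> carrier_mat N N" "m \<le> N"
    and "lower_left_zero m A" "lower_left_zero m B"
  shows "upper_left_block m (nc_eval_mat N P A B) =
           nc_eval_mat m P (upper_left_block m A) (upper_left_block m B)"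
proof -
  have "nc_word_mat m (upper_left_block m A) (upper_left_block m B) w $$ (i, j) =
        nc_word_mat N A B w $$ (i, j)" if "i < m" "j < m" for w i j
    using upper_left_block_word[OF assms, of w, THEN conjunct1, symmetric] that
    by (simp add: upper_left_block_def)
  then show ?thesis using assms(3)
    by (intro eq_matI) (auto simp: upper_left_block_def nc_eval_mat_def)
qed

text \<open>The matrices \<open>a\<close> and \<open>b\<close>. Here \<open>X\<close> is the corner of \<open>U\<close> and \<open>Z\<close> the entrywise conjugate of the
  corner, not transposed. Both are independent arguments because the rescaling of the corner treats
  them differently.\<close>

definition block_a :: "nat \<Rightarrow> nat \<Rightarrow> (nat \<Rightarrow> complex) \<Rightarrow> (nat \<Rightarrow> nat \<Rightarrow> complex) \<Rightarrow> complex mat" where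
  "block_a r s \<alpha> X = Matrix.mat (r + s) (r + s) (\<lambda>(p, q).
     if p < r then (if q < r then (if p = q then \<alpha> p else 0) else \<alpha> p * X p (q - r)) else 0)"

definition block_b :: "nat \<Rightarrow> nat \<Rightarrow> (nat \<Rightarrow> complex) \<Rightarrow> (nat \<Rightarrow> nat \<Rightarrow> complex) \<Rightarrow> complex mat" where
  "block_b r s \<beta> Z = Matrix.mat (r + s) (r + s) (\<lambda>(p, q).
     if p < r then 0 else if q < r then \<beta> (p - r) * Z q (p - r)
     else if p = q then \<beta> (p - r) else 0)"

lemma block_a_carrier [simp, intro]: "block_a r s \<alpha> X \<in> carrier_mat (r + s) (r + s)"
  and block_b_carrier [simp, intro]: "block_b r s \<beta> Z \<in> carrier_mat (r + s) (r + s)"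
  by (auto simp: block_a_def block_b_def)

lemma block_a_cong:
  "(\<And>i j. i < r \<Longrightarrow> j < s \<Longrightarrow> X i j = X' i j) \<Longrightarrow> block_a r s \<alpha> X = block_a r s \<alpha> X'"
  and block_b_cong:
  "(\<And>i j. i < r \<Longrightarrow> j < s \<Longrightarrow> Z i j = Z' i j) \<Longrightarrow> block_b r s \<beta> Z = block_b r s \<beta> Z'"
  by (auto simp: block_a_def block_b_def intro!: eq_matI)

definition corner_char_poly ::
  "nc_poly \<Rightarrow> nat \<Rightarrow> nat \<Rightarrow> (nat \<Rightarrow> complex) \<Rightarrow> (nat \<Rightarrow> complex) \<Rightarrow> (nat \<Rightarrow> nat \<Rightarrow> complex) \<Rightarrow> complex poly"
  where "corner_char_poly P r s \<alpha> \<beta> X =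
    char_poly (nc_eval_mat (r + s) P (block_a r s \<alpha> X) (block_b r s \<beta> (\<lambda>i j. cnj (X i j))))"

lemma basis_mat_carrier [intro]: "r + s \<le> N \<Longrightarrow> basis_mat r s N U \<in> carrier_mat N N"
  by (simp add: basis_mat_def mat_of_cols_def)

lemma basis_mat_entry:
  assumes "r + s \<le> N" "U \<in> carrier_mat N N" "p < N" "q < N"
  shows "basis_mat r s N U $$ (p, q) =
    (if q < r then (if p = q then 1 else 0) else if q < r + s then U $$ (p, q - r)
     else if p = q - s then 1 else 0)"
proof -
  let ?L = "map (unit_vec N) [0..<r] @ map (col U) [0..<s] @ map (unit_vec N) [r..<N - s]"
  have "basis_mat r s N U $$ (p, q) = ?L ! q $ p"
    using assms by (simp add: basis_mat_def mat_of_cols_def)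
  also have "\<dots> = (if q < r then (if p = q then 1 else 0) else if q < r + s then U $$ (p, q - r)
     else if p = q - s then 1 else 0)"
    using assms by (auto simp: nth_append unit_vec_def col_def)
  finally show ?thesis .
qed

lemma unitary_groupD:
  assumes "U \<in> unitary_group N"
  shows "U \<in> carrier_mat N N" "mat_adjoint U * U = 1\<^sub>m N" "U * mat_adjoint U = 1\<^sub>m N"
  using assms by (auto simp: unitary_group_def)

lemma unitary_col_orthonormal:
  assumes U: "U \<in> unitary_group N" and "j < N" "l < N"
  shows "(\<Sum>k<N. cnj (U $$ (k, j)) * U $$ (k, l)) = (if j = l then 1 else 0)"
proof -
  have "(mat_adjoint U * U) $$ (j, l) = (if j = l then 1 else 0)"
    using assms unitary_groupD[OF U] by simp
  moreover have "(mat_adjoint U * U) $$ (j, l) = (\<Sum>k<N. cnj (U $$ (k, j)) * U $$ (k, l))"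
    using assms unitary_groupD(1)[OF U]
    by (subst mat_mult_entry[where n=N and m=N and p=N]) (auto simp: mat_adjoint_entry)
  ultimately show ?thesis by simp
qed

text \<open>The columns of the right-hand side express that \<open>A\<close> maps each basis vector into the span of
  \<open>e\<^sub>1, \<dots>, e\<^sub>r\<close>, that is, the matrix \<open>A'\<close> representing \<open>A\<close> has nonzero rows only among the first
  \<open>r\<close>. It vanishes beyond column \<open>r + s\<close> because the remaining basis vectors are killed by \<open>A\<close>.\<close>

lemma basis_mat_intertwine_x:
  assumes N: "r + s \<le> N" and U: "U \<in> carrier_mat N N"
    and A': "A' = Matrix.mat N N (\<lambda>(p, q). if p < r \<and> q < r + s then block_a r s \<alpha> (\<lambda>i j. U $$ (i, j)) $$ (p, q) else 0)"
  shows "padded_diag N r \<alpha> * basis_mat r s N U = basis_mat r s N U * A'"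
proof (rule eq_matI)
  let ?S = "basis_mat r s N U"
  have S: "?S \<in> carrier_mat N N" using N by auto
  have A: "padded_diag N r \<alpha> \<in> carrier_mat N N" by (simp add: padded_diag_def)
  have A'c: "A' \<in> carrier_mat N N" by (simp add: A')
  show "dim_row (padded_diag N r \<alpha> * ?S) = dim_row (?S * A')" "dim_col (padded_diag N r \<alpha> * ?S) = dim_col (?S * A')"
    using S A A'c by auto
  fix p q assume "p < dim_row (?S * A')" "q < dim_col (?S * A')"
  then have pq: "p < N" "q < N" using S A'c by auto
  obtain d where d: "N = r + d" using N by (metis add.assoc le_Suc_ex)
  have "(?S * A') $$ (p, q) = (\<Sum>k<r + d. ?S $$ (p, k) * A' $$ (k, q))"
    using pq d by (subst mat_mult_entry[OF S A'c]) auto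
  also have "\<dots> = (\<Sum>k<r. ?S $$ (p, k) * A' $$ (k, q))"
    unfolding sum_lessThan_split using pq d by (simp add: A' sum.neutral)
  also have "\<dots> = (\<Sum>k<r. if k = p then A' $$ (k, q) else 0)"
    using pq N U by (intro sum.cong refl) (subst basis_mat_entry, auto)
  also have "\<dots> = (if p < r then A' $$ (p, q) else 0)" by (simp add: sum.delta)
  also have "\<dots> = (if p < r then \<alpha> p * ?S $$ (p, q) else 0)"
    using pq N U by (subst basis_mat_entry) (auto simp: A' block_a_def)
  also have "\<dots> = (padded_diag N r \<alpha> * ?S) $$ (p, q)"
    using pq by (simp add: padded_diag_def mat_diag_mult_left[OF S])
  finally show "(padded_diag N r \<alpha> * ?S) $$ (p, q) = (?S * A') $$ (p, q)" by simp
qed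

text \<open>The range of \<open>U B U\<^sup>*\<close> is spanned by \<open>u\<^sub>1, \<dots>, u\<^sub>s\<close>, so only the rows \<open>r, \<dots>, r + s - 1\<close> of the
  representing matrix \<open>B'\<close> can be nonzero. Its columns beyond \<open>r + s\<close> need not vanish, which is
  harmless because they lie outside the block of interest.\<close>

lemma basis_mat_intertwine_y:
  assumes N: "r + s \<le> N" and U: "U \<in> unitary_group N"
    and B': "B' = Matrix.mat N N (\<lambda>(p, q). if r \<le> p \<and> p < r + s
       then \<beta> (p - r) * (mat_adjoint U * basis_mat r s N U) $$ (p - r, q) else 0)"
  shows "U * padded_diag N s \<beta> * mat_adjoint U * basis_mat r s N U = basis_mat r s N U * B'"
proof (rule eq_matI)
  let ?S = "basis_mat r s N U" and ?D = "padded_diag N s \<beta>"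
  have S: "?S \<in> carrier_mat N N" using N by auto
  have Uc: "U \<in> carrier_mat N N" using unitary_groupD[OF U] by simp
  have Ua: "mat_adjoint U \<in> carrier_mat N N" using Uc by auto
  have D: "?D \<in> carrier_mat N N" by (simp add: padded_diag_def)
  have B'c: "B' \<in> carrier_mat N N" by (simp add: B')
  let ?V = "mat_adjoint U * ?S"
  have V: "?V \<in> carrier_mat N N" using Ua S by simp
  have "U * ?D * mat_adjoint U * ?S = (U * ?D) * ?V"
    using Uc Ua S D by (intro assoc_mult_mat) auto
  also have "\<dots> = U * (?D * ?V)" using Uc D V by (intro assoc_mult_mat) auto
  finally have eq: "U * ?D * mat_adjoint U * ?S = U * (?D * ?V)" .
  show "dim_row (U * ?D * mat_adjoint U * ?S) = dim_row (?S * B')"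
    "dim_col (U * ?D * mat_adjoint U * ?S) = dim_col (?S * B')"
    using S Uc B'c by auto
  fix p q assume "p < dim_row (?S * B')" "q < dim_col (?S * B')"
  then have pq: "p < N" "q < N" using S B'c by auto
  obtain d where d: "N = r + (s + d)" using N by (metis add.assoc le_Suc_ex)
  obtain d' where d': "N = s + d'" using N by (metis add_leD2 le_Suc_ex)
  have DV: "(?D * ?V) $$ (k, q) = (if k < s then \<beta> k * ?V $$ (k, q) else 0)" if "k < N" for k
    using pq that by (simp add: padded_diag_def mat_diag_mult_left[OF V] del: index_mult_mat)
  have "(U * (?D * ?V)) $$ (p, q) = (\<Sum>k<N. U $$ (p, k) * (?D * ?V) $$ (k, q))"
    using pq D V Uc by (subst mat_mult_entry[OF Uc]) auto
  also have "\<dots> = (\<Sum>k<s + d'. U $$ (p, k) * (if k < s then \<beta> k * ?V $$ (k, q) else 0))"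
    using d' DV by (intro sum.cong) auto
  also have "\<dots> = (\<Sum>k<s. U $$ (p, k) * (\<beta> k * ?V $$ (k, q)))"
    unfolding sum_lessThan_split by simp
  also have "\<dots> = (\<Sum>k<s. ?S $$ (p, r + k) * B' $$ (r + k, q))"
    using pq N Uc by (intro sum.cong refl) (subst basis_mat_entry, auto simp: B')
  also have "\<dots> = (\<Sum>k<r + (s + d). ?S $$ (p, k) * B' $$ (k, q))"
    unfolding sum_lessThan_split using pq d by (simp add: B' sum.neutral)
  also have "\<dots> = (?S * B') $$ (p, q)"
    using pq d by (subst mat_mult_entry[OF S B'c]) auto
  finally show "(U * ?D * mat_adjoint U * ?S) $$ (p, q) = (?S * B') $$ (p, q)" by (simp only: eq)
qed

text \<open>Modulo the standard basis vectors that belong to the basis, only the last \<open>s\<close> coordinates of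
  \<open>u\<^sub>1, \<dots>, u\<^sub>s\<close> are left; so the columns are independent as soon as this \<open>s \<times> s\<close> minor is nonzero.\<close>

lemma basis_mat_invertible:
  assumes N: "r + s \<le> N" and U: "U \<in> carrier_mat N N"
    and minor: "Determinant.det (Matrix.mat s s (\<lambda>(i, j). U $$ (N - s + i, j))) \<noteq> 0"
  shows "Determinant.det (basis_mat r s N U) \<noteq> 0"
proof
  let ?S = "basis_mat r s N U" and ?M = "Matrix.mat s s (\<lambda>(i, j). U $$ (N - s + i, j))"
  have S: "?S \<in> carrier_mat N N" using N by auto
  have M: "?M \<in> carrier_mat s s" by simp
  assume "Determinant.det ?S = 0"
  then obtain v where v: "v \<in> carrier_vec N" "v \<noteq> 0\<^sub>v N" "?S *\<^sub>v v = 0\<^sub>v N"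
    using det_0_iff_vec_prod_zero[OF S] by auto
  obtain d where d: "N = r + (s + d)" using N by (metis add.assoc le_Suc_ex)
  have eq: "(\<Sum>q<r. if q = p then v $ q else 0) + ((\<Sum>j<s. U $$ (p, j) * v $ (r + j)) +
      (\<Sum>k<d. if r + k = p then v $ (r + s + k) else 0)) = 0" if p: "p < N" for p
  proof -
    have "0 = (?S *\<^sub>v v) $ p" using v p by simp
    also have "\<dots> = (\<Sum>q<N. ?S $$ (p, q) * v $ q)"
      using v(1) S p by (simp add: scalar_prod_def lessThan_atLeast0)
    also have "\<dots> = (\<Sum>q<r + (s + d). ?S $$ (p, q) * v $ q)" using d by simp
    also have "\<dots> = (\<Sum>q<r. ?S $$ (p, q) * v $ q) + ((\<Sum>j<s. ?S $$ (p, r + j) * v $ (r + j)) +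
       (\<Sum>k<d. ?S $$ (p, r + (s + k)) * v $ (r + (s + k))))"
      unfolding sum_lessThan_split by simp
    also have "\<dots> = (\<Sum>q<r. if q = p then v $ q else 0) + ((\<Sum>j<s. U $$ (p, j) * v $ (r + j)) +
      (\<Sum>k<d. if r + k = p then v $ (r + s + k) else 0))"
      using p N U d by (intro arg_cong2[where f="(+)"] sum.cong refl; subst basis_mat_entry) (auto simp: add.assoc)
    finally show ?thesis by simp
  qed
  have "?M *\<^sub>v Matrix.vec s (\<lambda>j. v $ (r + j)) = 0\<^sub>v s"
  proof (rule eq_vecI)
    fix i assume "i < dim_vec (0\<^sub>v s :: complex vec)"
    then have i: "i < s" by simp
    have "(\<Sum>j<s. U $$ (N - s + i, j) * v $ (r + j)) = 0"
      using eq[of "N - s + i"] i d by (simp add: sum.neutral)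
    then show "(?M *\<^sub>v Matrix.vec s (\<lambda>j. v $ (r + j))) $ i = 0\<^sub>v s $ i"
      using i by (simp add: scalar_prod_def lessThan_atLeast0)
  qed simp
  then have "Matrix.vec s (\<lambda>j. v $ (r + j)) = 0\<^sub>v s"
    using det_0_iff_vec_prod_zero[OF M] minor by (metis vec_carrier)
  then have vs: "v $ (r + j) = 0" if "j < s" for j
    using that by (metis index_vec index_zero_vec(1))
  have vr: "v $ p = 0" if "p < r" for p
    using eq[of p] that d vs by (simp add: sum.delta sum.neutral)
  have vd: "v $ (r + s + k) = 0" if k: "k < d" for k
  proof -
    have "(\<Sum>k'<d. if r + k' = r + k then v $ (r + s + k') else 0) = v $ (r + s + k)"
      using k by (simp add: sum.delta)
    then show ?thesis using eq[of "r + k"] k d vs vr by (simp add: sum.neutral)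
  qed
  have "v = 0\<^sub>v N"
  proof (rule eq_vecI)
    fix p assume "p < dim_vec (0\<^sub>v N :: complex vec)"
    then have p: "p < r + s + d" using d by simp
    show "v $ p = 0\<^sub>v N $ p"
      using p d vr[of p] vs[of "p - r"] vd[of "p - (r + s)"]
      by (cases "p < r"; cases "p < r + s") auto
  qed (use v in auto)
  then show False using v by simp
qed

lemma upper_left_block_represent_model:
  assumes N: "r + s \<le> N" and U: "U \<in> unitary_group N"
    and det: "Determinant.det (basis_mat r s N U) \<noteq> 0"
  shows "upper_left_block (r + s) (represent_mat (basis_mat r s N U) (model_mat P r s \<alpha> \<beta> N U)) =
    nc_eval_mat (r + s) P (block_a r s \<alpha> (\<lambda>i j. U $$ (i, j))) (block_b r s \<beta> (\<lambda>i j. cnj (U $$ (i, j))))"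
proof -
  let ?S = "basis_mat r s N U"
  let ?V = "mat_adjoint U * ?S"
  define A where "A = padded_diag N r \<alpha>"
  define B where "B = U * padded_diag N s \<beta> * mat_adjoint U"
  define A' where "A' = Matrix.mat N N (\<lambda>(p, q). if p < r \<and> q < r + s then block_a r s \<alpha> (\<lambda>i j. U $$ (i, j)) $$ (p, q) else 0)"
  define B' where "B' = Matrix.mat N N (\<lambda>(p, q). if r \<le> p \<and> p < r + s
       then \<beta> (p - r) * ?V $$ (p - r, q) else 0)"
  have S: "?S \<in> carrier_mat N N" using N by auto
  have Uc: "U \<in> carrier_mat N N" using unitary_groupD[OF U] by simp
  have Ua: "mat_adjoint U \<in> carrier_mat N N" using Uc by auto
  have c: "A \<in> carrier_mat N N" "A' \<in> carrier_mat N N" "B \<in> carrier_mat N N" "B' \<in> carrier_mat N N"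
    using Uc Ua by (auto simp: A_def B_def A'_def B'_def padded_diag_def)
  have tw: "nc_eval_mat N P A B * ?S = ?S * nc_eval_mat N P A' B'"
    using nc_eval_mat_intertwine[OF c S] basis_mat_intertwine_x[OF N Uc A'_def] basis_mat_intertwine_y[OF N U B'_def]
    by (simp add: A_def B_def)
  have "mat_inverse ?S \<noteq> None"
    using mat_inverse(1)[OF S, of "()"] det_non_zero_imp_unit[OF S det, of "()"] by blast
  then obtain Si where Si: "mat_inverse ?S = Some Si" by blast
  have Si': "Si * ?S = 1\<^sub>m N" "Si \<in> carrier_mat N N" using mat_inverse(2)[OF S Si] by auto
  have E: "nc_eval_mat N P A B \<in> carrier_mat N N" "nc_eval_mat N P A' B' \<in> carrier_mat N N" by auto
  have "represent_mat ?S (model_mat P r s \<alpha> \<beta> N U) = Si * nc_eval_mat N P A B * ?S"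
    by (simp add: represent_mat_def model_mat_def Si A_def B_def)
  also have "\<dots> = Si * (?S * nc_eval_mat N P A' B')" using tw Si' E S by (simp add: assoc_mult_mat[of _ N N _ N _ N])
  also have "\<dots> = Si * ?S * nc_eval_mat N P A' B'"
    using Si' E S by (intro assoc_mult_mat[symmetric]) auto
  also have "\<dots> = nc_eval_mat N P A' B'" using Si' E by simp
  finally have rep: "represent_mat ?S (model_mat P r s \<alpha> \<beta> N U) = nc_eval_mat N P A' B'" .
  have "upper_left_block (r + s) A' = block_a r s \<alpha> (\<lambda>i j. U $$ (i, j))"
    using N by (intro eq_matI) (auto simp: upper_left_block_def A'_def block_a_def)
  moreover have "upper_left_block (r + s) B' = block_b r s \<beta> (\<lambda>i j. cnj (U $$ (i, j)))"
  proof (rule eq_matI)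
    fix p q assume "p < dim_row (block_b r s \<beta> (\<lambda>i j. cnj (U $$ (i, j))))" "q < dim_col (block_b r s \<beta> (\<lambda>i j. cnj (U $$ (i, j))))"
    then have pq: "p < r + s" "q < r + s" by (auto simp: block_b_def)
    have V: "?V $$ (j, q) = (if q < r then cnj (U $$ (q, j)) else if j = q - r then 1 else 0)" if j: "j < s" for j
    proof -
      have "?V $$ (j, q) = (\<Sum>k<N. cnj (U $$ (k, j)) * ?S $$ (k, q))"
        using pq N j Uc by (subst mat_mult_entry[OF Ua S]) (auto simp: mat_adjoint_entry)
      also have "\<dots> = (if q < r then cnj (U $$ (q, j)) else if j = q - r then 1 else 0)"
      proof (cases "q < r")
        case True
        then have "(\<Sum>k<N. cnj (U $$ (k, j)) * ?S $$ (k, q)) = (\<Sum>k<N. if k = q then cnj (U $$ (k, j)) else 0)"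
          using pq N Uc by (intro sum.cong refl) (subst basis_mat_entry, auto)
        then show ?thesis using True pq N by (simp add: sum.delta)
      next
        case False
        then have "(\<Sum>k<N. cnj (U $$ (k, j)) * ?S $$ (k, q)) = (\<Sum>k<N. cnj (U $$ (k, j)) * U $$ (k, q - r))"
          using pq N Uc by (intro sum.cong refl) (subst basis_mat_entry, auto)
        then show ?thesis using False pq N j unitary_col_orthonormal[OF U, of j "q - r"] by simp
      qed
      finally show ?thesis .
    qed
    show "upper_left_block (r + s) B' $$ (p, q) = block_b r s \<beta> (\<lambda>i j. cnj (U $$ (i, j))) $$ (p, q)"
      using pq N V[of "p - r"] by (auto simp: upper_left_block_def B'_def block_b_def)
  qed (auto simp: upper_left_block_def block_b_def)
  moreover have "lower_left_zero (r + s) A'" "lower_left_zero (r + s) B'"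
    by (auto simp: lower_left_zero_def A'_def B'_def)
  ultimately show ?thesis
    unfolding rep using upper_left_block_eval[OF c(2,4) N] by simp
qed

lemma nontrivial_eigenvalues_eq_proots_corner:
  assumes "r + s \<le> N" "U \<in> unitary_group N"
    and "Determinant.det (Matrix.mat s s (\<lambda>(i, j). U $$ (N - s + i, j))) \<noteq> 0"
  shows "nontrivial_eigenvalues P r s \<alpha> \<beta> N U = proots (corner_char_poly P r s \<alpha> \<beta> (\<lambda>i j. U $$ (i, j)))"
  using upper_left_block_represent_model[OF assms(1,2) basis_mat_invertible[OF assms(1) unitary_groupD(1)[OF assms(2)] assms(3)]]
  by (simp add: nontrivial_eigenvalues_def corner_char_poly_def)

section \<open>Leading values of words\<close>

text \<open>Values of words, read off letter by letter so that they can be compared with a matrix product in an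
  induction on the word. The first one is the value of a word with \<open>x\<close> for the letter \<open>a\<close> and \<open>0\<close>
  for the other letter.\<close>

primrec pure_val :: "letter \<Rightarrow> complex \<Rightarrow> letter list \<Rightarrow> complex" where
  "pure_val a x [] = 1"
| "pure_val a x (c # w) = (if c = a then x * pure_val a x w else 0)"

text \<open>The sum over all ways to split a word as \<open>a\<^sup>k b\<^sup>l\<close> with \<open>k \<ge> 1\<close> and \<open>l \<ge> 0\<close>. Allowing \<open>l = 0\<close> is
  what the recursion of matrix entries requires: summed over a polynomial, it yields \<open>P\<^sub>1 + P\<^sub>2\<close> and
  not \<open>P\<^sub>2\<close>.\<close>

primrec two_val :: "letter \<Rightarrow> letter \<Rightarrow> complex \<Rightarrow> complex \<Rightarrow> letter list \<Rightarrow> complex" where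
  "two_val a b x y [] = 0"
| "two_val a b x y (c # w) = (if c = a then x * (pure_val b y w + two_val a b x y w) else 0)"

text \<open>The sum over all ways to split a word as \<open>a\<^sup>k b\<^sup>l a\<^sup>m\<close> with \<open>k, l \<ge> 1\<close> and \<open>m \<ge> 0\<close>, which yields
  \<open>P\<^sub>2 + P\<^sub>3\<close>.\<close>

primrec three_val :: "letter \<Rightarrow> letter \<Rightarrow> complex \<Rightarrow> complex \<Rightarrow> letter list \<Rightarrow> complex" where
  "three_val a b x y [] = 0"
| "three_val a b x y (c # w) = (if c = a then x * (two_val b a y x w + three_val a b x y w) else 0)"

lemma pure_val_replicate: "pure_val a x (replicate k a @ w) = x ^ k * pure_val a x w"
  by (induction k) auto

lemma pure_val_eq_0: "w \<noteq> replicate (length w) a \<Longrightarrow> pure_val a x w = 0"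
  by (induction w) auto

lemma pure_val_letter_val:
  "pure_val LX x w = prod_list (map (letter_val x 0) w)"
  "pure_val LY y w = prod_list (map (letter_val 0 y) w)"
proof -
  have "pure_val LX x w = prod_list (map (letter_val x 0) w) \<and> pure_val LY y w = prod_list (map (letter_val 0 y) w)"
  proof (induction w)
    case (Cons c w)
    then show ?case by (cases c) auto
  qed auto
  then show "pure_val LX x w = prod_list (map (letter_val x 0) w)"
    "pure_val LY y w = prod_list (map (letter_val 0 y) w)" by auto
qed

lemma two_val_first: "v = [] \<or> hd v \<noteq> a \<Longrightarrow> two_val a b x y v = 0"
  by (cases v) auto

lemma three_val_first: "v = [] \<or> hd v \<noteq> a \<Longrightarrow> three_val a b x y v = 0"
  by (cases v) auto

lemma two_val_run:
  assumes "a \<noteq> b" "v = [] \<or> hd v \<noteq> a"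
  shows "two_val a b x y (replicate k a @ v) = (if k = 0 then 0 else x ^ k * pure_val b y v)"
proof (induction k)
  case (Suc k)
  have "pure_val b y (replicate k a @ v) = (if k = 0 then pure_val b y v else 0)"
    using assms by (cases k) auto
  then show ?case using Suc by auto
qed (use two_val_first[OF assms(2)] in auto)

lemma three_val_run:
  assumes "a \<noteq> b" "v = [] \<or> hd v \<noteq> a"
  shows "three_val a b x y (replicate k a @ v) = (if k = 0 then 0 else x ^ k * two_val b a y x v)"
proof (induction k)
  case (Suc k)
  have "two_val b a y x (replicate k a @ v) = (if k = 0 then two_val b a y x v else 0)"
    using assms by (cases k) auto
  then show ?case using Suc by auto
qed (use three_val_first[OF assms(2)] in auto)

lemma word_first_run:
  obtains k v where "w = replicate k a @ v" "v = [] \<or> hd v \<noteq> a"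
proof -
  have "\<exists>k v. w = replicate k a @ v \<and> (v = [] \<or> hd v \<noteq> a)"
  proof (induction w)
    case (Cons c w)
    then obtain k v where kv: "w = replicate k a @ v" "v = [] \<or> hd v \<noteq> a" by blast
    show ?case
    proof (cases "c = a")
      case True
      then show ?thesis using kv by (intro exI[of _ "Suc k"] exI[of _ v]) auto
    next
      case False
      then show ?thesis by (intro exI[of _ 0] exI[of _ "c # w"]) auto
    qed
  qed auto
  then show ?thesis using that by blast
qed

lemma sum_keys_reindex:
  fixes P :: nc_poly and f :: "letter list \<Rightarrow> complex"
  assumes inj: "inj_on \<phi> D" and v: "\<And>j. j \<in> D \<Longrightarrow> f (\<phi> j) = v j"
    and z: "\<And>w. w \<notin> \<phi> ` D \<Longrightarrow> f w = 0"
  shows "(\<Sum>w\<in>Poly_Mapping.keys P. Poly_Mapping.lookup P w * f w) =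
    (\<Sum>j\<in>{j \<in> D. \<phi> j \<in> Poly_Mapping.keys P}. Poly_Mapping.lookup P (\<phi> j) * v j)"
proof -
  let ?J = "{j \<in> D. \<phi> j \<in> Poly_Mapping.keys P}"
  have "(\<Sum>w\<in>Poly_Mapping.keys P. Poly_Mapping.lookup P w * f w) =
        (\<Sum>w\<in>\<phi> ` ?J. Poly_Mapping.lookup P w * f w)"
  proof (rule sum.mono_neutral_right)
    show "\<forall>i\<in>Poly_Mapping.keys P - \<phi> ` ?J. Poly_Mapping.lookup P i * f i = 0"
    proof
      fix i assume "i \<in> Poly_Mapping.keys P - \<phi> ` ?J"
      then have "i \<notin> \<phi> ` D" by auto
      then show "Poly_Mapping.lookup P i * f i = 0" using z by simp
    qed
  qed auto
  also have "\<dots> = (\<Sum>j\<in>?J. Poly_Mapping.lookup P (\<phi> j) * f (\<phi> j))"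
    using inj by (subst sum.reindex) (auto intro: inj_on_subset)
  also have "\<dots> = (\<Sum>j\<in>?J. Poly_Mapping.lookup P (\<phi> j) * v j)"
    using v by (intro sum.cong) auto
  finally show ?thesis .
qed

lemma sum_two_val:
  fixes P :: nc_poly
  assumes ab: "a \<noteq> b"
  shows "(\<Sum>w\<in>Poly_Mapping.keys P. Poly_Mapping.lookup P w * two_val a b x y w) =
    (\<Sum>w\<in>Poly_Mapping.keys P. Poly_Mapping.lookup P w * (if w = [] then 0 else pure_val a x w)) +
    (\<Sum>(k, l)\<in>{(k, l). 1 \<le> k \<and> 1 \<le> l \<and> replicate k a @ replicate l b \<in> Poly_Mapping.keys P}.
       Poly_Mapping.lookup P (replicate k a @ replicate l b) * (x ^ k * y ^ l))"
proof -
  let ?D = "{(k, l). 1 \<le> k \<and> 1 \<le> l} :: (nat \<times> nat) set"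
  let ?\<phi> = "\<lambda>(k, l). replicate k a @ replicate l b"
  let ?f = "\<lambda>w. two_val a b x y w - (if w = [] then 0 else pure_val a x w)"
  have inj: "inj_on ?\<phi> ?D"
  proof (rule inj_on_inverseI[where g = "\<lambda>w. (length (filter ((=) a) w), length (filter ((=) b) w))"])
    fix j assume "j \<in> ?D"
    then show "(length (filter ((=) a) (?\<phi> j)), length (filter ((=) b) (?\<phi> j))) = j"
      using ab by (auto simp: filter_replicate)
  qed
  have f: "?f (replicate k a @ v) = (if v = [] \<or> k = 0 then 0 else x ^ k * pure_val b y v)"
    if "v = [] \<or> hd v \<noteq> a" for k v
    using that ab two_val_run[OF ab that, of x y k] pure_val_replicate[of a x k v] by (cases v) auto
  have "(\<Sum>w\<in>Poly_Mapping.keys P. Poly_Mapping.lookup P w * ?f w) =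
    (\<Sum>j\<in>{j \<in> ?D. ?\<phi> j \<in> Poly_Mapping.keys P}. Poly_Mapping.lookup P (?\<phi> j) * (case j of (k, l) \<Rightarrow> x ^ k * y ^ l))"
  proof (rule sum_keys_reindex[OF inj])
    fix j assume "j \<in> ?D"
    then obtain k l where j: "j = (k, l)" "1 \<le> k" "1 \<le> l" by auto
    have "hd (replicate l b) \<noteq> a" using j ab by (cases l) auto
    then show "?f (?\<phi> j) = (case j of (k, l) \<Rightarrow> x ^ k * y ^ l)"
      using f[of "replicate l b" k] j pure_val_replicate[of b y l "[]"] by auto
  next
    fix w assume w: "w \<notin> ?\<phi> ` ?D"
    obtain k v where kv: "w = replicate k a @ v" "v = [] \<or> hd v \<noteq> a" by (rule word_first_run)
    show "?f w = 0"
    proof (cases "v = [] \<or> k = 0")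
      case True
      then show ?thesis using f[OF kv(2), of k] kv(1) by auto
    next
      case False
      then have "v \<noteq> replicate (length v) b"
        using w kv(1) by (auto simp: image_iff) (metis One_nat_def Suc_leI length_greater_0_conv neq0_conv)
      then show ?thesis using f[OF kv(2)] kv(1) False by (auto simp: pure_val_eq_0)
    qed
  qed
  also have "{j \<in> ?D. ?\<phi> j \<in> Poly_Mapping.keys P} =
      {(k, l). 1 \<le> k \<and> 1 \<le> l \<and> replicate k a @ replicate l b \<in> Poly_Mapping.keys P}" by auto
  finally show ?thesis
    by (simp add: algebra_simps sum_subtractf case_prod_unfold)
qed

lemma sum_three_val:
  fixes P :: nc_poly
  assumes ab: "a \<noteq> b"
  shows "(\<Sum>w\<in>Poly_Mapping.keys P. Poly_Mapping.lookup P w * three_val a b x y w) =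
    (\<Sum>(k, l)\<in>{(k, l). 1 \<le> k \<and> 1 \<le> l \<and> replicate k a @ replicate l b \<in> Poly_Mapping.keys P}.
       Poly_Mapping.lookup P (replicate k a @ replicate l b) * (x ^ k * y ^ l)) +
    (\<Sum>(k, l, m)\<in>{(k, l, m). 1 \<le> k \<and> 1 \<le> l \<and> 1 \<le> m \<and> replicate k a @ replicate l b @ replicate m a \<in> Poly_Mapping.keys P}.
       Poly_Mapping.lookup P (replicate k a @ replicate l b @ replicate m a) * (x ^ k * y ^ l * x ^ m))"
proof -
  let ?D = "{(k, l, m). 1 \<le> k \<and> 1 \<le> l \<and> 1 \<le> m} :: (nat \<times> nat \<times> nat) set"
  let ?\<phi> = "\<lambda>(k, l, m). replicate k a @ replicate l b @ replicate m a"
  define two where "two w = two_val a b x y w - (if w = [] then 0 else pure_val a x w)" for w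
  let ?f = "\<lambda>w. three_val a b x y w - two w"
  have inj: "inj_on ?\<phi> ?D"
  proof (rule inj_on_inverseI[where g = "\<lambda>w. (length (takeWhile ((=) a) w), length (filter ((=) b) w),
      length (filter ((=) a) w) - length (takeWhile ((=) a) w))"])
    fix j assume "j \<in> ?D"
    then obtain k l m where j: "j = (k, Suc l, m)" by (auto, metis One_nat_def Suc_le_D)
    have "takeWhile ((=) a) (?\<phi> j) = replicate k a"
      using ab unfolding j by (induction k) auto
    then show "(length (takeWhile ((=) a) (?\<phi> j)), length (filter ((=) b) (?\<phi> j)),
        length (filter ((=) a) (?\<phi> j)) - length (takeWhile ((=) a) (?\<phi> j))) = j"
      using ab j by (auto simp: filter_replicate)
  qed
  have two: "two (replicate k a @ v) = (if v = [] \<or> k = 0 then 0 else x ^ k * pure_val b y v)"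
    if "v = [] \<or> hd v \<noteq> a" for k v
    using that ab two_val_run[OF ab that, of x y k] pure_val_replicate[of a x k v]
    unfolding two_def by (cases v) auto
  have f: "?f (replicate k a @ replicate l b @ v) = (if l = 0 \<or> k = 0 \<or> v = [] then 0 else x ^ k * y ^ l * pure_val a x v)"
    if v: "v = [] \<or> hd v \<noteq> b" and l: "l = 0 \<longrightarrow> v = []" for k l v
  proof -
    have h: "replicate l b @ v = [] \<or> hd (replicate l b @ v) \<noteq> a" using l ab by (cases l) auto
    have "pure_val b y (replicate l b @ v) = (if v = [] then y ^ l else 0)"
      using v pure_val_replicate[of b y l v] by (cases v) auto
    then show ?thesis
      unfolding two[OF h] three_val_run[OF ab h] two_val_run[OF ab[symmetric] v] using ab v l by auto
  qed
  have s: "(\<Sum>w\<in>Poly_Mapping.keys P. Poly_Mapping.lookup P w * ?f w) =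
    (\<Sum>j\<in>{j \<in> ?D. ?\<phi> j \<in> Poly_Mapping.keys P}. Poly_Mapping.lookup P (?\<phi> j) * (case j of (k, l, m) \<Rightarrow> x ^ k * y ^ l * x ^ m))"
  proof (rule sum_keys_reindex[OF inj])
    fix j assume "j \<in> ?D"
    then obtain k l m where j: "j = (k, l, m)" "1 \<le> k" "1 \<le> l" "1 \<le> m" by auto
    have "hd (replicate m a) \<noteq> b" using j ab by (cases m) auto
    then show "?f (?\<phi> j) = (case j of (k, l, m) \<Rightarrow> x ^ k * y ^ l * x ^ m)"
      using f[of "replicate m a" l k] j pure_val_replicate[of a x m "[]"] by auto
  next
    fix w assume w: "w \<notin> ?\<phi> ` ?D"
    obtain k u where ku: "w = replicate k a @ u" "u = [] \<or> hd u \<noteq> a" by (rule word_first_run)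
    obtain l v where lv: "u = replicate l b @ v" "v = [] \<or> hd v \<noteq> b" by (rule word_first_run)
    have l0: "l = 0 \<longrightarrow> v = []"
    proof (intro impI)
      assume "l = 0"
      then show "v = []" using ku lv ab by (cases v) (auto, metis (full_types) letter.exhaust)
    qed
    note eq = f[OF lv(2) l0, of k]
    show "?f w = 0"
    proof (cases "l = 0 \<or> k = 0 \<or> v = []")
      case True
      then show ?thesis using eq ku(1) lv(1) by auto
    next
      case False
      have "v \<noteq> replicate (length v) a"
      proof
        assume "v = replicate (length v) a"
        then have "w = ?\<phi> (k, l, length v)" using ku lv by auto
        moreover have "(k, l, length v) \<in> ?D" using False by (auto simp: Suc_le_eq)
        ultimately show False using w by blast
      qed
      then show ?thesis using eq ku(1) lv(1) by (auto simp: pure_val_eq_0)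
    qed
  qed
  have eq1: "{j \<in> ?D. ?\<phi> j \<in> Poly_Mapping.keys P} =
      {(k, l, m). 1 \<le> k \<and> 1 \<le> l \<and> 1 \<le> m \<and> replicate k a @ replicate l b @ replicate m a \<in> Poly_Mapping.keys P}" by auto
  have eq2: "(\<Sum>w\<in>Poly_Mapping.keys P. Poly_Mapping.lookup P w * two w) =
    (\<Sum>(k, l)\<in>{(k, l). 1 \<le> k \<and> 1 \<le> l \<and> replicate k a @ replicate l b \<in> Poly_Mapping.keys P}.
       Poly_Mapping.lookup P (replicate k a @ replicate l b) * (x ^ k * y ^ l))"
    using sum_two_val[OF ab, of P x y] unfolding two_def by (simp add: algebra_simps sum_subtractf)
  show ?thesis using s unfolding eq1 eq2[symmetric]
    by (simp add: algebra_simps sum_subtractf case_prod_unfold)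
qed

lemma nc_P1_eq: "nc_P1 P x = (\<Sum>w\<in>Poly_Mapping.keys P. Poly_Mapping.lookup P w * pure_val LX x w)"
  and nc_Q1_eq: "nc_Q1 P y = (\<Sum>w\<in>Poly_Mapping.keys P. Poly_Mapping.lookup P w * pure_val LY y w)"
  by (simp_all add: nc_P1_def nc_Q1_def nc_eval_def pure_val_letter_val)

lemma lookup_Nil_eq_nc_eval: "nc_eval P 0 0 = Poly_Mapping.lookup P []"
proof -
  have "prod_list (map (letter_val 0 (0::complex)) w) = (if w = [] then 1 else 0)" for w
    by (cases w rule: list.exhaust; cases "hd w") auto
  then have "nc_eval P 0 0 = (\<Sum>w\<in>Poly_Mapping.keys P. if w = [] then Poly_Mapping.lookup P w else 0)"
    unfolding nc_eval_def by (intro sum.cong) auto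
  also have "\<dots> = Poly_Mapping.lookup P []"
    by (simp add: sum.delta' sum.delta in_keys_iff)
  finally show ?thesis .
qed

lemma sum_pure_val_nonempty:
  assumes "nc_eval P 0 0 = 0"
  shows "(\<Sum>w\<in>Poly_Mapping.keys P. Poly_Mapping.lookup P w * (if w = [] then 0 else pure_val a x w)) =
    (\<Sum>w\<in>Poly_Mapping.keys P. Poly_Mapping.lookup P w * pure_val a x w)"
  using assms by (intro sum.cong) (auto simp: lookup_Nil_eq_nc_eval)

lemma nc_Q2_eq: "nc_Q2 P x y = (\<Sum>(k, l)\<in>{(k, l). 1 \<le> k \<and> 1 \<le> l \<and> replicate k LY @ replicate l LX \<in> Poly_Mapping.keys P}.
       Poly_Mapping.lookup P (replicate k LY @ replicate l LX) * (y ^ k * x ^ l))"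
  unfolding nc_Q2_def word_yx_def
  by (rule sum.reindex_bij_witness[of _ prod.swap prod.swap]) (auto simp: mult.assoc)

lemma nc_Q3_eq: "nc_Q3 P x y = (\<Sum>(k, l, m)\<in>{(k, l, m). 1 \<le> k \<and> 1 \<le> l \<and> 1 \<le> m \<and> replicate k LY @ replicate l LX @ replicate m LY \<in> Poly_Mapping.keys P}.
       Poly_Mapping.lookup P (replicate k LY @ replicate l LX @ replicate m LY) * (y ^ k * x ^ l * y ^ m))"
  unfolding nc_Q3_def word_yxy_def
  by (rule sum.reindex_bij_witness[of _ "\<lambda>(k, l, m). (l, k, m)" "\<lambda>(k, l, m). (l, k, m)"]) (auto simp: mult.assoc)

text \<open>The empty word contributes to \<open>P\<^sub>1\<close> and \<open>Q\<^sub>1\<close> but to none of the sums on the left, so the identities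
  hold because the constant term vanishes.\<close>

lemma sums_leading_values:
  assumes "nc_eval P 0 0 = 0"
  shows "(\<Sum>w\<in>Poly_Mapping.keys P. Poly_Mapping.lookup P w * two_val LX LY x y w) = nc_P1 P x + nc_P2 P x y"
    and "(\<Sum>w\<in>Poly_Mapping.keys P. Poly_Mapping.lookup P w * two_val LY LX y x w) = nc_Q1 P y + nc_Q2 P x y"
    and "(\<Sum>w\<in>Poly_Mapping.keys P. Poly_Mapping.lookup P w * three_val LX LY x y w) = nc_P2 P x y + nc_P3 P x y"
    and "(\<Sum>w\<in>Poly_Mapping.keys P. Poly_Mapping.lookup P w * three_val LY LX y x w) = nc_Q2 P x y + nc_Q3 P x y"
  unfolding nc_P1_eq nc_Q1_eq nc_Q2_eq nc_Q3_eq
  by (simp_all add: sum_two_val sum_three_val sum_pure_val_nonempty[OF assms]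
        nc_P2_def nc_P3_def word_xy_def word_xyx_def mult.assoc)

section \<open>First order expansion of the corner\<close>

text \<open>Multiplication by \<open>a\<close> from the left produces zero rows at the bottom, multiplication by \<open>b\<close> zero
  rows at the top. The entries of a word thus satisfy a linear recursion in its first letter.\<close>

lemma block_word_x:
  assumes q: "q < r + s"
  shows "i < r \<Longrightarrow> nc_word_mat (r + s) (block_a r s \<alpha> X) (block_b r s \<beta> Z) (LX # w) $$ (i, q) =
      \<alpha> i * (nc_word_mat (r + s) (block_a r s \<alpha> X) (block_b r s \<beta> Z) w $$ (i, q) +
        (\<Sum>j<s. X i j * nc_word_mat (r + s) (block_a r s \<alpha> X) (block_b r s \<beta> Z) w $$ (r + j, q)))"
    and "j < s \<Longrightarrow> nc_word_mat (r + s) (block_a r s \<alpha> X) (block_b r s \<beta> Z) (LX # w) $$ (r + j, q) = 0"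
proof -
  let ?W = "nc_word_mat (r + s) (block_a r s \<alpha> X) (block_b r s \<beta> Z) w"
  have W: "?W \<in> carrier_mat (r + s) (r + s)" by auto
  have e: "(block_a r s \<alpha> X * ?W) $$ (p, q) = (\<Sum>k<r. block_a r s \<alpha> X $$ (p, k) * ?W $$ (k, q)) +
      (\<Sum>j<s. block_a r s \<alpha> X $$ (p, r + j) * ?W $$ (r + j, q))" if "p < r + s" for p
    using that q by (subst mat_mult_entry[OF block_a_carrier W]) (auto simp: sum_lessThan_split)
  show "nc_word_mat (r + s) (block_a r s \<alpha> X) (block_b r s \<beta> Z) (LX # w) $$ (i, q) =
      \<alpha> i * (?W $$ (i, q) + (\<Sum>j<s. X i j * ?W $$ (r + j, q)))" if i: "i < r"
  proof -
    have "(\<Sum>k<r. block_a r s \<alpha> X $$ (i, k) * ?W $$ (k, q)) = (\<Sum>k<r. if k = i then \<alpha> i * ?W $$ (i, q) else 0)"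
      using i by (intro sum.cong) (auto simp: block_a_def)
    then show ?thesis using i e[of i]
      by (simp add: block_a_def sum.delta sum_distrib_left algebra_simps)
  qed
  show "nc_word_mat (r + s) (block_a r s \<alpha> X) (block_b r s \<beta> Z) (LX # w) $$ (r + j, q) = 0" if "j < s"
    using that e[of "r + j"] by (simp add: block_a_def)
qed

lemma block_word_y:
  assumes q: "q < r + s"
  shows "i < r \<Longrightarrow> nc_word_mat (r + s) (block_a r s \<alpha> X) (block_b r s \<beta> Z) (LY # w) $$ (i, q) = 0"
    and "j < s \<Longrightarrow> nc_word_mat (r + s) (block_a r s \<alpha> X) (block_b r s \<beta> Z) (LY # w) $$ (r + j, q) =
      \<beta> j * ((\<Sum>i<r. Z i j * nc_word_mat (r + s) (block_a r s \<alpha> X) (block_b r s \<beta> Z) w $$ (i, q)) +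
        nc_word_mat (r + s) (block_a r s \<alpha> X) (block_b r s \<beta> Z) w $$ (r + j, q))"
proof -
  let ?W = "nc_word_mat (r + s) (block_a r s \<alpha> X) (block_b r s \<beta> Z) w"
  have W: "?W \<in> carrier_mat (r + s) (r + s)" by auto
  have e: "(block_b r s \<beta> Z * ?W) $$ (p, q) = (\<Sum>k<r. block_b r s \<beta> Z $$ (p, k) * ?W $$ (k, q)) +
      (\<Sum>j<s. block_b r s \<beta> Z $$ (p, r + j) * ?W $$ (r + j, q))" if "p < r + s" for p
    using that q by (subst mat_mult_entry[OF block_b_carrier W]) (auto simp: sum_lessThan_split)
  show "nc_word_mat (r + s) (block_a r s \<alpha> X) (block_b r s \<beta> Z) (LY # w) $$ (i, q) = 0" if "i < r"
    using that e[of i] by (simp add: block_b_def)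
  show "nc_word_mat (r + s) (block_a r s \<alpha> X) (block_b r s \<beta> Z) (LY # w) $$ (r + j, q) =
      \<beta> j * ((\<Sum>i<r. Z i j * ?W $$ (i, q)) + ?W $$ (r + j, q))" if j: "j < s"
  proof -
    have "(\<Sum>k<s. block_b r s \<beta> Z $$ (r + j, r + k) * ?W $$ (r + k, q)) = (\<Sum>k<s. if k = j then \<beta> j * ?W $$ (r + j, q) else 0)"
      using j by (intro sum.cong) (auto simp: block_b_def)
    then show ?thesis using j e[of "r + j"]
      by (simp add: block_b_def sum.delta sum_distrib_left algebra_simps)
  qed
qed

text \<open>The shape of the four blocks when the corner enters \<open>a\<close> as \<open>d Y\<close> and \<open>b\<close> as the conjugate of \<open>Y\<close>,
  with \<open>d\<close> small and \<open>Y\<close> bounded. The precision differs from block to block: only the diagonal and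
  the upper right block are needed up to \<open>O(d\<^sup>2)\<close>, since the lower left block is removed by a shear
  that meets the upper right one in a product, and the remaining off-diagonal entries enter
  determinants in pairs.\<close>

definition first_order_expansion ::
  "nat \<Rightarrow> nat \<Rightarrow> 'a filter \<Rightarrow> ('a \<Rightarrow> nat \<Rightarrow> nat \<Rightarrow> complex) \<Rightarrow> ('a \<Rightarrow> complex) \<Rightarrow>
   (nat \<Rightarrow> complex) \<Rightarrow> (nat \<Rightarrow> complex) \<Rightarrow> (nat \<Rightarrow> nat \<Rightarrow> complex) \<Rightarrow> (nat \<Rightarrow> nat \<Rightarrow> complex) \<Rightarrow>
   (nat \<Rightarrow> nat \<Rightarrow> complex) \<Rightarrow> (nat \<Rightarrow> nat \<Rightarrow> complex) \<Rightarrow> ('a \<Rightarrow> complex mat) \<Rightarrow> bool" where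
  "first_order_expansion r s F Y d t1 t2 e1 e2 f h T \<longleftrightarrow>
    (\<forall>i<r. \<forall>i'<r. i \<noteq> i' \<longrightarrow> (\<lambda>x. T x $$ (i, i')) \<in> O[F](d)) \<and>
    (\<forall>i<r. (\<lambda>x. T x $$ (i, i) - t1 i - d x * (\<Sum>j<s. e1 i j * (Y x i j * cnj (Y x i j)))) \<in> O[F](\<lambda>x. (d x)\<^sup>2)) \<and>
    (\<forall>i<r. \<forall>j<s. (\<lambda>x. T x $$ (i, r + j) - d x * (f i j * Y x i j)) \<in> O[F](\<lambda>x. (d x)\<^sup>2)) \<and>
    (\<forall>i<r. \<forall>j<s. (\<lambda>x. T x $$ (r + j, i) - h i j * cnj (Y x i j)) \<in> O[F](d)) \<and>
    (\<forall>j<s. \<forall>j'<s. j \<noteq> j' \<longrightarrow> (\<lambda>x. T x $$ (r + j, r + j')) \<in> O[F](d)) \<and>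
    (\<forall>j<s. (\<lambda>x. T x $$ (r + j, r + j) - t2 j - d x * (\<Sum>i<r. e2 i j * (Y x i j * cnj (Y x i j)))) \<in> O[F](\<lambda>x. (d x)\<^sup>2))"

lemma first_order_expansionD:
  assumes "first_order_expansion r s F Y d t1 t2 e1 e2 f h T"
  shows "i < r \<Longrightarrow> i' < r \<Longrightarrow> i \<noteq> i' \<Longrightarrow> (\<lambda>x. T x $$ (i, i')) \<in> O[F](d)"
    and "i < r \<Longrightarrow> (\<lambda>x. T x $$ (i, i) - t1 i - d x * (\<Sum>j<s. e1 i j * (Y x i j * cnj (Y x i j)))) \<in> O[F](\<lambda>x. (d x)\<^sup>2)"
    and "i < r \<Longrightarrow> j < s \<Longrightarrow> (\<lambda>x. T x $$ (i, r + j) - d x * (f i j * Y x i j)) \<in> O[F](\<lambda>x. (d x)\<^sup>2)"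
    and "i < r \<Longrightarrow> j < s \<Longrightarrow> (\<lambda>x. T x $$ (r + j, i) - h i j * cnj (Y x i j)) \<in> O[F](d)"
    and "j < s \<Longrightarrow> j' < s \<Longrightarrow> j \<noteq> j' \<Longrightarrow> (\<lambda>x. T x $$ (r + j, r + j')) \<in> O[F](d)"
    and "j < s \<Longrightarrow> (\<lambda>x. T x $$ (r + j, r + j) - t2 j - d x * (\<Sum>i<r. e2 i j * (Y x i j * cnj (Y x i j)))) \<in> O[F](\<lambda>x. (d x)\<^sup>2)"
  using assms unfolding first_order_expansion_def by (elim conjE; simp)+

lemma bigo_bounded_mult:
  "f \<in> O[F](\<lambda>_. 1) \<Longrightarrow> g \<in> O[F](h) \<Longrightarrow> (\<lambda>x. f x * g x) \<in> O[F](h)"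
  using landau_o.big.mult[of f F "\<lambda>_. 1" g h] by simp

lemma bigo_cong_fun: "f \<in> O[F](h) \<Longrightarrow> (\<And>x. f x = g x) \<Longrightarrow> g \<in> O[F](h)"
  by (subst (asm) ext[of f g]) auto

lemma sum_weighted_swap:
  fixes c :: "'w \<Rightarrow> complex"
  shows "(\<Sum>w\<in>K. c w * (z * (\<Sum>j\<in>J. e w j * y j))) = z * (\<Sum>j\<in>J. (\<Sum>w\<in>K. c w * e w j) * y j)"
  by (simp add: sum_distrib_left sum_distrib_right sum.swap[of _ J K] ac_simps)

lemma sum_weighted_residual:
  fixes c :: "'w \<Rightarrow> complex"
  shows "(\<Sum>w\<in>K. c w * (a w - b w - z * (\<Sum>j\<in>J. e w j * y j))) =
    (\<Sum>w\<in>K. c w * a w) - (\<Sum>w\<in>K. c w * b w) - z * (\<Sum>j\<in>J. (\<Sum>w\<in>K. c w * e w j) * y j)"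
  unfolding sum_weighted_swap[symmetric] by (simp only: right_diff_distrib sum_subtractf)

context
  fixes r s :: nat and F :: "'a filter" and Y :: "'a \<Rightarrow> nat \<Rightarrow> nat \<Rightarrow> complex" and d :: "'a \<Rightarrow> complex"
  assumes bounded_Y: "\<forall>i<r. \<forall>j<s. (\<lambda>x. Y x i j) \<in> O[F](\<lambda>_. 1)"
    and d: "d \<in> O[F](\<lambda>_. 1)"
begin

lemma bounded_entry: "i < r \<Longrightarrow> j < s \<Longrightarrow> (\<lambda>x. Y x i j) \<in> O[F](\<lambda>_. 1)"
  using bounded_Y by blast

lemma bounded_cnj_entry: "i < r \<Longrightarrow> j < s \<Longrightarrow> (\<lambda>x. cnj (Y x i j)) \<in> O[F](\<lambda>_. 1)"
  using bounded_entry[of i j] by (simp add: landau_o.big.cong_ex bigo_def)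

lemma bigo_d2_d: "f \<in> O[F](\<lambda>x. (d x)\<^sup>2) \<Longrightarrow> f \<in> O[F](d)"
  using bigo_bounded_mult[OF d, of d d] landau_o.big_trans[of f F "\<lambda>x. (d x)\<^sup>2" d]
  by (simp add: power2_eq_square)

lemma bigo_d_1: "f \<in> O[F](d) \<Longrightarrow> f \<in> O[F](\<lambda>_. 1)"
  using d landau_o.big_trans by blast

lemma bigo_d_mult: "f \<in> O[F](\<lambda>_. 1) \<Longrightarrow> (\<lambda>x. d x * f x) \<in> O[F](d)"
  using landau_o.big.mult[of d F d f "\<lambda>_. 1"] by simp

lemma bigo_d_mult_d: "f \<in> O[F](d) \<Longrightarrow> (\<lambda>x. d x * f x) \<in> O[F](\<lambda>x. (d x)\<^sup>2)"
  using landau_o.big.mult[of d F d f d] by (simp add: power2_eq_square)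

lemma first_order_expansion_coarse:
  assumes "first_order_expansion r s F Y d t1 t2 e1 e2 f h T"
  shows "i < r \<Longrightarrow> i' < r \<Longrightarrow> (\<lambda>x. T x $$ (i, i') - (if i = i' then t1 i else 0)) \<in> O[F](d)"
    and "i < r \<Longrightarrow> j < s \<Longrightarrow> (\<lambda>x. T x $$ (i, r + j)) \<in> O[F](d)"
    and "j < s \<Longrightarrow> j' < s \<Longrightarrow> (\<lambda>x. T x $$ (r + j, r + j') - (if j = j' then t2 j else 0)) \<in> O[F](d)"
    and "i < r \<Longrightarrow> j < s \<Longrightarrow> (\<lambda>x. T x $$ (r + j, i)) \<in> O[F](\<lambda>_. 1)"
proof -
  note E = first_order_expansionD[OF assms]
  have YY: "(\<lambda>x. Y x i j * cnj (Y x i j)) \<in> O[F](\<lambda>_. 1)" if "i < r" "j < s" for i j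
    using bigo_bounded_mult[OF bounded_entry[OF that] bounded_cnj_entry[OF that]] .
  show "(\<lambda>x. T x $$ (i, i') - (if i = i' then t1 i else 0)) \<in> O[F](d)" if "i < r" "i' < r"
  proof (cases "i = i'")
    case True
    have "(\<lambda>x. d x * (\<Sum>j<s. e1 i j * (Y x i j * cnj (Y x i j)))) \<in> O[F](d)"
      using that by (intro bigo_d_mult big_sum_in_bigo bigo_bounded_mult[OF _ YY]) auto
    from sum_in_bigo(1)[OF bigo_d2_d[OF E(2)[of i]] this] that True show ?thesis by simp
  qed (use E(1) that in auto)
  show "(\<lambda>x. T x $$ (r + j, r + j') - (if j = j' then t2 j else 0)) \<in> O[F](d)" if "j < s" "j' < s"
  proof (cases "j = j'")
    case True
    have "(\<lambda>x. d x * (\<Sum>i<r. e2 i j * (Y x i j * cnj (Y x i j)))) \<in> O[F](d)"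
      using that by (intro bigo_d_mult big_sum_in_bigo bigo_bounded_mult[OF _ YY]) auto
    from sum_in_bigo(1)[OF bigo_d2_d[OF E(6)[of j]] this] that True show ?thesis by simp
  qed (use E(5) that in auto)
  show "(\<lambda>x. T x $$ (i, r + j)) \<in> O[F](d)" if "i < r" "j < s"
  proof -
    have "(\<lambda>x. d x * (f i j * Y x i j)) \<in> O[F](d)"
      using that bounded_entry by (intro bigo_d_mult bigo_bounded_mult) auto
    from sum_in_bigo(1)[OF bigo_d2_d[OF E(3)[of i j]] this] that show ?thesis by simp
  qed
  show "(\<lambda>x. T x $$ (r + j, i)) \<in> O[F](\<lambda>_. 1)" if "i < r" "j < s"
  proof -
    have "(\<lambda>x. h i j * cnj (Y x i j)) \<in> O[F](\<lambda>_. 1)"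
      using that bounded_cnj_entry by (intro bigo_bounded_mult) auto
    from sum_in_bigo(1)[OF bigo_d_1[OF E(4)[of i j]] this] that show ?thesis by simp
  qed
qed

text \<open>Induction along the word. Prefixing \<open>x\<close> replaces the upper rows by \<open>\<alpha>\<close> times themselves plus \<open>d Y\<close>
  times the lower rows, and prefixing \<open>y\<close> replaces the lower rows by \<open>\<beta>\<close> times themselves plus the
  conjugate of \<open>Y\<close> times the upper rows. The coefficients follow exactly the recursions that define
  \<open>pure_val\<close>, \<open>two_val\<close> and \<open>three_val\<close>.\<close>

lemma word_first_order_expansion:
  "first_order_expansion r s F Y d (\<lambda>i. pure_val LX (\<alpha> i) w) (\<lambda>j. pure_val LY (\<beta> j) w)
     (\<lambda>i j. three_val LX LY (\<alpha> i) (\<beta> j) w) (\<lambda>i j. three_val LY LX (\<beta> j) (\<alpha> i) w)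
     (\<lambda>i j. two_val LX LY (\<alpha> i) (\<beta> j) w) (\<lambda>i j. two_val LY LX (\<beta> j) (\<alpha> i) w)
     (\<lambda>x. nc_word_mat (r + s) (block_a r s \<alpha> (\<lambda>i j. d x * Y x i j)) (block_b r s \<beta> (\<lambda>i j. cnj (Y x i j))) w)"
proof (induction w)
  case Nil
  show ?case by (auto simp: first_order_expansion_def)
next
  case (Cons c w)
  define W where "W x = nc_word_mat (r + s) (block_a r s \<alpha> (\<lambda>i j. d x * Y x i j)) (block_b r s \<beta> (\<lambda>i j. cnj (Y x i j))) w" for x
  define W' where "W' x = nc_word_mat (r + s) (block_a r s \<alpha> (\<lambda>i j. d x * Y x i j)) (block_b r s \<beta> (\<lambda>i j. cnj (Y x i j))) (c # w)" for x
  note IH = Cons[folded W_def]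
  note E = first_order_expansionD[OF IH] and C = first_order_expansion_coarse[OF IH]
  show ?case
  proof (cases c)
    case c: LX
    have Wi: "W' x $$ (i, q) = \<alpha> i * (W x $$ (i, q) + (\<Sum>j<s. d x * Y x i j * W x $$ (r + j, q)))" if "i < r" "q < r + s" for x i q
      using that by (simp only: W'_def W_def c block_word_x)
    have Wj: "W' x $$ (r + j, q) = 0" if "j < s" "q < r + s" for x j q
      using that unfolding W'_def c by (simp only: block_word_x)
    show ?thesis
      unfolding W'_def[symmetric] first_order_expansion_def
    proof (intro conjI allI impI)
      fix i i' assume i: "i < r" "i' < r" "i \<noteq> i'"
      have "(\<lambda>x. \<Sum>j<s. d x * (Y x i j * W x $$ (r + j, i'))) \<in> O[F](d)"
        using i by (intro big_sum_in_bigo bigo_d_mult bigo_bounded_mult[OF bounded_entry] C(4)) auto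
      then have "(\<lambda>x. \<alpha> i * (W x $$ (i, i') + (\<Sum>j<s. d x * (Y x i j * W x $$ (r + j, i'))))) \<in> O[F](d)"
        using i by (intro bigo_bounded_mult sum_in_bigo(1)[OF E(1)]) auto
      then show "(\<lambda>x. W' x $$ (i, i')) \<in> O[F](d)" using i by (simp add: Wi mult.assoc)
    next
      fix i assume i: "i < r"
      let ?h = "\<lambda>j. two_val LY LX (\<beta> j) (\<alpha> i) w" and ?p = "\<lambda>j. three_val LX LY (\<alpha> i) (\<beta> j) w"
      have "(\<lambda>x. \<Sum>j<s. d x * (Y x i j * (W x $$ (r + j, i) - ?h j * cnj (Y x i j)))) \<in> O[F](\<lambda>x. (d x)\<^sup>2)"
        using i by (intro big_sum_in_bigo bigo_d_mult_d bigo_bounded_mult[OF bounded_entry] E(4)) auto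
      then have "(\<lambda>x. \<alpha> i * (W x $$ (i, i) - pure_val LX (\<alpha> i) w - d x * (\<Sum>j<s. ?p j * (Y x i j * cnj (Y x i j))) +
         (\<Sum>j<s. d x * (Y x i j * (W x $$ (r + j, i) - ?h j * cnj (Y x i j)))))) \<in> O[F](\<lambda>x. (d x)\<^sup>2)" (is "?f \<in> _")
        using i by (intro bigo_bounded_mult sum_in_bigo(1)[OF E(2)]) auto
      then show "(\<lambda>x. W' x $$ (i, i) - pure_val LX (\<alpha> i) (c # w) -
          d x * (\<Sum>j<s. three_val LX LY (\<alpha> i) (\<beta> j) (c # w) * (Y x i j * cnj (Y x i j)))) \<in> O[F](\<lambda>x. (d x)\<^sup>2)"
        by (rule bigo_cong_fun) (use i c in \<open>simp add: Wi algebra_simps sum_distrib_left sum.distrib sum_subtractf\<close>)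
    next
      fix i j assume ij: "i < r" "j < s"
      let ?g = "two_val LX LY (\<alpha> i) (\<beta> j) w" and ?y = "pure_val LY (\<beta> j) w"
      have "(\<lambda>x. \<Sum>j'<s. d x * (Y x i j' * (W x $$ (r + j', r + j) - (if j' = j then pure_val LY (\<beta> j') w else 0)))) \<in> O[F](\<lambda>x. (d x)\<^sup>2)"
        using ij by (intro big_sum_in_bigo bigo_d_mult_d bigo_bounded_mult[OF bounded_entry] C(3)) auto
      then have A: "(\<lambda>x. \<alpha> i * (W x $$ (i, r + j) - d x * (?g * Y x i j) +
         (\<Sum>j'<s. d x * (Y x i j' * (W x $$ (r + j', r + j) - (if j' = j then pure_val LY (\<beta> j') w else 0)))))) \<in> O[F](\<lambda>x. (d x)\<^sup>2)"
        using ij by (intro bigo_bounded_mult sum_in_bigo(1)[OF E(3)]) auto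
      have B: "(\<Sum>j'<s. d x * (Y x i j' * (W x $$ (r + j', r + j) - (if j' = j then pure_val LY (\<beta> j') w else 0)))) =
          (\<Sum>j'<s. d x * Y x i j' * W x $$ (r + j', r + j)) - d x * Y x i j * ?y" for x
      proof -
        have "(\<Sum>j'<s. d x * (Y x i j' * (W x $$ (r + j', r + j) - (if j' = j then pure_val LY (\<beta> j') w else 0)))) =
          (\<Sum>j'<s. d x * Y x i j' * W x $$ (r + j', r + j) - (if j' = j then d x * Y x i j * ?y else 0))"
          by (intro sum.cong) (auto simp: algebra_simps)
        then show ?thesis using ij by (simp add: sum_subtractf sum.delta)
      qed
      show "(\<lambda>x. W' x $$ (i, r + j) - d x * (two_val LX LY (\<alpha> i) (\<beta> j) (c # w) * Y x i j)) \<in> O[F](\<lambda>x. (d x)\<^sup>2)"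
        by (rule bigo_cong_fun[OF A], subst B) (use ij c in \<open>simp add: Wi algebra_simps\<close>)
    qed (use Wj c in auto)
  next
    case c: LY
    have Wi: "W' x $$ (i, q) = 0" if "i < r" "q < r + s" for x i q
      using that unfolding W'_def c by (simp only: block_word_y)
    have Wj: "W' x $$ (r + j, q) = \<beta> j * ((\<Sum>i<r. cnj (Y x i j) * W x $$ (i, q)) + W x $$ (r + j, q))" if "j < s" "q < r + s" for x j q
      using that by (simp only: W'_def W_def c block_word_y)
    show ?thesis
      unfolding W'_def[symmetric] first_order_expansion_def
    proof (intro conjI allI impI)
      fix j j' assume j: "j < s" "j' < s" "j \<noteq> j'"
      have "(\<lambda>x. \<Sum>i<r. cnj (Y x i j) * W x $$ (i, r + j')) \<in> O[F](d)"
        using j by (intro big_sum_in_bigo bigo_bounded_mult[OF bounded_cnj_entry] C(2)) auto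
      then have "(\<lambda>x. \<beta> j * ((\<Sum>i<r. cnj (Y x i j) * W x $$ (i, r + j')) + W x $$ (r + j, r + j'))) \<in> O[F](d)"
        using j by (intro bigo_bounded_mult sum_in_bigo(1)[OF _ E(5)]) auto
      then show "(\<lambda>x. W' x $$ (r + j, r + j')) \<in> O[F](d)" using j by (simp add: Wj)
    next
      fix j assume j: "j < s"
      let ?g = "\<lambda>i. two_val LX LY (\<alpha> i) (\<beta> j) w" and ?q = "\<lambda>i. three_val LY LX (\<beta> j) (\<alpha> i) w"
      have "(\<lambda>x. \<Sum>i<r. cnj (Y x i j) * (W x $$ (i, r + j) - d x * (?g i * Y x i j))) \<in> O[F](\<lambda>x. (d x)\<^sup>2)"
        using j by (intro big_sum_in_bigo bigo_bounded_mult[OF bounded_cnj_entry] E(3)) auto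
      then have "(\<lambda>x. \<beta> j * ((\<Sum>i<r. cnj (Y x i j) * (W x $$ (i, r + j) - d x * (?g i * Y x i j))) +
          (W x $$ (r + j, r + j) - pure_val LY (\<beta> j) w - d x * (\<Sum>i<r. ?q i * (Y x i j * cnj (Y x i j)))))) \<in> O[F](\<lambda>x. (d x)\<^sup>2)"
        using j by (intro bigo_bounded_mult sum_in_bigo(1)[OF _ E(6)]) auto
      then show "(\<lambda>x. W' x $$ (r + j, r + j) - pure_val LY (\<beta> j) (c # w) -
          d x * (\<Sum>i<r. three_val LY LX (\<beta> j) (\<alpha> i) (c # w) * (Y x i j * cnj (Y x i j)))) \<in> O[F](\<lambda>x. (d x)\<^sup>2)"
        by (rule bigo_cong_fun, subst Wj) (use j c in \<open>simp_all add: algebra_simps sum_distrib_left sum.distrib sum_subtractf\<close>)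
    next
      fix i j assume ij: "i < r" "j < s"
      let ?h = "two_val LY LX (\<beta> j) (\<alpha> i) w" and ?x = "pure_val LX (\<alpha> i) w"
      have "(\<lambda>x. \<Sum>i'<r. cnj (Y x i' j) * (W x $$ (i', i) - (if i' = i then pure_val LX (\<alpha> i') w else 0))) \<in> O[F](d)"
        using ij by (intro big_sum_in_bigo bigo_bounded_mult[OF bounded_cnj_entry] C(1)) auto
      then have A: "(\<lambda>x. \<beta> j * ((\<Sum>i'<r. cnj (Y x i' j) * (W x $$ (i', i) - (if i' = i then pure_val LX (\<alpha> i') w else 0))) +
          (W x $$ (r + j, i) - ?h * cnj (Y x i j)))) \<in> O[F](d)"
        using ij by (intro bigo_bounded_mult sum_in_bigo(1)[OF _ E(4)]) auto
      have B: "(\<Sum>i'<r. cnj (Y x i' j) * (W x $$ (i', i) - (if i' = i then pure_val LX (\<alpha> i') w else 0))) =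
          (\<Sum>i'<r. cnj (Y x i' j) * W x $$ (i', i)) - cnj (Y x i j) * ?x" for x
      proof -
        have "(\<Sum>i'<r. cnj (Y x i' j) * (W x $$ (i', i) - (if i' = i then pure_val LX (\<alpha> i') w else 0))) =
          (\<Sum>i'<r. cnj (Y x i' j) * W x $$ (i', i) - (if i' = i then cnj (Y x i j) * ?x else 0))"
          by (intro sum.cong) (auto simp: algebra_simps)
        then show ?thesis using ij by (simp add: sum_subtractf sum.delta)
      qed
      show "(\<lambda>x. W' x $$ (r + j, i) - two_val LY LX (\<beta> j) (\<alpha> i) (c # w) * cnj (Y x i j)) \<in> O[F](d)"
        by (rule bigo_cong_fun[OF A], subst B, subst Wj) (use ij c in \<open>simp_all add: algebra_simps\<close>)
    qed (use Wi c in auto)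
  qed
qed

lemma first_order_expansion_sum:
  assumes "\<And>w. w \<in> K \<Longrightarrow> first_order_expansion r s F Y d (t1 w) (t2 w) (e1 w) (e2 w) (f w) (h w) (T w)"
    and S: "\<And>x p q. p < r + s \<Longrightarrow> q < r + s \<Longrightarrow> S x $$ (p, q) = (\<Sum>w\<in>K. c w * T w x $$ (p, q))"
  shows "first_order_expansion r s F Y d (\<lambda>i. \<Sum>w\<in>K. c w * t1 w i) (\<lambda>i. \<Sum>w\<in>K. c w * t2 w i)
    (\<lambda>i j. \<Sum>w\<in>K. c w * e1 w i j) (\<lambda>i j. \<Sum>w\<in>K. c w * e2 w i j)
    (\<lambda>i j. \<Sum>w\<in>K. c w * f w i j) (\<lambda>i j. \<Sum>w\<in>K. c w * h w i j) S"
proof -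
  note E = first_order_expansionD[OF assms(1)]
  have B: "(\<lambda>x. \<Sum>w\<in>K. c w * D w x) \<in> O[F](g)" if "\<And>w. w \<in> K \<Longrightarrow> D w \<in> O[F](g)" for D g
    using that by (intro big_sum_in_bigo bigo_bounded_mult) auto
  show ?thesis
    unfolding first_order_expansion_def
  proof (intro conjI allI impI, goal_cases)
    case (1 i i')
    from B[OF E(1)[OF _ this]] show ?case using 1 by (simp add: S)
  next
    case (2 i)
    have S': "S x $$ (i, i) = (\<Sum>w\<in>K. c w * T w x $$ (i, i))" for x using 2 by (simp add: S)
    show ?case
      by (rule bigo_cong_fun[OF B[OF E(2)[OF _ 2]]]) (simp_all only: S' sum_weighted_residual)
  next
    case (3 i j)
    have S': "S x $$ (i, r + j) = (\<Sum>w\<in>K. c w * T w x $$ (i, r + j))" for x using 3 by (simp add: S)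
    show ?case
      by (rule bigo_cong_fun[OF B[OF E(3)[OF _ 3]]])
        (simp_all add: S' right_diff_distrib sum_distrib_left sum_distrib_right sum_subtractf mult_ac)
  next
    case (4 i j)
    have S': "S x $$ (r + j, i) = (\<Sum>w\<in>K. c w * T w x $$ (r + j, i))" for x using 4 by (simp add: S)
    show ?case
      by (rule bigo_cong_fun[OF B[OF E(4)[OF _ 4]]])
        (simp_all add: S' right_diff_distrib sum_distrib_left sum_distrib_right sum_subtractf mult.assoc)
  next
    case (5 j j')
    from B[OF E(5)[OF _ this]] show ?case using 5 by (simp add: S)
  next
    case (6 j)
    have S': "S x $$ (r + j, r + j) = (\<Sum>w\<in>K. c w * T w x $$ (r + j, r + j))" for x using 6 by (simp add: S)
    show ?case
      by (rule bigo_cong_fun[OF B[OF E(6)[OF _ 6]]]) (simp_all only: S' sum_weighted_residual)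
  qed
qed

lemma eval_first_order_expansion:
  assumes P0: "nc_eval P 0 0 = 0"
  shows "first_order_expansion r s F Y d (\<lambda>i. nc_P1 P (\<alpha> i)) (\<lambda>j. nc_Q1 P (\<beta> j))
     (\<lambda>i j. nc_P2 P (\<alpha> i) (\<beta> j) + nc_P3 P (\<alpha> i) (\<beta> j)) (\<lambda>i j. nc_Q2 P (\<alpha> i) (\<beta> j) + nc_Q3 P (\<alpha> i) (\<beta> j))
     (\<lambda>i j. nc_P1 P (\<alpha> i) + nc_P2 P (\<alpha> i) (\<beta> j)) (\<lambda>i j. nc_Q1 P (\<beta> j) + nc_Q2 P (\<alpha> i) (\<beta> j))
     (\<lambda>x. nc_eval_mat (r + s) P (block_a r s \<alpha> (\<lambda>i j. d x * Y x i j)) (block_b r s \<beta> (\<lambda>i j. cnj (Y x i j))))"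
  using first_order_expansion_sum[where K = "Poly_Mapping.keys P"
      and S = "\<lambda>x. nc_eval_mat (r + s) P (block_a r s \<alpha> (\<lambda>i j. d x * Y x i j)) (block_b r s \<beta> (\<lambda>i j. cnj (Y x i j)))"
      and c = "Poly_Mapping.lookup P"
      and T = "\<lambda>w x. nc_word_mat (r + s) (block_a r s \<alpha> (\<lambda>i j. d x * Y x i j)) (block_b r s \<beta> (\<lambda>i j. cnj (Y x i j))) w",
      OF word_first_order_expansion[of \<alpha> _ \<beta>]]
  by (simp add: nc_eval_mat_entry sums_leading_values[OF P0] nc_P1_eq[symmetric] nc_Q1_eq[symmetric])

end

section \<open>The characteristic polynomial near a limiting eigenvalue\<close>

text \<open>In the permutation expansion, a permutation that fixes \<open>k\<close> contributes the entry \<open>(k, k)\<close>, and any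
  other one contributes one off-diagonal entry of row \<open>k\<close> and one of column \<open>k\<close>.\<close>

lemma det_bigo_square:
  fixes A :: "'a \<Rightarrow> nat \<Rightarrow> nat \<Rightarrow> complex"
  assumes k: "k < n" and b: "\<And>p q. p < n \<Longrightarrow> q < n \<Longrightarrow> (\<lambda>x. A x p q) \<in> O[F](\<lambda>_. 1)"
    and kk: "(\<lambda>x. A x k k) \<in> O[F](\<lambda>x. (d x)\<^sup>2)"
    and row: "\<And>q. q < n \<Longrightarrow> q \<noteq> k \<Longrightarrow> (\<lambda>x. A x k q) \<in> O[F](d)"
    and col: "\<And>p. p < n \<Longrightarrow> p \<noteq> k \<Longrightarrow> (\<lambda>x. A x p k) \<in> O[F](d)"
  shows "(\<lambda>x. Determinant.det (Matrix.mat n n (\<lambda>(p, q). A x p q))) \<in> O[F](\<lambda>x. (d x)\<^sup>2)"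
proof -
  have "(\<lambda>x. signof \<sigma> * (\<Prod>p = 0..<n. A x p (\<sigma> p))) \<in> O[F](\<lambda>x. (d x)\<^sup>2)"
    if \<sigma>: "\<sigma> permutes {0..<n}" for \<sigma>
  proof (rule bigo_bounded_mult)
    have lt: "\<sigma> p < n" if "p < n" for p using permutes_in_image[OF \<sigma>, of p] that by simp
    show "(\<lambda>x. \<Prod>p = 0..<n. A x p (\<sigma> p)) \<in> O[F](\<lambda>x. (d x)\<^sup>2)"
    proof (cases "\<sigma> k = k")
      case True
      have "(\<lambda>x. \<Prod>p = 0..<n. A x p (\<sigma> p)) \<in> O[F](\<lambda>x. \<Prod>p = 0..<n. if p = k then (d x)\<^sup>2 else 1)"
      proof (rule landau_o.big_prod)
        fix p assume "p \<in> {0..<n}"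
        then show "(\<lambda>x. A x p (\<sigma> p)) \<in> O[F](\<lambda>x. if p = k then (d x)\<^sup>2 else 1)"
          using kk b lt True by (cases "p = k") auto
      qed
      then show ?thesis using k by (simp add: prod.delta)
    next
      case False
      \<comment> \<open>The row whose entry in the product lies in column \<open>k\<close>.\<close>
      define m where "m = inv_into UNIV \<sigma> k"
      have m: "\<sigma> m = k" using permutes_inverses(1)[OF \<sigma>] by (simp add: m_def)
      have mn: "m < n" using permutes_in_image[OF \<sigma>, of m] m k by simp
      have mk: "m \<noteq> k" using m False by auto
      have "(\<lambda>x. \<Prod>p = 0..<n. A x p (\<sigma> p)) \<in>
          O[F](\<lambda>x. \<Prod>p = 0..<n. (if p = k then d x else 1) * (if p = m then d x else 1))"
      proof (rule landau_o.big_prod)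
        fix p assume p: "p \<in> {0..<n}"
        show "(\<lambda>x. A x p (\<sigma> p)) \<in> O[F](\<lambda>x. (if p = k then d x else 1) * (if p = m then d x else 1))"
        proof (cases "p = k")
          case True
          then show ?thesis using row[OF lt[OF k] False] mk by simp
        next
          case pk: False
          show ?thesis
          proof (cases "p = m")
            case True
            then show ?thesis using col[OF mn mk] m pk by simp
          next
            case False
            then show ?thesis using b[of p "\<sigma> p"] p lt pk by simp
          qed
        qed
      qed
      then show ?thesis using k mn by (simp add: prod.distrib prod.delta power2_eq_square)
    qed
  qed (simp add: sign_def)
  then have B: "(\<lambda>x. \<Sum>\<sigma>\<in>{\<sigma>. \<sigma> permutes {0..<n}}. signof \<sigma> * (\<Prod>p = 0..<n. A x p (\<sigma> p))) \<in> O[F](\<lambda>x. (d x)\<^sup>2)"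
    by (intro big_sum_in_bigo) auto
  show ?thesis
  proof (rule bigo_cong_fun[OF B])
    fix x
    have "(\<Prod>p = 0..<n. Matrix.mat n n (\<lambda>(p, q). A x p q) $$ (p, \<sigma> p)) = (\<Prod>p = 0..<n. A x p (\<sigma> p))"
      if "\<sigma> permutes {0..<n}" for \<sigma>
    proof (rule prod.cong)
      fix p assume p: "p \<in> {0..<n}"
      then have "\<sigma> p < n" using permutes_in_image[OF that, of p] by simp
      then show "Matrix.mat n n (\<lambda>(p, q). A x p q) $$ (p, \<sigma> p) = A x p (\<sigma> p)" using p by simp
    qed simp
    then show "(\<Sum>\<sigma>\<in>{\<sigma>. \<sigma> permutes {0..<n}}. signof \<sigma> * (\<Prod>p = 0..<n. A x p (\<sigma> p))) =
        Determinant.det (Matrix.mat n n (\<lambda>(p, q). A x p q))"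
      unfolding Determinant.det_def by simp
  qed
qed

text \<open>The matrix with diagonal blocks \<open>1\<close> and lower left block \<open>G\<close>; its inverse has lower left block
  \<open>- G\<close>.\<close>

definition shear_mat :: "nat \<Rightarrow> nat \<Rightarrow> (nat \<Rightarrow> nat \<Rightarrow> complex) \<Rightarrow> complex mat" where
  "shear_mat r s G = Matrix.mat (r + s) (r + s)
     (\<lambda>(p, q). if p = q then 1 else if r \<le> p \<and> q < r then G (p - r) q else 0)"

lemma shear_mat_carrier [simp, intro]: "shear_mat r s G \<in> carrier_mat (r + s) (r + s)"
  by (simp add: shear_mat_def)

lemma mult_shear_mat:
  assumes T: "T \<in> carrier_mat (r + s) (r + s)" and p: "p < r + s"
  shows "i < r \<Longrightarrow> (T * shear_mat r s G) $$ (p, i) = T $$ (p, i) + (\<Sum>j<s. T $$ (p, r + j) * G j i)"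
    and "j < s \<Longrightarrow> (T * shear_mat r s G) $$ (p, r + j) = T $$ (p, r + j)"
proof -
  have e: "(T * shear_mat r s G) $$ (p, q) = (\<Sum>k<r. T $$ (p, k) * shear_mat r s G $$ (k, q)) +
      (\<Sum>j<s. T $$ (p, r + j) * shear_mat r s G $$ (r + j, q))" if "q < r + s" for q
    using that p by (subst mat_mult_entry[OF T shear_mat_carrier]) (auto simp: sum_lessThan_split)
  show "(T * shear_mat r s G) $$ (p, i) = T $$ (p, i) + (\<Sum>j<s. T $$ (p, r + j) * G j i)" if i: "i < r"
  proof -
    have "(\<Sum>k<r. T $$ (p, k) * shear_mat r s G $$ (k, i)) = (\<Sum>k<r. if k = i then T $$ (p, i) else 0)"
      using i by (intro sum.cong) (auto simp: shear_mat_def)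
    moreover have "(\<Sum>j<s. T $$ (p, r + j) * shear_mat r s G $$ (r + j, i)) = (\<Sum>j<s. T $$ (p, r + j) * G j i)"
      using i by (intro sum.cong) (auto simp: shear_mat_def)
    ultimately show ?thesis using i e[of i] by simp
  qed
  show "(T * shear_mat r s G) $$ (p, r + j) = T $$ (p, r + j)" if j: "j < s"
  proof -
    have "(\<Sum>k<r. T $$ (p, k) * shear_mat r s G $$ (k, r + j)) = 0"
      using j by (intro sum.neutral) (auto simp: shear_mat_def)
    moreover have "(\<Sum>l<s. T $$ (p, r + l) * shear_mat r s G $$ (r + l, r + j)) = (\<Sum>l<s. if l = j then T $$ (p, r + j) else 0)"
      using j by (intro sum.cong) (auto simp: shear_mat_def)
    ultimately show ?thesis using j e[of "r + j"] by simp
  qed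
qed

lemma shear_mat_mult:
  assumes T: "T \<in> carrier_mat (r + s) (r + s)" and q: "q < r + s"
  shows "i < r \<Longrightarrow> (shear_mat r s G * T) $$ (i, q) = T $$ (i, q)"
    and "j < s \<Longrightarrow> (shear_mat r s G * T) $$ (r + j, q) = (\<Sum>i<r. G j i * T $$ (i, q)) + T $$ (r + j, q)"
proof -
  have e: "(shear_mat r s G * T) $$ (p, q) = (\<Sum>k<r. shear_mat r s G $$ (p, k) * T $$ (k, q)) +
      (\<Sum>j<s. shear_mat r s G $$ (p, r + j) * T $$ (r + j, q))" if "p < r + s" for p
    using that q by (subst mat_mult_entry[OF shear_mat_carrier T]) (auto simp: sum_lessThan_split)
  show "(shear_mat r s G * T) $$ (i, q) = T $$ (i, q)" if i: "i < r"
  proof -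
    have "(\<Sum>k<r. shear_mat r s G $$ (i, k) * T $$ (k, q)) = (\<Sum>k<r. if k = i then T $$ (i, q) else 0)"
      using i by (intro sum.cong) (auto simp: shear_mat_def)
    moreover have "(\<Sum>j<s. shear_mat r s G $$ (i, r + j) * T $$ (r + j, q)) = 0"
      using i by (intro sum.neutral) (auto simp: shear_mat_def)
    ultimately show ?thesis using i e[of i] by simp
  qed
  show "(shear_mat r s G * T) $$ (r + j, q) = (\<Sum>i<r. G j i * T $$ (i, q)) + T $$ (r + j, q)" if j: "j < s"
  proof -
    have "(\<Sum>k<r. shear_mat r s G $$ (r + j, k) * T $$ (k, q)) = (\<Sum>i<r. G j i * T $$ (i, q))"
      using j by (intro sum.cong) (auto simp: shear_mat_def)
    moreover have "(\<Sum>l<s. shear_mat r s G $$ (r + j, r + l) * T $$ (r + l, q)) = (\<Sum>l<s. if l = j then T $$ (r + j, q) else 0)"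
      using j by (intro sum.cong) (auto simp: shear_mat_def)
    ultimately show ?thesis using j e[of "r + j"] by simp
  qed
qed

lemma less_add_cases:
  assumes "(p::nat) < r + s"
  obtains "p < r" | j where "j < s" "p = r + j"
  using assms by (metis add_less_cancel_left le_Suc_ex not_le)

lemma shear_mat_inverse: "shear_mat r s G * shear_mat r s (\<lambda>j i. - G j i) = 1\<^sub>m (r + s)"
proof (rule eq_matI)
  fix p q assume "p < dim_row (1\<^sub>m (r + s) :: complex mat)" "q < dim_col (1\<^sub>m (r + s) :: complex mat)"
  then have pq: "p < r + s" "q < r + s" by auto
  have c: "(\<Sum>j<s. (if p = r + j then 1 else 0) * - G j q) = - G (p - r) q" if "r \<le> p"
  proof -
    have "(\<Sum>j<s. (if p = r + j then 1 else 0) * - G j q) = (\<Sum>j<s. if j = p - r then - G j q else 0)"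
      using that by (intro sum.cong) auto
    then show ?thesis using pq that by (simp add: sum.delta)
  qed
  show "(shear_mat r s G * shear_mat r s (\<lambda>j i. - G j i)) $$ (p, q) = 1\<^sub>m (r + s) $$ (p, q)"
    using pq(2)
  proof (cases rule: less_add_cases)
    case 1
    have "(\<Sum>j<s. shear_mat r s G $$ (p, r + j) * - G j q) = (if r \<le> p then - G (p - r) q else 0)"
    proof (cases "r \<le> p")
      case True
      have "(\<Sum>j<s. shear_mat r s G $$ (p, r + j) * - G j q) = (\<Sum>j<s. (if p = r + j then 1 else 0) * - G j q)"
        using pq by (intro sum.cong) (auto simp: shear_mat_def)
      then show ?thesis using c True by simp
    next
      case False
      then show ?thesis using pq by (simp, intro sum.neutral) (auto simp: shear_mat_def)
    qed
    then show ?thesis using pq 1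
      by (simp add: mult_shear_mat(1)[OF shear_mat_carrier pq(1)] del: index_mult_mat) (auto simp: shear_mat_def)
  next
    case (2 j)
    then show ?thesis using pq
      by (simp add: mult_shear_mat(2)[OF shear_mat_carrier pq(1)] del: index_mult_mat) (auto simp: shear_mat_def)
  qed
qed (auto simp: shear_mat_def)

context
  fixes r s :: nat and F :: "'a filter" and Y :: "'a \<Rightarrow> nat \<Rightarrow> nat \<Rightarrow> complex" and d :: "'a \<Rightarrow> complex"
    and t1 t2 :: "nat \<Rightarrow> complex" and e1 e2 f h :: "nat \<Rightarrow> nat \<Rightarrow> complex" and T :: "'a \<Rightarrow> complex mat"
  assumes bounded_Y: "\<forall>i<r. \<forall>j<s. (\<lambda>x. Y x i j) \<in> O[F](\<lambda>_. 1)"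
    and d: "d \<in> O[F](\<lambda>_. 1)"
    and Tc: "\<And>x. T x \<in> carrier_mat (r + s) (r + s)"
    and gap: "\<And>i j. i < r \<Longrightarrow> j < s \<Longrightarrow> t1 i \<noteq> t2 j"
    and E: "first_order_expansion r s F Y d t1 t2 e1 e2 f h T"
begin

text \<open>The lower left block of the sheared matrix is \<open>H + T\<^sub>2\<^sub>2 G - G T\<^sub>1\<^sub>1\<close> up to \<open>O(d)\<close>, where \<open>H\<close> is the
  block to be removed and \<open>T\<^sub>1\<^sub>1\<close>, \<open>T\<^sub>2\<^sub>2\<close> are diagonal to leading order. So \<open>G\<close> is \<open>H\<close> divided
  entrywise by \<open>t1 i - t2 j\<close>. On the diagonal the shear adds the product of the upper right block
  with \<open>G\<close> at the top and subtracts it at the bottom: this is the origin of the quotients, with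
  opposite signs, in the second order coefficients.\<close>

lemma sheared_expansion:
  defines "G \<equiv> \<lambda>x j i. h i j * cnj (Y x i j) / (t1 i - t2 j)"
  defines "S \<equiv> \<lambda>x. shear_mat r s (\<lambda>j i. - G x j i) * (T x * shear_mat r s (G x))"
  defines "u \<equiv> \<lambda>p. if p < r then t1 p else t2 (p - r)"
  defines "v \<equiv> \<lambda>x p. if p < r
      then (\<Sum>j<s. (e1 p j + f p j * h p j / (t1 p - t2 j)) * (Y x p j * cnj (Y x p j)))
      else (\<Sum>i<r. (e2 i (p - r) - f i (p - r) * h i (p - r) / (t1 i - t2 (p - r))) * (Y x i (p - r) * cnj (Y x i (p - r))))"
  shows "p < r + s \<Longrightarrow> q < r + s \<Longrightarrow> p \<noteq> q \<Longrightarrow> (\<lambda>x. S x $$ (p, q)) \<in> O[F](d)"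
    and "p < r + s \<Longrightarrow> (\<lambda>x. S x $$ (p, p) - u p - d x * v x p) \<in> O[F](\<lambda>x. (d x)\<^sup>2)"
proof -
  note D = first_order_expansionD[OF E] and C = first_order_expansion_coarse[OF bounded_Y d E]
  note bm = bigo_bounded_mult
  have G: "(\<lambda>x. G x j i) \<in> O[F](\<lambda>_. 1)" if "i < r" "j < s" for i j
  proof -
    have "(\<lambda>x. (h i j / (t1 i - t2 j)) * cnj (Y x i j)) \<in> O[F](\<lambda>_. 1)"
      using bounded_cnj_entry[OF bounded_Y d that] by (intro bm) auto
    then show ?thesis by (simp add: G_def)
  qed
  define TS where "TS x = T x * shear_mat r s (G x)" for x
  have TSc: "TS x \<in> carrier_mat (r + s) (r + s)" for x
    unfolding TS_def using Tc shear_mat_carrier by (rule mult_carrier_mat)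
  have TS1: "TS x $$ (p, i) = T x $$ (p, i) + (\<Sum>j<s. T x $$ (p, r + j) * G x j i)" if "p < r + s" "i < r" for x p i
    unfolding TS_def using mult_shear_mat(1)[OF Tc] that by blast
  have TS2: "TS x $$ (p, r + j) = T x $$ (p, r + j)" if "p < r + s" "j < s" for x p j
    unfolding TS_def using mult_shear_mat(2)[OF Tc] that by blast
  have S1: "S x $$ (i, q) = TS x $$ (i, q)" if "i < r" "q < r + s" for x i q
    unfolding S_def TS_def[symmetric] using shear_mat_mult(1)[OF TSc] that by blast
  have S2: "S x $$ (r + j, q) = TS x $$ (r + j, q) - (\<Sum>i<r. G x j i * TS x $$ (i, q))" if "j < s" "q < r + s" for x j q
    unfolding S_def TS_def[symmetric] using shear_mat_mult(2)[OF TSc that(2,1)] by (simp add: sum_negf)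
  have TG: "(\<lambda>x. \<Sum>j<s. T x $$ (i, r + j) * G x j i') \<in> O[F](d)" if "i < r" "i' < r" for i i'
  proof (rule big_sum_in_bigo)
    fix j assume j: "j \<in> {..<s}"
    have "(\<lambda>x. G x j i' * T x $$ (i, r + j)) \<in> O[F](d)"
      using that j by (intro bm[OF G C(2)]) auto
    then show "(\<lambda>x. T x $$ (i, r + j) * G x j i') \<in> O[F](d)" by (simp add: mult.commute)
  qed
  have TS_top: "(\<lambda>x. TS x $$ (i, i') - (if i = i' then t1 i else 0)) \<in> O[F](d)" if "i < r" "i' < r" for i i'
    by (rule bigo_cong_fun[OF sum_in_bigo(1)[OF C(1)[OF that] TG[OF that]]]) (use that in \<open>simp add: TS1\<close>)
  \<comment> \<open>The choice of \<open>G\<close> turns the lower left block into \<open>G\<close> times \<open>t1\<close>, which the left factor of the shear then cancels.\<close>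
  have TS_bot: "(\<lambda>x. TS x $$ (r + j, i) - G x j i * t1 i) \<in> O[F](d)" if "i < r" "j < s" for i j
  proof -
    have "(\<lambda>x. \<Sum>j'<s. G x j' i * (T x $$ (r + j, r + j') - (if j = j' then t2 j else 0))) \<in> O[F](d)"
      using that by (intro big_sum_in_bigo bm[OF G C(3)]) auto
    from sum_in_bigo(1)[OF D(4)[OF that] this]
    have A: "(\<lambda>x. T x $$ (r + j, i) - h i j * cnj (Y x i j) + (\<Sum>j'<s. G x j' i * (T x $$ (r + j, r + j') - (if j = j' then t2 j else 0)))) \<in> O[F](d)" .
    show ?thesis
    proof (rule bigo_cong_fun[OF A])
      fix x
      have "(\<Sum>j'<s. G x j' i * (T x $$ (r + j, r + j') - (if j = j' then t2 j else 0))) =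
        (\<Sum>j'<s. T x $$ (r + j, r + j') * G x j' i - (if j' = j then G x j i * t2 j else 0))"
        by (intro sum.cong) (auto simp: algebra_simps)
      also have "\<dots> = (\<Sum>j'<s. T x $$ (r + j, r + j') * G x j' i) - G x j i * t2 j"
        using that by (simp add: sum_subtractf sum.delta)
      finally have B: "(\<Sum>j'<s. G x j' i * (T x $$ (r + j, r + j') - (if j = j' then t2 j else 0))) =
         (\<Sum>j'<s. T x $$ (r + j, r + j') * G x j' i) - G x j i * t2 j" .
      have "h i j * cnj (Y x i j) = G x j i * (t1 i - t2 j)"
        using gap[OF that] by (simp add: G_def)
      also have "\<dots> = G x j i * t1 i - G x j i * t2 j" by (rule right_diff_distrib)
      finally have "h i j * cnj (Y x i j) = G x j i * t1 i - G x j i * t2 j" .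
      then show "T x $$ (r + j, i) - h i j * cnj (Y x i j) + (\<Sum>j'<s. G x j' i * (T x $$ (r + j, r + j') - (if j = j' then t2 j else 0))) =
        TS x $$ (r + j, i) - G x j i * t1 i"
        unfolding B using that by (simp add: TS1)
    qed
  qed
  show "(\<lambda>x. S x $$ (p, q)) \<in> O[F](d)" if pq: "p < r + s" "q < r + s" "p \<noteq> q"
    using pq(1)
  proof (cases rule: less_add_cases)
    case p: 1
    show ?thesis using pq(2)
    proof (cases rule: less_add_cases)
      case 1
      then show ?thesis using TS_top[OF p 1] pq p by (simp add: S1)
    next
      case (2 j)
      then show ?thesis using C(2) p by (simp add: S1 TS2)
    qed
  next
    case p: (2 j)
    show ?thesis using pq(2)
    proof (cases rule: less_add_cases)
      case q: 1
      have "(\<lambda>x. \<Sum>i<r. G x j i * (TS x $$ (i, q) - (if i = q then t1 i else 0))) \<in> O[F](d)"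
        using p q by (intro big_sum_in_bigo bm[OF G TS_top]) auto
      from sum_in_bigo(2)[OF TS_bot[OF q p(1)] this]
      have A: "(\<lambda>x. TS x $$ (r + j, q) - G x j q * t1 q - (\<Sum>i<r. G x j i * (TS x $$ (i, q) - (if i = q then t1 i else 0)))) \<in> O[F](d)" .
      show ?thesis
      proof (rule bigo_cong_fun[OF A])
        fix x
        have "(\<Sum>i<r. G x j i * (TS x $$ (i, q) - (if i = q then t1 i else 0))) =
          (\<Sum>i<r. G x j i * TS x $$ (i, q) - (if i = q then G x j q * t1 q else 0))"
          by (intro sum.cong) (auto simp: algebra_simps)
        then show "TS x $$ (r + j, q) - G x j q * t1 q - (\<Sum>i<r. G x j i * (TS x $$ (i, q) - (if i = q then t1 i else 0))) = S x $$ (p, q)"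
          using p q by (simp add: S2 sum_subtractf sum.delta)
      qed
    next
      case q: (2 j')
      have "(\<lambda>x. \<Sum>i<r. G x j i * T x $$ (i, r + j')) \<in> O[F](d)"
        using p q by (intro big_sum_in_bigo bm[OF G C(2)]) auto
      from sum_in_bigo(2)[OF D(5)[of j j'] this] show ?thesis using p q pq by (simp add: S2 TS2)
    qed
  qed
  show "(\<lambda>x. S x $$ (p, p) - u p - d x * v x p) \<in> O[F](\<lambda>x. (d x)\<^sup>2)" if "p < r + s"
    using that
  proof (cases rule: less_add_cases)
    case p: 1
    have "(\<lambda>x. \<Sum>j<s. G x j p * (T x $$ (p, r + j) - d x * (f p j * Y x p j))) \<in> O[F](\<lambda>x. (d x)\<^sup>2)"
      using p by (intro big_sum_in_bigo bm[OF G D(3)]) auto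
    from sum_in_bigo(1)[OF D(2)[OF p] this] show ?thesis
      by (rule bigo_cong_fun)
        (use p in \<open>simp add: u_def v_def S1 TS1 G_def algebra_simps sum_distrib_left sum.distrib sum_subtractf\<close>)
  next
    case p: (2 j)
    have "(\<lambda>x. \<Sum>i<r. G x j i * (T x $$ (i, r + j) - d x * (f i j * Y x i j))) \<in> O[F](\<lambda>x. (d x)\<^sup>2)"
      using p by (intro big_sum_in_bigo bm[OF G D(3)]) auto
    from sum_in_bigo(2)[OF D(6)[OF p(1)] this]
    have A: "(\<lambda>x. T x $$ (r + j, r + j) - t2 j - d x * (\<Sum>i<r. e2 i j * (Y x i j * cnj (Y x i j))) -
       (\<Sum>i<r. G x j i * (T x $$ (i, r + j) - d x * (f i j * Y x i j)))) \<in> O[F](\<lambda>x. (d x)\<^sup>2)" .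
    have S: "S x $$ (p, p) = T x $$ (r + j, r + j) - (\<Sum>i<r. G x j i * T x $$ (i, r + j))" for x
      using p by (simp add: S2 TS2)
    show ?thesis unfolding S
      by (rule bigo_cong_fun[OF A])
        (use p in \<open>simp add: u_def v_def G_def algebra_simps sum_distrib_left sum.distrib sum_subtractf\<close>)
  qed
qed

lemma char_poly_at_second_order:
  defines "u \<equiv> \<lambda>p. if p < r then t1 p else t2 (p - r)"
  defines "v \<equiv> \<lambda>x p. if p < r
      then (\<Sum>j<s. (e1 p j + f p j * h p j / (t1 p - t2 j)) * (Y x p j * cnj (Y x p j)))
      else (\<Sum>i<r. (e2 i (p - r) - f i (p - r) * h i (p - r) / (t1 i - t2 (p - r))) * (Y x i (p - r) * cnj (Y x i (p - r))))"
  assumes k: "k < r + s"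
  shows "(\<lambda>x. poly (char_poly (T x)) (u k + d x * v x k)) \<in> O[F](\<lambda>x. (d x)\<^sup>2)"
proof -
  define G where "G = (\<lambda>x j i. h i j * cnj (Y x i j) / (t1 i - t2 j))"
  define S where "S = (\<lambda>x. shear_mat r s (\<lambda>j i. - G x j i) * (T x * shear_mat r s (G x)))"
  define z where "z x = u k + d x * v x k" for x
  have X1: "(\<lambda>x. S x $$ (p, q)) \<in> O[F](d)" if "p < r + s" "q < r + s" "p \<noteq> q" for p q
    unfolding S_def G_def using that by (rule sheared_expansion(1))
  have X2: "(\<lambda>x. S x $$ (p, p) - u p - d x * v x p) \<in> O[F](\<lambda>x. (d x)\<^sup>2)" if "p < r + s" for p
    unfolding S_def G_def u_def v_def using that by (rule sheared_expansion(2))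
  have Sc: "S x \<in> carrier_mat (r + s) (r + s)" for x
    unfolding S_def using Tc by (intro mult_carrier_mat) auto
  have bd: "(\<lambda>x. v x p) \<in> O[F](\<lambda>_. 1)" if "p < r + s" for p
    using that
  proof (cases rule: less_add_cases)
    case 1
    then show ?thesis unfolding v_def
      by (simp, intro big_sum_in_bigo bigo_bounded_mult[OF _ bigo_bounded_mult[OF bounded_entry[OF bounded_Y d] bounded_cnj_entry[OF bounded_Y d]]]) auto
  next
    case (2 j)
    then show ?thesis unfolding v_def
      by (simp, intro big_sum_in_bigo bigo_bounded_mult[OF _ bigo_bounded_mult[OF bounded_entry[OF bounded_Y d] bounded_cnj_entry[OF bounded_Y d]]]) auto
  qed
  \<comment> \<open>The shear is a conjugation, so it does not change the characteristic polynomial.\<close>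
  have sim: "similar_mat (S x) (T x)" for x
  proof -
    have "similar_mat_wit (S x) (T x) (shear_mat r s (\<lambda>j i. - G x j i)) (shear_mat r s (G x))"
      using Tc[of x] Sc[of x] shear_mat_inverse[of r s "G x"] shear_mat_inverse[of r s "\<lambda>j i. - G x j i"]
      unfolding S_def by (intro similar_mat_witI[where n = "r + s"]) (auto simp: assoc_mult_mat[of _ "r+s" "r+s" _ "r+s" _ "r+s"])
    then show ?thesis by (auto simp: similar_mat_def)
  qed
  define A where "A x p q = (if p = q then z x else 0) - S x $$ (p, q)" for x p q
  have pc: "poly (char_poly (T x)) (z x) = Determinant.det (Matrix.mat (r + s) (r + s) (\<lambda>(p, q). A x p q))" for x
  proof -
    have "poly (char_poly (S x)) (z x) = Determinant.det (- (char_matrix (S x) (z x)))"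
      by (rule char_poly_matrix[OF Sc])
    also have "- (char_matrix (S x) (z x)) = Matrix.mat (r + s) (r + s) (\<lambda>(p, q). A x p q)"
      using Sc[of x] by (intro eq_matI) (auto simp: char_matrix_def A_def)
    finally show ?thesis using char_poly_similar[OF sim] by simp
  qed
  have dv: "(\<lambda>x. d x * v x p) \<in> O[F](d)" if "p < r + s" for p
    using bigo_d_mult[OF bounded_Y d bd[OF that]] .
  have "(\<lambda>x. Determinant.det (Matrix.mat (r + s) (r + s) (\<lambda>(p, q). A x p q))) \<in> O[F](\<lambda>x. (d x)\<^sup>2)"
  proof (rule det_bigo_square[OF k])
    have off: "(\<lambda>x. A x p q) \<in> O[F](d)" if "p < r + s" "q < r + s" "p \<noteq> q" for p q
      using X1[OF that] that by (simp add: A_def)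
    then show "(\<lambda>x. A x k q) \<in> O[F](d)" if "q < r + s" "q \<noteq> k" for q using that k by blast
    show "(\<lambda>x. A x p k) \<in> O[F](d)" if "p < r + s" "p \<noteq> k" for p using off that k by blast
    have "(\<lambda>x. - (S x $$ (k, k) - u k - d x * v x k)) \<in> O[F](\<lambda>x. (d x)\<^sup>2)"
      using X2[OF k] by (subst landau_o.big.uminus_in_iff)
    then show "(\<lambda>x. A x k k) \<in> O[F](\<lambda>x. (d x)\<^sup>2)" by (simp add: A_def z_def algebra_simps)
    show "(\<lambda>x. A x p q) \<in> O[F](\<lambda>_. 1)" if "p < r + s" "q < r + s" for p q
    proof (cases "p = q")
      case True
      have const: "(\<lambda>x. c) \<in> O[F](\<lambda>_. 1)" for c :: complex by simp
      have "(\<lambda>x. u k + d x * v x k - (S x $$ (p, p) - u p - d x * v x p) - u p - d x * v x p) \<in> O[F](\<lambda>_. 1)"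
        by (rule sum_in_bigo(2)[OF sum_in_bigo(2)[OF sum_in_bigo(2)[OF sum_in_bigo(1)[OF const
              bigo_d_1[OF bounded_Y d dv[OF k]]] bigo_d_1[OF bounded_Y d bigo_d2_d[OF bounded_Y d X2[OF that(1)]]]]
              const] bigo_d_1[OF bounded_Y d dv[OF that(1)]]])
      then show ?thesis using True by (simp add: A_def z_def add_diff_eq)
    qed (use off that bigo_d_1[OF bounded_Y d] in blast)
  qed
  then show ?thesis unfolding pc[symmetric] z_def .
qed

end

section \<open>Measurable and continuous labels for roots\<close>

definition poly_tendsto :: "('a \<Rightarrow> complex poly) \<Rightarrow> complex poly \<Rightarrow> 'a filter \<Rightarrow> bool" where
  "poly_tendsto p q F \<longleftrightarrow> (\<forall>k. ((\<lambda>x. poly.coeff (p x) k) \<longlongrightarrow> poly.coeff q k) F)"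

lemma poly_tendsto_mult:
  "poly_tendsto p q F \<Longrightarrow> poly_tendsto p' q' F \<Longrightarrow> poly_tendsto (\<lambda>x. p x * p' x) (q * q') F"
  by (auto simp: poly_tendsto_def coeff_mult intro!: tendsto_intros)

lemma poly_tendsto_const: "poly_tendsto (\<lambda>_. q) q F"
  by (auto simp: poly_tendsto_def)

lemma poly_tendsto_prod:
  "(\<And>i. i \<in> I \<Longrightarrow> poly_tendsto (p i) (q i) F) \<Longrightarrow> poly_tendsto (\<lambda>x. \<Prod>i\<in>I. p i x) (\<Prod>i\<in>I. q i) F"
  by (induction I rule: infinite_finite_induct) (auto intro: poly_tendsto_mult poly_tendsto_const)

lemma poly_tendsto_sum:
  "(\<And>i. i \<in> I \<Longrightarrow> poly_tendsto (p i) (q i) F) \<Longrightarrow> poly_tendsto (\<lambda>x. \<Sum>i\<in>I. p i x) (\<Sum>i\<in>I. q i) F"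
  by (auto simp: poly_tendsto_def coeff_sum intro!: tendsto_intros)

lemma char_poly_Leibniz:
  assumes "A \<in> carrier_mat n n"
  shows "char_poly A = (\<Sum>\<sigma>\<in>{\<sigma>. \<sigma> permutes {0..<n}}. signof \<sigma> *
    (\<Prod>i = 0..<n. [: - A $$ (i, \<sigma> i), if i = \<sigma> i then 1 else 0 :]))"
proof -
  have "(\<Prod>i = 0..<n. char_poly_matrix A $$ (i, \<sigma> i)) = (\<Prod>i = 0..<n. [: - A $$ (i, \<sigma> i), if i = \<sigma> i then 1 else 0 :])"
    if "\<sigma> permutes {0..<n}" for \<sigma>
  proof (rule prod.cong)
    fix i assume i: "i \<in> {0..<n}"
    then have "\<sigma> i < n" using permutes_in_image[OF that, of i] by simp
    then show "char_poly_matrix A $$ (i, \<sigma> i) = [: - A $$ (i, \<sigma> i), if i = \<sigma> i then 1 else 0 :]"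
      using i assms by (auto simp: char_poly_matrix_def)
  qed simp
  then show ?thesis using assms
    unfolding char_poly_def Determinant.det_def by (auto simp: char_poly_matrix_def)
qed

lemma poly_tendsto_char_poly:
  assumes "\<And>x. A x \<in> carrier_mat n n" "B \<in> carrier_mat n n"
    and lim: "\<And>i j. i < n \<Longrightarrow> j < n \<Longrightarrow> ((\<lambda>x. A x $$ (i, j)) \<longlongrightarrow> B $$ (i, j)) F"
  shows "poly_tendsto (\<lambda>x. char_poly (A x)) (char_poly B) F"
  unfolding char_poly_Leibniz[OF assms(1)] char_poly_Leibniz[OF assms(2)]
proof (intro poly_tendsto_sum poly_tendsto_mult poly_tendsto_const poly_tendsto_prod)
  fix \<sigma> i assume "\<sigma> \<in> {\<sigma>. \<sigma> permutes {0..<n}}" and i: "i \<in> {0..<n}"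
  then have "\<sigma> i < n" using permutes_in_image[of \<sigma> "{0..<n}" i] by simp
  then show "poly_tendsto (\<lambda>x. [: - A x $$ (i, \<sigma> i), if i = \<sigma> i then 1 else 0 :])
      [: - B $$ (i, \<sigma> i), if i = \<sigma> i then 1 else 0 :] F"
    using i by (auto simp: poly_tendsto_def coeff_pCons split: nat.split intro!: tendsto_intros lim)
qed

lemma poly_tendsto_poly:
  assumes p: "poly_tendsto p q F" and d: "\<And>x. degree (p x) \<le> n" "degree q \<le> n"
  shows "((\<lambda>x. poly (p x) z) \<longlongrightarrow> poly q z) F"
proof -
  have "poly r z = (\<Sum>k\<le>n. poly.coeff r k * z ^ k)" if "degree r \<le> n" for r :: "complex poly"
  proof -
    have "(\<Sum>k\<le>n. poly.coeff r k * z ^ k) = (\<Sum>k\<le>degree r. poly.coeff r k * z ^ k)"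
      using that by (intro sum.mono_neutral_right) (auto simp: coeff_eq_0)
    then show ?thesis by (simp add: poly_altdef)
  qed
  then show ?thesis using p d by (auto simp: poly_tendsto_def intro!: tendsto_intros)
qed

definition poly_measurable :: "'a measure \<Rightarrow> ('a \<Rightarrow> complex poly) \<Rightarrow> bool" where
  "poly_measurable M p \<longleftrightarrow> (\<forall>k. (\<lambda>x. poly.coeff (p x) k) \<in> borel_measurable M)"

lemma poly_measurable_mult:
  "poly_measurable M p \<Longrightarrow> poly_measurable M q \<Longrightarrow> poly_measurable M (\<lambda>x. p x * q x)"
  by (auto simp: poly_measurable_def coeff_mult intro!: borel_measurable_sum borel_measurable_times)

lemma poly_measurable_const: "poly_measurable M (\<lambda>_. q)"
  by (auto simp: poly_measurable_def)

lemma poly_measurable_prod: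
  "(\<And>i. i \<in> I \<Longrightarrow> poly_measurable M (p i)) \<Longrightarrow> poly_measurable M (\<lambda>x. \<Prod>i\<in>I. p i x)"
  by (induction I rule: infinite_finite_induct) (auto intro: poly_measurable_mult poly_measurable_const)

lemma poly_measurable_sum:
  "(\<And>i. i \<in> I \<Longrightarrow> poly_measurable M (p i)) \<Longrightarrow> poly_measurable M (\<lambda>x. \<Sum>i\<in>I. p i x)"
  by (auto simp: poly_measurable_def coeff_sum intro!: borel_measurable_sum)

lemma poly_measurable_char_poly:
  assumes "\<And>x. A x \<in> carrier_mat n n"
    and m: "\<And>i j. i < n \<Longrightarrow> j < n \<Longrightarrow> (\<lambda>x. A x $$ (i, j)) \<in> borel_measurable M"
  shows "poly_measurable M (\<lambda>x. char_poly (A x))"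
  unfolding char_poly_Leibniz[OF assms(1)]
proof (intro poly_measurable_sum poly_measurable_mult poly_measurable_const poly_measurable_prod)
  fix \<sigma> i assume "\<sigma> \<in> {\<sigma>. \<sigma> permutes {0..<n}}" and i: "i \<in> {0..<n}"
  then have "\<sigma> i < n" using permutes_in_image[of \<sigma> "{0..<n}" i] by simp
  then show "poly_measurable M (\<lambda>x. [: - A x $$ (i, \<sigma> i), if i = \<sigma> i then 1 else 0 :])"
    using i m by (auto simp: poly_measurable_def coeff_pCons split: nat.split)
qed

lemma poly_measurable_poly:
  assumes p: "poly_measurable M p" and d: "\<And>x. degree (p x) = n"
  shows "(\<lambda>x. poly (p x) z) \<in> borel_measurable M"
  using p unfolding poly_altdef d
  by (auto simp: poly_measurable_def intro!: borel_measurable_sum borel_measurable_times)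

text \<open>The sublevel set is compact, so a zero exists iff the function is arbitrarily small on a countable
  dense set.\<close>

lemma measurable_zero_exists:
  fixes h :: "'a \<Rightarrow> complex \<Rightarrow> real"
  assumes m: "\<And>z. (\<lambda>x. h x z) \<in> borel_measurable M"
    and c: "\<And>x. continuous_on UNIV (h x)"
    and b: "\<And>x. bounded {z. h x z \<le> 1}"
  shows "{x \<in> space M. \<exists>z. h x z \<le> 0} \<in> sets M"
proof -
  obtain D :: "complex set" where D: "countable D" "\<And>X. open X \<Longrightarrow> X \<noteq> {} \<Longrightarrow> \<exists>d\<in>D. d \<in> X"
    using countable_dense_setE by blast
  have "(\<exists>z. h x z \<le> 0) \<longleftrightarrow> (\<forall>n::nat. \<exists>q\<in>D. h x q < 1 / Suc n)" for x
  proof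
    assume "\<exists>z. h x z \<le> 0"
    then obtain z where z: "h x z \<le> 0" by blast
    show "\<forall>n::nat. \<exists>q\<in>D. h x q < 1 / Suc n"
    proof
      fix n :: nat
      have "open {q. h x q < 1 / Suc n}" using c by (intro open_Collect_less) auto
      moreover have "z \<in> {q. h x q < 1 / Suc n}" using z by (simp add: le_less_trans)
      ultimately show "\<exists>q\<in>D. h x q < 1 / Suc n" using D(2)[of "{q. h x q < 1 / Suc n}"] by auto
    qed
  next
    assume "\<forall>n::nat. \<exists>q\<in>D. h x q < 1 / Suc n"
    then obtain q where q: "\<And>n. h x (q n) < 1 / Suc n" by metis
    have "closed {z. h x z \<le> 1}" using c by (intro closed_Collect_le) auto
    then have "compact {z. h x z \<le> 1}" using b by (simp add: compact_eq_bounded_closed)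
    moreover have "\<forall>n. q n \<in> {z. h x z \<le> 1}"
    proof
      fix n
      have "1 / real (Suc n) \<le> 1" by simp
      then show "q n \<in> {z. h x z \<le> 1}"
        by (intro CollectI order.trans[OF less_imp_le[OF q[of n]]])
    qed
    ultimately obtain z l where l: "strict_mono l" "(q \<circ> l) \<longlonglongrightarrow> z"
      unfolding compact_def by blast
    have "isCont (h x) z" using c by (simp add: continuous_on_eq_continuous_at)
    then have "(\<lambda>n. h x ((q \<circ> l) n)) \<longlonglongrightarrow> h x z" using l(2) by (rule isCont_tendsto_compose)
    moreover have "(\<lambda>n. 1 / real (Suc n)) \<longlonglongrightarrow> 0"
      using LIMSEQ_inverse_real_of_nat by (simp add: inverse_eq_divide)
    moreover have "\<exists>N. \<forall>n\<ge>N. h x ((q \<circ> l) n) \<le> 1 / real (Suc n)"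
    proof (intro exI[of _ 0] allI impI)
      fix n
      have "1 / real (Suc (l n)) \<le> 1 / real (Suc n)"
        using seq_suble[OF l(1), of n] by (intro divide_left_mono) auto
      then show "h x ((q \<circ> l) n) \<le> 1 / real (Suc n)" using q[of "l n"] by simp
    qed
    ultimately have "h x z \<le> 0" by (rule LIMSEQ_le)
    then show "\<exists>z. h x z \<le> 0" by blast
  qed
  then have "{x \<in> space M. \<exists>z. h x z \<le> 0} = {x \<in> space M. \<forall>n::nat. \<exists>q\<in>D. h x q < 1 / Suc n}" by simp
  also have "\<dots> \<in> sets M" using m D(1) by measurable
  finally show ?thesis .
qed

lemma measurable_minimum_on_zeros:
  fixes h :: "'a \<Rightarrow> complex \<Rightarrow> real" and f :: "complex \<Rightarrow> real"
  assumes m: "\<And>z. (\<lambda>x. h x z) \<in> borel_measurable M"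
    and c: "\<And>x. continuous_on UNIV (h x)"
    and b: "\<And>x. bounded {z. h x z \<le> 1}"
    and f: "continuous_on UNIV f"
    and fin: "\<And>x. finite {z. h x z \<le> 0}" "\<And>x. {z. h x z \<le> 0} \<noteq> {}"
  shows "(\<lambda>x. Min (f ` {z. h x z \<le> 0})) \<in> borel_measurable M"
  unfolding borel_measurable_iff_le
proof
  fix a :: real
  have "{x \<in> space M. Min (f ` {z. h x z \<le> 0}) \<le> a} = {x \<in> space M. \<exists>z. max (h x z) (f z - a) \<le> 0}"
    using fin by (subst Min_le_iff) auto
  also have "\<dots> \<in> sets M"
  proof (rule measurable_zero_exists)
    show "bounded {z. max (h x z) (f z - a) \<le> 1}" for x
      by (rule bounded_subset[OF b[of x]]) auto
    show "continuous_on UNIV (\<lambda>z. max (h x z) (f z - a))" for x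
      using c f by (intro continuous_intros)
    show "(\<lambda>x. max (h x z) (f z - a)) \<in> borel_measurable M" for z using m by measurable
  qed
  finally show "{x \<in> space M. Min (f ` {z. h x z \<le> 0}) \<le> a} \<in> sets M" .
qed

text \<open>Among the roots at minimal distance from \<open>t\<close>, the one with least real part and then least imaginary
  part. The nested maxima describe each of these finite sets as the zero set of a single continuous
  function, which is the form that \<open>measurable_minimum_on_zeros\<close> applies to.\<close>

definition nearest_root :: "complex poly \<Rightarrow> complex \<Rightarrow> complex" where
  "nearest_root p t =
    (let Z0 = {z. cmod (poly p z) \<le> 0};
         Z1 = {z. max (cmod (poly p z)) (cmod (z - t) - Min ((\<lambda>z. cmod (z - t)) ` Z0)) \<le> 0};
         a = Min (Re ` Z1);
         Z2 = {z. max (max (cmod (poly p z)) (cmod (z - t) - Min ((\<lambda>z. cmod (z - t)) ` Z0))) (Re z - a) \<le> 0}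
     in Complex a (Min (Im ` Z2)))"

lemma sublevel_set_minimum:
  assumes fin: "finite {z. h z \<le> (0::real)}" and ne: "{z. h z \<le> 0} \<noteq> {}"
  shows "{z. max (h z) (f z - Min (f ` {z. h z \<le> 0})) \<le> (0::real)} = {z. h z \<le> 0 \<and> f z = Min (f ` {z. h z \<le> 0})}"
    and "finite {z. max (h z) (f z - Min (f ` {z. h z \<le> 0})) \<le> 0}"
    and "{z. max (h z) (f z - Min (f ` {z. h z \<le> 0})) \<le> 0} \<noteq> {}"
proof -
  let ?m = "Min (f ` {z. h z \<le> 0})"
  have le: "?m \<le> f z" if "h z \<le> 0" for z using that fin by (intro Min_le) auto
  show eq: "{z. max (h z) (f z - ?m) \<le> 0} = {z. h z \<le> 0 \<and> f z = ?m}" using le by force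
  show "finite {z. max (h z) (f z - ?m) \<le> 0}" unfolding eq by (rule finite_subset[OF _ fin]) auto
  have "?m \<in> f ` {z. h z \<le> 0}" using fin ne by (intro Min_in) auto
  then show "{z. max (h z) (f z - ?m) \<le> 0} \<noteq> {}" unfolding eq by auto
qed

lemma nearest_root_unfold:
  fixes p :: "complex poly" and t :: complex
  assumes d: "degree p > 0"
  defines "Z0 \<equiv> {z. cmod (poly p z) \<le> 0}"
  defines "h1 \<equiv> \<lambda>z. max (cmod (poly p z)) (cmod (z - t) - Min ((\<lambda>z. cmod (z - t)) ` Z0))"
  defines "h2 \<equiv> \<lambda>z. max (h1 z) (Re z - Min (Re ` {z. h1 z \<le> 0}))"
  shows "finite Z0" "Z0 \<noteq> {}" "finite {z. h1 z \<le> 0}" "{z. h1 z \<le> 0} \<noteq> {}"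
    "finite {z. h2 z \<le> 0}" "{z. h2 z \<le> 0} \<noteq> {}"
    "nearest_root p t = Complex (Min (Re ` {z. h1 z \<le> 0})) (Min (Im ` {z. h2 z \<le> 0}))"
    "poly p (nearest_root p t) = 0"
    "\<And>z. poly p z = 0 \<Longrightarrow> cmod (nearest_root p t - t) \<le> cmod (z - t)"
proof -
  have p0: "p \<noteq> 0" using d by auto
  show f0: "finite Z0" using poly_roots_finite[OF p0] by (simp add: Z0_def)
  have "\<exists>z. poly p z = 0" using d by (intro fundamental_theorem_of_algebra) (auto simp: constant_degree)
  then show n0: "Z0 \<noteq> {}" by (auto simp: Z0_def)
  have s1: "{z. h1 z \<le> 0} = {z. cmod (poly p z) \<le> 0 \<and> cmod (z - t) = Min ((\<lambda>z. cmod (z - t)) ` Z0)}"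
    "finite {z. h1 z \<le> 0}" "{z. h1 z \<le> 0} \<noteq> {}"
    unfolding h1_def Z0_def by (rule sublevel_set_minimum[OF f0[unfolded Z0_def] n0[unfolded Z0_def]])+
  show "finite {z. h1 z \<le> 0}" by (fact s1(2))
  show "{z. h1 z \<le> 0} \<noteq> {}" by (fact s1(3))
  have s2: "{z. h2 z \<le> 0} = {z. h1 z \<le> 0 \<and> Re z = Min (Re ` {z. h1 z \<le> 0})}"
    "finite {z. h2 z \<le> 0}" "{z. h2 z \<le> 0} \<noteq> {}"
    unfolding h2_def by (rule sublevel_set_minimum[OF s1(2,3)])+
  show "finite {z. h2 z \<le> 0}" by (fact s2(2))
  show "{z. h2 z \<le> 0} \<noteq> {}" by (fact s2(3))
  show eq: "nearest_root p t = Complex (Min (Re ` {z. h1 z \<le> 0})) (Min (Im ` {z. h2 z \<le> 0}))"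
    by (simp add: nearest_root_def Let_def h1_def h2_def Z0_def)
  have "Min (Im ` {z. h2 z \<le> 0}) \<in> Im ` {z. h2 z \<le> 0}" using s2(2,3) by (intro Min_in) auto
  then obtain z where z: "h2 z \<le> 0" "Im z = Min (Im ` {z. h2 z \<le> 0})" by auto
  then have "h1 z \<le> 0" "Re z = Min (Re ` {z. h1 z \<le> 0})" using s2(1) by auto
  then have zn: "z = nearest_root p t" "h1 z \<le> 0" using z eq by (auto simp: complex_eq_iff)
  then show "poly p (nearest_root p t) = 0" using s1(1) by (auto simp: Z0_def)
  fix w assume "poly p w = 0"
  then have "Min ((\<lambda>z. cmod (z - t)) ` Z0) \<le> cmod (w - t)" using f0 by (intro Min_le) (auto simp: Z0_def)
  moreover have "cmod (z - t) = Min ((\<lambda>z. cmod (z - t)) ` Z0)" using s1(1) zn by auto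
  ultimately show "cmod (nearest_root p t - t) \<le> cmod (w - t)" using zn by simp
qed

lemma bounded_poly_sublevel:
  fixes p :: "complex poly"
  assumes "degree p > 0"
  shows "bounded {z. cmod (poly p z) \<le> 1}"
proof -
  obtain a q where p: "p = pCons a q" by (cases p)
  have q: "q \<noteq> 0" using assms p by auto
  obtain R where R: "\<And>z. R \<le> cmod z \<Longrightarrow> 2 \<le> cmod (poly p z)"
    using poly_infinity[OF q, of 2 a] p by auto
  have "cmod z \<le> R" if "cmod (poly p z) \<le> 1" for z
    using R[of z] that by linarith
  then show ?thesis by (intro boundedI[of _ R]) auto
qed

lemma measurable_nearest_root:
  assumes p: "poly_measurable M p" and d: "\<And>x. degree (p x) = n" and n: "n > 0"
  shows "(\<lambda>x. nearest_root (p x) t) \<in> borel_measurable M"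
proof -
  have dp: "degree (p x) > 0" for x using d n by simp
  define h0 where "h0 = (\<lambda>x z. cmod (poly (p x) z))"
  define m0 where "m0 x = Min ((\<lambda>z. cmod (z - t)) ` {z. h0 x z \<le> 0})" for x
  define h1 where "h1 = (\<lambda>x z. max (h0 x z) (cmod (z - t) - m0 x))"
  define m1 where "m1 x = Min (Re ` {z. h1 x z \<le> 0})" for x
  define h2 where "h2 = (\<lambda>x z. max (h1 x z) (Re z - m1 x))"
  have b0: "bounded {z. h0 x z \<le> 1}" for x using bounded_poly_sublevel[OF dp] by (simp add: h0_def)
  have c0: "continuous_on UNIV (h0 x)" for x unfolding h0_def by (intro continuous_intros)
  have mh0: "(\<lambda>x. h0 x z) \<in> borel_measurable M" for z
    unfolding h0_def using poly_measurable_poly[OF p d] by measurable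
  have F: "finite {z. h0 x z \<le> 0}" "{z. h0 x z \<le> 0} \<noteq> {}" "finite {z. h1 x z \<le> 0}" "{z. h1 x z \<le> 0} \<noteq> {}"
    "finite {z. h2 x z \<le> 0}" "{z. h2 x z \<le> 0} \<noteq> {}"
    "nearest_root (p x) t = Complex (m1 x) (Min (Im ` {z. h2 x z \<le> 0}))" for x
    using nearest_root_unfold(1,2)[OF dp[of x]] nearest_root_unfold(3-7)[where p = "p x" and t = t, OF dp] unfolding h0_def h1_def h2_def m0_def m1_def by blast+
  have mm0: "m0 \<in> borel_measurable M"
    unfolding m0_def using mh0 c0 b0 F by (intro measurable_minimum_on_zeros continuous_intros)
  have b1: "bounded {z. h1 x z \<le> 1}" for x by (rule bounded_subset[OF b0[of x]]) (auto simp: h1_def)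
  have c1: "continuous_on UNIV (h1 x)" for x unfolding h1_def using c0 by (intro continuous_intros)
  have mh1: "(\<lambda>x. h1 x z) \<in> borel_measurable M" for z unfolding h1_def using mh0 mm0 by measurable
  have mm1: "m1 \<in> borel_measurable M"
    unfolding m1_def using mh1 c1 b1 F by (intro measurable_minimum_on_zeros continuous_intros)
  have b2: "bounded {z. h2 x z \<le> 1}" for x by (rule bounded_subset[OF b1[of x]]) (auto simp: h2_def)
  have c2: "continuous_on UNIV (h2 x)" for x unfolding h2_def using c1 by (intro continuous_intros)
  have mh2: "(\<lambda>x. h2 x z) \<in> borel_measurable M" for z unfolding h2_def using mh1 mm1 by measurable
  have mm2: "(\<lambda>x. Min (Im ` {z. h2 x z \<le> 0})) \<in> borel_measurable M"
    using mh2 c2 b2 F by (intro measurable_minimum_on_zeros continuous_intros)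
  show ?thesis unfolding F(7) complex_eq Complex_eq using mm1 mm2 by measurable
qed

text \<open>The root nearest to the first target is divided out before the next one is chosen; the labels
  therefore exhaust the roots with multiplicities, also when targets coincide.\<close>

primrec root_labels :: "complex list \<Rightarrow> complex poly \<Rightarrow> complex list" where
  "root_labels [] p = []"
| "root_labels (t # ts) p = nearest_root p t # root_labels ts (synthetic_div p (nearest_root p t))"

lemma length_root_labels [simp]: "length (root_labels ts p) = length ts"
  by (induction ts arbitrary: p) auto

lemma synthetic_div_root:
  fixes p :: "'a::field poly"
  assumes "poly p z = 0"
  shows "p = [:- z, 1:] * synthetic_div p z"
  using synthetic_div_correct'[of z p] assms by simp

lemma monic_synthetic_div:
  fixes p :: "complex poly"
  assumes "poly p z = 0" "degree p = Suc n" "lead_coeff p = 1"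
  shows "degree (synthetic_div p z) = n" "lead_coeff (synthetic_div p z) = 1"
proof -
  show "degree (synthetic_div p z) = n" using assms by (simp add: degree_synthetic_div)
  have "lead_coeff ([:- z, 1:] * synthetic_div p z) = lead_coeff [:- z, 1:] * lead_coeff (synthetic_div p z)"
    by (rule lead_coeff_mult)
  then have "lead_coeff p = lead_coeff [:- z, 1:] * lead_coeff (synthetic_div p z)"
    by (simp only: synthetic_div_root[OF assms(1), symmetric])
  then show "lead_coeff (synthetic_div p z) = 1" using assms by simp
qed

lemma mset_root_labels:
  assumes "degree p = length ts" "lead_coeff p = 1"
  shows "mset (root_labels ts p) = proots p \<and> p = (\<Prod>z\<leftarrow>root_labels ts p. [:- z, 1:])"
  using assms
proof (induction ts arbitrary: p)
  case Nil
  then have "p = 1" by (auto simp: monic_degree_0)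
  then show ?case by simp
next
  case (Cons t ts)
  let ?z = "nearest_root p t"
  have z: "poly p ?z = 0" using nearest_root_unfold(8)[of p t] Cons by simp
  note p = synthetic_div_root[OF z] and m = monic_synthetic_div[OF z]
  have sd: "synthetic_div p ?z \<noteq> 0" using m(2)[of "length ts"] Cons by auto
  have IH: "mset (root_labels ts (synthetic_div p ?z)) = proots (synthetic_div p ?z) \<and>
      synthetic_div p ?z = (\<Prod>z\<leftarrow>root_labels ts (synthetic_div p ?z). [:- z, 1:])"
    using Cons m[of "length ts"] by auto
  have "proots p = proots ([:- ?z, 1:] * synthetic_div p ?z)" using p by simp
  also have "\<dots> = {#?z#} + proots (synthetic_div p ?z)" using sd by (subst proots_mult) (auto simp: proots_linear_factor)
  finally show ?case using IH p by simp
qed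

text \<open>Read from the top coefficient downwards, this recursion shows that the quotient depends measurably
  and continuously on the polynomial and on the root.\<close>

lemma coeff_synthetic_div:
  "poly.coeff (synthetic_div p z) k = poly.coeff p (Suc k) + z * poly.coeff (synthetic_div p z) (Suc k)"
proof -
  have "poly.coeff (p + Polynomial.smult z (synthetic_div p z)) (Suc k) = poly.coeff (pCons (poly p z) (synthetic_div p z)) (Suc k)"
    by (simp only: synthetic_div_correct)
  then show ?thesis by simp
qed

lemma measurable_root_labels:
  assumes "poly_measurable M p" "\<And>x. degree (p x) = length ts" "\<And>x. lead_coeff (p x) = 1" "k < length ts"
  shows "(\<lambda>x. root_labels ts (p x) ! k) \<in> borel_measurable M"
  using assms
proof (induction ts arbitrary: p k)
  case (Cons t ts)
  let ?z = "\<lambda>x. nearest_root (p x) t"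
  have mz: "?z \<in> borel_measurable M"
    using Cons by (intro measurable_nearest_root[where n = "Suc (length ts)"]) auto
  have z: "poly (p x) (?z x) = 0" for x using nearest_root_unfold(8)[of "p x" t] Cons by simp
  have m: "degree (synthetic_div (p x) (?z x)) = length ts" "lead_coeff (synthetic_div (p x) (?z x)) = 1" for x
    using monic_synthetic_div[OF z, of x "length ts"] Cons by auto
  \<comment> \<open>Downward induction, starting above the degree of the quotient.\<close>
  have "(\<lambda>x. poly.coeff (synthetic_div (p x) (?z x)) (Suc (length ts) - i)) \<in> borel_measurable M" for i
  proof (induction i)
    case 0
    then show ?case using m by (simp add: coeff_eq_0)
  next
    case (Suc i)
    show ?case
    proof (cases "Suc (length ts) - i = 0")
      case True
      then show ?thesis using Suc by simp
    next
      case False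
      then have e: "Suc (Suc (length ts) - Suc i) = Suc (length ts) - i" by simp
      have "(\<lambda>x. poly.coeff (p x) (Suc (length ts) - i) + ?z x * poly.coeff (synthetic_div (p x) (?z x)) (Suc (length ts) - i)) \<in> borel_measurable M"
        using Suc mz Cons.prems(1)
        by (intro borel_measurable_add borel_measurable_times) (auto simp: poly_measurable_def)
      then show ?thesis by (subst coeff_synthetic_div) (simp only: e)
    qed
  qed
  note main = this
  have "(\<lambda>x. poly.coeff (synthetic_div (p x) (?z x)) j) \<in> borel_measurable M" for j
  proof (cases "j \<le> length ts")
    case True
    then show ?thesis using main[of "Suc (length ts) - j"] by simp
  qed (use m in \<open>simp add: coeff_eq_0\<close>)
  then have sd: "poly_measurable M (\<lambda>x. synthetic_div (p x) (?z x))" by (simp add: poly_measurable_def)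
  show ?case
  proof (cases k)
    case (Suc l)
    then show ?thesis using Cons.IH[OF sd m, of l] Cons.prems(4) by simp
  qed (use mz in simp)
qed simp

text \<open>A monic polynomial at \<open>t\<close> is the product of the differences between \<open>t\<close> and its roots, and the
  nearest root gives the smallest factor.\<close>

lemma nearest_root_power_le:
  assumes "degree p = n" "lead_coeff p = 1" "n > 0"
  shows "cmod (nearest_root p t - t) ^ n \<le> cmod (poly p t)"
proof -
  \<comment> \<open>Labelling with \<open>n\<close> copies of \<open>t\<close> factorizes \<open>p\<close> into linear factors.\<close>
  define ts where "ts = replicate n t"
  have p: "p = (\<Prod>z\<leftarrow>root_labels ts p. [:- z, 1:])" and r: "mset (root_labels ts p) = proots p"
    using mset_root_labels[of p ts] assms by (auto simp: ts_def)
  have p0: "p \<noteq> 0" using assms by auto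
  have "cmod (nearest_root p t - t) ^ length zs \<le> cmod (poly (\<Prod>z\<leftarrow>zs. [:- z, 1:]) t)"
    if "\<And>z. z \<in> set zs \<Longrightarrow> poly p z = 0" for zs
    using that
  proof (induction zs)
    case (Cons z zs)
    have "cmod (nearest_root p t - t) \<le> cmod (t - z)"
      using nearest_root_unfold(9)[of p z t] Cons assms by (simp add: norm_minus_commute)
    moreover have "poly (\<Prod>z\<leftarrow>z # zs. [:- z, 1:]) t = (t - z) * poly (\<Prod>z\<leftarrow>zs. [:- z, 1:]) t"
      by (simp add: algebra_simps)
    ultimately show ?case using Cons by (simp only: norm_mult) (auto intro!: mult_mono)
  qed simp
  from this[of "root_labels ts p"] show ?thesis
  proof -
    have "poly p z = 0" if "z \<in> set (root_labels ts p)" for z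
      using that set_count_proots[OF p0] r by (metis mem_Collect_eq set_mset_mset)
    then have "cmod (nearest_root p t - t) ^ length (root_labels ts p) \<le> cmod (poly (\<Prod>z\<leftarrow>root_labels ts p. [:- z, 1:]) t)"
      using \<open>(\<And>z. z \<in> set (root_labels ts p) \<Longrightarrow> poly p z = 0) \<Longrightarrow> _\<close> by blast
    then show ?thesis using p by (simp add: ts_def)
  qed
qed

lemma tendsto_nearest_root:
  assumes p: "poly_tendsto p q F" and d: "\<And>x. degree (p x) = n" "degree q = n"
    and m: "\<And>x. lead_coeff (p x) = 1" and n: "n > 0" and q: "poly q t = 0"
  shows "((\<lambda>x. nearest_root (p x) t) \<longlongrightarrow> t) F"
proof -
  have "((\<lambda>x. cmod (poly (p x) t)) \<longlongrightarrow> 0) F"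
    using poly_tendsto_poly[OF p, of n t] d q by (simp add: tendsto_norm_zero)
  then have "((\<lambda>x. root n (cmod (poly (p x) t))) \<longlongrightarrow> root n 0) F" by (rule tendsto_real_root)
  then have lim: "((\<lambda>x. root n (cmod (poly (p x) t))) \<longlongrightarrow> 0) F" using n by simp
  have "norm (nearest_root (p x) t - t) \<le> root n (cmod (poly (p x) t))" for x
  proof -
    have "norm (nearest_root (p x) t - t) = root n (norm (nearest_root (p x) t - t) ^ n)"
      using n by (simp add: real_root_power_cancel)
    also have "\<dots> \<le> root n (cmod (poly (p x) t))"
      using n nearest_root_power_le[OF d(1) m n] by (intro real_root_le_mono)
    finally show ?thesis .
  qed
  then have "((\<lambda>x. nearest_root (p x) t - t) \<longlongrightarrow> 0) F"
    by (rule Lim_null_comparison[OF always_eventually[OF allI] lim])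
  then show ?thesis by (simp add: LIM_zero_iff)
qed

lemma tendsto_root_labels:
  assumes "poly_tendsto p (\<Prod>t\<leftarrow>ts. [:- t, 1:]) F" "\<And>x. degree (p x) = length ts" "\<And>x. lead_coeff (p x) = 1"
    "k < length ts"
  shows "((\<lambda>x. root_labels ts (p x) ! k) \<longlongrightarrow> ts ! k) F"
  using assms
proof (induction ts arbitrary: p k)
  case (Cons t ts)
  let ?z = "\<lambda>x. nearest_root (p x) t"
  let ?q = "\<Prod>t\<leftarrow>ts. [:- t, 1:]"
  have dq: "degree (\<Prod>t\<leftarrow>us. [:- t, 1:]) = length us \<and> lead_coeff (\<Prod>t\<leftarrow>us. [:- t, 1:]) = 1" for us :: "complex list"
  proof (induction us)
    case (Cons u us)
    then have "(\<Prod>t\<leftarrow>us. [:- t, 1:]) \<noteq> 0" by auto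
    then have "degree ([:- u, 1:] * (\<Prod>t\<leftarrow>us. [:- t, 1:])) = Suc (length us)"
      using Cons by (subst degree_mult_eq) auto
    moreover have "lead_coeff ([:- u, 1:] * (\<Prod>t\<leftarrow>us. [:- t, 1:])) = 1"
    proof -
      have "lead_coeff [:- u, 1:] = 1" "lead_coeff (\<Prod>t\<leftarrow>us. [:- t, 1:]) = 1" using Cons by auto
      then show ?thesis by (simp only: lead_coeff_mult mult_1)
    qed
    ultimately show ?case by (simp del: mult_pCons_left)
  qed simp
  have mz: "(?z \<longlongrightarrow> t) F"
    using Cons.prems dq[of "t # ts"] by (intro tendsto_nearest_root[of p "[:- t, 1:] * ?q" F "Suc (length ts)"]) auto
  have z: "poly (p x) (?z x) = 0" for x using nearest_root_unfold(8)[of "p x" t] Cons by simp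
  have m: "degree (synthetic_div (p x) (?z x)) = length ts" "lead_coeff (synthetic_div (p x) (?z x)) = 1" for x
    using monic_synthetic_div[OF z, of x "length ts"] Cons by auto
  have cq: "poly.coeff ?q i = poly.coeff ([:- t, 1:] * ?q) (Suc i) + t * poly.coeff ?q (Suc i)" for i
    by simp
  have "((\<lambda>x. poly.coeff (synthetic_div (p x) (?z x)) (Suc (length ts) - i)) \<longlongrightarrow> poly.coeff ?q (Suc (length ts) - i)) F" for i
  proof (induction i)
    case 0
    then show ?case using m dq[of ts] by (simp add: coeff_eq_0)
  next
    case (Suc i)
    show ?case
    proof (cases "Suc (length ts) - i = 0")
      case True
      then show ?thesis using Suc by simp
    next
      case False
      then have e: "Suc (Suc (length ts) - Suc i) = Suc (length ts) - i" by simp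
      have "((\<lambda>x. poly.coeff (p x) (Suc (length ts) - i) + ?z x * poly.coeff (synthetic_div (p x) (?z x)) (Suc (length ts) - i))
         \<longlongrightarrow> poly.coeff ([:- t, 1:] * ?q) (Suc (length ts) - i) + t * poly.coeff ?q (Suc (length ts) - i)) F"
        using Suc mz Cons.prems(1) by (intro tendsto_intros) (auto simp: poly_tendsto_def)
      then show ?thesis by (subst coeff_synthetic_div, subst cq) (simp only: e)
    qed
  qed
  note main = this
  have "((\<lambda>x. poly.coeff (synthetic_div (p x) (?z x)) j) \<longlongrightarrow> poly.coeff ?q j) F" for j
  proof (cases "j \<le> length ts")
    case True
    then show ?thesis using main[of "Suc (length ts) - j"] by simp
  qed (use m dq[of ts] in \<open>simp add: coeff_eq_0\<close>)
  then have sd: "poly_tendsto (\<lambda>x. synthetic_div (p x) (?z x)) ?q F" by (simp add: poly_tendsto_def)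
  show ?case
  proof (cases k)
    case (Suc l)
    then show ?thesis using Cons.IH[OF sd m, of l] Cons.prems(4) by simp
  qed (use mz in simp)
qed simp

section \<open>Eigenvalues of the corner\<close>

definition corner_norm :: "nat \<Rightarrow> nat \<Rightarrow> (nat \<Rightarrow> nat \<Rightarrow> complex) \<Rightarrow> real" where
  "corner_norm r s X = (\<Sum>i<r. \<Sum>j<s. cmod (X i j))"

text \<open>Corners are functions on all pairs of indices, with only the entries in \<open>r \<times> s\<close> being relevant. The
  filter describes smallness of these entries and leaves the others free.\<close>

definition corner_filter :: "nat \<Rightarrow> nat \<Rightarrow> (nat \<Rightarrow> nat \<Rightarrow> complex) filter" where
  "corner_filter r s = filtercomap (corner_norm r s) (nhds 0)"

lemma corner_norm_nonneg: "0 \<le> corner_norm r s X"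
  by (simp add: corner_norm_def sum_nonneg)

lemma entry_le_corner_norm: "i < r \<Longrightarrow> j < s \<Longrightarrow> cmod (X i j) \<le> corner_norm r s X"
proof -
  assume ij: "i < r" "j < s"
  have "cmod (X i j) \<le> (\<Sum>j<s. cmod (X i j))" using ij by (intro member_le_sum) auto
  also have "\<dots> \<le> corner_norm r s X"
    unfolding corner_norm_def using ij by (intro member_le_sum[of i _ "\<lambda>i. \<Sum>j<s. cmod (X i j)"]) (auto intro: sum_nonneg)
  finally show ?thesis .
qed

lemma eventually_corner_filter:
  "eventually Q (corner_filter r s) \<longleftrightarrow> (\<exists>\<eta>>0. \<forall>X. corner_norm r s X < \<eta> \<longrightarrow> Q X)"
proof
  assume "eventually Q (corner_filter r s)"
  then obtain R where R: "eventually R (nhds 0)" "\<And>X. R (corner_norm r s X) \<Longrightarrow> Q X"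
    by (auto simp: corner_filter_def eventually_filtercomap)
  then obtain \<eta> where "\<eta> > 0" "\<And>x. dist x 0 < \<eta> \<Longrightarrow> R x" by (auto simp: eventually_nhds_metric)
  then show "\<exists>\<eta>>0. \<forall>X. corner_norm r s X < \<eta> \<longrightarrow> Q X"
    using R(2) corner_norm_nonneg by (intro exI[of _ \<eta>]) auto
next
  assume "\<exists>\<eta>>0. \<forall>X. corner_norm r s X < \<eta> \<longrightarrow> Q X"
  then obtain \<eta> where \<eta>: "\<eta> > 0" "\<And>X. corner_norm r s X < \<eta> \<Longrightarrow> Q X" by blast
  have "eventually (\<lambda>x. x \<in> {..<\<eta>}) (nhds 0)"
    using \<eta>(1) by (intro eventually_nhds_in_open) auto
  then have "eventually (\<lambda>x. x < \<eta>) (nhds 0)" by simp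
  then show "eventually Q (corner_filter r s)"
    unfolding corner_filter_def eventually_filtercomap using \<eta> by blast
qed

lemma filterlim_corner_filter:
  assumes "\<And>i j. i < r \<Longrightarrow> j < s \<Longrightarrow> ((\<lambda>x. f x i j) \<longlongrightarrow> 0) G"
  shows "filterlim f (corner_filter r s) G"
proof -
  have "((\<lambda>x. corner_norm r s (f x)) \<longlongrightarrow> (\<Sum>i<r. \<Sum>j<s. 0)) G"
    unfolding corner_norm_def using assms by (intro tendsto_sum tendsto_norm_zero) auto
  then show ?thesis
    by (simp add: corner_filter_def filterlim_filtercomap_iff o_def)
qed

lemma tendsto_corner_norm: "(corner_norm r s \<longlongrightarrow> 0) (corner_filter r s)"
  by (simp add: corner_filter_def filterlim_filtercomap)

lemma tendsto_corner_entry: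
  assumes "i < r" "j < s"
  shows "((\<lambda>X. X i j) \<longlongrightarrow> 0) (corner_filter r s)"
  by (rule Lim_null_comparison[OF always_eventually tendsto_corner_norm]) (use entry_le_corner_norm assms in blast)

lemma block_word_tendsto:
  assumes X: "\<And>i j. i < r \<Longrightarrow> j < s \<Longrightarrow> ((\<lambda>x. X x i j) \<longlongrightarrow> X0 i j) G"
    and Z: "\<And>i j. i < r \<Longrightarrow> j < s \<Longrightarrow> ((\<lambda>x. Z x i j) \<longlongrightarrow> Z0 i j) G"
    and pq: "p < r + s" "q < r + s"
  shows "((\<lambda>x. nc_word_mat (r + s) (block_a r s \<alpha> (X x)) (block_b r s \<beta> (Z x)) w $$ (p, q)) \<longlongrightarrow>
    nc_word_mat (r + s) (block_a r s \<alpha> X0) (block_b r s \<beta> Z0) w $$ (p, q)) G"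
  using pq
proof (induction w arbitrary: p)
  case (Cons c w)
  show ?case using Cons.prems(1)
  proof (cases rule: less_add_cases)
    case 1
    then show ?thesis using Cons
      by (cases c) (simp_all only: block_word_x block_word_y, (intro tendsto_intros X Cons.IH; simp)+)
  next
    case (2 j)
    then show ?thesis using Cons
      by (cases c) (simp_all only: block_word_x block_word_y, (intro tendsto_intros Z Cons.IH; simp)+)
  qed
qed simp

lemma block_word_measurable:
  assumes X: "\<And>i j. i < r \<Longrightarrow> j < s \<Longrightarrow> (\<lambda>x. X x i j) \<in> borel_measurable M"
    and Z: "\<And>i j. i < r \<Longrightarrow> j < s \<Longrightarrow> (\<lambda>x. Z x i j) \<in> borel_measurable M"
    and pq: "p < r + s" "q < r + s"
  shows "(\<lambda>x. nc_word_mat (r + s) (block_a r s \<alpha> (X x)) (block_b r s \<beta> (Z x)) w $$ (p, q)) \<in> borel_measurable M"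
  using pq
proof (induction w arbitrary: p)
  case (Cons c w)
  note m = borel_measurable_times borel_measurable_add borel_measurable_sum borel_measurable_const
  show ?case using Cons.prems(1)
  proof (cases rule: less_add_cases)
    case 1
    then show ?thesis using Cons
      by (cases c) (simp_all only: block_word_x block_word_y, (intro m X Cons.IH; simp)+)
  next
    case (2 j)
    then show ?thesis using Cons
      by (cases c) (simp_all only: block_word_x block_word_y, (intro m Z Cons.IH; simp)+)
  qed
qed simp

lemma corner_char_poly_monic:
  "degree (corner_char_poly P r s \<alpha> \<beta> X) = r + s" "lead_coeff (corner_char_poly P r s \<alpha> \<beta> X) = 1"
  using degree_monic_char_poly[OF nc_eval_mat_carrier[of "r + s" P "block_a r s \<alpha> X" "block_b r s \<beta> (\<lambda>i j. cnj (X i j))"]]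
  by (simp_all add: corner_char_poly_def)

lemma corner_char_poly_measurable:
  assumes X: "\<And>i j. i < r \<Longrightarrow> j < s \<Longrightarrow> (\<lambda>x. X x i j) \<in> borel_measurable M"
  shows "poly_measurable M (\<lambda>x. corner_char_poly P r s \<alpha> \<beta> (X x))"
  unfolding corner_char_poly_def
proof (rule poly_measurable_char_poly)
  have Z: "(\<lambda>x. cnj (X x i j)) \<in> borel_measurable M" if "i < r" "j < s" for i j
    using X[OF that] by (rule measurable_compose) (intro borel_measurable_continuous_onI continuous_intros)
  show "(\<lambda>x. nc_eval_mat (r + s) P (block_a r s \<alpha> (X x)) (block_b r s \<beta> (\<lambda>i j. cnj (X x i j))) $$ (p, q)) \<in> borel_measurable M"
    if "p < r + s" "q < r + s" for p q
    unfolding nc_eval_mat_entry[OF that]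
    by (intro borel_measurable_sum borel_measurable_times borel_measurable_const block_word_measurable X Z that)
qed auto

definition limit_eigenvalues :: "nc_poly \<Rightarrow> nat \<Rightarrow> nat \<Rightarrow> (nat \<Rightarrow> complex) \<Rightarrow> (nat \<Rightarrow> complex) \<Rightarrow> complex list" where
  "limit_eigenvalues P r s \<alpha> \<beta> = map (\<lambda>i. nc_P1 P (\<alpha> i)) [0..<r] @ map (\<lambda>j. nc_Q1 P (\<beta> j)) [0..<s]"

lemma length_limit_eigenvalues [simp]: "length (limit_eigenvalues P r s \<alpha> \<beta>) = r + s"
  by (simp add: limit_eigenvalues_def)

lemma nth_limit_eigenvalues:
  "k < r + s \<Longrightarrow> limit_eigenvalues P r s \<alpha> \<beta> ! k = (if k < r then nc_P1 P (\<alpha> k) else nc_Q1 P (\<beta> (k - r)))"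
  by (auto simp: limit_eigenvalues_def nth_append)

text \<open>For a vanishing corner the expansion holds with \<open>d = 0\<close>, where all error terms are exactly zero.\<close>

lemma corner_char_poly_zero:
  assumes P0: "nc_eval P 0 0 = 0"
  shows "char_poly (nc_eval_mat (r + s) P (block_a r s \<alpha> (\<lambda>i j. 0)) (block_b r s \<beta> (\<lambda>i j. 0))) =
    (\<Prod>t\<leftarrow>limit_eigenvalues P r s \<alpha> \<beta>. [:- t, 1:])"
proof -
  let ?B = "nc_eval_mat (r + s) P (block_a r s \<alpha> (\<lambda>i j. 0)) (block_b r s \<beta> (\<lambda>i j. 0))"
  have B: "?B \<in> carrier_mat (r + s) (r + s)" by auto
  \<comment> \<open>Along a nontrivial filter, a constant is \<open>O(0)\<close> only if it is \<open>0\<close>.\<close>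
  have E: "first_order_expansion r s (sequentially) (\<lambda>_ _ _. 0) (\<lambda>_. 0) (\<lambda>i. nc_P1 P (\<alpha> i)) (\<lambda>j. nc_Q1 P (\<beta> j))
     (\<lambda>i j. nc_P2 P (\<alpha> i) (\<beta> j) + nc_P3 P (\<alpha> i) (\<beta> j)) (\<lambda>i j. nc_Q2 P (\<alpha> i) (\<beta> j) + nc_Q3 P (\<alpha> i) (\<beta> j))
     (\<lambda>i j. nc_P1 P (\<alpha> i) + nc_P2 P (\<alpha> i) (\<beta> j)) (\<lambda>i j. nc_Q1 P (\<beta> j) + nc_Q2 P (\<alpha> i) (\<beta> j)) (\<lambda>_. ?B)"
    using eval_first_order_expansion[OF _ _ P0, where F = "sequentially" and Y = "\<lambda>_ _ _. 0" and d = "\<lambda>_. 0"] by simp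
  have z: "c = 0" if "(\<lambda>_. c) \<in> O[sequentially](\<lambda>_. 0)" for c :: complex
    using that by (auto simp: bigo_def)
  note D = first_order_expansionD[OF E]
  have ent: "?B $$ (p, q) = (if p = q then limit_eigenvalues P r s \<alpha> \<beta> ! p else 0)" if "p < r + s" "q < r + s" for p q
    using that(1)
  proof (cases rule: less_add_cases)
    case p: 1
    show ?thesis using that(2)
    proof (cases rule: less_add_cases)
      case 1
      then show ?thesis using z[OF D(1)[OF p 1]] z[of "?B $$ (p, p) - nc_P1 P (\<alpha> p)"] D(2)[OF p] p by (auto simp: nth_limit_eigenvalues)
    next
      case (2 j)
      then show ?thesis using z[of "?B $$ (p, r + j)"] D(3)[OF p 2(1)] p by auto
    qed
  next
    case p: (2 j)
    show ?thesis using that(2)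
    proof (cases rule: less_add_cases)
      case 1
      then show ?thesis using z[of "?B $$ (r + j, q)"] D(4)[OF 1 p(1)] p by auto
    next
      case (2 j')
      then show ?thesis using z[OF D(5)[OF p(1) 2(1)]] z[of "?B $$ (r + j, r + j) - nc_Q1 P (\<beta> j)"] D(6)[OF p(1)] p by (auto simp: nth_limit_eigenvalues)
    qed
  qed
  have "upper_triangular ?B" using ent B by (auto simp: upper_triangular_def)
  then have "char_poly ?B = (\<Prod>a\<leftarrow>diag_mat ?B. [:- a, 1:])" by (rule char_poly_upper_triangular[OF B])
  also have "diag_mat ?B = limit_eigenvalues P r s \<alpha> \<beta>"
    using ent B by (intro nth_equalityI) (auto simp: diag_mat_def)
  finally show ?thesis .
qed

lemma corner_char_poly_tendsto:
  assumes P0: "nc_eval P 0 0 = 0"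
  shows "poly_tendsto (corner_char_poly P r s \<alpha> \<beta>) (\<Prod>t\<leftarrow>limit_eigenvalues P r s \<alpha> \<beta>. [:- t, 1:]) (corner_filter r s)"
  unfolding corner_char_poly_zero[OF P0, symmetric] corner_char_poly_def
proof (rule poly_tendsto_char_poly)
  fix p q assume pq: "p < r + s" "q < r + s"
  have Z: "((\<lambda>X. cnj (X i j)) \<longlongrightarrow> 0) (corner_filter r s)" if "i < r" "j < s" for i j
    using tendsto_cnj[OF tendsto_corner_entry[OF that]] by simp
  show "((\<lambda>X. nc_eval_mat (r + s) P (block_a r s \<alpha> X) (block_b r s \<beta> (\<lambda>i j. cnj (X i j))) $$ (p, q)) \<longlongrightarrow>
     nc_eval_mat (r + s) P (block_a r s \<alpha> (\<lambda>i j. 0)) (block_b r s \<beta> (\<lambda>i j. 0)) $$ (p, q)) (corner_filter r s)"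
    unfolding nc_eval_mat_entry[OF pq]
    by (intro tendsto_intros block_word_tendsto pq Z tendsto_corner_entry)
qed auto

definition corner_eigenvalue ::
  "nc_poly \<Rightarrow> nat \<Rightarrow> nat \<Rightarrow> (nat \<Rightarrow> complex) \<Rightarrow> (nat \<Rightarrow> complex) \<Rightarrow> nat \<Rightarrow> (nat \<Rightarrow> nat \<Rightarrow> complex) \<Rightarrow> complex"
  where "corner_eigenvalue P r s \<alpha> \<beta> k X =
    root_labels (limit_eigenvalues P r s \<alpha> \<beta>) (corner_char_poly P r s \<alpha> \<beta> X) ! k"

lemma corner_eigenvalue_measurable:
  assumes "\<And>i j. i < r \<Longrightarrow> j < s \<Longrightarrow> (\<lambda>x. X x i j) \<in> borel_measurable M" "k < r + s"
  shows "(\<lambda>x. corner_eigenvalue P r s \<alpha> \<beta> k (X x)) \<in> borel_measurable M"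
  unfolding corner_eigenvalue_def using assms corner_char_poly_monic
  by (intro measurable_root_labels corner_char_poly_measurable) auto

lemma corner_eigenvalue_tendsto:
  assumes "nc_eval P 0 0 = 0" "k < r + s"
  shows "((\<lambda>X. corner_eigenvalue P r s \<alpha> \<beta> k X) \<longlongrightarrow> limit_eigenvalues P r s \<alpha> \<beta> ! k) (corner_filter r s)"
  unfolding corner_eigenvalue_def using assms corner_char_poly_monic
  by (intro tendsto_root_labels corner_char_poly_tendsto) auto

lemma proots_corner_char_poly:
  "proots (corner_char_poly P r s \<alpha> \<beta> X) =
     image_mset (\<lambda>i. corner_eigenvalue P r s \<alpha> \<beta> i X) (mset_set {..<r}) +
     image_mset (\<lambda>j. corner_eigenvalue P r s \<alpha> \<beta> (r + j) X) (mset_set {..<s})"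
proof -
  let ?L = "root_labels (limit_eigenvalues P r s \<alpha> \<beta>) (corner_char_poly P r s \<alpha> \<beta> X)"
  have m: "mset_set {..<n} = mset [0..<n]" for n by (simp add: lessThan_atLeast0)
  have "?L = map (\<lambda>k. corner_eigenvalue P r s \<alpha> \<beta> k X) [0..<r + s]"
    by (rule nth_equalityI) (auto simp: corner_eigenvalue_def)
  also have "[0..<r + s] = [0..<r] @ map ((+) r) [0..<s]"
    by (rule nth_equalityI) (auto simp: nth_append)
  finally have "mset ?L = image_mset (\<lambda>i. corner_eigenvalue P r s \<alpha> \<beta> i X) (mset_set {..<r}) +
     image_mset (\<lambda>j. corner_eigenvalue P r s \<alpha> \<beta> (r + j) X) (mset_set {..<s})"
    unfolding m by (simp add: multiset.map_comp o_def)
  then show ?thesis using mset_root_labels[of "corner_char_poly P r s \<alpha> \<beta> X" "limit_eigenvalues P r s \<alpha> \<beta>"] corner_char_poly_monic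
    by auto
qed

lemma corner_char_poly_factor:
  "poly (corner_char_poly P r s \<alpha> \<beta> X) z = (\<Prod>k<r + s. z - corner_eigenvalue P r s \<alpha> \<beta> k X)"
proof -
  let ?L = "root_labels (limit_eigenvalues P r s \<alpha> \<beta>) (corner_char_poly P r s \<alpha> \<beta> X)"
  have "poly (corner_char_poly P r s \<alpha> \<beta> X) z = poly (\<Prod>z\<leftarrow>?L. [:- z, 1:]) z"
    using mset_root_labels[of "corner_char_poly P r s \<alpha> \<beta> X" "limit_eigenvalues P r s \<alpha> \<beta>"] corner_char_poly_monic by auto
  also have "\<dots> = (\<Prod>w\<leftarrow>?L. z - w)" by (simp add: poly_prod_list o_def)
  also have "?L = map (\<lambda>k. corner_eigenvalue P r s \<alpha> \<beta> k X) [0..<r + s]"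
    by (rule nth_equalityI) (auto simp: corner_eigenvalue_def)
  finally show ?thesis
    by (simp add: o_def prod.distinct_set_conv_list[symmetric] lessThan_atLeast0)
qed

text \<open>Conjugation by the diagonal matrix with entries \<open>1\<close> (\<open>r\<close> times) and \<open>e\<close> (\<open>s\<close> times). The same
  formula holds for \<open>e = 0\<close>, where the corner is zero and division by \<open>0\<close> returns \<open>0\<close>.\<close>

lemma corner_char_poly_rescale:
  fixes X :: "nat \<Rightarrow> nat \<Rightarrow> complex" and r s :: nat
  defines "e \<equiv> complex_of_real (corner_norm r s X)"
  shows "corner_char_poly P r s \<alpha> \<beta> X = char_poly (nc_eval_mat (r + s) P
     (block_a r s \<alpha> (\<lambda>i j. e\<^sup>2 * (X i j / e))) (block_b r s \<beta> (\<lambda>i j. cnj (X i j / e))))"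
proof (cases "e = 0")
  case True
  have "X i j = 0" if "i < r" "j < s" for i j
    using entry_le_corner_norm[OF that, of X] True by (simp add: e_def)
  then have "block_a r s \<alpha> X = block_a r s \<alpha> (\<lambda>i j. e\<^sup>2 * (X i j / e))"
    "block_b r s \<beta> (\<lambda>i j. cnj (X i j)) = block_b r s \<beta> (\<lambda>i j. cnj (X i j / e))"
    using True by (auto intro!: block_a_cong block_b_cong)
  then show ?thesis by (simp add: corner_char_poly_def)
next
  case False
  let ?n = "r + s" and ?a = "block_a r s \<alpha> X" and ?b = "block_b r s \<beta> (\<lambda>i j. cnj (X i j))"
    and ?a' = "block_a r s \<alpha> (\<lambda>i j. e\<^sup>2 * (X i j / e))" and ?b' = "block_b r s \<beta> (\<lambda>i j. cnj (X i j / e))"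
  let ?C = "mat_diag ?n (\<lambda>p. if p < r then 1 else e)" and ?D = "mat_diag ?n (\<lambda>p. if p < r then 1 else 1 / e)"
  have cn: "cnj e = e" by (simp add: e_def)
  have CD: "?C * ?D = 1\<^sub>m ?n" "?D * ?C = 1\<^sub>m ?n"
    using False by (auto simp: mat_diag_mult_left[of _ ?n ?n] intro!: eq_matI) (auto simp: mat_diag_def)
  have C: "?C \<in> carrier_mat ?n ?n" "?D \<in> carrier_mat ?n ?n" by auto
  have "?a * ?C = ?C * ?a'"
    unfolding mat_diag_mult_left[OF block_a_carrier] mat_diag_mult_right[OF block_a_carrier]
    using False by (auto intro!: eq_matI simp: block_a_def power2_eq_square)
  moreover have "?b * ?C = ?C * ?b'"
    unfolding mat_diag_mult_left[OF block_b_carrier] mat_diag_mult_right[OF block_b_carrier]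
    using False cn by (auto intro!: eq_matI simp: block_b_def)
  ultimately have tw: "nc_eval_mat ?n P ?a ?b * ?C = ?C * nc_eval_mat ?n P ?a' ?b'"
    by (intro nc_eval_mat_intertwine C) auto
  have T: "nc_eval_mat ?n P ?a ?b \<in> carrier_mat ?n ?n" "nc_eval_mat ?n P ?a' ?b' \<in> carrier_mat ?n ?n" by auto
  have "nc_eval_mat ?n P ?a ?b = nc_eval_mat ?n P ?a ?b * (?C * ?D)"
    by (simp only: CD right_mult_one_mat[OF T(1)])
  also have "\<dots> = nc_eval_mat ?n P ?a ?b * ?C * ?D" by (rule assoc_mult_mat[OF T(1) C, symmetric])
  also have "\<dots> = ?C * nc_eval_mat ?n P ?a' ?b' * ?D" by (simp only: tw)
  finally have "similar_mat_wit (nc_eval_mat ?n P ?a ?b) (nc_eval_mat ?n P ?a' ?b') ?C ?D"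
    by (rule similar_mat_witI[OF CD _ T C])
  then have "similar_mat (nc_eval_mat ?n P ?a ?b) (nc_eval_mat ?n P ?a' ?b')" by (auto simp: similar_mat_def)
  then show ?thesis unfolding corner_char_poly_def by (rule char_poly_similar)
qed

definition second_order_shift ::
  "nc_poly \<Rightarrow> nat \<Rightarrow> nat \<Rightarrow> (nat \<Rightarrow> complex) \<Rightarrow> (nat \<Rightarrow> complex) \<Rightarrow> nat \<Rightarrow> (nat \<Rightarrow> nat \<Rightarrow> complex) \<Rightarrow> complex"
  where "second_order_shift P r s \<alpha> \<beta> k X =
    (if k < r then (\<Sum>j<s. coef_p P (\<alpha> k) (\<beta> j) * complex_of_real ((cmod (X k j))\<^sup>2))
     else (\<Sum>i<r. coef_q P (\<alpha> i) (\<beta> (k - r)) * complex_of_real ((cmod (X i (k - r)))\<^sup>2)))"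

lemma corner_char_poly_second_order:
  assumes P0: "nc_eval P 0 0 = 0"
    and gap: "\<And>i j. i < r \<Longrightarrow> j < s \<Longrightarrow> nc_P1 P (\<alpha> i) \<noteq> nc_Q1 P (\<beta> j)"
    and k: "k < r + s"
  shows "(\<lambda>X. poly (corner_char_poly P r s \<alpha> \<beta> X) (limit_eigenvalues P r s \<alpha> \<beta> ! k + second_order_shift P r s \<alpha> \<beta> k X))
    \<in> O[corner_filter r s](\<lambda>X. complex_of_real (corner_norm r s X ^ 4))"
proof -
  let ?F = "corner_filter r s"
  define e where "e X = complex_of_real (corner_norm r s X)" for X
  define Y where "Y X i j = X i j / e X" for X i j
  define d where "d X = (e X)\<^sup>2" for X
  \<comment> \<open>Each entry is at most the norm, so \<open>\<bar>Y X i j\<bar> \<le> 1\<close>.\<close>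
  have Y: "\<forall>i<r. \<forall>j<s. (\<lambda>X. Y X i j) \<in> O[?F](\<lambda>_. 1)"
  proof (intro allI impI)
    fix i j assume ij: "i < r" "j < s"
    have "norm (Y X i j) \<le> 1 * norm (1::complex)" for X
      using entry_le_corner_norm[OF ij, of X] corner_norm_nonneg[of r s X]
      by (auto simp: Y_def e_def norm_divide divide_le_eq_1)
    then show "(\<lambda>X. Y X i j) \<in> O[?F](\<lambda>_. 1)" by (intro bigoI[of _ 1] always_eventually allI)
  qed
  have "(d \<longlongrightarrow> (complex_of_real 0)\<^sup>2) ?F"
    unfolding d_def e_def by (intro tendsto_intros tendsto_corner_norm)
  then have d: "d \<in> O[?F](\<lambda>_. 1)" by (intro bigoI_tendsto[where c = "(complex_of_real 0)\<^sup>2"]) auto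
  define T where "T X = nc_eval_mat (r + s) P (block_a r s \<alpha> (\<lambda>i j. d X * Y X i j)) (block_b r s \<beta> (\<lambda>i j. cnj (Y X i j)))" for X
  have eq: "corner_char_poly P r s \<alpha> \<beta> X = char_poly (T X)" for X
    using corner_char_poly_rescale[of P r s \<alpha> \<beta> X] by (simp add: T_def d_def Y_def e_def)
  have dY: "d X * (c * (Y X i j * cnj (Y X i j))) = c * complex_of_real ((cmod (X i j))\<^sup>2)" if "i < r" "j < s" for X c i j
  proof (cases "e X = 0")
    case True
    then have "X i j = 0" using entry_le_corner_norm[OF that, of X] by (simp add: e_def)
    then show ?thesis by (simp add: Y_def)
  next
    case False
    moreover have "cnj (e X) = e X" by (simp add: e_def)
    moreover have "complex_of_real ((cmod (X i j))\<^sup>2) = X i j * cnj (X i j)" by (rule complex_norm_square)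
    ultimately show ?thesis by (simp add: d_def Y_def power2_eq_square)
  qed
  have "(\<lambda>x. poly (char_poly (T x))
    ((if k < r then nc_P1 P (\<alpha> k) else nc_Q1 P (\<beta> (k - r))) + d x * (if k < r
      then (\<Sum>j<s. (nc_P2 P (\<alpha> k) (\<beta> j) + nc_P3 P (\<alpha> k) (\<beta> j) + (nc_P1 P (\<alpha> k) + nc_P2 P (\<alpha> k) (\<beta> j)) * (nc_Q1 P (\<beta> j) + nc_Q2 P (\<alpha> k) (\<beta> j)) / (nc_P1 P (\<alpha> k) - nc_Q1 P (\<beta> j))) * (Y x k j * cnj (Y x k j)))
      else (\<Sum>i<r. (nc_Q2 P (\<alpha> i) (\<beta> (k - r)) + nc_Q3 P (\<alpha> i) (\<beta> (k - r)) - (nc_P1 P (\<alpha> i) + nc_P2 P (\<alpha> i) (\<beta> (k - r))) * (nc_Q1 P (\<beta> (k - r)) + nc_Q2 P (\<alpha> i) (\<beta> (k - r))) / (nc_P1 P (\<alpha> i) - nc_Q1 P (\<beta> (k - r)))) * (Y x i (k - r) * cnj (Y x i (k - r))))))) \<in> O[?F](\<lambda>x. (d x)\<^sup>2)"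
  proof (rule char_poly_at_second_order[OF Y d _ _ _ k])
    show "first_order_expansion r s ?F Y d (\<lambda>i. nc_P1 P (\<alpha> i)) (\<lambda>j. nc_Q1 P (\<beta> j))
     (\<lambda>i j. nc_P2 P (\<alpha> i) (\<beta> j) + nc_P3 P (\<alpha> i) (\<beta> j)) (\<lambda>i j. nc_Q2 P (\<alpha> i) (\<beta> j) + nc_Q3 P (\<alpha> i) (\<beta> j))
     (\<lambda>i j. nc_P1 P (\<alpha> i) + nc_P2 P (\<alpha> i) (\<beta> j)) (\<lambda>i j. nc_Q1 P (\<beta> j) + nc_Q2 P (\<alpha> i) (\<beta> j)) T"
      using eval_first_order_expansion[OF Y d P0, of \<alpha> \<beta>] by (simp add: T_def[abs_def])
  qed (use gap in \<open>auto simp: T_def\<close>)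
  then have "(\<lambda>X. poly (char_poly (T X)) (limit_eigenvalues P r s \<alpha> \<beta> ! k + second_order_shift P r s \<alpha> \<beta> k X)) \<in> O[?F](\<lambda>x. (d x)\<^sup>2)"
  proof (rule bigo_cong_fun)
    fix X
    have "d X * (\<Sum>j<s. coef_p P (\<alpha> k) (\<beta> j) * (Y X k j * cnj (Y X k j))) = second_order_shift P r s \<alpha> \<beta> k X" if "k < r"
      using that by (simp add: second_order_shift_def sum_distrib_left dY)
    moreover have "d X * (\<Sum>i<r. coef_q P (\<alpha> i) (\<beta> (k - r)) * (Y X i (k - r) * cnj (Y X i (k - r)))) = second_order_shift P r s \<alpha> \<beta> k X" if "\<not> k < r"
      using that k by (simp add: second_order_shift_def sum_distrib_left dY)
    ultimately show "poly (char_poly (T X)) ((if k < r then nc_P1 P (\<alpha> k) else nc_Q1 P (\<beta> (k - r))) + d X * (if k < r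
      then (\<Sum>j<s. (nc_P2 P (\<alpha> k) (\<beta> j) + nc_P3 P (\<alpha> k) (\<beta> j) + (nc_P1 P (\<alpha> k) + nc_P2 P (\<alpha> k) (\<beta> j)) * (nc_Q1 P (\<beta> j) + nc_Q2 P (\<alpha> k) (\<beta> j)) / (nc_P1 P (\<alpha> k) - nc_Q1 P (\<beta> j))) * (Y X k j * cnj (Y X k j)))
      else (\<Sum>i<r. (nc_Q2 P (\<alpha> i) (\<beta> (k - r)) + nc_Q3 P (\<alpha> i) (\<beta> (k - r)) - (nc_P1 P (\<alpha> i) + nc_P2 P (\<alpha> i) (\<beta> (k - r))) * (nc_Q1 P (\<beta> (k - r)) + nc_Q2 P (\<alpha> i) (\<beta> (k - r))) / (nc_P1 P (\<alpha> i) - nc_Q1 P (\<beta> (k - r)))) * (Y X i (k - r) * cnj (Y X i (k - r)))))) =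
      poly (char_poly (T X)) (limit_eigenvalues P r s \<alpha> \<beta> ! k + second_order_shift P r s \<alpha> \<beta> k X)"
      using k by (simp add: nth_limit_eigenvalues coef_p_def coef_q_def)
  qed
  then show ?thesis by (simp add: eq d_def e_def power_mult[symmetric])
qed

text \<open>The characteristic polynomial at the predicted value is the product of the differences to all
  eigenvalues. The differences to the other eigenvalues stay away from \<open>0\<close>, so the remaining one is
  as small as the whole product.\<close>

lemma corner_eigenvalue_second_order:
  assumes P0: "nc_eval P 0 0 = 0" and dist: "distinct (limit_eigenvalues P r s \<alpha> \<beta>)" and k: "k < r + s"
  shows "(\<lambda>X. corner_eigenvalue P r s \<alpha> \<beta> k X - (limit_eigenvalues P r s \<alpha> \<beta> ! k + second_order_shift P r s \<alpha> \<beta> k X))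
    \<in> O[corner_filter r s](\<lambda>X. complex_of_real (corner_norm r s X ^ 4))"
proof -
  let ?F = "corner_filter r s" and ?t = "limit_eigenvalues P r s \<alpha> \<beta>"
  let ?l = "\<lambda>k X. corner_eigenvalue P r s \<alpha> \<beta> k X"
  define z where "z X = ?t ! k + second_order_shift P r s \<alpha> \<beta> k X" for X
  have ne: "?t ! p \<noteq> ?t ! q" if "p < r + s" "q < r + s" "p \<noteq> q" for p q
    using dist that by (simp add: nth_eq_iff_index_eq)
  have gap: "nc_P1 P (\<alpha> i) \<noteq> nc_Q1 P (\<beta> j)" if "i < r" "j < s" for i j
    using ne[of i "r + j"] that by (simp add: nth_limit_eigenvalues)
  have shift: "(second_order_shift P r s \<alpha> \<beta> k \<longlongrightarrow> 0) ?F"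
  proof -
    have entry: "((\<lambda>X. c * complex_of_real ((cmod (X i j))\<^sup>2)) \<longlongrightarrow> 0) ?F" if "i < r" "j < s" for c i j
    proof -
      have "((\<lambda>X. c * complex_of_real ((cmod (X i j))\<^sup>2)) \<longlongrightarrow> c * complex_of_real ((cmod 0)\<^sup>2)) ?F"
        by (intro tendsto_intros tendsto_corner_entry that)
      then show ?thesis by simp
    qed
    show ?thesis unfolding second_order_shift_def[abs_def]
      using k by (cases "k < r") (auto simp del: of_real_power intro!: tendsto_null_sum entry)
  qed
  have z: "(z \<longlongrightarrow> ?t ! k) ?F"
    unfolding z_def[abs_def] using tendsto_add[OF tendsto_const shift, of "?t ! k"] by simp
  \<comment> \<open>The factors that belong to the other eigenvalues.\<close>
  let ?Q = "\<lambda>X. \<Prod>l\<in>{..<r + s} - {k}. z X - ?l l X"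
  let ?c = "\<Prod>l\<in>{..<r + s} - {k}. ?t ! k - ?t ! l"
  have Q: "(?Q \<longlongrightarrow> ?c) ?F"
    using P0 by (intro tendsto_prod tendsto_diff z corner_eigenvalue_tendsto) auto
  have c: "?c \<noteq> 0" using ne k by auto
  have "((\<lambda>X. inverse (?Q X)) \<longlongrightarrow> inverse ?c) ?F" using Q c by (rule tendsto_inverse)
  then have "(\<lambda>X. inverse (?Q X)) \<in> O[?F](\<lambda>_. 1)" by (intro bigoI_tendsto[where c = "inverse ?c"]) auto
  then have "(\<lambda>X. inverse (?Q X) * poly (corner_char_poly P r s \<alpha> \<beta> X) (z X)) \<in> O[?F](\<lambda>X. complex_of_real (corner_norm r s X ^ 4))"
    unfolding z_def using corner_char_poly_second_order[OF P0 gap k] by (rule bigo_bounded_mult)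
  moreover have "eventually (\<lambda>X. inverse (?Q X) * poly (corner_char_poly P r s \<alpha> \<beta> X) (z X) = - (?l k X - z X)) ?F"
  proof -
    have "eventually (\<lambda>X. ?Q X \<noteq> 0) ?F" using Q c by (rule tendsto_imp_eventually_ne)
    then show ?thesis
    proof eventually_elim
      case (elim X)
      have "poly (corner_char_poly P r s \<alpha> \<beta> X) (z X) = (z X - ?l k X) * ?Q X"
        unfolding corner_char_poly_factor using k by (simp add: prod.remove)
      then show ?case using elim by simp
    qed
  qed
  ultimately have "(\<lambda>X. - (?l k X - z X)) \<in> O[?F](\<lambda>X. complex_of_real (corner_norm r s X ^ 4))"
    by (rule landau_o.big.in_cong[THEN iffD1, rotated])
  then show ?thesis unfolding z_def by (subst (asm) landau_o.big.uminus_in_iff)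
qed

section \<open>Haar unitary matrices\<close>

lemma mat_adjoint_mult:
  fixes A B :: "complex mat"
  assumes "A \<in> carrier_mat n m" "B \<in> carrier_mat m p"
  shows "mat_adjoint (A * B) = mat_adjoint B * mat_adjoint A"
proof (rule eq_matI)
  have c: "mat_adjoint (A * B) \<in> carrier_mat p n" "mat_adjoint B \<in> carrier_mat p m" "mat_adjoint A \<in> carrier_mat m n"
    using assms by auto
  fix i j assume "i < dim_row (mat_adjoint B * mat_adjoint A)" "j < dim_col (mat_adjoint B * mat_adjoint A)"
  then have ij: "i < p" "j < n" using c by auto
  have "mat_adjoint (A * B) $$ (i, j) = cnj (\<Sum>k<m. A $$ (j, k) * B $$ (k, i))"
    using ij assms by (subst mat_adjoint_entry[of _ n p]) (auto simp: mat_mult_entry[OF assms] simp del: index_mult_mat)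
  also have "\<dots> = (mat_adjoint B * mat_adjoint A) $$ (i, j)"
    using ij assms by (subst mat_mult_entry[OF c(2,3)]) (auto simp: mat_adjoint_entry intro!: sum.cong)
  finally show "mat_adjoint (A * B) $$ (i, j) = (mat_adjoint B * mat_adjoint A) $$ (i, j)" .
qed (use assms in \<open>auto simp: mat_adjoint_def\<close>)

lemma unitary_groupI:
  assumes "A \<in> carrier_mat n n" "A * mat_adjoint A = 1\<^sub>m n"
  shows "A \<in> unitary_group n"
  using assms mat_mult_left_right_inverse[OF assms(1) mat_adjoint_carrier[OF assms(1)] assms(2)]
  by (simp add: unitary_group_def)

lemma unitary_group_mult:
  assumes V: "V \<in> unitary_group n" and A: "A \<in> unitary_group n"
  shows "V * A \<in> unitary_group n"
proof (rule unitary_groupI)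
  note c = unitary_groupD(1)[OF V] unitary_groupD(1)[OF A]
  note d = mat_adjoint_carrier[OF c(1)] mat_adjoint_carrier[OF c(2)]
  show "V * A \<in> carrier_mat n n" using c by auto
  have "V * A * mat_adjoint (V * A) = V * A * (mat_adjoint A * mat_adjoint V)" by (simp add: mat_adjoint_mult[OF c])
  also have "\<dots> = V * (A * (mat_adjoint A * mat_adjoint V))"
    using c d by (intro assoc_mult_mat) auto
  also have "A * (mat_adjoint A * mat_adjoint V) = A * mat_adjoint A * mat_adjoint V"
    using c d by (intro assoc_mult_mat[symmetric]) auto
  also have "\<dots> = mat_adjoint V" using d by (simp add: unitary_groupD(3)[OF A])
  finally show "V * A * mat_adjoint (V * A) = 1\<^sub>m n" by (simp add: unitary_groupD(3)[OF V])
qed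

lemma unitary_col_norm:
  assumes U: "U \<in> unitary_group N" and "j < N"
  shows "(\<Sum>k<N. (cmod (U $$ (k, j)))\<^sup>2) = 1"
proof -
  have "complex_of_real (\<Sum>k<N. (cmod (U $$ (k, j)))\<^sup>2) = (\<Sum>k<N. cnj (U $$ (k, j)) * U $$ (k, j))"
    by (simp add: complex_norm_square mult.commute del: of_real_power)
  also have "\<dots> = 1" using unitary_col_orthonormal[OF assms(1,2,2)] by simp
  finally show ?thesis by (simp only: of_real_eq_1_iff)
qed

lemma unitary_entry_le_1:
  assumes U: "U \<in> unitary_group N" and "i < N" "j < N"
  shows "cmod (U $$ (i, j)) \<le> 1"
proof -
  have "(cmod (U $$ (i, j)))\<^sup>2 \<le> (\<Sum>k<N. (cmod (U $$ (k, j)))\<^sup>2)"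
    using assms by (intro member_le_sum) auto
  then show ?thesis using unitary_col_norm[OF assms(1,3)] by (simp add: power2_le_iff_abs_le abs_square_le_1)
qed

text \<open>A unitary that mixes the rows \<open>p\<close> and \<open>q\<close>; for \<open>c = 0\<close>, \<open>s = 1\<close> it exchanges them up to a sign.\<close>

definition givens :: "nat \<Rightarrow> nat \<Rightarrow> nat \<Rightarrow> complex \<Rightarrow> complex \<Rightarrow> complex mat" where
  "givens n p q c s = Matrix.mat n n (\<lambda>(i, j).
     if i = p then (if j = p then c else if j = q then s else 0)
     else if i = q then (if j = p then - cnj s else if j = q then cnj c else 0)
     else if i = j then 1 else 0)"

lemma givens_carrier [simp]: "givens n p q c s \<in> carrier_mat n n"
  by (simp add: givens_def)

lemma givens_mult:
  assumes A: "A \<in> carrier_mat n m" and pq: "p < n" "q < n" "p \<noteq> q" and ij: "i < n" "j < m"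
  shows "(givens n p q c s * A) $$ (i, j) =
    (if i = p then c * A $$ (p, j) + s * A $$ (q, j)
     else if i = q then - cnj s * A $$ (p, j) + cnj c * A $$ (q, j) else A $$ (i, j))"
proof -
  have e: "(givens n p q c s * A) $$ (i, j) = (\<Sum>k<n. givens n p q c s $$ (i, k) * A $$ (k, j))"
    using ij by (subst mat_mult_entry[OF givens_carrier A]) auto
  show ?thesis
  proof (cases "i = p \<or> i = q")
    case True
    have "(\<Sum>k<n. givens n p q c s $$ (i, k) * A $$ (k, j)) =
       (\<Sum>k<n. (if k = p then givens n p q c s $$ (i, p) * A $$ (p, j) else 0) + (if k = q then givens n p q c s $$ (i, q) * A $$ (q, j) else 0))"
      using True ij pq by (intro sum.cong) (auto simp: givens_def)
    also have "\<dots> = givens n p q c s $$ (i, p) * A $$ (p, j) + givens n p q c s $$ (i, q) * A $$ (q, j)"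
      using pq by (simp add: sum.distrib sum.delta)
    finally show ?thesis using e True pq ij by (auto simp: givens_def)
  next
    case False
    have "(\<Sum>k<n. givens n p q c s $$ (i, k) * A $$ (k, j)) = (\<Sum>k<n. if k = i then A $$ (i, j) else 0)"
      using False ij by (intro sum.cong) (auto simp: givens_def)
    then show ?thesis using e False ij by simp
  qed
qed

lemma givens_unitary:
  assumes pq: "p < n" "q < n" "p \<noteq> q" and cs: "(cmod c)\<^sup>2 + (cmod s)\<^sup>2 = 1"
  shows "givens n p q c s \<in> unitary_group n"
proof (rule unitary_groupI)
  let ?G = "givens n p q c s"
  have "c * cnj c + s * cnj s = complex_of_real ((cmod c)\<^sup>2 + (cmod s)\<^sup>2)"
    by (simp add: complex_norm_square del: of_real_power)
  then have cs': "c * cnj c + s * cnj s = 1" using cs by simp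
  have adj: "mat_adjoint ?G \<in> carrier_mat n n" by auto
  show "?G * mat_adjoint ?G = 1\<^sub>m n"
  proof (rule eq_matI)
    fix i j assume "i < dim_row (1\<^sub>m n :: complex mat)" "j < dim_col (1\<^sub>m n :: complex mat)"
    then have ij: "i < n" "j < n" by auto
    have G: "mat_adjoint ?G $$ (k, j) = cnj (?G $$ (j, k))" if "k < n" for k
      using that ij by (simp add: mat_adjoint_entry[OF givens_carrier])
    show "(?G * mat_adjoint ?G) $$ (i, j) = 1\<^sub>m n $$ (i, j)"
      unfolding givens_mult[OF adj pq ij] G[OF pq(1)] G[OF pq(2)] G[OF ij(1)]
      using ij pq cs' by (auto simp: givens_def algebra_simps)
  qed (auto simp: mat_adjoint_def givens_def)
qed simp

lemma space_unitary_borel [simp]: "space (unitary_borel N) = unitary_group N"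
  by (simp add: unitary_borel_def)

lemma measurable_unitary_entry:
  assumes "i < N" "j < N"
  shows "(\<lambda>A. A $$ (i, j)) \<in> borel_measurable (unitary_borel N)"
proof -
  have "(\<lambda>A. \<lambda>ij\<in>{..<N} \<times> {..<N}. A $$ ij) \<in> unitary_borel N \<rightarrow>\<^sub>M Pi\<^sub>M ({..<N} \<times> {..<N}) (\<lambda>_. borel :: complex measure)"
    unfolding unitary_borel_def by (rule measurable_vimage_algebra1) (auto simp: space_PiM)
  from measurable_compose[OF this measurable_component_singleton[of "(i, j)"]] assms
  show ?thesis by simp
qed

lemma measurable_unitary_cmod:
  "i < N \<Longrightarrow> j < N \<Longrightarrow> (\<lambda>A. cmod (A $$ (i, j))) \<in> borel_measurable (unitary_borel N)"
  by (rule measurable_compose[OF measurable_unitary_entry borel_measurable_norm])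

lemma measurable_unitary_mult:
  assumes V: "V \<in> unitary_group N"
  shows "(\<lambda>A. V * A) \<in> unitary_borel N \<rightarrow>\<^sub>M unitary_borel N"
  unfolding unitary_borel_def[of N, THEN arg_cong[where f = "measurable (unitary_borel N)"]]
proof (rule measurable_vimage_algebra2)
  show "(\<lambda>A. V * A) \<in> space (unitary_borel N) \<rightarrow> unitary_group N"
    using unitary_group_mult[OF V] by auto
  show "(\<lambda>A. \<lambda>ij\<in>{..<N} \<times> {..<N}. (V * A) $$ ij) \<in> unitary_borel N \<rightarrow>\<^sub>M Pi\<^sub>M ({..<N} \<times> {..<N}) (\<lambda>_. borel :: complex measure)"
  proof (rule measurable_restrict)
    fix ij assume "ij \<in> {..<N} \<times> {..<N}"
    then obtain i j where ij: "ij = (i, j)" "i < N" "j < N" by auto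
    have "(\<lambda>A. \<Sum>k<N. V $$ (i, k) * A $$ (k, j)) \<in> borel_measurable (unitary_borel N)"
      using ij by (intro borel_measurable_sum borel_measurable_times measurable_unitary_entry) auto
    then show "(\<lambda>A. (V * A) $$ ij) \<in> borel_measurable (unitary_borel N)"
      by (rule measurable_cong[THEN iffD1, rotated])
        (use ij unitary_groupD(1)[OF V] in \<open>simp add: mat_mult_entry[OF _ unitary_groupD(1)] del: index_mult_mat\<close>)
  qed
qed

locale haar_matrix = prob_space M for M :: "'w measure" +
  fixes N :: nat and U :: "'w \<Rightarrow> complex mat"
  assumes N: "N \<ge> 1" and haar: "haar_unitary M N U"
begin

lemma U_measurable: "U \<in> M \<rightarrow>\<^sub>M unitary_borel N"
  using haar by (simp add: haar_unitary_def)

lemma U_unitary: "\<omega> \<in> space M \<Longrightarrow> U \<omega> \<in> unitary_group N"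
  using measurable_space[OF U_measurable] by simp

lemma measurable_U: "f \<in> borel_measurable (unitary_borel N) \<Longrightarrow> (\<lambda>\<omega>. f (U \<omega>)) \<in> borel_measurable M"
  using measurable_compose[OF U_measurable] by blast

lemma integrable_U:
  fixes f :: "complex mat \<Rightarrow> 'b::{banach, second_countable_topology}"
  assumes "f \<in> borel_measurable (unitary_borel N)" "\<And>A. A \<in> unitary_group N \<Longrightarrow> norm (f A) \<le> B"
  shows "integrable M (\<lambda>\<omega>. f (U \<omega>))"
  using assms U_unitary by (intro integrable_const_bound[of _ B] measurable_U) auto

lemma left_invariant:
  fixes f :: "complex mat \<Rightarrow> 'b::{banach, second_countable_topology}"
  assumes f: "f \<in> borel_measurable (unitary_borel N)" and V: "V \<in> unitary_group N"
  shows "(\<integral>\<omega>. f (V * U \<omega>) \<partial>M) = (\<integral>\<omega>. f (U \<omega>) \<partial>M)"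
proof -
  let ?ub = "unitary_borel N"
  have inv: "distr (distr M ?ub U) ?ub (\<lambda>A. V * A) = distr M ?ub U"
    using haar V by (auto simp: haar_unitary_def is_haar_measure_def)
  have "(\<integral>\<omega>. f (V * U \<omega>) \<partial>M) = (\<integral>A. f (V * A) \<partial>distr M ?ub U)"
    using f measurable_unitary_mult[OF V] by (intro integral_distr[symmetric] U_measurable) (rule measurable_compose)
  also have "\<dots> = (\<integral>A. f A \<partial>distr (distr M ?ub U) ?ub (\<lambda>A. V * A))"
    using f measurable_unitary_mult[OF V] by (intro integral_distr[symmetric]) auto
  also have "\<dots> = (\<integral>A. f A \<partial>distr M ?ub U)" by (simp only: inv)
  also have "\<dots> = (\<integral>\<omega>. f (U \<omega>) \<partial>M)" using f by (intro integral_distr U_measurable)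
  finally show ?thesis .
qed

lemma left_invariant_prob:
  assumes Q: "{A \<in> unitary_group N. Q A} \<in> sets (unitary_borel N)" and V: "V \<in> unitary_group N"
  shows "prob {\<omega> \<in> space M. Q (V * U \<omega>)} = prob {\<omega> \<in> space M. Q (U \<omega>)}"
proof -
  let ?S = "{A \<in> unitary_group N. Q A}"
  have m: "(\<lambda>A. indicator ?S A :: real) \<in> borel_measurable (unitary_borel N)" using Q by auto
  have i: "(\<integral>\<omega>. indicator ?S (W \<omega>) \<partial>M) = prob {\<omega> \<in> space M. Q (W \<omega>)}"
    if "\<And>\<omega>. \<omega> \<in> space M \<Longrightarrow> W \<omega> \<in> unitary_group N" for W
  proof -
    have "(\<integral>\<omega>. indicator ?S (W \<omega>) \<partial>M) = (\<integral>\<omega>. indicator {\<omega> \<in> space M. Q (W \<omega>)} \<omega> \<partial>M :: real)"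
      using that by (intro Bochner_Integration.integral_cong) (auto simp: indicator_def)
    also have "\<dots> = prob ({\<omega> \<in> space M. Q (W \<omega>)} \<inter> space M)" by simp
    also have "{\<omega> \<in> space M. Q (W \<omega>)} \<inter> space M = {\<omega> \<in> space M. Q (W \<omega>)}" by auto
    finally show ?thesis .
  qed
  show ?thesis using left_invariant[OF m V] i[of "\<lambda>\<omega>. V * U \<omega>"] i[of U] U_unitary unitary_group_mult[OF V] by simp
qed

lemma givens_U:
  assumes "p < N" "q < N" "p \<noteq> q" "i < N" "j < N" "\<omega> \<in> space M"
  shows "(givens N p q c s * U \<omega>) $$ (i, j) =
    (if i = p then c * U \<omega> $$ (p, j) + s * U \<omega> $$ (q, j)
     else if i = q then - cnj s * U \<omega> $$ (p, j) + cnj c * U \<omega> $$ (q, j) else U \<omega> $$ (i, j))"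
  using givens_mult[OF unitary_groupD(1)[OF U_unitary]] assms by blast

lemma swap_rows:
  assumes "p < N" "q < N" "p \<noteq> q"
  shows "givens N p q 0 1 \<in> unitary_group N"
  using assms by (intro givens_unitary) auto

lemma U_entry_measurable: "i < N \<Longrightarrow> j < N \<Longrightarrow> (\<lambda>\<omega>. U \<omega> $$ (i, j)) \<in> borel_measurable M"
  by (intro measurable_U measurable_unitary_entry)

lemma integrable_U_pow: "i < N \<Longrightarrow> j < N \<Longrightarrow> integrable M (\<lambda>\<omega>. cmod (U \<omega> $$ (i, j)) ^ n)"
  by (rule integrable_U[of "\<lambda>A. cmod (A $$ (i, j)) ^ n" 1])
    (auto intro!: borel_measurable_power measurable_unitary_cmod power_le_one unitary_entry_le_1)

lemma moment_row_indep:
  assumes "p < N" "q < N" "j < N"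
  shows "expectation (\<lambda>\<omega>. cmod (U \<omega> $$ (p, j)) ^ n) = expectation (\<lambda>\<omega>. cmod (U \<omega> $$ (q, j)) ^ n)"
proof (cases "p = q")
  case False
  have m: "(\<lambda>A. cmod (A $$ (p, j)) ^ n) \<in> borel_measurable (unitary_borel N)"
    using assms by (intro borel_measurable_power measurable_unitary_cmod)
  have "expectation (\<lambda>\<omega>. cmod (U \<omega> $$ (p, j)) ^ n) = expectation (\<lambda>\<omega>. cmod ((givens N p q 0 1 * U \<omega>) $$ (p, j)) ^ n)"
    using left_invariant[OF m swap_rows[OF assms(1,2) False]] by simp
  also have "\<dots> = expectation (\<lambda>\<omega>. cmod (U \<omega> $$ (q, j)) ^ n)"
    using assms False by (intro Bochner_Integration.integral_cong refl) (subst givens_U, auto)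
  finally show ?thesis .
qed simp

lemma second_moment:
  assumes "p < N" "j < N"
  shows "expectation (\<lambda>\<omega>. (cmod (U \<omega> $$ (p, j)))\<^sup>2) = 1 / real N"
proof -
  have "real N * expectation (\<lambda>\<omega>. (cmod (U \<omega> $$ (p, j)))\<^sup>2) = (\<Sum>k<N. expectation (\<lambda>\<omega>. (cmod (U \<omega> $$ (k, j)))\<^sup>2))"
    using moment_row_indep[OF _ assms(1,2), of _ 2] by simp
  also have "\<dots> = expectation (\<lambda>\<omega>. \<Sum>k<N. (cmod (U \<omega> $$ (k, j)))\<^sup>2)"
    using assms by (intro Bochner_Integration.integral_sum[symmetric] integrable_U_pow) auto
  also have "\<dots> = expectation (\<lambda>\<omega>. 1)"
    using unitary_col_norm[OF U_unitary assms(2)] by (intro Bochner_Integration.integral_cong) auto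
  finally show ?thesis using N prob_space by (simp add: field_simps)
qed

text \<open>Averaging over fourth roots of unity removes all mixed terms except \<open>\<bar>x\<bar>\<^sup>2 \<bar>y\<bar>\<^sup>2\<close>. Finitely many
  phases suffice, so no integral over the circle is needed.\<close>

lemma quarter_turn_average:
  "(cmod (x + y)) ^ 4 + (cmod (x + \<i> * y)) ^ 4 + (cmod (x + (- 1) * y)) ^ 4 + (cmod (x + (- \<i>) * y)) ^ 4 =
    4 * (cmod x ^ 4 + cmod y ^ 4 + 4 * ((cmod x)\<^sup>2 * (cmod y)\<^sup>2))"
proof -
  have *: "cmod z ^ 4 = ((Re z)\<^sup>2 + (Im z)\<^sup>2)\<^sup>2" for z
    by (simp add: cmod_power2[symmetric] power_mult[symmetric])
  show ?thesis unfolding * cmod_power2 by (simp add: power2_eq_square algebra_simps)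
qed

text \<open>Rotating two rows by \<open>45\<close> degrees with four different phases and averaging shows
  \<open>E \<bar>u\<^sub>p\<bar>\<^sup>4 = 2 E \<bar>u\<^sub>p\<bar>\<^sup>2 \<bar>u\<^sub>q\<bar>\<^sup>2\<close> for entries of the same column. Summing over \<open>q\<close>, where
  \<open>\<Sum> \<bar>u\<^sub>q\<bar>\<^sup>2 = 1\<close>, gives an equation for the fourth moment.\<close>

lemma fourth_moment:
  assumes "p < N" "j < N"
  shows "expectation (\<lambda>\<omega>. cmod (U \<omega> $$ (p, j)) ^ 4) = 2 / (real N * (real N + 1))"
proof -
  let ?x = "\<lambda>k \<omega>. U \<omega> $$ (k, j)"
  let ?a = "expectation (\<lambda>\<omega>. cmod (?x p \<omega>) ^ 4)"
  have int2: "integrable M (\<lambda>\<omega>. (cmod (?x p \<omega>))\<^sup>2 * (cmod (?x q \<omega>))\<^sup>2)" if "q < N" for q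
    using assms that
    by (intro integrable_U[of "\<lambda>A. (cmod (A $$ (p, j)))\<^sup>2 * (cmod (A $$ (q, j)))\<^sup>2" 1])
      (auto intro!: borel_measurable_times borel_measurable_power measurable_unitary_cmod
         mult_le_one power_le_one unitary_entry_le_1 simp: abs_mult)
  have b: "2 * expectation (\<lambda>\<omega>. (cmod (?x p \<omega>))\<^sup>2 * (cmod (?x q \<omega>))\<^sup>2) = ?a" if q: "q < N" "q \<noteq> p" for q
  proof -
    let ?h = "complex_of_real (1 / sqrt 2)"
    have h: "cmod (?h * z) ^ 4 = cmod z ^ 4 / 4" for z
      by (simp add: norm_mult norm_divide power_mult_distrib power_divide) (simp add: power4_eq_xxxx)
    have m: "(\<lambda>A. cmod (A $$ (p, j)) ^ 4) \<in> borel_measurable (unitary_borel N)"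
      using assms by (intro borel_measurable_power measurable_unitary_cmod)
    have e: "?a = expectation (\<lambda>\<omega>. cmod (?x p \<omega> + u * ?x q \<omega>) ^ 4) / 4" if "cmod u = 1" for u
    proof -
      have V: "givens N p q ?h (?h * u) \<in> unitary_group N"
        using assms q that by (intro givens_unitary) (auto simp: norm_mult norm_divide power_divide)
      have "?a = expectation (\<lambda>\<omega>. cmod ((givens N p q ?h (?h * u) * U \<omega>) $$ (p, j)) ^ 4)"
        using left_invariant[OF m V] by simp
      also have "\<dots> = expectation (\<lambda>\<omega>. cmod (?h * (?x p \<omega> + u * ?x q \<omega>)) ^ 4)"
        using assms q by (intro Bochner_Integration.integral_cong refl) (subst givens_U, auto simp: distrib_left mult.assoc)
      finally show ?thesis unfolding h by simp
    qed
    have i: "integrable M (\<lambda>\<omega>. cmod (?x p \<omega> + u * ?x q \<omega>) ^ 4)" if "cmod u = 1" for u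
    proof (rule integrable_U[of "\<lambda>A. cmod (A $$ (p, j) + u * A $$ (q, j)) ^ 4" "2 ^ 4"])
      show "norm (cmod (A $$ (p, j) + u * A $$ (q, j)) ^ 4) \<le> 2 ^ 4" if A: "A \<in> unitary_group N" for A
      proof -
        have "cmod (A $$ (p, j) + u * A $$ (q, j)) \<le> cmod (A $$ (p, j)) + cmod (u * A $$ (q, j))" by (rule norm_triangle_ineq)
        also have "\<dots> \<le> 2" using unitary_entry_le_1[OF A assms] unitary_entry_le_1[OF A q(1) assms(2)] \<open>cmod u = 1\<close>
          by (simp add: norm_mult)
        finally have "cmod (A $$ (p, j) + u * A $$ (q, j)) ^ 4 \<le> 2 ^ 4" by (rule power_mono) simp
        then show ?thesis by simp
      qed
    qed (use assms q in \<open>auto intro!: borel_measurable_power measurable_compose[OF _ borel_measurable_norm] borel_measurable_add borel_measurable_times measurable_unitary_entry\<close>)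
    have i4: "integrable M (\<lambda>\<omega>. cmod (?x k \<omega>) ^ 4)" if "k < N" for k using integrable_U_pow that assms by blast
    have "16 * ?a = expectation (\<lambda>\<omega>. cmod (?x p \<omega> + 1 * ?x q \<omega>) ^ 4) + expectation (\<lambda>\<omega>. cmod (?x p \<omega> + \<i> * ?x q \<omega>) ^ 4) +
       expectation (\<lambda>\<omega>. cmod (?x p \<omega> + (- 1) * ?x q \<omega>) ^ 4) + expectation (\<lambda>\<omega>. cmod (?x p \<omega> + (- \<i>) * ?x q \<omega>) ^ 4)"
      using e[of 1] e[of \<i>] e[of "- 1"] e[of "- \<i>"] by simp
    also have "\<dots> = expectation (\<lambda>\<omega>. cmod (?x p \<omega> + 1 * ?x q \<omega>) ^ 4 + cmod (?x p \<omega> + \<i> * ?x q \<omega>) ^ 4 +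
       cmod (?x p \<omega> + (- 1) * ?x q \<omega>) ^ 4 + cmod (?x p \<omega> + (- \<i>) * ?x q \<omega>) ^ 4)"
      using i[of 1] i[of \<i>] i[of "- 1"] i[of "- \<i>"] by simp
    also have "\<dots> = expectation (\<lambda>\<omega>. 4 * (cmod (?x p \<omega>) ^ 4 + cmod (?x q \<omega>) ^ 4 + 4 * ((cmod (?x p \<omega>))\<^sup>2 * (cmod (?x q \<omega>))\<^sup>2)))"
      by (simp only: mult_1 quarter_turn_average)
    also have "\<dots> = 4 * (?a + expectation (\<lambda>\<omega>. cmod (?x q \<omega>) ^ 4) + 4 * expectation (\<lambda>\<omega>. (cmod (?x p \<omega>))\<^sup>2 * (cmod (?x q \<omega>))\<^sup>2))"
      using i4 int2 assms q by simp
    also have "expectation (\<lambda>\<omega>. cmod (?x q \<omega>) ^ 4) = ?a" using moment_row_indep assms q by blast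
    finally show ?thesis by simp
  qed
  \<comment> \<open>The second factor equals \<open>1\<close>.\<close>
  have "1 / real N = expectation (\<lambda>\<omega>. (cmod (?x p \<omega>))\<^sup>2 * (\<Sum>q<N. (cmod (?x q \<omega>))\<^sup>2))"
    using second_moment[OF assms] unitary_col_norm[OF U_unitary assms(2)] by (simp cong: Bochner_Integration.integral_cong)
  also have "\<dots> = (\<Sum>q<N. expectation (\<lambda>\<omega>. (cmod (?x p \<omega>))\<^sup>2 * (cmod (?x q \<omega>))\<^sup>2))"
    using int2 by (simp add: sum_distrib_left)
  also have "\<dots> = (\<Sum>q<N. if q = p then ?a else ?a / 2)"
  proof (rule sum.cong)
    fix q assume "q \<in> {..<N}"
    then show "expectation (\<lambda>\<omega>. (cmod (?x p \<omega>))\<^sup>2 * (cmod (?x q \<omega>))\<^sup>2) = (if q = p then ?a else ?a / 2)"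
      using b[of q] by (auto simp: power_add[symmetric])
  qed simp
  also have "\<dots> = ?a + (\<Sum>q\<in>{..<N} - {p}. ?a / 2)"
    using assms by (subst sum.remove[of _ p]) auto
  also have "\<dots> = ?a + (real N - 1) * (?a / 2)"
    using assms N by (simp add: of_nat_diff)
  finally have "2 = real N * (2 * ?a + (real N - 1) * ?a)" using N by (simp add: field_simps)
  also have "\<dots> = ?a * (real N * (real N + 1))" by (simp add: algebra_simps)
  finally show ?thesis using N by (simp add: eq_divide_eq)
qed

end

lemma borel_measurable_cnj: "f \<in> borel_measurable M \<Longrightarrow> (\<lambda>x. cnj (f x)) \<in> borel_measurable M"
  by (rule measurable_compose, assumption) (intro borel_measurable_continuous_onI continuous_intros)

context haar_matrix
begin

text \<open>The products \<open>x k\<close> of the entries of two columns form an exchangeable family, so all mixed second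
  moments \<open>E (x k) (cnj (x l))\<close> with \<open>k \<noteq> l\<close> are equal. Weights with sum \<open>0\<close> cancel this common part
  and leave only the diagonal terms, which are fourth moments.\<close>

lemma weighted_column_product:
  fixes c :: "nat \<Rightarrow> complex"
  assumes j: "j < N" "j' < N" and c: "\<And>k. k < N \<Longrightarrow> cmod (c k) = 1" and c0: "(\<Sum>k<N. c k) = 0"
  shows "expectation (\<lambda>\<omega>. (cmod (\<Sum>k<N. c k * (U \<omega> $$ (k, j) * cnj (U \<omega> $$ (k, j')))))\<^sup>2) \<le> 4 / real N"
proof -
  define x where "x k A = A $$ (k, j) * cnj (A $$ (k, j'))" for k and A :: "complex mat"
  have xm: "x k \<in> borel_measurable (unitary_borel N)" if "k < N" for k
    unfolding x_def[abs_def] using that j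
    by (intro borel_measurable_times borel_measurable_cnj measurable_unitary_entry)
  have x1: "cmod (x k A) \<le> 1" if "k < N" "A \<in> unitary_group N" for k A
    using that j by (auto simp: x_def norm_mult intro!: mult_le_one unitary_entry_le_1)
  have bm: "(\<lambda>A. x k A * cnj (x l A)) \<in> borel_measurable (unitary_borel N)" if "k < N" "l < N" for k l
    using that by (intro borel_measurable_times borel_measurable_cnj xm)
  have bi: "integrable M (\<lambda>\<omega>. x k (U \<omega>) * cnj (x l (U \<omega>)))" if "k < N" "l < N" for k l
    by (rule integrable_U[OF bm[OF that], of 1]) (use that x1 in \<open>auto simp: norm_mult intro!: mult_le_one\<close>)
  have ai: "integrable M (\<lambda>\<omega>. (cmod (x k (U \<omega>)))\<^sup>2)" if "k < N" for k
    by (rule integrable_U[of "\<lambda>A. (cmod (x k A))\<^sup>2" 1])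
      (use that x1 xm in \<open>auto intro!: power_le_one borel_measurable_power measurable_compose[OF xm borel_measurable_norm]\<close>)
  define b where "b k l = (\<integral>\<omega>. x k (U \<omega>) * cnj (x l (U \<omega>)) \<partial>M)" for k l
  define a where "a = expectation (\<lambda>\<omega>. (cmod (x 0 (U \<omega>)))\<^sup>2)"
  define e where "e = (\<integral>\<omega>. x 0 (U \<omega>) \<partial>M)"
  have N0: "0 < N" using N by simp
  have swap: "x i (givens N p q 0 1 * U \<omega>) = x (if i = p then q else if i = q then p else i) (U \<omega>)"
    if "p < N" "q < N" "p \<noteq> q" "i < N" "\<omega> \<in> space M" for p q i \<omega>
    using that j by (simp add: x_def givens_U del: index_mult_mat)
  have a: "expectation (\<lambda>\<omega>. (cmod (x k (U \<omega>)))\<^sup>2) = a" if "k < N" for k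
  proof (cases "k = 0")
    case False
    have "expectation (\<lambda>\<omega>. (cmod (x k (U \<omega>)))\<^sup>2) = expectation (\<lambda>\<omega>. (cmod (x k (givens N k 0 0 1 * U \<omega>)))\<^sup>2)"
      using left_invariant[OF _ swap_rows[OF that N0 False], of "\<lambda>A. (cmod (x k A))\<^sup>2"] that
      by (simp add: borel_measurable_power measurable_compose[OF xm borel_measurable_norm])
    also have "\<dots> = a" unfolding a_def
      using that N0 False by (intro Bochner_Integration.integral_cong) (auto simp: swap)
    finally show ?thesis .
  qed (simp add: a_def)
  have e: "(\<integral>\<omega>. x k (U \<omega>) \<partial>M) = e" if "k < N" for k
  proof (cases "k = 0")
    case False
    have "(\<integral>\<omega>. x k (U \<omega>) \<partial>M) = (\<integral>\<omega>. x k (givens N k 0 0 1 * U \<omega>) \<partial>M)"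
      using left_invariant[OF xm[OF that] swap_rows[OF that N0 False]] by simp
    also have "\<dots> = e" unfolding e_def
      using that N0 False by (intro Bochner_Integration.integral_cong) (auto simp: swap)
    finally show ?thesis .
  qed (simp add: e_def)
  have bkk: "b k k = complex_of_real a" if "k < N" for k
  proof -
    have "b k k = (\<integral>\<omega>. complex_of_real ((cmod (x k (U \<omega>)))\<^sup>2) \<partial>M)"
      unfolding b_def complex_norm_square ..
    then show ?thesis using a[OF that] by (simp only: integral_complex_of_real)
  qed
  have bswap: "b k l = b k l'" if "k < N" "l < N" "l' < N" "l \<noteq> k" "l' \<noteq> k" "l \<noteq> l'" for k l l'
  proof -
    have "b k l = (\<integral>\<omega>. x k (givens N l l' 0 1 * U \<omega>) * cnj (x l (givens N l l' 0 1 * U \<omega>)) \<partial>M)"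
      unfolding b_def using left_invariant[OF bm swap_rows, of k l l l'] that by simp
    also have "\<dots> = b k l'" unfolding b_def
      using that by (intro Bochner_Integration.integral_cong) (auto simp: swap)
    finally show ?thesis .
  qed
  \<comment> \<open>The common value of the mixed moments comes from summing over \<open>l\<close>, as the sum of all \<open>x l\<close> is the constant \<open>\<delta>\<close>.\<close>
  define \<delta> where "\<delta> = (if j = j' then 1 else 0 :: complex)"
  define b0 where "b0 = (\<delta> * e - complex_of_real a) / (of_nat N - 1)"
  have col: "(\<Sum>l<N. cnj (x l (U \<omega>))) = \<delta>" if "\<omega> \<in> space M" for \<omega>
    using unitary_col_orthonormal[OF U_unitary[OF that] j] by (simp add: x_def \<delta>_def)
  have bkl: "b k l = b0" if kl: "k < N" "l < N" "l \<noteq> k" for k l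
  proof -
    have "(\<Sum>l<N. b k l) = (\<integral>\<omega>. (\<Sum>l<N. x k (U \<omega>) * cnj (x l (U \<omega>))) \<partial>M)"
      unfolding b_def using kl bi by (intro Bochner_Integration.integral_sum[symmetric]) auto
    also have "\<dots> = (\<integral>\<omega>. \<delta> * x k (U \<omega>) \<partial>M)"
      by (intro Bochner_Integration.integral_cong refl) (simp add: sum_distrib_left[symmetric] col mult.commute)
    also have "\<dots> = \<delta> * e" using e[OF kl(1)] by simp
    finally have "(\<Sum>l<N. b k l) = \<delta> * e" .
    moreover have "(\<Sum>l<N. b k l) = b k k + (\<Sum>l'\<in>{..<N} - {k}. b k l')"
      using kl by (simp add: sum.remove)
    moreover have "(\<Sum>l'\<in>{..<N} - {k}. b k l') = (\<Sum>l'\<in>{..<N} - {k}. b k l)"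
      using bswap kl by (intro sum.cong) auto
    moreover have "card ({..<N} - {k}) = N - 1" using kl by simp
    ultimately have "of_nat (N - 1) * b k l = \<delta> * e - complex_of_real a"
      using bkk[OF kl(1)] by (simp add: algebra_simps)
    moreover have "N \<ge> 2" using kl by linarith
    then have "of_nat (N - 1) \<noteq> (0 :: complex)" "of_nat (N - 1) = (of_nat N - 1 :: complex)" by (auto simp: of_nat_diff)
    ultimately show ?thesis unfolding b0_def by (simp add: eq_divide_eq mult.commute)
  qed
  have abs_b: "cmod (b k l) \<le> a" if "k < N" "l < N" for k l
  proof -
    have "cmod (b k l) \<le> expectation (\<lambda>\<omega>. cmod (x k (U \<omega>) * cnj (x l (U \<omega>))))"
      unfolding b_def by (rule integral_norm_bound)
    also have "\<dots> \<le> expectation (\<lambda>\<omega>. ((cmod (x k (U \<omega>)))\<^sup>2 + (cmod (x l (U \<omega>)))\<^sup>2) / 2)"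
    proof (rule integral_mono)
      show "cmod (x k (U \<omega>) * cnj (x l (U \<omega>))) \<le> ((cmod (x k (U \<omega>)))\<^sup>2 + (cmod (x l (U \<omega>)))\<^sup>2) / 2" for \<omega>
        using sum_squares_bound[of "cmod (x k (U \<omega>))" "cmod (x l (U \<omega>))"] by (simp add: norm_mult)
    qed (use that ai bi in auto)
    also have "\<dots> = a" using that ai a by simp
    finally show ?thesis .
  qed
  have abs_b0: "cmod b0 \<le> a"
  proof (cases "N = 1")
    case True
    then show ?thesis unfolding b0_def a_def by simp
  next
    case False
    then have "b 0 1 = b0" using N by (intro bkl) auto
    then show ?thesis using abs_b[of 0 1] N False by simp
  qed
  have a_le: "a \<le> 2 / (real N * (real N + 1))"
  proof -
    have "a \<le> expectation (\<lambda>\<omega>. (cmod (U \<omega> $$ (0, j)) ^ 4 + cmod (U \<omega> $$ (0, j')) ^ 4) / 2)"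
      unfolding a_def
    proof (rule integral_mono)
      show "(cmod (x 0 (U \<omega>)))\<^sup>2 \<le> (cmod (U \<omega> $$ (0, j)) ^ 4 + cmod (U \<omega> $$ (0, j')) ^ 4) / 2" for \<omega>
        using sum_squares_bound[of "(cmod (U \<omega> $$ (0, j)))\<^sup>2" "(cmod (U \<omega> $$ (0, j')))\<^sup>2"]
        by (simp add: x_def norm_mult power_mult_distrib power_mult[symmetric])
    qed (use N0 ai j integrable_U_pow in auto)
    also have "\<dots> = 2 / (real N * (real N + 1))"
      using N0 j integrable_U_pow fourth_moment by simp
    finally show ?thesis .
  qed
  have cc: "c k * cnj (c k) = 1" if "k < N" for k
    using c[OF that] complex_norm_square[of "c k"] by simp
  let ?S = "\<lambda>\<omega>. \<Sum>k<N. c k * x k (U \<omega>)"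
  have "complex_of_real (expectation (\<lambda>\<omega>. (cmod (?S \<omega>))\<^sup>2)) = (\<integral>\<omega>. ?S \<omega> * cnj (?S \<omega>) \<partial>M)"
    unfolding complex_norm_square[symmetric] by (simp only: integral_complex_of_real)
  also have "\<dots> = (\<integral>\<omega>. (\<Sum>k<N. \<Sum>l<N. (c k * cnj (c l)) * (x k (U \<omega>) * cnj (x l (U \<omega>)))) \<partial>M)"
    by (simp add: sum_product mult_ac)
  also have "\<dots> = (\<Sum>k<N. \<Sum>l<N. (c k * cnj (c l)) * b k l)"
  proof -
    have "(\<integral>\<omega>. (\<Sum>k<N. \<Sum>l<N. (c k * cnj (c l)) * (x k (U \<omega>) * cnj (x l (U \<omega>)))) \<partial>M) =
        (\<Sum>k<N. \<integral>\<omega>. (\<Sum>l<N. (c k * cnj (c l)) * (x k (U \<omega>) * cnj (x l (U \<omega>)))) \<partial>M)"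
      using bi by (intro Bochner_Integration.integral_sum Bochner_Integration.integrable_sum integrable_mult_right) auto
    also have "\<dots> = (\<Sum>k<N. \<Sum>l<N. \<integral>\<omega>. (c k * cnj (c l)) * (x k (U \<omega>) * cnj (x l (U \<omega>))) \<partial>M)"
      using bi by (intro sum.cong refl Bochner_Integration.integral_sum integrable_mult_right) auto
    finally show ?thesis by (simp only: b_def integral_mult_right_zero)
  qed
  also have "\<dots> = (\<Sum>k<N. \<Sum>l<N. (c k * cnj (c l)) * b0 + (if k = l then complex_of_real a - b0 else 0))"
    using bkl bkk cc by (intro sum.cong refl) (auto simp: algebra_simps)
  also have "\<dots> = (\<Sum>k<N. c k) * cnj (\<Sum>k<N. c k) * b0 + of_nat N * (complex_of_real a - b0)"
  proof -
    have "(\<Sum>k<N. c k) * cnj (\<Sum>k<N. c k) * b0 = (\<Sum>k<N. \<Sum>l<N. c k * cnj (c l)) * b0"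
      by (simp only: cnj_sum sum_product)
    also have "\<dots> = (\<Sum>k<N. \<Sum>l<N. (c k * cnj (c l)) * b0)"
      by (simp only: sum_distrib_right)
    finally show ?thesis by (simp add: sum.distrib sum.delta del: cnj_sum)
  qed
  also have "\<dots> = of_nat N * (complex_of_real a - b0)" using c0 by simp
  finally have "expectation (\<lambda>\<omega>. (cmod (?S \<omega>))\<^sup>2) = Re (of_nat N * (complex_of_real a - b0))"
    by (metis Re_complex_of_real)
  also have "\<dots> = real N * (a - Re b0)" by simp
  also have "\<dots> \<le> real N * (2 * a)"
    using abs_b0 abs_Re_le_cmod[of b0] by (intro mult_left_mono) auto
  also have "\<dots> \<le> real N * (2 * (2 / (real N * (real N + 1))))"
    using a_le by (intro mult_left_mono) auto
  also have "\<dots> = 4 / (real N + 1)" using N0 by (simp add: divide_simps)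
  also have "\<dots> \<le> 4 / real N" using N0 by (intro divide_left_mono) auto
  finally show ?thesis by (simp add: x_def)
qed

lemma measurable_minor:
  assumes "\<And>i. i < k \<Longrightarrow> \<rho> i < N" "k \<le> N"
  shows "(\<lambda>A. Determinant.det (Matrix.mat k k (\<lambda>(i, j). A $$ (\<rho> i, j)))) \<in> borel_measurable (unitary_borel N)"
proof -
  have "(\<lambda>A. \<Sum>\<sigma>\<in>{\<sigma>. \<sigma> permutes {0..<k}}. signof \<sigma> * (\<Prod>i = 0..<k. A $$ (\<rho> i, \<sigma> i))) \<in> borel_measurable (unitary_borel N)"
  proof (intro borel_measurable_sum borel_measurable_times borel_measurable_const borel_measurable_prod)
    fix \<sigma> i assume s: "\<sigma> \<in> {\<sigma>. \<sigma> permutes {0..<k}}" and i: "i \<in> {0..<k}"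
    then have "\<sigma> i < k" using permutes_in_image[of \<sigma> "{0..<k}" i] by simp
    then show "(\<lambda>A. A $$ (\<rho> i, \<sigma> i)) \<in> borel_measurable (unitary_borel N)"
      using assms i by (intro measurable_unitary_entry) auto
  qed
  moreover have "Determinant.det (Matrix.mat k k (\<lambda>(i, j). A $$ (\<rho> i, j))) =
      (\<Sum>\<sigma>\<in>{\<sigma>. \<sigma> permutes {0..<k}}. signof \<sigma> * (\<Prod>i = 0..<k. A $$ (\<rho> i, \<sigma> i)))" for A :: "complex mat"
  proof -
    have "(\<Prod>i = 0..<k. Matrix.mat k k (\<lambda>(i, j). A $$ (\<rho> i, j)) $$ (i, \<sigma> i)) = (\<Prod>i = 0..<k. A $$ (\<rho> i, \<sigma> i))"
      if "\<sigma> permutes {0..<k}" for \<sigma>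
    proof (rule prod.cong)
      fix i assume i: "i \<in> {0..<k}"
      then have "\<sigma> i < k" using permutes_in_image[OF that, of i] by simp
      then show "Matrix.mat k k (\<lambda>(i, j). A $$ (\<rho> i, j)) $$ (i, \<sigma> i) = A $$ (\<rho> i, \<sigma> i)" using i by simp
    qed simp
    then show ?thesis unfolding Determinant.det_def by simp
  qed
  ultimately show ?thesis by simp
qed

text \<open>The events \<open>f + t g = 0\<close> for \<open>t = 0, 1, 2, \<dots>\<close> have equal probability, because a rotation carries
  \<open>f = 0\<close> to each of them. They are disjoint outside the event \<open>f = g = 0\<close>; infinitely many disjoint
  events of equal probability are null.\<close>

lemma AE_nonzero_of_mixing:
  fixes f g :: "complex mat \<Rightarrow> complex"
  assumes m: "f \<in> borel_measurable (unitary_borel N)" "g \<in> borel_measurable (unitary_borel N)"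
    and pq: "p < N" "q < N" "p \<noteq> q"
    and mix: "\<And>c s \<omega>. \<omega> \<in> space M \<Longrightarrow> f (givens N p q c s * U \<omega>) = c * f (U \<omega>) + s * g (U \<omega>)"
  shows "AE \<omega> in M. f (U \<omega>) = 0 \<longrightarrow> g (U \<omega>) = 0"
proof -
  define E where "E t = {\<omega> \<in> space M. f (U \<omega>) + of_nat t * g (U \<omega>) = 0}" for t :: nat
  define Z where "Z = {\<omega> \<in> space M. f (U \<omega>) = 0 \<and> g (U \<omega>) = 0}"
  have fm: "(\<lambda>\<omega>. f (U \<omega>)) \<in> borel_measurable M" "(\<lambda>\<omega>. g (U \<omega>)) \<in> borel_measurable M"
    using m measurable_U by auto
  have E: "E t \<in> sets M" for t unfolding E_def using fm by measurable
  have Z: "Z \<in> sets M" unfolding Z_def using fm by measurable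
  have ZE: "Z \<subseteq> E t" for t by (auto simp: Z_def E_def)
  have pE: "prob (E t) = prob (E 0)" for t
  proof -
    \<comment> \<open>The rotation with \<open>s / c = t\<close> maps \<open>f\<close> to a multiple of \<open>f + t g\<close>.\<close>
    let ?r = "sqrt (1 + (real t)\<^sup>2)"
    let ?c = "complex_of_real (1 / ?r)" and ?s = "complex_of_real (real t / ?r)"
    have r: "?r > 0" by (simp add: add_pos_nonneg)
    have "(cmod ?c)\<^sup>2 + (cmod ?s)\<^sup>2 = (1 / ?r)\<^sup>2 + (real t / ?r)\<^sup>2" by (simp only: norm_of_real power2_abs)
    also have "\<dots> = (1 + (real t)\<^sup>2) / ?r\<^sup>2" by (simp only: power_divide add_divide_distrib power_one)
    also have "\<dots> = 1"
    proof -
      have "1 + (real t)\<^sup>2 \<noteq> 0" by (metis add_nonneg_eq_0_iff zero_le_one zero_le_power2 zero_neq_one)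
      then show ?thesis by simp
    qed
    finally have V: "givens N p q ?c ?s \<in> unitary_group N" by (intro givens_unitary pq)
    have S: "{A \<in> unitary_group N. f A = 0} \<in> sets (unitary_borel N)"
      using measurable_sets[OF m(1), of "{0}"] by (simp add: vimage_def Int_def conj_commute)
    have "prob {\<omega> \<in> space M. f (givens N p q ?c ?s * U \<omega>) = 0} = prob {\<omega> \<in> space M. f (U \<omega>) = 0}"
      by (rule left_invariant_prob[OF S V])
    moreover have "{\<omega> \<in> space M. f (givens N p q ?c ?s * U \<omega>) = 0} = E t"
    proof -
      have "?c * a + ?s * b = ?c * (a + of_nat t * b)" for a b by (simp add: add_divide_distrib algebra_simps)
      moreover have "?c \<noteq> 0" using r by auto
      ultimately show ?thesis by (auto simp: E_def mix simp del: of_real_divide)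
    qed
    ultimately show ?thesis by (simp add: E_def)
  qed
  have dis: "disjoint_family (\<lambda>t. E t - Z)"
  proof (unfold disjoint_family_on_def, intro ballI impI)
    fix t u :: nat assume tu: "t \<noteq> u"
    show "(E t - Z) \<inter> (E u - Z) = {}"
    proof (rule ccontr)
      assume "(E t - Z) \<inter> (E u - Z) \<noteq> {}"
      then obtain \<omega> where w: "\<omega> \<in> space M" "f (U \<omega>) + of_nat t * g (U \<omega>) = 0" "f (U \<omega>) + of_nat u * g (U \<omega>) = 0" "\<omega> \<notin> Z"
        by (auto simp: E_def)
      then have "of_nat t * g (U \<omega>) = of_nat u * g (U \<omega>)" by (metis add_left_cancel)
      then have "g (U \<omega>) = 0" using tu by simp
      then show False using w by (auto simp: Z_def)
    qed
  qed
  have "(\<lambda>t. prob (E t - Z)) sums prob (\<Union>t. E t - Z)"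
    using E Z dis by (intro finite_measure_UNION) auto
  moreover have "prob (E t - Z) = prob (E 0) - prob Z" for t
    using finite_measure_Diff[OF E Z ZE] pE by simp
  ultimately have "summable (\<lambda>t::nat. prob (E 0) - prob Z)" by (simp add: sums_iff)
  then have "prob (E 0) - prob Z = 0" by (simp add: summable_const_iff)
  then have "prob (E 0 - Z) = 0" using finite_measure_Diff[OF E Z ZE] by simp
  then have "AE \<omega> in M. \<omega> \<notin> E 0 - Z" using E Z by (subst (asm) prob_eq_0) auto
  then show ?thesis using AE_space by eventually_elim (auto simp: E_def Z_def)
qed

text \<open>Induction on the size. Expand along the last row \<open>m\<close>: the minor is a linear form in the first
  entries of row \<open>m\<close>, and its coefficients do not involve that row. If it vanishes, then by rotation
  invariance the same form vanishes on every row \<open>q\<close>. The columns of a unitary matrix are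
  independent, so all coefficients vanish, but one of them is the smaller minor.\<close>

lemma AE_minor_nonzero:
  assumes "k \<le> N" "inj_on \<rho> {..<k}" "\<And>i. i < k \<Longrightarrow> \<rho> i < N"
  shows "AE \<omega> in M. Determinant.det (Matrix.mat k k (\<lambda>(i, j). U \<omega> $$ (\<rho> i, j))) \<noteq> 0"
  using assms
proof (induction k)
  case (Suc k)
  \<comment> \<open>The minor with its last row replaced by row \<open>m\<close> is \<open>y m\<close>, and \<open>cof\<close> are its coefficients.\<close>
  define R where "R m i = (if i < k then \<rho> i else m)" for m i
  define y where "y m A = Determinant.det (Matrix.mat (Suc k) (Suc k) (\<lambda>(i, j). A $$ (R m i, j)))" for m and A :: "complex mat"
  define cof where "cof A j = cofactor (Matrix.mat (Suc k) (Suc k) (\<lambda>(i, j). A $$ (R 0 i, j))) k j" for j and A :: "complex mat"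
  have cof: "cofactor (Matrix.mat (Suc k) (Suc k) (\<lambda>(i, j). A $$ (R m i, j))) k j = cof A' j"
    if "\<And>i l. i < k \<Longrightarrow> l < Suc k \<Longrightarrow> A $$ (\<rho> i, l) = A' $$ (\<rho> i, l)" "j < Suc k" for A A' m j
  proof -
    have "mat_delete (Matrix.mat (Suc k) (Suc k) (\<lambda>(i, j). A $$ (R m i, j))) k j =
          mat_delete (Matrix.mat (Suc k) (Suc k) (\<lambda>(i, j). A' $$ (R 0 i, j))) k j"
      using that by (intro eq_matI) (auto simp: mat_delete_def R_def)
    then show ?thesis by (simp add: cofactor_def cof_def)
  qed
  have y: "y m A = (\<Sum>j<Suc k. A $$ (m, j) * cof A j)" for m A
  proof -
    let ?A = "Matrix.mat (Suc k) (Suc k) (\<lambda>(i, j). A $$ (R m i, j))"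
    have "y m A = (\<Sum>j<Suc k. ?A $$ (k, j) * cofactor ?A k j)"
      unfolding y_def by (rule laplace_expansion_row) auto
    also have "\<dots> = (\<Sum>j<Suc k. A $$ (m, j) * cof A j)"
      by (intro sum.cong refl arg_cong2[where f = "(*)"] cof) (auto simp: R_def)
    finally show ?thesis .
  qed
  have ym: "y m \<in> borel_measurable (unitary_borel N)" if "m < N" for m
    unfolding y_def[abs_def] using Suc.prems that by (intro measurable_minor) (auto simp: R_def)
  have y_rep: "y (\<rho> i) A = 0" if "i < k" for i A
  proof -
    have "row (Matrix.mat (Suc k) (Suc k) (\<lambda>(a, j). A $$ (R (\<rho> i) a, j))) i = row (Matrix.mat (Suc k) (Suc k) (\<lambda>(a, j). A $$ (R (\<rho> i) a, j))) k"
      using that by (intro eq_vecI) (auto simp: R_def)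
    then show ?thesis unfolding y_def using that
      by (intro det_identical_rows[of _ "Suc k" i k]) auto
  qed
  let ?m = "\<rho> k"
  have m: "?m < N" "?m \<notin> \<rho> ` {..<k}"
    using Suc.prems inj_on_image_mem_iff[OF Suc.prems(2), of k "{..<k}"] by auto
  have AEq: "AE \<omega> in M. y ?m (U \<omega>) = 0 \<longrightarrow> y q (U \<omega>) = 0" if q: "q < N" for q
  proof (cases "q = ?m \<or> q \<in> \<rho> ` {..<k}")
    case True
    then show ?thesis using y_rep by auto
  next
    case False
    show ?thesis
    proof (rule AE_nonzero_of_mixing[OF ym[OF m(1)] ym[OF q] m(1) q])
      show "\<rho> k \<noteq> q" using False by auto
      fix c s \<omega> assume w: "\<omega> \<in> space M"
      let ?V = "givens N ?m q c s * U \<omega>"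
      have V: "?V $$ (i, j) = (if i = ?m then c * U \<omega> $$ (?m, j) + s * U \<omega> $$ (q, j)
          else if i = q then - cnj s * U \<omega> $$ (?m, j) + cnj c * U \<omega> $$ (q, j) else U \<omega> $$ (i, j))" if "i < N" "j < N" for i j
        using that w m q False by (intro givens_U) auto
      have "cof ?V j = cof (U \<omega>) j" if j: "j < Suc k" for j
        unfolding cof_def[of ?V]
      proof (rule cof[OF _ j])
        fix i l assume il: "i < k" "l < Suc k"
        then have "\<rho> i \<in> \<rho> ` {..<k}" by simp
        then have "\<rho> i \<noteq> ?m" "\<rho> i \<noteq> q" using m False by metis+
        then show "?V $$ (\<rho> i, l) = U \<omega> $$ (\<rho> i, l)" using V[of "\<rho> i" l] il Suc.prems by simp
      qed
      then have "y ?m ?V = (\<Sum>j<Suc k. (c * U \<omega> $$ (?m, j) + s * U \<omega> $$ (q, j)) * cof (U \<omega>) j)"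
        unfolding y using V m Suc.prems by (intro sum.cong) auto
      also have "\<dots> = c * y ?m (U \<omega>) + s * y q (U \<omega>)"
        unfolding y by (simp add: algebra_simps sum.distrib sum_distrib_left del: sum.lessThan_Suc)
      finally show "y ?m ?V = c * y ?m (U \<omega>) + s * y q (U \<omega>)" .
    qed
  qed
  have all: "AE \<omega> in M. \<forall>q\<in>{..<N}. y ?m (U \<omega>) = 0 \<longrightarrow> y q (U \<omega>) = 0"
    using AEq by (intro AE_finite_allI) auto
  have IH: "AE \<omega> in M. Determinant.det (Matrix.mat k k (\<lambda>(i, j). U \<omega> $$ (\<rho> i, j))) \<noteq> 0"
    using Suc.prems by (intro Suc.IH inj_on_subset[OF Suc.prems(2)]) auto
  have goal: "Matrix.mat (Suc k) (Suc k) (\<lambda>(i, j). A $$ (\<rho> i, j)) = Matrix.mat (Suc k) (Suc k) (\<lambda>(i, j). A $$ (R ?m i, j))" for A :: "complex mat"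
    by (intro eq_matI) (auto simp: R_def less_Suc_eq)
  have "AE \<omega> in M. \<omega> \<in> space M" by simp
  then show ?case using all IH
  proof eventually_elim
    case (elim \<omega>)
    note u = U_unitary[OF elim(1)]
    show ?case
    proof
      assume "Determinant.det (Matrix.mat (Suc k) (Suc k) (\<lambda>(i, j). U \<omega> $$ (\<rho> i, j))) = 0"
      then have "y ?m (U \<omega>) = 0" unfolding y_def goal .
      then have z: "(\<Sum>j<Suc k. U \<omega> $$ (q, j) * cof (U \<omega>) j) = 0" if "q < N" for q
        using elim(2) that y[of q "U \<omega>"] by auto
      have "cof (U \<omega>) k = Determinant.det (Matrix.mat k k (\<lambda>(i, j). U \<omega> $$ (\<rho> i, j)))"
      proof -
        have "mat_delete (Matrix.mat (Suc k) (Suc k) (\<lambda>(i, j). U \<omega> $$ (R 0 i, j))) k k = Matrix.mat k k (\<lambda>(i, j). U \<omega> $$ (\<rho> i, j))"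
          by (intro eq_matI) (auto simp: mat_delete_def R_def)
        then show ?thesis by (simp add: cof_def cofactor_def)
      qed
      then have nz: "cof (U \<omega>) k \<noteq> 0" using elim(3) by simp
      \<comment> \<open>Pairing with column \<open>k\<close> isolates the last coefficient.\<close>
      have "0 = (\<Sum>q<N. cnj (U \<omega> $$ (q, k)) * (\<Sum>j<Suc k. U \<omega> $$ (q, j) * cof (U \<omega>) j))" using z by simp
      also have "\<dots> = (\<Sum>j<Suc k. (\<Sum>q<N. cnj (U \<omega> $$ (q, k)) * U \<omega> $$ (q, j)) * cof (U \<omega>) j)"
        by (simp add: sum_distrib_left sum_distrib_right mult.assoc del: sum.lessThan_Suc) (rule sum.swap)
      also have "\<dots> = (\<Sum>j<Suc k. if j = k then cof (U \<omega>) k else 0)"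
        using unitary_col_orthonormal[OF u, of k] Suc.prems by (intro sum.cong) auto
      also have "\<dots> = cof (U \<omega>) k" by simp
      finally show False using nz by simp
    qed
  qed
qed simp

end

text \<open>The fourth moments are summable in \<open>N\<close>, whereas the second moments \<open>1 / N\<close> are not.\<close>

lemma AE_haar_entry_tendsto_0:
  assumes H: "\<And>n. n \<ge> 1 \<Longrightarrow> haar_matrix M n (U n)"
  shows "AE \<omega> in M. (\<lambda>n. U n \<omega> $$ (i, j)) \<longlonglongrightarrow> 0"
proof -
  let ?n0 = "Suc (max i j)"
  define f where "f n \<omega> = cmod (U (n + ?n0) \<omega> $$ (i, j)) ^ 4" for n \<omega>
  have h: "haar_matrix M (n + ?n0) (U (n + ?n0))" for n by (rule H) simp
  have ij: "i < n + ?n0" "j < n + ?n0" for n by auto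
  have fi: "integrable M (f n)" for n
    unfolding f_def[abs_def] by (rule haar_matrix.integrable_U_pow[OF h ij])
  have fe: "integral\<^sup>L M (f n) \<le> 2 * inverse (real (Suc n) ^ 2)" for n
  proof -
    have "integral\<^sup>L M (f n) = 2 / (real (n + ?n0) * (real (n + ?n0) + 1))"
      unfolding f_def[abs_def] by (rule haar_matrix.fourth_moment[OF h ij])
    also have "\<dots> \<le> 2 / (real (Suc n) * real (Suc n))"
      by (intro divide_left_mono mult_mono) auto
    finally show ?thesis by (simp add: power2_eq_square divide_inverse)
  qed
  have f0: "0 \<le> f n \<omega>" for n \<omega> by (simp add: f_def)
  have sm: "summable (\<lambda>n. 2 * inverse (real (Suc n) ^ 2))"
    using inverse_power_summable[of 2, where 'a = real] summable_Suc_iff[of "\<lambda>n. inverse (real n ^ 2)"]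
    by (intro summable_mult) auto
  have "(\<integral>\<^sup>+\<omega>. suminf (\<lambda>n. ennreal (f n \<omega>)) \<partial>M) = suminf (\<lambda>n. \<integral>\<^sup>+\<omega>. ennreal (f n \<omega>) \<partial>M)"
    using fi by (intro nn_integral_suminf) auto
  also have "\<dots> = suminf (\<lambda>n. ennreal (integral\<^sup>L M (f n)))"
    using fi f0 by (intro suminf_cong nn_integral_eq_integral) auto
  also have "\<dots> \<le> suminf (\<lambda>n. ennreal (2 * inverse (real (Suc n) ^ 2)))"
    using fe by (intro suminf_le ennreal_leI) auto
  also have "\<dots> = ennreal (suminf (\<lambda>n. 2 * inverse (real (Suc n) ^ 2)))"
    using sm by (intro suminf_ennreal2) auto
  also have "\<dots> < \<infinity>" by simp
  finally have "(\<integral>\<^sup>+\<omega>. suminf (\<lambda>n. ennreal (f n \<omega>)) \<partial>M) \<noteq> \<infinity>" by simp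
  then have "AE \<omega> in M. suminf (\<lambda>n. ennreal (f n \<omega>)) \<noteq> \<infinity>"
    using fi by (intro nn_integral_PInf_AE) auto
  then show ?thesis
  proof eventually_elim
    case (elim \<omega>)
    then have "summable (\<lambda>n. f n \<omega>)" using f0 by (intro summable_suminf_not_top) auto
    then have "(\<lambda>n. f n \<omega>) \<longlonglongrightarrow> 0" by (rule summable_LIMSEQ_zero)
    then have "(\<lambda>n. root 4 (f n \<omega>)) \<longlonglongrightarrow> root 4 0" by (rule tendsto_real_root)
    then have "(\<lambda>n. cmod (U (n + ?n0) \<omega> $$ (i, j))) \<longlonglongrightarrow> 0"
      by (simp add: f_def real_root_power_cancel)
    then have "(\<lambda>n. U (n + ?n0) \<omega> $$ (i, j)) \<longlonglongrightarrow> 0" by (rule tendsto_norm_zero_cancel)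
    then show ?case by (rule LIMSEQ_offset)
  qed
qed

section \<open>The characteristic function of the corner\<close>

lemma cos_quadratic: "\<bar>cos x - (1 - x\<^sup>2 / 2)\<bar> \<le> x ^ 4 / 24" for x :: real
proof -
  obtain t where "cos x = (\<Sum>m<4. cos_coeff m * x ^ m) + (cos (t + 1 / 2 * real 4 * pi) / fact 4) * x ^ 4"
    using Maclaurin_cos_expansion[of x 4] by blast
  moreover have "(\<Sum>m<4. cos_coeff m * x ^ m) = 1 - x\<^sup>2 / 2"
    by (simp add: eval_nat_numeral cos_coeff_Suc sin_coeff_Suc)
  ultimately have "cos x - (1 - x\<^sup>2 / 2) = cos (t + 1 / 2 * real 4 * pi) * (x ^ 4 / 24)"
    by (simp add: fact_numeral)
  then have "\<bar>cos x - (1 - x\<^sup>2 / 2)\<bar> = \<bar>cos (t + 1 / 2 * real 4 * pi)\<bar> * \<bar>x ^ 4 / 24\<bar>" by (simp only: abs_mult)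
  also have "\<bar>x ^ 4 / 24\<bar> = x ^ 4 / 24" by simp
  also have "\<bar>cos (t + 1 / 2 * real 4 * pi)\<bar> * (x ^ 4 / 24) \<le> 1 * (x ^ 4 / 24)" by (intro mult_right_mono) auto
  finally show ?thesis by simp
qed

lemma exp_linear: "0 \<le> y \<Longrightarrow> \<bar>exp (- y) - (1 - y)\<bar> \<le> y\<^sup>2" for y :: real
proof -
  assume y: "0 \<le> y"
  have "exp (- y) * (1 + y) \<le> exp (- y) * exp y" using exp_ge_add_one_self[of y] by (intro mult_left_mono) auto
  also have "\<dots> = 1" by (simp add: exp_minus)
  also have "\<dots> \<le> (1 - y + y\<^sup>2) * (1 + y)" using y by (simp add: algebra_simps power2_eq_square)
  finally have "exp (- y) \<le> 1 - y + y\<^sup>2" using y by (simp add: mult_le_cancel_right)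
  moreover have "1 - y \<le> exp (- y)" using exp_ge_add_one_self[of "- y"] by simp
  ultimately show ?thesis by simp
qed

lemma exp_neg_lipschitz: "0 \<le> a \<Longrightarrow> 0 \<le> b \<Longrightarrow> \<bar>exp (- a) - exp (- b)\<bar> \<le> \<bar>a - b\<bar>" for a b :: real
proof -
  have *: "exp (- a) - exp (- b) \<le> b - a" "0 \<le> exp (- a) - exp (- b)" if "0 \<le> a" "a \<le> b" for a b :: real
  proof -
    have "exp (- a) - exp (- b) = exp (- a) * (1 - exp (- (b - a)))" by (simp add: algebra_simps exp_add[symmetric])
    also have "\<dots> \<le> 1 * (b - a)"
    proof (rule mult_mono)
      show "1 - exp (- (b - a)) \<le> b - a" using exp_ge_add_one_self[of "- (b - a)"] by linarith
    qed (use that in auto)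
    finally show "exp (- a) - exp (- b) \<le> b - a" by simp
    show "0 \<le> exp (- a) - exp (- b)" using that by simp
  qed
  assume "0 \<le> a" "0 \<le> b"
  then show ?thesis using *[of a b] *[of b a] by (cases "a \<le> b") (auto simp: abs_if)
qed

text \<open>The characteristic function of a uniformly distributed fourth root of unity \<open>e\<close>, that is, the
  expectation of \<open>exp (\<i> Re (e d))\<close>.\<close>

definition quarter_char :: "complex \<Rightarrow> real" where
  "quarter_char d = (cos (Re d) + cos (Im d)) / 2"

lemma quarter_char_sum:
  "(\<Sum>e\<in>{1, \<i>, - 1, - \<i>}. cis (Re (e * d))) = 4 * complex_of_real (quarter_char d)"
proof -
  have d: "\<i> \<noteq> 1" "- 1 \<noteq> (1 :: complex)" "- \<i> \<noteq> 1" "\<i> \<noteq> - 1" "\<i> \<noteq> - \<i>" "- 1 \<noteq> - \<i>"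
    by (auto simp: complex_eq_iff)
  have "(\<Sum>e\<in>{1, \<i>, - 1, - \<i>}. cis (Re (e * d))) = cis (Re d) + cis (- Im d) + cis (- Re d) + cis (Im d)"
    using d by simp
  then show ?thesis by (simp add: quarter_char_def complex_eq_iff)
qed

lemma card_quarter: "card {1, \<i>, - 1, - \<i> :: complex} = 4"
  by (simp add: complex_eq_iff)

lemma abs_quarter_char: "\<bar>quarter_char d\<bar> \<le> 1"
proof -
  have "\<bar>cos (Re d) + cos (Im d)\<bar> \<le> \<bar>cos (Re d)\<bar> + \<bar>cos (Im d)\<bar>" by (rule abs_triangle_ineq)
  also have "\<dots> \<le> 2" using abs_cos_le_one[of "Re d"] abs_cos_le_one[of "Im d"] by linarith
  finally show ?thesis by (simp add: quarter_char_def)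
qed

lemma quarter_char_gauss: "\<bar>quarter_char d - exp (- ((cmod d)\<^sup>2 / 4))\<bar> \<le> cmod d ^ 4"
proof -
  let ?a = "Re d" and ?b = "Im d" and ?y = "(cmod d)\<^sup>2 / 4"
  have y: "(cmod d)\<^sup>2 = ?a\<^sup>2 + ?b\<^sup>2" by (rule cmod_power2)
  have d4: "cmod d ^ 4 = (?a\<^sup>2 + ?b\<^sup>2)\<^sup>2" unfolding y[symmetric] by (simp add: power_mult[symmetric])
  have "\<bar>quarter_char d - (1 - ?y)\<bar> \<le> (?a ^ 4 + ?b ^ 4) / 48"
  proof -
    have "quarter_char d - (1 - ?y) = ((cos ?a - (1 - ?a\<^sup>2 / 2)) + (cos ?b - (1 - ?b\<^sup>2 / 2))) / 2"
      unfolding quarter_char_def y by (simp add: field_simps)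
    moreover have "\<bar>(u + v) / 2\<bar> \<le> (\<bar>u\<bar> + \<bar>v\<bar>) / 2" for u v :: real
      using abs_triangle_ineq[of u v] by simp
    ultimately have "\<bar>quarter_char d - (1 - ?y)\<bar> \<le> (\<bar>cos ?a - (1 - ?a\<^sup>2 / 2)\<bar> + \<bar>cos ?b - (1 - ?b\<^sup>2 / 2)\<bar>) / 2"
      by presburger
    then show ?thesis using cos_quadratic[of ?a] cos_quadratic[of ?b] by argo
  qed
  moreover have "\<bar>exp (- ?y) - (1 - ?y)\<bar> \<le> cmod d ^ 4 / 16"
    using exp_linear[of ?y] by (simp add: power_divide power_mult[symmetric])
  moreover have "?a ^ 4 + ?b ^ 4 \<le> cmod d ^ 4" unfolding d4
    using mult_nonneg_nonneg[OF zero_le_power2[of ?a] zero_le_power2[of ?b]]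
    by (simp add: power2_eq_square power4_eq_xxxx algebra_simps)
  moreover have "0 \<le> cmod d ^ 4" by simp
  ultimately show ?thesis by argo
qed

lemma sum_power4_le:
  fixes u :: "nat \<Rightarrow> real"
  assumes "\<And>j. j < s \<Longrightarrow> 0 \<le> u j"
  shows "(\<Sum>j<s. u j) ^ 4 \<le> real s ^ 4 * (\<Sum>j<s. u j ^ 4)"
proof -
  let ?S = "\<Sum>j<s. u j ^ 4"
  have S: "0 \<le> ?S" by (intro sum_nonneg) auto
  have "u j \<le> root 4 ?S" if "j < s" for j
  proof -
    have "u j = root 4 (u j ^ 4)" using assms that by (simp add: real_root_power_cancel)
    also have "\<dots> \<le> root 4 ?S" using that by (intro real_root_le_mono member_le_sum) auto
    finally show ?thesis .
  qed
  then have "(\<Sum>j<s. u j) \<le> real s * root 4 ?S" using sum_mono[of "{..<s}" u "\<lambda>_. root 4 ?S"] by simp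
  then have "(\<Sum>j<s. u j) ^ 4 \<le> (real s * root 4 ?S) ^ 4" using assms by (intro power_mono sum_nonneg) auto
  then show ?thesis using S by (simp add: power_mult_distrib)
qed

definition root_unity :: "nat \<Rightarrow> nat \<Rightarrow> complex" where
  "root_unity n i = exp (2 * complex_of_real pi * \<i> * complex_of_nat i / complex_of_nat n)"

lemma norm_root_unity: "cmod (root_unity n i) = 1"
  by (simp add: root_unity_def)

lemma root_unity_sum:
  assumes "i < n" "i' < n"
  shows "(\<Sum>k<n. (root_unity n i * cnj (root_unity n i')) ^ k) = (if i = i' then of_nat n else 0)"
proof (cases "i = i'")
  case True
  have "root_unity n i * cnj (root_unity n i) = 1"
    using complex_norm_square[of "root_unity n i"] by (simp add: norm_root_unity)
  then show ?thesis using True by simp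
next
  case False
  let ?z = "root_unity n i * cnj (root_unity n i')"
  have n: "n \<noteq> 0" using assms by auto
  have r1: "root_unity n i' * cnj (root_unity n i') = 1"
    using complex_norm_square[of "root_unity n i'"] by (simp add: norm_root_unity)
  have "?z \<noteq> 1"
  proof
    assume "?z = 1"
    then have "root_unity n i * cnj (root_unity n i') * root_unity n i' = root_unity n i'" by simp
    then have "root_unity n i = root_unity n i'" using r1 by (simp add: mult.assoc mult.commute[of "cnj _"])
    then have "i mod n = i' mod n" unfolding root_unity_def using complex_root_unity_eq[of n i i'] n by simp
    then show False using False assms by simp
  qed
  moreover have "?z ^ n = 1"
    using complex_root_unity[OF n] by (simp add: power_mult_distrib root_unity_def flip: complex_cnj_power)
  ultimately show ?thesis using False by (simp add: geometric_sum)
qed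

definition fourier_phase :: "nat \<Rightarrow> (nat \<Rightarrow> complex) \<Rightarrow> complex mat" where
  "fourier_phase n e = Matrix.mat n n (\<lambda>(i, k). root_unity n i ^ k / complex_of_real (sqrt n) * e k)"

lemma fourier_phase_unitary:
  assumes "\<And>k. k < n \<Longrightarrow> cmod (e k) = 1"
  shows "fourier_phase n e \<in> unitary_group n"
proof (rule unitary_groupI)
  let ?W = "fourier_phase n e"
  show W: "?W \<in> carrier_mat n n" by (simp add: fourier_phase_def)
  show "?W * mat_adjoint ?W = 1\<^sub>m n"
  proof (rule eq_matI)
    fix i j assume "i < dim_row (1\<^sub>m n :: complex mat)" "j < dim_col (1\<^sub>m n :: complex mat)"
    then have ij: "i < n" "j < n" by auto
    have "(?W * mat_adjoint ?W) $$ (i, j) = (\<Sum>k<n. ?W $$ (i, k) * cnj (?W $$ (j, k)))"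
      using ij by (subst mat_mult_entry[OF W mat_adjoint_carrier[OF W]]) (auto simp: mat_adjoint_entry[OF W])
    also have "\<dots> = (\<Sum>k<n. (root_unity n i * cnj (root_unity n j)) ^ k / of_nat n)"
    proof (rule sum.cong)
      fix k assume k: "k \<in> {..<n}"
      have "e k * cnj (e k) = 1" using complex_norm_square[of "e k"] assms k by simp
      moreover have "complex_of_real (sqrt n) * complex_of_real (sqrt n) = of_nat n"
        by (simp flip: of_real_mult)
      ultimately show "?W $$ (i, k) * cnj (?W $$ (j, k)) = (root_unity n i * cnj (root_unity n j)) ^ k / of_nat n"
        using ij k by (simp add: fourier_phase_def power_mult_distrib mult_ac)
    qed simp
    also have "\<dots> = 1\<^sub>m n $$ (i, j)"
      using ij by (simp add: sum_divide_distrib[symmetric] root_unity_sum)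
    finally show "(?W * mat_adjoint ?W) $$ (i, j) = 1\<^sub>m n $$ (i, j)" .
  qed (use W mat_adjoint_carrier[OF W] in auto)
qed

context haar_matrix
begin

context
  fixes r s :: nat and t :: "nat \<times> nat \<Rightarrow> complex"
  assumes rs: "r \<le> N" "s \<le> N"
begin

abbreviation idx :: "(nat \<times> nat) set" where "idx \<equiv> {..<r} \<times> {..<s}"

lemma idx_less: "p \<in> idx \<Longrightarrow> fst p < N \<and> snd p < N \<and> snd p < s"
  using rs by auto

text \<open>The argument of the characteristic function at \<open>t\<close> of the rescaled corner \<open>\<surd>N A\<close> is the real part of
  this number.\<close>

definition functional :: "complex mat \<Rightarrow> complex" where
  "functional A = (\<Sum>p\<in>idx. t p * (complex_of_real (sqrt N) * A $$ p))"

text \<open>The coefficient of the random phase of row \<open>k\<close> after multiplication by \<open>fourier_phase\<close>; the factor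
  \<open>\<surd>N\<close> cancels against the normalization of the Fourier matrix.\<close>

definition row_coeff :: "nat \<Rightarrow> complex mat \<Rightarrow> complex" where
  "row_coeff k A = (\<Sum>p\<in>idx. t p * (root_unity N (fst p) ^ k * A $$ (k, snd p)))"

definition total :: real where "total = (\<Sum>p\<in>idx. cmod (t p))"

lemma functional_measurable: "functional \<in> borel_measurable (unitary_borel N)"
  unfolding functional_def[abs_def]
proof (intro borel_measurable_sum borel_measurable_times borel_measurable_const)
  fix p assume "p \<in> idx"
  then show "(\<lambda>A. A $$ p) \<in> borel_measurable (unitary_borel N)"
    using idx_less[of p] measurable_unitary_entry[of "fst p" N "snd p"] by simp
qed

lemma row_coeff_measurable: "k < N \<Longrightarrow> row_coeff k \<in> borel_measurable (unitary_borel N)"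
  unfolding row_coeff_def[abs_def] using idx_less
  by (intro borel_measurable_sum borel_measurable_times borel_measurable_const measurable_unitary_entry) auto

lemma functional_fourier:
  assumes "A \<in> carrier_mat N N"
  shows "functional (fourier_phase N e * A) = (\<Sum>k<N. e k * row_coeff k A)"
proof -
  have W: "fourier_phase N e \<in> carrier_mat N N" by (simp add: fourier_phase_def)
  have sN: "complex_of_real (sqrt N) \<noteq> 0" using N by simp
  have "complex_of_real (sqrt N) * (fourier_phase N e * A) $$ p = (\<Sum>k<N. e k * (root_unity N (fst p) ^ k * A $$ (k, snd p)))"
    if "p \<in> idx" for p
  proof -
    have "(fourier_phase N e * A) $$ (fst p, snd p) = (\<Sum>k<N. fourier_phase N e $$ (fst p, k) * A $$ (k, snd p))"
      using idx_less[OF that] by (subst mat_mult_entry[OF W assms]) auto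
    also have "\<dots> = (\<Sum>k<N. (root_unity N (fst p) ^ k / complex_of_real (sqrt N) * e k) * A $$ (k, snd p))"
      using idx_less[OF that] by (intro sum.cong) (auto simp: fourier_phase_def)
    finally show ?thesis using sN by (simp add: sum_distrib_left mult_ac)
  qed
  then have "functional (fourier_phase N e * A) = (\<Sum>p\<in>idx. t p * (\<Sum>k<N. e k * (root_unity N (fst p) ^ k * A $$ (k, snd p))))"
    unfolding functional_def by (intro sum.cong refl) auto
  also have "\<dots> = (\<Sum>p\<in>idx. \<Sum>k<N. e k * (t p * (root_unity N (fst p) ^ k * A $$ (k, snd p))))"
    by (simp add: sum_distrib_left mult_ac)
  also have "\<dots> = (\<Sum>k<N. \<Sum>p\<in>idx. e k * (t p * (root_unity N (fst p) ^ k * A $$ (k, snd p))))"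
    by (rule sum.swap)
  finally show ?thesis by (simp add: row_coeff_def sum_distrib_left)
qed

text \<open>By left invariance the characteristic function does not change when it is averaged over all \<open>4\<^sup>N\<close>
  choices of the phases, and the average factorizes over the rows.\<close>

lemma char_as_product:
  "(\<integral>\<omega>. cis (Re (functional (U \<omega>))) \<partial>M) = complex_of_real (expectation (\<lambda>\<omega>. \<Prod>k<N. quarter_char (row_coeff k (U \<omega>))))"
proof -
  let ?E = "PiE {..<N} (\<lambda>_. {1, \<i>, - 1, - \<i> :: complex})"
  let ?f = "\<lambda>A. cis (Re (functional A))"
  have cism: "(\<lambda>x. cis (g x)) \<in> borel_measurable Q" if "g \<in> borel_measurable Q" for g and Q :: "'q measure"
    using that by (rule measurable_compose) (intro borel_measurable_continuous_onI continuous_intros)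
  have fm: "?f \<in> borel_measurable (unitary_borel N)"
    by (rule cism) (rule measurable_compose[OF functional_measurable], simp)
  have e: "(\<integral>\<omega>. ?f (U \<omega>) \<partial>M) = (\<integral>\<omega>. ?f (fourier_phase N e * U \<omega>) \<partial>M)" "integrable M (\<lambda>\<omega>. ?f (fourier_phase N e * U \<omega>))" if "e \<in> ?E" for e
  proof -
    have "cmod (e k) = 1" if "k < N" for k
    proof -
      have "e k \<in> {1, \<i>, - 1, - \<i>}" using \<open>e \<in> ?E\<close> that by (auto simp: PiE_iff)
      then show ?thesis by auto
    qed
    then have V: "fourier_phase N e \<in> unitary_group N" by (rule fourier_phase_unitary)
    show "(\<integral>\<omega>. ?f (U \<omega>) \<partial>M) = (\<integral>\<omega>. ?f (fourier_phase N e * U \<omega>) \<partial>M)"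
      using left_invariant[OF fm V] by simp
    show "integrable M (\<lambda>\<omega>. ?f (fourier_phase N e * U \<omega>))"
      by (rule integrable_U[OF measurable_compose[OF measurable_unitary_mult[OF V] fm], of 1]) simp
  qed
  have cE: "card ?E = 4 ^ N" by (simp add: card_PiE card_quarter del: card.insert card_insert_disjoint)
  have "4 ^ N * (\<integral>\<omega>. ?f (U \<omega>) \<partial>M) = (\<Sum>e\<in>?E. \<integral>\<omega>. ?f (fourier_phase N e * U \<omega>) \<partial>M)"
  proof -
    have "(\<Sum>e\<in>?E. \<integral>\<omega>. ?f (fourier_phase N e * U \<omega>) \<partial>M) = (\<Sum>e\<in>?E. \<integral>\<omega>. ?f (U \<omega>) \<partial>M)"
      by (intro sum.cong refl e(1)[symmetric])
    then show ?thesis by (simp only: sum_constant cE) simp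
  qed
  also have "\<dots> = (\<integral>\<omega>. (\<Sum>e\<in>?E. ?f (fourier_phase N e * U \<omega>)) \<partial>M)"
    using e(2) by (intro Bochner_Integration.integral_sum[symmetric])
  also have "\<dots> = (\<integral>\<omega>. 4 ^ N * complex_of_real (\<Prod>k<N. quarter_char (row_coeff k (U \<omega>))) \<partial>M)"
  proof (rule Bochner_Integration.integral_cong)
    fix \<omega> assume w: "\<omega> \<in> space M"
    have "(\<Sum>e\<in>?E. ?f (fourier_phase N e * U \<omega>)) = (\<Sum>e\<in>?E. \<Prod>k<N. cis (Re (e k * row_coeff k (U \<omega>))))"
      using functional_fourier[OF unitary_groupD(1)[OF U_unitary[OF w]]] by (simp add: cis_conv_exp exp_sum sum_distrib_left)
    also have "\<dots> = (\<Prod>k<N. \<Sum>e\<in>{1, \<i>, - 1, - \<i>}. cis (Re (e * row_coeff k (U \<omega>))))"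
      by (rule prod_sum_PiE[symmetric]) auto
    also have "\<dots> = 4 ^ N * complex_of_real (\<Prod>k<N. quarter_char (row_coeff k (U \<omega>)))"
      by (simp only: quarter_char_sum prod.distrib) simp
    finally show "(\<Sum>e\<in>?E. ?f (fourier_phase N e * U \<omega>)) = 4 ^ N * complex_of_real (\<Prod>k<N. quarter_char (row_coeff k (U \<omega>)))" .
  qed simp
  also have "\<dots> = 4 ^ N * complex_of_real (expectation (\<lambda>\<omega>. \<Prod>k<N. quarter_char (row_coeff k (U \<omega>))))"
    by (simp only: integral_mult_right_zero integral_complex_of_real)
  finally show ?thesis by simp
qed

lemma total_nonneg: "0 \<le> total"
  by (auto simp: total_def intro!: sum_nonneg)

lemma row_coeff_le: "cmod (row_coeff k A) \<le> total * (\<Sum>j<s. cmod (A $$ (k, j)))"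
proof -
  have "cmod (row_coeff k A) \<le> (\<Sum>p\<in>idx. cmod (t p * (root_unity N (fst p) ^ k * A $$ (k, snd p))))"
    unfolding row_coeff_def by (rule norm_sum)
  also have "\<dots> \<le> (\<Sum>p\<in>idx. cmod (t p) * (\<Sum>j<s. cmod (A $$ (k, j))))"
  proof (rule sum_mono)
    fix p assume p: "p \<in> idx"
    have "cmod (A $$ (k, snd p)) \<le> (\<Sum>j<s. cmod (A $$ (k, j)))"
      using idx_less[OF p] by (intro member_le_sum[of "snd p" "{..<s}" "\<lambda>j. cmod (A $$ (k, j))"]) auto
    then show "cmod (t p * (root_unity N (fst p) ^ k * A $$ (k, snd p))) \<le> cmod (t p) * (\<Sum>j<s. cmod (A $$ (k, j)))"
      by (simp add: norm_mult norm_power norm_root_unity mult_left_mono)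
  qed
  finally show ?thesis by (simp add: total_def sum_distrib_right)
qed

lemma row_coeff_fourth: "cmod (row_coeff k A) ^ 4 \<le> total ^ 4 * real s ^ 4 * (\<Sum>j<s. cmod (A $$ (k, j)) ^ 4)"
proof -
  have "cmod (row_coeff k A) ^ 4 \<le> (total * (\<Sum>j<s. cmod (A $$ (k, j)))) ^ 4"
    by (intro power_mono row_coeff_le) auto
  also have "\<dots> = total ^ 4 * (\<Sum>j<s. cmod (A $$ (k, j))) ^ 4" by (rule power_mult_distrib)
  also have "\<dots> \<le> total ^ 4 * (real s ^ 4 * (\<Sum>j<s. cmod (A $$ (k, j)) ^ 4))"
    using total_nonneg by (intro mult_left_mono sum_power4_le) auto
  finally show ?thesis by (simp add: mult.assoc)
qed

definition sq_total :: real where "sq_total = (\<Sum>p\<in>idx. (cmod (t p))\<^sup>2)"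

text \<open>The Fourier weighted inner product of two columns. It is an ordinary inner product of columns if
  both indices have the same first component, and a sum with weights of total \<open>0\<close> otherwise.\<close>

definition cross :: "nat \<times> nat \<Rightarrow> nat \<times> nat \<Rightarrow> complex mat \<Rightarrow> complex" where
  "cross p q A = (\<Sum>k<N. (root_unity N (fst p) * cnj (root_unity N (fst q))) ^ k * (A $$ (k, snd p) * cnj (A $$ (k, snd q))))"

lemma cross_measurable: "p \<in> idx \<Longrightarrow> q \<in> idx \<Longrightarrow> cross p q \<in> borel_measurable (unitary_borel N)"
  unfolding cross_def[abs_def] using idx_less[of p] idx_less[of q]
  by (intro borel_measurable_sum borel_measurable_times borel_measurable_const borel_measurable_cnj measurable_unitary_entry) auto

lemma cross_le:
  assumes A: "A \<in> unitary_group N" and pq: "p \<in> idx" "q \<in> idx"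
  shows "cmod (cross p q A) \<le> real N"
proof -
  have "cmod (cross p q A) \<le> (\<Sum>k<N. cmod ((root_unity N (fst p) * cnj (root_unity N (fst q))) ^ k * (A $$ (k, snd p) * cnj (A $$ (k, snd q)))))"
    unfolding cross_def by (rule norm_sum)
  also have "\<dots> \<le> (\<Sum>k<N. 1)"
    using A idx_less[OF pq(1)] idx_less[OF pq(2)]
    by (intro sum_mono) (auto simp: norm_mult norm_power norm_root_unity intro!: mult_le_one unitary_entry_le_1)
  finally show ?thesis by simp
qed

lemma cross_cmod_measurable:
  "p \<in> idx \<Longrightarrow> q \<in> idx \<Longrightarrow> (\<lambda>A. cmod (cross p q A)) \<in> borel_measurable (unitary_borel N)"
  by (rule measurable_compose[OF cross_measurable borel_measurable_norm])

lemma cross_integrable: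
  "p \<in> idx \<Longrightarrow> q \<in> idx \<Longrightarrow> integrable M (\<lambda>\<omega>. cmod (cross p q (U \<omega>)))"
  using cross_le by (intro integrable_U[where f = "\<lambda>A. cmod (cross p q A)" and B = "real N"] cross_cmod_measurable) auto

lemma cross_expectation:
  assumes pq: "p \<in> idx" "q \<in> idx" "fst p \<noteq> fst q"
  shows "expectation (\<lambda>\<omega>. cmod (cross p q (U \<omega>))) \<le> 2 / sqrt N"
proof -
  have sN: "sqrt N > 0" using N by simp
  note i1 = cross_integrable[OF pq(1,2)]
  have i2: "integrable M (\<lambda>\<omega>. (cmod (cross p q (U \<omega>)))\<^sup>2)"
    using cross_le[OF _ pq(1,2)]
    by (intro integrable_U[where f = "\<lambda>A. (cmod (cross p q A))\<^sup>2" and B = "(real N)\<^sup>2"] borel_measurable_power cross_cmod_measurable pq)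
      (auto intro!: power_mono)
  have e2: "expectation (\<lambda>\<omega>. (cmod (cross p q (U \<omega>)))\<^sup>2) \<le> 4 / real N"
    unfolding cross_def using pq idx_less[OF pq(1)] idx_less[OF pq(2)] root_unity_sum[of "fst p" N "fst q"]
    by (intro weighted_column_product) (auto simp: norm_power norm_mult norm_root_unity)
  have "expectation (\<lambda>\<omega>. cmod (cross p q (U \<omega>))) \<le>
      expectation (\<lambda>\<omega>. (cmod (cross p q (U \<omega>)))\<^sup>2 * (sqrt N / 4) + 1 / sqrt N)"
  proof (rule integral_mono)
    fix \<omega>
    let ?x = "cmod (cross p q (U \<omega>))"
    \<comment> \<open>An elementary replacement for the Cauchy-Schwarz inequality, applied with \<open>y = \<surd>N\<close> because the second moment is at most \<open>4 / N\<close>.\<close>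
    have "x * y \<le> x\<^sup>2 * y\<^sup>2 / 4 + 1" for x y :: real
    proof -
      have "0 \<le> (x * (y / 2) - 1)\<^sup>2" by simp
      then show ?thesis by (simp add: power2_eq_square algebra_simps)
    qed
    then have "?x * sqrt N \<le> ?x\<^sup>2 * (sqrt N)\<^sup>2 / 4 + 1" .
    also have "\<dots> = (?x\<^sup>2 * (sqrt N / 4) + 1 / sqrt N) * sqrt N"
      using sN by (simp add: distrib_right power2_eq_square)
    finally show "?x \<le> ?x\<^sup>2 * (sqrt N / 4) + 1 / sqrt N" using sN by (simp only: mult_le_cancel_right_pos)
  qed (use i1 i2 in auto)
  also have "\<dots> = expectation (\<lambda>\<omega>. (cmod (cross p q (U \<omega>)))\<^sup>2) * (sqrt N / 4) + 1 / sqrt N"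
    using i2 prob_space by simp
  also have "\<dots> \<le> 4 / real N * (sqrt N / 4) + 1 / sqrt N"
    using sN e2 by (intro add_right_mono mult_right_mono) auto
  also have "4 / real N * (sqrt N / 4) = sqrt N / (sqrt N * sqrt N)" by simp
  also have "\<dots> = 1 / sqrt N" using sN by (simp del: real_sqrt_mult_self)
  finally show ?thesis by simp
qed

lemma sum_row_coeff_squares:
  "complex_of_real (\<Sum>k<N. (cmod (row_coeff k A))\<^sup>2) = (\<Sum>p\<in>idx. \<Sum>q\<in>idx. t p * cnj (t q) * cross p q A)"
proof -
  define a where "a k p = t p * (root_unity N (fst p) ^ k * A $$ (k, snd p))" for k p
  have "complex_of_real (\<Sum>k<N. (cmod (row_coeff k A))\<^sup>2) = (\<Sum>k<N. row_coeff k A * cnj (row_coeff k A))"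
    by (simp only: of_real_sum complex_norm_square)
  also have "\<dots> = (\<Sum>k<N. \<Sum>p\<in>idx. \<Sum>q\<in>idx. a k p * cnj (a k q))"
    unfolding row_coeff_def a_def[symmetric] by (simp only: cnj_sum sum_product)
  also have "\<dots> = (\<Sum>p\<in>idx. \<Sum>k<N. \<Sum>q\<in>idx. a k p * cnj (a k q))" by (rule sum.swap)
  also have "\<dots> = (\<Sum>p\<in>idx. \<Sum>q\<in>idx. \<Sum>k<N. a k p * cnj (a k q))" by (intro sum.cong refl sum.swap)
  also have "\<dots> = (\<Sum>p\<in>idx. \<Sum>q\<in>idx. t p * cnj (t q) * cross p q A)"
    by (simp add: a_def cross_def sum_distrib_left power_mult_distrib mult_ac)
  finally show ?thesis .
qed

text \<open>Expanding the squares, the terms with equal row index of the corner are exact by orthonormality of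
  the columns, and the others are small on average.\<close>

lemma row_coeff_squares_deviation:
  assumes A: "A \<in> unitary_group N"
  shows "\<bar>(\<Sum>k<N. (cmod (row_coeff k A))\<^sup>2) - sq_total\<bar> \<le>
    (\<Sum>p\<in>idx. \<Sum>q\<in>idx. cmod (t p) * cmod (t q) * (if fst p = fst q then 0 else cmod (cross p q A)))"
proof -
  have diag: "cross p q A = (if p = q then 1 else 0)" if "p \<in> idx" "q \<in> idx" "fst p = fst q" for p q
  proof -
    have "root_unity N (fst p) * cnj (root_unity N (fst p)) = 1"
      using complex_norm_square[of "root_unity N (fst p)"] by (simp add: norm_root_unity)
    then have "cross p q A = (if snd q = snd p then 1 else 0)"
      using unitary_col_orthonormal[OF A, of "snd q" "snd p"] idx_less[OF that(1)] idx_less[OF that(2)] that(3)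
      by (simp add: cross_def mult.commute)
    then show ?thesis using that(3) by (auto simp: prod_eq_iff)
  qed
  have "complex_of_real sq_total = (\<Sum>p\<in>idx. t p * cnj (t p))"
    unfolding sq_total_def by (simp only: of_real_sum complex_norm_square)
  also have "\<dots> = (\<Sum>p\<in>idx. \<Sum>q\<in>idx. if q = p then t p * cnj (t p) else 0)"
    by (intro sum.cong refl) (simp add: sum.delta)
  finally have "complex_of_real ((\<Sum>k<N. (cmod (row_coeff k A))\<^sup>2) - sq_total) =
    (\<Sum>p\<in>idx. \<Sum>q\<in>idx. t p * cnj (t q) * cross p q A - (if q = p then t p * cnj (t p) else 0))"
    unfolding of_real_diff sum_row_coeff_squares by (simp only: sum_subtractf)
  also have "\<dots> = (\<Sum>p\<in>idx. \<Sum>q\<in>idx. t p * cnj (t q) * (if fst p = fst q then 0 else cross p q A))"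
  proof (intro sum.cong refl)
    fix p q assume pq: "p \<in> idx" "q \<in> idx"
    show "t p * cnj (t q) * cross p q A - (if q = p then t p * cnj (t p) else 0) =
        t p * cnj (t q) * (if fst p = fst q then 0 else cross p q A)"
      using diag[OF pq] by (cases "fst p = fst q") auto
  qed
  finally have e: "complex_of_real ((\<Sum>k<N. (cmod (row_coeff k A))\<^sup>2) - sq_total) =
      (\<Sum>p\<in>idx. \<Sum>q\<in>idx. t p * cnj (t q) * (if fst p = fst q then 0 else cross p q A))" .
  have "\<bar>(\<Sum>k<N. (cmod (row_coeff k A))\<^sup>2) - sq_total\<bar> =
      cmod (\<Sum>p\<in>idx. \<Sum>q\<in>idx. t p * cnj (t q) * (if fst p = fst q then 0 else cross p q A))"
    unfolding e[symmetric] norm_of_real ..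
  also have "\<dots> \<le> (\<Sum>p\<in>idx. \<Sum>q\<in>idx. cmod (t p * cnj (t q) * (if fst p = fst q then 0 else cross p q A)))"
    by (rule order.trans[OF norm_sum], rule sum_mono, rule norm_sum)
  also have "\<dots> = (\<Sum>p\<in>idx. \<Sum>q\<in>idx. cmod (t p) * cmod (t q) * (if fst p = fst q then 0 else cmod (cross p q A)))"
    by (intro sum.cong refl) (auto simp: norm_mult)
  finally show ?thesis .
qed

text \<open>Each factor of the product is replaced by \<open>exp (- \<bar>d\<bar>\<^sup>2 / 4)\<close>, with an error bounded by fourth
  moments of the entries. The sum of the exponents is then replaced by its typical value
  \<open>sq_total / 4\<close>.\<close>

lemma char_gauss_bound:
  "cmod ((\<integral>\<omega>. cis (Re (functional (U \<omega>))) \<partial>M) - complex_of_real (exp (- (sq_total / 4)))) \<le>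
    (2 * total ^ 4 * real s ^ 5 + total\<^sup>2) / sqrt N"
proof -
  let ?d = "\<lambda>k \<omega>. cmod (row_coeff k (U \<omega>))"
  let ?P = "\<lambda>\<omega>. \<Prod>k<N. quarter_char (row_coeff k (U \<omega>))"
  let ?S = "\<lambda>\<omega>. \<Sum>k<N. (?d k \<omega>)\<^sup>2"
  let ?D = "\<lambda>\<omega>. (\<Sum>p\<in>idx. \<Sum>q\<in>idx. cmod (t p) * cmod (t q) * (if fst p = fst q then 0 else cmod (cross p q (U \<omega>))))"
  let ?Q = "\<lambda>\<omega>. total ^ 4 * real s ^ 4 * (\<Sum>k<N. \<Sum>j<s. cmod (U \<omega> $$ (k, j)) ^ 4)"
  have sN: "sqrt N > 0" "1 \<le> sqrt N" using N by auto
  have pw: "\<bar>?P \<omega> - exp (- (sq_total / 4))\<bar> \<le> ?Q \<omega> + ?D \<omega> / 4" if w: "\<omega> \<in> space M" for \<omega>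
  proof -
    have "\<bar>?P \<omega> - (\<Prod>k<N. exp (- ((?d k \<omega>)\<^sup>2 / 4)))\<bar> \<le> (\<Sum>k<N. \<bar>quarter_char (row_coeff k (U \<omega>)) - exp (- ((?d k \<omega>)\<^sup>2 / 4))\<bar>)"
      using norm_prod_diff[of "{..<N}" "\<lambda>k. quarter_char (row_coeff k (U \<omega>))" "\<lambda>k. exp (- ((?d k \<omega>)\<^sup>2 / 4))"] abs_quarter_char
      by simp
    also have "\<dots> \<le> (\<Sum>k<N. total ^ 4 * real s ^ 4 * (\<Sum>j<s. cmod (U \<omega> $$ (k, j)) ^ 4))"
      by (intro sum_mono order.trans[OF quarter_char_gauss row_coeff_fourth])
    also have "\<dots> = ?Q \<omega>" by (simp add: sum_distrib_left)
    finally have 1: "\<bar>?P \<omega> - (\<Prod>k<N. exp (- ((?d k \<omega>)\<^sup>2 / 4)))\<bar> \<le> ?Q \<omega>" .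
    have "(\<Prod>k<N. exp (- ((?d k \<omega>)\<^sup>2 / 4))) = exp (- (?S \<omega> / 4))"
      by (simp add: exp_sum[symmetric] sum_negf sum_divide_distrib)
    moreover have "\<bar>exp (- (?S \<omega> / 4)) - exp (- (sq_total / 4))\<bar> \<le> \<bar>?S \<omega> / 4 - sq_total / 4\<bar>"
      by (rule exp_neg_lipschitz) (auto simp: sq_total_def intro!: sum_nonneg divide_nonneg_nonneg)
    moreover have "\<bar>?S \<omega> / 4 - sq_total / 4\<bar> \<le> ?D \<omega> / 4"
      using row_coeff_squares_deviation[OF U_unitary[OF w]] by (simp add: diff_divide_distrib[symmetric])
    ultimately show ?thesis using 1 by linarith
  qed
  have iP: "integrable M ?P"
  proof (rule integrable_U[of "\<lambda>A. \<Prod>k<N. quarter_char (row_coeff k A)" 1])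
    have "(\<lambda>A. quarter_char (row_coeff k A)) \<in> borel_measurable (unitary_borel N)" if "k < N" for k
      unfolding quarter_char_def by (rule measurable_compose[OF row_coeff_measurable[OF that]]) measurable
    then show "(\<lambda>A. \<Prod>k<N. quarter_char (row_coeff k A)) \<in> borel_measurable (unitary_borel N)"
      by (intro borel_measurable_prod) auto
    show "norm (\<Prod>k<N. quarter_char (row_coeff k A)) \<le> 1" for A
      using abs_quarter_char by (simp add: abs_prod prod_le_1)
  qed
  have iQ: "integrable M ?Q" using rs integrable_U_pow
    by (intro integrable_mult_right Bochner_Integration.integrable_sum) auto
  have iX: "integrable M (\<lambda>\<omega>. cmod (t p) * cmod (t q) * (if fst p = fst q then 0 else cmod (cross p q (U \<omega>))))"
    if "p \<in> idx" "q \<in> idx" for p q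
    using cross_integrable[OF that] by (cases "fst p = fst q") auto
  have iD: "integrable M ?D"
    using iX by (intro Bochner_Integration.integrable_sum) auto
  have EQ: "expectation ?Q \<le> 2 * total ^ 4 * real s ^ 5 / sqrt N"
  proof -
    have "expectation ?Q = total ^ 4 * real s ^ 4 * (\<Sum>k<N. \<Sum>j<s. expectation (\<lambda>\<omega>. cmod (U \<omega> $$ (k, j)) ^ 4))"
    proof -
      have "expectation ?Q = total ^ 4 * real s ^ 4 * expectation (\<lambda>\<omega>. \<Sum>k<N. \<Sum>j<s. cmod (U \<omega> $$ (k, j)) ^ 4)"
        by (rule integral_mult_right_zero)
      also have "expectation (\<lambda>\<omega>. \<Sum>k<N. \<Sum>j<s. cmod (U \<omega> $$ (k, j)) ^ 4) = (\<Sum>k<N. expectation (\<lambda>\<omega>. \<Sum>j<s. cmod (U \<omega> $$ (k, j)) ^ 4))"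
        using rs integrable_U_pow by (intro Bochner_Integration.integral_sum Bochner_Integration.integrable_sum) auto
      also have "\<dots> = (\<Sum>k<N. \<Sum>j<s. expectation (\<lambda>\<omega>. cmod (U \<omega> $$ (k, j)) ^ 4))"
        using rs integrable_U_pow by (intro sum.cong refl Bochner_Integration.integral_sum) auto
      finally show ?thesis .
    qed
    also have "(\<Sum>k<N. \<Sum>j<s. expectation (\<lambda>\<omega>. cmod (U \<omega> $$ (k, j)) ^ 4)) = (\<Sum>k<N. \<Sum>j<s. 2 / (real N * (real N + 1)))"
      using rs fourth_moment by (intro sum.cong refl) auto
    also have "\<dots> = real N * (real s * ((2 / (real N + 1)) / real N))"
      by (simp add: divide_divide_eq_left mult.commute)
    also have "\<dots> = real s * (2 / (real N + 1))" using N by simp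
    also have "2 / (real N + 1) \<le> 2 / sqrt N"
    proof -
      have "sqrt N \<le> sqrt N * sqrt N" using sN by (metis mult.right_neutral mult_le_cancel_left_pos)
      then show ?thesis using sN by (intro divide_left_mono) auto
    qed
    finally have "expectation ?Q \<le> total ^ 4 * real s ^ 4 * (real s * (2 / sqrt N))"
      by (simp add: mult_left_mono)
    then show ?thesis by (simp add: power_def[symmetric] eval_nat_numeral mult_ac)
  qed
  have ED: "expectation ?D \<le> total\<^sup>2 * (2 / sqrt N)"
  proof -
    have "expectation ?D = (\<Sum>p\<in>idx. expectation (\<lambda>\<omega>. \<Sum>q\<in>idx. cmod (t p) * cmod (t q) * (if fst p = fst q then 0 else cmod (cross p q (U \<omega>)))))"
      using iX by (intro Bochner_Integration.integral_sum Bochner_Integration.integrable_sum) auto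
    also have "\<dots> = (\<Sum>p\<in>idx. \<Sum>q\<in>idx. expectation (\<lambda>\<omega>. cmod (t p) * cmod (t q) * (if fst p = fst q then 0 else cmod (cross p q (U \<omega>)))))"
      using iX by (intro sum.cong refl Bochner_Integration.integral_sum) auto
    also have "\<dots> \<le> (\<Sum>p\<in>idx. \<Sum>q\<in>idx. cmod (t p) * cmod (t q) * (2 / sqrt N))"
    proof (intro sum_mono)
      fix p q assume pq: "p \<in> idx" "q \<in> idx"
      show "expectation (\<lambda>\<omega>. cmod (t p) * cmod (t q) * (if fst p = fst q then 0 else cmod (cross p q (U \<omega>)))) \<le> cmod (t p) * cmod (t q) * (2 / sqrt N)"
        using cross_expectation[OF pq] sN by (cases "fst p = fst q") (auto intro!: mult_left_mono simp del: times_divide_eq_right)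
    qed
    also have "\<dots> = (\<Sum>p\<in>idx. \<Sum>q\<in>idx. cmod (t p) * cmod (t q)) * (2 / sqrt N)"
      by (simp only: sum_distrib_right)
    also have "\<dots> = total\<^sup>2 * (2 / sqrt N)"
      by (simp only: total_def power2_eq_square sum_product)
    finally show ?thesis .
  qed
  have "cmod ((\<integral>\<omega>. cis (Re (functional (U \<omega>))) \<partial>M) - complex_of_real (exp (- (sq_total / 4)))) = \<bar>expectation ?P - exp (- (sq_total / 4))\<bar>"
    unfolding char_as_product of_real_diff[symmetric] norm_of_real ..
  also have "\<dots> = \<bar>expectation (\<lambda>\<omega>. ?P \<omega> - exp (- (sq_total / 4)))\<bar>" using iP prob_space by simp
  also have "\<dots> \<le> expectation (\<lambda>\<omega>. \<bar>?P \<omega> - exp (- (sq_total / 4))\<bar>)" by (rule integral_abs_bound)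
  also have "\<dots> \<le> expectation (\<lambda>\<omega>. ?Q \<omega> + ?D \<omega> / 4)" using iP iQ iD pw by (intro integral_mono) auto
  also have "\<dots> = expectation ?Q + expectation ?D / 4" using iQ iD by simp
  also have "\<dots> \<le> 2 * total ^ 4 * real s ^ 5 / sqrt N + total\<^sup>2 * (2 / sqrt N) / 4"
    by (intro add_mono divide_right_mono EQ ED) simp
  also have "\<dots> \<le> (2 * total ^ 4 * real s ^ 5 + total\<^sup>2) / sqrt N"
  proof -
    have "total\<^sup>2 * (2 / sqrt N) / 4 = (total\<^sup>2 / sqrt N) / 2" by simp
    moreover have "0 \<le> total\<^sup>2 / sqrt N" using sN by simp
    ultimately show ?thesis unfolding add_divide_distrib by argo
  qed
  finally show ?thesis .
qed

lemma char_bound: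
  "cmod ((\<integral>\<omega>. cis (Re (\<Sum>p\<in>idx. t p * (complex_of_real (sqrt N) * U \<omega> $$ p))) \<partial>M) -
     complex_of_real (exp (- ((\<Sum>p\<in>idx. (cmod (t p))\<^sup>2) / 4)))) \<le>
    (2 * (\<Sum>p\<in>idx. cmod (t p)) ^ 4 * real s ^ 5 + (\<Sum>p\<in>idx. cmod (t p))\<^sup>2) / sqrt N"
  using char_gauss_bound unfolding functional_def sq_total_def total_def .

end

end

section \<open>Convergence in law from Laplace transforms\<close>

lemma continuous_on_product_topology_extend:
  fixes f :: "('i \<Rightarrow> real) \<Rightarrow> real"
  assumes "continuous_map (product_topology (\<lambda>_. euclideanreal) I) euclideanreal f"
  shows "continuous_on UNIV (\<lambda>u. f (restrict u I))"
proof -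
  have "continuous_map euclidean (product_topology (\<lambda>_. euclideanreal) I) (\<lambda>u :: 'i \<Rightarrow> real. restrict u I)"
    unfolding continuous_map_componentwise by (auto simp: continuous_map_iff_continuous2 continuous_on_product_coordinates)
  from continuous_map_compose[OF this assms] show ?thesis
    by (simp add: o_def continuous_map_iff_continuous2)
qed

lemma measurable_product_topology:
  fixes f :: "('i::countable \<Rightarrow> real) \<Rightarrow> real"
  assumes "continuous_map (product_topology (\<lambda>_. euclideanreal) I) euclideanreal f"
  shows "f \<in> borel_measurable (Pi\<^sub>M I (\<lambda>_. borel))"
proof -
  have F: "(\<lambda>u. f (restrict u I)) \<in> borel_measurable borel"
    by (rule borel_measurable_continuous_onI[OF continuous_on_product_topology_extend[OF assms]])
  have "(\<lambda>x i. if i \<in> I then x i else 0) \<in> Pi\<^sub>M I (\<lambda>_. borel :: real measure) \<rightarrow>\<^sub>M Pi\<^sub>M UNIV (\<lambda>_. borel)"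
  proof (intro measurable_PiM_single')
    fix i :: 'i
    show "(\<lambda>x. if i \<in> I then x i else 0) \<in> borel_measurable (Pi\<^sub>M I (\<lambda>_. borel :: real measure))"
      by (cases "i \<in> I") auto
  qed auto
  then have "(\<lambda>x i. if i \<in> I then x i else 0) \<in> Pi\<^sub>M I (\<lambda>_. borel :: real measure) \<rightarrow>\<^sub>M (borel :: ('i \<Rightarrow> real) measure)"
    using sets_PiM_equal_borel measurable_cong_sets by blast
  from measurable_compose[OF this F]
  have "(\<lambda>x. f (\<lambda>i\<in>I. if i \<in> I then x i else 0)) \<in> borel_measurable (Pi\<^sub>M I (\<lambda>_. borel :: real measure))" .
  then show ?thesis
  proof (rule measurable_cong[THEN iffD1, rotated])
    fix x assume "x \<in> space (Pi\<^sub>M I (\<lambda>_. borel :: real measure))"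
    then have "(\<lambda>i\<in>I. if i \<in> I then x i else 0) = x"
      by (auto simp: space_PiM PiE_def extensional_def)
    then show "f (\<lambda>i\<in>I. if i \<in> I then x i else 0) = f x" by simp
  qed
qed

text \<open>Laplace transforms are only assumed to converge at integer points. Under \<open>x \<mapsto> exp (- x)\<close> they become
  moments of laws on a cube, and moments determine laws on a compact set.\<close>

locale laplace_convergence =
  fixes I :: "'i::countable set" and \<mu> :: "nat \<Rightarrow> ('i \<Rightarrow> real) measure" and \<nu> :: "('i \<Rightarrow> real) measure"
  assumes I: "finite I"
    and pm: "\<And>n. prob_space (\<mu> n)" and pn: "prob_space \<nu>"
    and sm: "\<And>n. sets (\<mu> n) = sets (Pi\<^sub>M I (\<lambda>_. borel))" and sn: "sets \<nu> = sets (Pi\<^sub>M I (\<lambda>_. borel))"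
    and nonneg_m: "\<And>n. AE x in \<mu> n. \<forall>i\<in>I. 0 \<le> x i" and nonneg_n: "AE x in \<nu>. \<forall>i\<in>I. 0 \<le> x i"
    and laplace: "\<And>k :: 'i \<Rightarrow> nat. (\<lambda>n. \<integral>x. exp (- (\<Sum>i\<in>I. real (k i) * x i)) \<partial>\<mu> n)
        \<longlonglongrightarrow> (\<integral>x. exp (- (\<Sum>i\<in>I. real (k i) * x i)) \<partial>\<nu>)"
begin

text \<open>The cube is a subset of the space of all functions, with value \<open>0\<close> outside \<open>I\<close>, because the
  compactness criterion for products and the Stone-Weierstrass theorem are then available in the
  type class topology.\<close>

definition cube :: "('i \<Rightarrow> real) set" where
  "cube = PiE UNIV (\<lambda>i. if i \<in> I then {0..1} else {0})"

definition to_cube :: "('i \<Rightarrow> real) \<Rightarrow> 'i \<Rightarrow> real" where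
  "to_cube x = (\<lambda>i. if i \<in> I then exp (- x i) else 0)"

lemma in_cube: "y \<in> cube \<longleftrightarrow> (\<forall>i. (i \<in> I \<longrightarrow> 0 \<le> y i \<and> y i \<le> 1) \<and> (i \<notin> I \<longrightarrow> y i = 0))"
  by (auto simp: cube_def PiE_iff split: if_splits)

lemma compact_cube: "compact cube"
proof -
  have "compactin (product_topology (\<lambda>_. euclideanreal) UNIV) cube"
    unfolding cube_def compactin_PiE by auto
  then show ?thesis by (simp add: euclidean_product_topology)
qed

lemma to_cube_in_cube: "\<forall>i\<in>I. 0 \<le> x i \<Longrightarrow> to_cube x \<in> cube"
  by (auto simp: in_cube to_cube_def)

lemma AE_cube: "AE x in \<mu> n. to_cube x \<in> cube" "AE x in \<nu>. to_cube x \<in> cube"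
  using nonneg_m[of n] nonneg_n by (auto elim!: eventually_mono intro: to_cube_in_cube)

lemma measurable_laplace_sets:
  "f \<in> borel_measurable (Pi\<^sub>M I (\<lambda>_. borel)) \<Longrightarrow> f \<in> borel_measurable (\<mu> n)"
  "f \<in> borel_measurable (Pi\<^sub>M I (\<lambda>_. borel)) \<Longrightarrow> f \<in> borel_measurable \<nu>"
  using measurable_cong_sets[OF sm refl] measurable_cong_sets[OF sn refl] by blast+

lemma to_cube_measurable: "to_cube \<in> Pi\<^sub>M I (\<lambda>_. borel) \<rightarrow>\<^sub>M borel"
proof -
  have "to_cube \<in> Pi\<^sub>M I (\<lambda>_. borel :: real measure) \<rightarrow>\<^sub>M Pi\<^sub>M UNIV (\<lambda>_. borel)"
    unfolding to_cube_def[abs_def]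
  proof (intro measurable_PiM_single')
    fix i :: 'i
    show "(\<lambda>x. if i \<in> I then exp (- x i) else 0) \<in> borel_measurable (Pi\<^sub>M I (\<lambda>_. borel :: real measure))"
      by (cases "i \<in> I") (auto intro!: borel_measurable_exp borel_measurable_uminus)
  qed auto
  then show ?thesis using sets_PiM_equal_borel measurable_cong_sets by blast
qed

text \<open>Convergence is required after multiplication by every monomial. This makes the property stable under
  multiplication by a coordinate function, which convergence of the expectations of \<open>h\<close> alone is
  not.\<close>

definition tame :: "(('i \<Rightarrow> real) \<Rightarrow> real) \<Rightarrow> bool" where
  "tame h \<longleftrightarrow> continuous_on UNIV h \<and>
    (\<forall>k :: 'i \<Rightarrow> nat. (\<lambda>n. \<integral>x. exp (- (\<Sum>i\<in>I. real (k i) * x i)) * h (to_cube x) \<partial>\<mu> n)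
        \<longlonglongrightarrow> (\<integral>x. exp (- (\<Sum>i\<in>I. real (k i) * x i)) * h (to_cube x) \<partial>\<nu>))"

text \<open>Unlike \<open>tame\<close>, this class is closed under products for trivial reasons, as the Stone-Weierstrass
  theorem requires.\<close>

definition multiplier :: "(('i \<Rightarrow> real) \<Rightarrow> real) \<Rightarrow> bool" where
  "multiplier g \<longleftrightarrow> continuous_on UNIV g \<and> (\<forall>h. tame h \<longrightarrow> tame (\<lambda>y. h y * g y))"

lemma measurable_monomial:
  "(\<lambda>x. exp (- (\<Sum>i\<in>I. real (k i) * x i))) \<in> borel_measurable (Pi\<^sub>M I (\<lambda>_. borel :: real measure))"
  by (intro measurable_compose[OF _ borel_measurable_exp] borel_measurable_uminus borel_measurable_sum borel_measurable_times
      borel_measurable_const measurable_component_singleton)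

lemma integrable_on_cube:
  assumes h: "continuous_on UNIV h"
  shows "integrable (\<mu> n) (\<lambda>x. exp (- (\<Sum>i\<in>I. real (k i) * x i)) * h (to_cube x))"
    and "integrable \<nu> (\<lambda>x. exp (- (\<Sum>i\<in>I. real (k i) * x i)) * h (to_cube x))"
proof -
  have "bounded (h ` cube)"
    using compact_continuous_image[OF continuous_on_subset[OF h] compact_cube] compact_imp_bounded by blast
  then obtain B where B: "\<And>y. y \<in> cube \<Longrightarrow> \<bar>h y\<bar> \<le> B" by (auto simp: bounded_iff)
  have m: "(\<lambda>x. exp (- (\<Sum>i\<in>I. real (k i) * x i)) * h (to_cube x)) \<in> borel_measurable (Pi\<^sub>M I (\<lambda>_. borel))"
    by (intro borel_measurable_times measurable_monomial measurable_compose[OF to_cube_measurable] borel_measurable_continuous_onI h)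
  have b: "norm (exp (- (\<Sum>i\<in>I. real (k i) * x i)) * h (to_cube x)) \<le> B" if "\<forall>i\<in>I. 0 \<le> x i" for x
  proof -
    have "exp (- (\<Sum>i\<in>I. real (k i) * x i)) \<le> 1" using that by (auto intro!: sum_nonneg)
    moreover have "0 \<le> B" using B[OF to_cube_in_cube[OF that]] by linarith
    ultimately have "exp (- (\<Sum>i\<in>I. real (k i) * x i)) * \<bar>h (to_cube x)\<bar> \<le> 1 * B"
      using B[OF to_cube_in_cube[OF that]] by (intro mult_mono) auto
    then show ?thesis by (simp add: abs_mult)
  qed
  interpret p: prob_space "\<mu> n" by (rule pm)
  interpret q: prob_space \<nu> by (rule pn)
  show "integrable (\<mu> n) (\<lambda>x. exp (- (\<Sum>i\<in>I. real (k i) * x i)) * h (to_cube x))"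
    using nonneg_m[of n] b by (intro p.integrable_const_bound[of _ B] measurable_laplace_sets m) (auto elim!: eventually_mono)
  show "integrable \<nu> (\<lambda>x. exp (- (\<Sum>i\<in>I. real (k i) * x i)) * h (to_cube x))"
    using nonneg_n b by (intro q.integrable_const_bound[of _ B] measurable_laplace_sets m) (auto elim!: eventually_mono)
qed

lemma tame_one: "tame (\<lambda>_. 1)"
  using laplace by (simp add: tame_def)

lemma tame_add: "tame f \<Longrightarrow> tame g \<Longrightarrow> tame (\<lambda>y. f y + g y)"
  using integrable_on_cube[of f] integrable_on_cube[of g]
  by (auto simp: tame_def distrib_left intro!: continuous_intros tendsto_add)

lemma tame_scale: "tame f \<Longrightarrow> tame (\<lambda>y. f y * c)"
  by (auto simp: tame_def mult.assoc[symmetric] intro!: continuous_intros tendsto_mult)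

lemma tame_coordinate:
  assumes h: "tame h" and i: "i \<in> I"
  shows "tame (\<lambda>y. h y * y i)"
  unfolding tame_def
proof (intro conjI allI)
  show "continuous_on UNIV (\<lambda>y. h y * y i)"
    using h by (auto simp: tame_def intro!: continuous_intros continuous_on_product_coordinates)
  fix k :: "'i \<Rightarrow> nat"
  have "exp (- (\<Sum>l\<in>I. real (k l) * x l)) * (h (to_cube x) * to_cube x i) =
      exp (- (\<Sum>l\<in>I. real ((k(i := Suc (k i))) l) * x l)) * h (to_cube x)" for x
  proof -
    have "(\<Sum>l\<in>I. real ((k(i := Suc (k i))) l) * x l) = (\<Sum>l\<in>I. real (k l) * x l + (if l = i then x i else 0))"
      by (intro sum.cong) (auto simp: algebra_simps)
    also have "\<dots> = (\<Sum>l\<in>I. real (k l) * x l) + x i" using i I by (simp add: sum.distrib sum.delta)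
    finally have "exp (- (\<Sum>l\<in>I. real ((k(i := Suc (k i))) l) * x l)) = exp (- (\<Sum>l\<in>I. real (k l) * x l)) * exp (- x i)"
      by (simp add: exp_add[symmetric])
    then show ?thesis using i by (simp add: to_cube_def)
  qed
  then show "(\<lambda>n. \<integral>x. exp (- (\<Sum>l\<in>I. real (k l) * x l)) * (h (to_cube x) * to_cube x i) \<partial>\<mu> n)
        \<longlonglongrightarrow> (\<integral>x. exp (- (\<Sum>l\<in>I. real (k l) * x l)) * (h (to_cube x) * to_cube x i) \<partial>\<nu>)"
    using h by (simp only: tame_def)
qed

lemma multiplier_dense:
  assumes G: "continuous_on cube G" and e: "0 < e"
  obtains g where "continuous_on UNIV g" "tame g" "\<And>y. y \<in> cube \<Longrightarrow> \<bar>G y - g y\<bar> < e"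
proof -
  have "\<exists>g. multiplier g \<and> (\<forall>y\<in>cube. \<bar>G y - g y\<bar> < e)"
  proof (rule Stone_Weierstrass_HOL[OF compact_cube _ _ _ _ _ G e])
    show "multiplier (\<lambda>x. c)" for c by (auto simp: multiplier_def intro: tame_scale)
    show "multiplier f \<Longrightarrow> continuous_on cube f" for f by (auto simp: multiplier_def intro: continuous_on_subset)
    show "multiplier f \<and> multiplier g \<Longrightarrow> multiplier (\<lambda>x. f x + g x)" for f g
      using tame_add[of "\<lambda>y. _ y * f y" "\<lambda>y. _ y * g y"]
      by (auto simp: multiplier_def distrib_left intro!: continuous_intros)
    show "multiplier f \<and> multiplier g \<Longrightarrow> multiplier (\<lambda>x. f x * g x)" for f g
      by (auto simp: multiplier_def mult.assoc[symmetric] intro!: continuous_intros)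
    show "\<exists>f. multiplier f \<and> f x \<noteq> f y" if xy: "x \<in> cube \<and> y \<in> cube \<and> x \<noteq> y" for x y
    proof -
      obtain i where i: "x i \<noteq> y i" using xy by (auto simp: fun_eq_iff)
      then have "i \<in> I" using xy by (metis in_cube)
      then have "multiplier (\<lambda>y. y i)"
        using tame_coordinate by (auto simp: multiplier_def intro!: continuous_on_product_coordinates)
      then show ?thesis using i by blast
    qed
  qed
  then obtain g where g: "multiplier g" "\<And>y. y \<in> cube \<Longrightarrow> \<bar>G y - g y\<bar> < e" by blast
  have "tame (\<lambda>y. 1 * g y)" using g(1) tame_one unfolding multiplier_def by blast
  then show ?thesis using that[of g] g by (auto simp: multiplier_def)
qed

lemma expectation_close:
  fixes F H :: "('i \<Rightarrow> real) \<Rightarrow> real"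
  assumes p: "prob_space P" and ae: "AE x in P. to_cube x \<in> cube"
    and i: "integrable P F" "integrable P H" and le: "\<And>x. to_cube x \<in> cube \<Longrightarrow> \<bar>F x - H x\<bar> \<le> e"
  shows "\<bar>(\<integral>x. F x \<partial>P) - (\<integral>x. H x \<partial>P)\<bar> \<le> e"
proof -
  interpret prob_space P by (rule p)
  have "\<bar>(\<integral>x. F x \<partial>P) - (\<integral>x. H x \<partial>P)\<bar> = \<bar>\<integral>x. F x - H x \<partial>P\<bar>" using i by simp
  also have "\<dots> \<le> (\<integral>x. \<bar>F x - H x\<bar> \<partial>P)" by (rule integral_abs_bound)
  also have "\<dots> \<le> (\<integral>x. e \<partial>P)" using i ae le by (intro integral_mono_AE) (auto elim!: eventually_mono)
  finally show ?thesis by (simp add: prob_space)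
qed

lemma cube_convergence:
  fixes G :: "('i \<Rightarrow> real) \<Rightarrow> real"
  assumes G: "continuous_on cube G" and m: "(\<lambda>x. G (to_cube x)) \<in> borel_measurable (Pi\<^sub>M I (\<lambda>_. borel))"
  shows "(\<lambda>n. \<integral>x. G (to_cube x) \<partial>\<mu> n) \<longlonglongrightarrow> (\<integral>x. G (to_cube x) \<partial>\<nu>)"
proof (rule LIMSEQ_I)
  fix e :: real assume e: "0 < e"
  obtain B where B: "\<And>y. y \<in> cube \<Longrightarrow> \<bar>G y\<bar> \<le> B"
    using compact_imp_bounded[OF compact_continuous_image[OF G compact_cube]] by (auto simp: bounded_iff)
  have Gi: "integrable (\<mu> n) (\<lambda>x. G (to_cube x))" "integrable \<nu> (\<lambda>x. G (to_cube x))" for n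
    using AE_cube(1)[of n] AE_cube(2) B pm[of n] pn m
    by (auto intro!: finite_measure.integrable_const_bound[of _ _ B] prob_space.finite_measure measurable_laplace_sets elim!: eventually_mono)
  obtain g where g: "continuous_on UNIV g" "tame g" "\<And>y. y \<in> cube \<Longrightarrow> \<bar>G y - g y\<bar> < e / 4"
    using multiplier_dense[OF G, of "e / 4"] e by auto
  have gi: "integrable (\<mu> n) (\<lambda>x. g (to_cube x))" "integrable \<nu> (\<lambda>x. g (to_cube x))" for n
    using integrable_on_cube[OF g(1), where k = "\<lambda>_. 0"] by simp_all
  have "(\<lambda>n. \<integral>x. g (to_cube x) \<partial>\<mu> n) \<longlonglongrightarrow> (\<integral>x. g (to_cube x) \<partial>\<nu>)"
    using g(2)[unfolded tame_def, THEN conjunct2, THEN spec[of _ "\<lambda>_. 0"]] by simp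
  then obtain n0 where n0: "\<And>n. n \<ge> n0 \<Longrightarrow> \<bar>(\<integral>x. g (to_cube x) \<partial>\<mu> n) - (\<integral>x. g (to_cube x) \<partial>\<nu>)\<bar> < e / 4"
    using LIMSEQ_D[of _ _ "e / 4"] e by (metis real_norm_def zero_less_divide_iff zero_less_numeral)
  show "\<exists>no. \<forall>n\<ge>no. norm ((\<integral>x. G (to_cube x) \<partial>\<mu> n) - (\<integral>x. G (to_cube x) \<partial>\<nu>)) < e"
  proof (intro exI[of _ n0] allI impI)
    fix n assume "n0 \<le> n"
    have "\<bar>(\<integral>x. G (to_cube x) \<partial>\<mu> n) - (\<integral>x. g (to_cube x) \<partial>\<mu> n)\<bar> \<le> e / 4"
      using g(3) by (intro expectation_close pm AE_cube Gi gi) (simp add: less_imp_le)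
    moreover have "\<bar>(\<integral>x. G (to_cube x) \<partial>\<nu>) - (\<integral>x. g (to_cube x) \<partial>\<nu>)\<bar> \<le> e / 4"
      using g(3) by (intro expectation_close pn AE_cube Gi gi) (simp add: less_imp_le)
    ultimately show "norm ((\<integral>x. G (to_cube x) \<partial>\<mu> n) - (\<integral>x. G (to_cube x) \<partial>\<nu>)) < e"
      using n0[OF \<open>n0 \<le> n\<close>] e unfolding real_norm_def by linarith
  qed
qed

text \<open>A bounded continuous \<open>f\<close> becomes a function on the part of the cube where no coordinate vanishes. It
  need not extend continuously to the faces where a coordinate is \<open>0\<close>, which correspond to infinite
  values of \<open>x\<close>. It is multiplied by a cutoff \<open>ct m\<close> that vanishes there. The mass that the cutoff
  loses is small for the limit law and large \<open>m\<close>, and since the cutoff is itself a continuous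
  function on the cube, the loss converges as well, so that no separate tightness argument is
  needed.\<close>

lemma conv_in_law_laplace: "conv_in_law (product_topology (\<lambda>_. euclideanreal) I) \<mu> \<nu>"
  unfolding conv_in_law_def
proof (intro allI impI)
  fix f :: "('i \<Rightarrow> real) \<Rightarrow> real"
  assume f: "continuous_map (product_topology (\<lambda>_. euclideanreal) I) euclideanreal f"
    and bf: "bounded (f ` topspace (product_topology (\<lambda>_. euclideanreal) I))"
  define F where "F u = f (restrict u I)" for u
  have Fc: "continuous_on UNIV F" unfolding F_def[abs_def] by (rule continuous_on_product_topology_extend[OF f])
  have "restrict u I \<in> topspace (product_topology (\<lambda>_. euclideanreal) I)" for u :: "'i \<Rightarrow> real" by simp
  then obtain B0 where B0: "\<And>u. \<bar>F u\<bar> \<le> B0" using bf unfolding bounded_iff F_def by (metis imageI real_norm_def)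
  define B where "B = \<bar>B0\<bar> + 1"
  have B: "\<bar>F u\<bar> \<le> B" "B > 0" for u
    using B0[of u] by (auto simp: B_def)
  have Ff: "F x = f x" if "x \<in> space (Pi\<^sub>M I (\<lambda>_. borel :: real measure))" for x
    using that by (simp add: F_def space_PiM PiE_def extensional_restrict)
  have fm: "f \<in> borel_measurable (Pi\<^sub>M I (\<lambda>_. borel))" by (rule measurable_product_topology[OF f])
  have Fm: "F \<in> borel_measurable (Pi\<^sub>M I (\<lambda>_. borel))" using measurable_cong[of _ F f] Ff fm by blast
  \<comment> \<open>As \<open>F\<close> is bounded, this factor makes \<open>G m\<close> continuous also on the faces of the cube, where \<open>L\<close> is not.\<close>
  define ct where "ct m y = min 1 (real m * (\<Prod>i\<in>I. y i))" for m and y :: "'i \<Rightarrow> real"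
  define L where "L y = (\<lambda>i. if i \<in> I then - ln (y i) else 0)" for y :: "'i \<Rightarrow> real"
  define G where "G m y = F (L y) * ct m y" for m y
  have ctc: "continuous_on UNIV (ct m)" for m
    unfolding ct_def[abs_def] by (intro continuous_intros continuous_on_product_coordinates)
  have prod0: "0 \<le> (\<Prod>i\<in>I. y i)" if "y \<in> cube" for y using that by (intro prod_nonneg) (auto simp: in_cube)
  have ct01: "0 \<le> ct m y" "ct m y \<le> 1" if "y \<in> cube" for m y using prod0[OF that] by (auto simp: ct_def)
  have LF: "F (L (to_cube x)) = F x" for x
  proof -
    have "restrict (L (to_cube x)) I = restrict x I" by (auto simp: L_def to_cube_def)
    then show ?thesis by (simp add: F_def)
  qed
  have Gc: "continuous_on cube (G m)" for m
    unfolding continuous_on_def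
  proof
    fix y assume y: "y \<in> cube"
    show "(G m \<longlongrightarrow> G m y) (at y within cube)"
    proof (cases "(\<Prod>i\<in>I. y i) = 0")
      case True
      have "((\<lambda>z. B * (real m * (\<Prod>i\<in>I. z i))) \<longlongrightarrow> B * (real m * (\<Prod>i\<in>I. y i))) (at y within cube)"
      proof -
        have "continuous_on UNIV (\<lambda>z :: 'i \<Rightarrow> real. B * (real m * (\<Prod>i\<in>I. z i)))"
          by (intro continuous_intros continuous_on_product_coordinates)
        then have "((\<lambda>z. B * (real m * (\<Prod>i\<in>I. z i))) \<longlongrightarrow> B * (real m * (\<Prod>i\<in>I. y i))) (at y)"
          by (simp add: continuous_on_def)
        then show ?thesis by (rule tendsto_within_subset) simp
      qed
      then have lim: "((\<lambda>z. B * (real m * (\<Prod>i\<in>I. z i))) \<longlongrightarrow> 0) (at y within cube)" using True by simp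
      have "eventually (\<lambda>z. norm (G m z) \<le> B * (real m * (\<Prod>i\<in>I. z i))) (at y within cube)"
        unfolding eventually_at_filter
      proof (intro always_eventually allI impI)
        fix z assume z: "z \<in> cube"
        have "\<bar>ct m z\<bar> \<le> real m * (\<Prod>i\<in>I. z i)" using prod0[OF z] by (auto simp: ct_def)
        then have "\<bar>F (L z)\<bar> * \<bar>ct m z\<bar> \<le> B * (real m * (\<Prod>i\<in>I. z i))" using B by (intro mult_mono) auto
        then show "norm (G m z) \<le> B * (real m * (\<Prod>i\<in>I. z i))" by (simp add: G_def abs_mult)
      qed
      then have "(G m \<longlongrightarrow> 0) (at y within cube)" using lim by (rule Lim_null_comparison)
      moreover have "G m y = 0" using True by (simp add: G_def ct_def)
      ultimately show ?thesis by simp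
    next
      case False
      define S where "S = {y :: 'i \<Rightarrow> real. \<forall>i\<in>I. 0 < y i}"
      have "open (\<Inter>i\<in>I. {y :: 'i \<Rightarrow> real. 0 < y i})"
        using I by (intro open_INT ballI open_Collect_less continuous_on_const continuous_on_product_coordinates)
      also have "(\<Inter>i\<in>I. {y :: 'i \<Rightarrow> real. 0 < y i}) = S" by (auto simp: S_def)
      finally have So: "open S" .
      have "y i \<noteq> 0" if "i \<in> I" for i using False I that by auto
      then have yS: "y \<in> S" using y by (force simp: S_def in_cube less_le)
      have "continuous_on S L"
        unfolding L_def[abs_def]
      proof (rule continuous_on_coordinatewise_then_product)
        fix i
        show "continuous_on S (\<lambda>y. if i \<in> I then - ln (y i) else 0)"
        proof (cases "i \<in> I")
          case True
          have "continuous_on S (\<lambda>y. - ln (y i))"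
          proof (intro continuous_intros)
            show "continuous_on S (\<lambda>y. y i)" by (rule continuous_on_subset[OF continuous_on_product_coordinates]) auto
            show "\<forall>x\<in>S. x i \<noteq> 0" using True by (auto simp: S_def)
          qed
          then show ?thesis using True by simp
        qed auto
      qed
      then have "continuous_on S (\<lambda>y. F (L y))"
        by (rule continuous_on_compose2[OF Fc]) auto
      then have "continuous_on S (G m)"
        unfolding G_def[abs_def] by (intro continuous_on_mult continuous_on_subset[OF ctc]) auto
      then have "isCont (G m) y" using So yS by (simp add: continuous_on_eq_continuous_at)
      then show ?thesis unfolding isCont_def by (rule tendsto_within_subset) simp
    qed
  qed
  have ctm: "(\<lambda>x. ct m (to_cube x)) \<in> borel_measurable (Pi\<^sub>M I (\<lambda>_. borel))" for m
    by (rule measurable_compose[OF to_cube_measurable borel_measurable_continuous_onI[OF ctc]])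
  have Gm: "(\<lambda>x. G m (to_cube x)) \<in> borel_measurable (Pi\<^sub>M I (\<lambda>_. borel))" for m
    unfolding G_def LF by (intro borel_measurable_times Fm ctm)
  have GL: "(\<lambda>n. \<integral>x. G m (to_cube x) \<partial>\<mu> n) \<longlonglongrightarrow> (\<integral>x. G m (to_cube x) \<partial>\<nu>)" for m
    by (rule cube_convergence[OF Gc Gm])
  have ctL: "(\<lambda>n. \<integral>x. ct m (to_cube x) \<partial>\<mu> n) \<longlonglongrightarrow> (\<integral>x. ct m (to_cube x) \<partial>\<nu>)" for m
    by (rule cube_convergence[OF continuous_on_subset[OF ctc] ctm]) auto
  have tight: "(\<lambda>m. \<integral>x. ct m (to_cube x) \<partial>\<nu>) \<longlonglongrightarrow> (\<integral>x. 1 \<partial>\<nu>)"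
  proof (rule integral_dominated_convergence[where w = "\<lambda>_. 1"])
    show "integrable \<nu> (\<lambda>_. 1 :: real)" using pn by (simp add: prob_space.finite_measure finite_measure.integrable_const)
    show "AE x in \<nu>. norm (ct m (to_cube x)) \<le> 1" for m
      using AE_cube(2) ct01[of _ m] by (auto elim!: eventually_mono)
    show "AE x in \<nu>. (\<lambda>m. ct m (to_cube x)) \<longlonglongrightarrow> 1"
    proof (intro always_eventually allI)
      fix x :: "'i \<Rightarrow> real"
      have p: "0 < (\<Prod>i\<in>I. to_cube x i)" by (intro prod_pos) (auto simp: to_cube_def)
      obtain m0 where m0: "1 / (\<Prod>i\<in>I. to_cube x i) \<le> real m0" using real_arch_simple by blast
      have "ct m (to_cube x) = 1" if "m \<ge> m0" for m
      proof -
        have "1 / (\<Prod>i\<in>I. to_cube x i) \<le> real m" using m0 that by linarith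
        then show ?thesis using p by (simp add: ct_def pos_divide_le_eq)
      qed
      then have "eventually (\<lambda>m. ct m (to_cube x) = 1) sequentially" by (auto simp: eventually_sequentially)
      then show "(\<lambda>m. ct m (to_cube x)) \<longlonglongrightarrow> 1" by (rule tendsto_eventually)
    qed
  qed (use ctm measurable_laplace_sets in auto)
  have one: "(\<integral>x. 1 \<partial>\<nu>) = (1::real)" using prob_space.prob_space[OF pn] by simp
  have close: "\<bar>(\<integral>x. f x \<partial>Q) - (\<integral>x. G m (to_cube x) \<partial>Q)\<bar> \<le> B * (1 - (\<integral>x. ct m (to_cube x) \<partial>Q))"
    if Q: "prob_space Q" "sets Q = sets (Pi\<^sub>M I (\<lambda>_. borel))" "AE x in Q. to_cube x \<in> cube" for Q m
  proof -
    interpret prob_space Q by (rule Q)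
    have mQ: "g \<in> borel_measurable Q" if "g \<in> borel_measurable (Pi\<^sub>M I (\<lambda>_. borel))" for g :: "_ \<Rightarrow> real"
      using measurable_cong_sets[OF Q(2) refl] that by blast
    have sQ: "space Q = space (Pi\<^sub>M I (\<lambda>_. borel))" by (rule sets_eq_imp_space_eq[OF Q(2)])
    have fi: "integrable Q F" using B by (intro integrable_const_bound[of _ B] mQ Fm) auto
    have cti: "integrable Q (\<lambda>x. ct m (to_cube x))"
      using Q(3) ct01[of _ m] by (intro integrable_const_bound[of _ 1] mQ ctm) (auto elim!: eventually_mono)
    have Gi: "integrable Q (\<lambda>x. G m (to_cube x))"
    proof (intro integrable_const_bound[of _ B] mQ Gm)
      show "AE x in Q. norm (G m (to_cube x)) \<le> B"
        using Q(3)
      proof eventually_elim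
        case (elim x)
        have "\<bar>F (L (to_cube x))\<bar> * \<bar>ct m (to_cube x)\<bar> \<le> B * 1" using B ct01[OF elim, of m] by (intro mult_mono) auto
        then show ?case by (simp add: G_def abs_mult)
      qed
    qed
    have "(\<integral>x. f x \<partial>Q) = (\<integral>x. F x \<partial>Q)" using Ff sQ by (intro Bochner_Integration.integral_cong) auto
    then have "\<bar>(\<integral>x. f x \<partial>Q) - (\<integral>x. G m (to_cube x) \<partial>Q)\<bar> = \<bar>\<integral>x. F x - G m (to_cube x) \<partial>Q\<bar>" using fi Gi by simp
    also have "\<dots> \<le> (\<integral>x. \<bar>F x - G m (to_cube x)\<bar> \<partial>Q)" by (rule integral_abs_bound)
    also have "\<dots> \<le> (\<integral>x. B * (1 - ct m (to_cube x)) \<partial>Q)"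
    proof (rule integral_mono_AE)
      show "AE x in Q. \<bar>F x - G m (to_cube x)\<bar> \<le> B * (1 - ct m (to_cube x))"
        using Q(3)
      proof eventually_elim
        case (elim x)
        have "F x - G m (to_cube x) = F x * (1 - ct m (to_cube x))" by (simp add: G_def LF algebra_simps)
        moreover have "\<bar>F x\<bar> * \<bar>1 - ct m (to_cube x)\<bar> \<le> B * (1 - ct m (to_cube x))" using B ct01[OF elim, of m] by (intro mult_mono) auto
        ultimately show ?case by (simp add: abs_mult)
      qed
    qed (use fi Gi cti in auto)
    also have "\<dots> = B * (1 - (\<integral>x. ct m (to_cube x) \<partial>Q))" using cti prob_space by simp
    finally show ?thesis .
  qed
  show "(\<lambda>n. integral\<^sup>L (\<mu> n) f) \<longlonglongrightarrow> integral\<^sup>L \<nu> f"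
  proof (rule LIMSEQ_I)
    fix e :: real assume e: "0 < e"
    have "(\<lambda>m. B * (1 - (\<integral>x. ct m (to_cube x) \<partial>\<nu>))) \<longlonglongrightarrow> B * (1 - 1)"
      using tight one by (intro tendsto_intros) simp
    then obtain m where m: "B * (1 - (\<integral>x. ct m (to_cube x) \<partial>\<nu>)) < e / 4"
      using order_tendstoD(2)[of _ "0" sequentially "e / 4"] e by (auto simp: eventually_sequentially)
    have "(\<lambda>n. B * (1 - (\<integral>x. ct m (to_cube x) \<partial>\<mu> n))) \<longlonglongrightarrow> B * (1 - (\<integral>x. ct m (to_cube x) \<partial>\<nu>))"
      by (intro tendsto_intros ctL)
    then have "eventually (\<lambda>n. B * (1 - (\<integral>x. ct m (to_cube x) \<partial>\<mu> n)) < e / 4) sequentially"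
      using m by (rule order_tendstoD(2))
    moreover have "eventually (\<lambda>n. dist (\<integral>x. G m (to_cube x) \<partial>\<mu> n) (\<integral>x. G m (to_cube x) \<partial>\<nu>) < e / 4) sequentially"
      using GL[of m] e by (intro tendstoD) auto
    ultimately have "eventually (\<lambda>n. norm (integral\<^sup>L (\<mu> n) f - integral\<^sup>L \<nu> f) < e) sequentially"
    proof eventually_elim
      case (elim n)
      show ?case
        using elim m close[OF pm sm AE_cube(1), of n m] close[OF pn sn AE_cube(2), of m] e
        unfolding dist_real_def real_norm_def by linarith
    qed
    then show "\<exists>no. \<forall>n\<ge>no. norm (integral\<^sup>L (\<mu> n) f - integral\<^sup>L \<nu> f) < e"
      by (simp add: eventually_sequentially)
  qed
qed

end

section \<open>The limiting law of the squared moduli\<close>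

lemma prob_space_std_normal: "prob_space std_normal_distribution"
  by (rule prob_space_normal_density) simp

lemma borel_measurable_cis: "g \<in> borel_measurable Q \<Longrightarrow> (\<lambda>x. cis (g x)) \<in> borel_measurable Q"
  by (rule measurable_compose, assumption) (intro borel_measurable_continuous_onI continuous_intros)

lemma integral_gauss_cis:
  assumes J: "finite J"
  shows "(\<integral>h. cis (\<Sum>p\<in>J. c p * h p) \<partial>Pi\<^sub>M J (\<lambda>_. std_normal_distribution)) = complex_of_real (exp (- (\<Sum>p\<in>J. (c p)\<^sup>2) / 2))"
proof -
  interpret g: prob_space std_normal_distribution by (rule prob_space_std_normal)
  interpret product_sigma_finite "\<lambda>_. std_normal_distribution" ..
  have "(\<integral>h. cis (\<Sum>p\<in>J. c p * h p) \<partial>Pi\<^sub>M J (\<lambda>_. std_normal_distribution)) =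
      (\<integral>h. (\<Prod>p\<in>J. cis (c p * h p)) \<partial>Pi\<^sub>M J (\<lambda>_. std_normal_distribution))"
    using J by (simp add: cis_conv_exp exp_sum sum_distrib_left)
  also have "\<dots> = (\<Prod>p\<in>J. \<integral>x. cis (c p * x) \<partial>std_normal_distribution)"
    using J by (intro product_integral_prod g.integrable_const_bound[of _ 1] borel_measurable_cis) auto
  also have "\<dots> = (\<Prod>p\<in>J. complex_of_real (exp (- (c p)\<^sup>2 / 2)))"
    using char_std_normal_distribution by (simp add: char_def cis_conv_exp fun_eq_iff)
  also have "\<dots> = complex_of_real (exp (- (\<Sum>p\<in>J. (c p)\<^sup>2) / 2))"
    using J by (simp add: exp_sum[symmetric] sum_negf sum_divide_distrib flip: of_real_prod)
  finally show ?thesis .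
qed

text \<open>Up to the factor \<open>1 / sqrt (1 + a)\<close> the integrand is the density of a centred normal law of variance
  \<open>1 / (1 + a)\<close>.\<close>

lemma integral_std_normal_exp_square:
  assumes a: "0 \<le> a"
  shows "(\<integral>x. exp (- (a * x\<^sup>2 / 2)) \<partial>std_normal_distribution) = 1 / sqrt (1 + a)"
proof -
  let ?s = "1 / sqrt (1 + a)"
  have s: "0 < ?s" using a by simp
  have "(\<integral>x. exp (- (a * x\<^sup>2 / 2)) \<partial>std_normal_distribution) = (\<integral>x. std_normal_density x * exp (- (a * x\<^sup>2 / 2)) \<partial>lborel)"
    by (subst integral_density) auto
  also have "\<dots> = (\<integral>x. ?s * normal_density 0 ?s x \<partial>lborel)"
  proof (intro Bochner_Integration.integral_cong refl)
    fix x :: real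
    have s2: "?s\<^sup>2 = 1 / (1 + a)" using a by (simp add: power_divide)
    have "sqrt (2 * pi * ?s\<^sup>2) = sqrt (2 * pi) * ?s" using s by (simp add: real_sqrt_mult)
    then have "?s * normal_density 0 ?s x = 1 / sqrt (2 * pi) * exp (- x\<^sup>2 / (2 * ?s\<^sup>2))"
      using s by (simp add: normal_density_def)
    also have "- x\<^sup>2 / (2 * ?s\<^sup>2) = - x\<^sup>2 / 2 + - (a * x\<^sup>2 / 2)" unfolding s2 using a by (simp add: field_simps)
    finally show "std_normal_density x * exp (- (a * x\<^sup>2 / 2)) = ?s * normal_density 0 ?s x"
      by (simp only: std_normal_density_def exp_add mult.assoc)
  qed
  also have "\<dots> = ?s" using integral_normal_density[OF s, of 0] by simp
  finally show ?thesis .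
qed

lemma integral_gauss_exp_squares:
  assumes J: "finite J" and a: "\<And>p. p \<in> J \<Longrightarrow> 0 \<le> a p"
  shows "(\<integral>h. exp (- (\<Sum>p\<in>J. a p * (h p)\<^sup>2 / 2)) \<partial>Pi\<^sub>M J (\<lambda>_. std_normal_distribution)) = (\<Prod>p\<in>J. 1 / sqrt (1 + a p))"
proof -
  interpret g: prob_space std_normal_distribution by (rule prob_space_std_normal)
  interpret product_sigma_finite "\<lambda>_. std_normal_distribution" ..
  have "(\<integral>h. exp (- (\<Sum>p\<in>J. a p * (h p)\<^sup>2 / 2)) \<partial>Pi\<^sub>M J (\<lambda>_. std_normal_distribution)) =
      (\<integral>h. (\<Prod>p\<in>J. exp (- (a p * (h p)\<^sup>2 / 2))) \<partial>Pi\<^sub>M J (\<lambda>_. std_normal_distribution))"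
    using J by (simp add: exp_sum[symmetric] sum_negf)
  also have "\<dots> = (\<Prod>p\<in>J. \<integral>x. exp (- (a p * x\<^sup>2 / 2)) \<partial>std_normal_distribution)"
    using J a by (intro product_integral_prod g.integrable_const_bound[of _ 1]) auto
  also have "\<dots> = (\<Prod>p\<in>J. 1 / sqrt (1 + a p))"
    using a integral_std_normal_exp_square by (intro prod.cong) auto
  finally show ?thesis .
qed

lemma prob_space_exponential_law: "prob_space exponential_law"
  unfolding exponential_law_def by (rule prob_space_exponential_density) simp

lemma integral_exponential_law_exp:
  assumes k: "0 \<le> k"
  shows "(\<integral>x. exp (- (k * x)) \<partial>exponential_law) = 1 / (1 + k)"
proof -
  have k1: "0 < 1 + k" using k by simp
  interpret e: prob_space "density lborel (\<lambda>x. ennreal (exponential_density (1 + k) x))"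
    by (rule prob_space_exponential_density[OF k1])
  have nn: "0 \<le> exponential_density l x" if "0 < l" for l x :: real
    using that by (simp add: exponential_density_def erlang_density_def)
  have "(\<integral>x. exp (- (k * x)) \<partial>exponential_law) = (\<integral>x. exponential_density 1 x * exp (- (k * x)) \<partial>lborel)"
    unfolding exponential_law_def using nn by (subst integral_density) auto
  also have "\<dots> = (\<integral>x. 1 / (1 + k) * (exponential_density (1 + k) x * 1) \<partial>lborel)"
  proof (intro Bochner_Integration.integral_cong refl)
    fix x :: real
    have "exp (- x) * exp (- (k * x)) = exp (- x * (1 + k))"
      by (simp add: exp_add[symmetric] algebra_simps)
    then show "exponential_density 1 x * exp (- (k * x)) = 1 / (1 + k) * (exponential_density (1 + k) x * 1)"
      using k1 by (simp add: exponential_density_def)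
  qed
  also have "\<dots> = 1 / (1 + k) * (\<integral>x. 1 \<partial>density lborel (\<lambda>x. ennreal (exponential_density (1 + k) x)))"
    using nn[OF k1] by (subst integral_density) auto
  also have "\<dots> = 1 / (1 + k)" using e.prob_space by simp
  finally show ?thesis .
qed

lemma AE_exponential_law_nonneg: "AE x in exponential_law. 0 \<le> x"
  unfolding exponential_law_def by (subst AE_density) (auto simp: exponential_density_def)

lemma integral_exponential_law_product:
  assumes I: "finite I"
  shows "(\<integral>x. exp (- (\<Sum>p\<in>I. real (k p) * x p)) \<partial>Pi\<^sub>M I (\<lambda>_. exponential_law)) = (\<Prod>p\<in>I. 1 / (1 + real (k p)))"
proof -
  interpret g: prob_space exponential_law by (rule prob_space_exponential_law)
  interpret product_sigma_finite "\<lambda>_. exponential_law" ..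
  have s: "sets exponential_law = sets borel" by (simp add: exponential_law_def)
  have "(\<integral>x. exp (- (\<Sum>p\<in>I. real (k p) * x p)) \<partial>Pi\<^sub>M I (\<lambda>_. exponential_law)) =
      (\<integral>x. (\<Prod>p\<in>I. exp (- (real (k p) * x p))) \<partial>Pi\<^sub>M I (\<lambda>_. exponential_law))"
    using I by (simp add: exp_sum[symmetric] sum_negf)
  also have "\<dots> = (\<Prod>p\<in>I. \<integral>x. exp (- (real (k p) * x)) \<partial>exponential_law)"
  proof (intro product_integral_prod I g.integrable_const_bound[of _ 1])
    fix p
    show "AE x in exponential_law. norm (exp (- (real (k p) * x))) \<le> 1"
      using AE_exponential_law_nonneg by eventually_elim simp
    show "(\<lambda>x. exp (- (real (k p) * x))) \<in> borel_measurable exponential_law"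
      unfolding measurable_cong_sets[OF s refl] by measurable
  qed
  also have "\<dots> = (\<Prod>p\<in>I. 1 / (1 + real (k p)))"
    by (intro prod.cong refl integral_exponential_law_exp) simp
  finally show ?thesis .
qed

context haar_matrix
begin

context
  fixes r s :: nat and k :: "nat \<times> nat \<Rightarrow> nat"
  assumes rs: "r \<le> N" "s \<le> N"
begin

abbreviation entries :: "(nat \<times> nat) set" where "entries \<equiv> {..<r} \<times> {..<s}"
abbreviation halves :: "((nat \<times> nat) \<times> bool) set" where "halves \<equiv> entries \<times> UNIV"
abbreviation gauss :: "((nat \<times> nat) \<times> bool \<Rightarrow> real) measure" where
  "gauss \<equiv> Pi\<^sub>M halves (\<lambda>_. std_normal_distribution)"

text \<open>The two Gaussian variables of an entry of the corner, indexed by a Boolean, pair with its real and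
  imaginary part.\<close>

abbreviation gcoef :: "((nat \<times> nat) \<times> bool \<Rightarrow> real) \<Rightarrow> nat \<times> nat \<Rightarrow> complex" where
  "gcoef h p \<equiv> complex_of_real (sqrt (2 * real (k p))) * Complex (h (p, True)) (- h (p, False))"

lemma sum_halves: "(\<Sum>x\<in>halves. f x) = (\<Sum>p\<in>entries. f (p, True) + f (p, False))" for f :: "_ \<Rightarrow> real"
  by (subst sum.cartesian_product[symmetric, where g = "\<lambda>p b. f (p, b)", simplified]) (simp add: UNIV_bool add.commute)

text \<open>The identity \<open>exp (- c\<^sup>2 / 2) = E exp (\<i> c h)\<close> for a standard normal \<open>h\<close>, applied to the real and
  imaginary parts of all entries.\<close>

lemma laplace_mixture:
  "complex_of_real (expectation (\<lambda>\<omega>. exp (- (\<Sum>p\<in>entries. real (k p) * (cmod (complex_of_real (sqrt N) * U \<omega> $$ p))\<^sup>2)))) =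
    (\<integral>h. (\<integral>\<omega>. cis (Re (\<Sum>p\<in>entries. gcoef h p * (complex_of_real (sqrt N) * U \<omega> $$ p))) \<partial>M) \<partial>gauss)"
  and char_gauss_measurable:
  "(\<lambda>h. \<integral>\<omega>. cis (Re (\<Sum>p\<in>entries. gcoef h p * (complex_of_real (sqrt N) * U \<omega> $$ p))) \<partial>M) \<in> borel_measurable gauss"
proof -
  define z where "z \<omega> p = complex_of_real (sqrt N) * U \<omega> $$ p" for \<omega> p
  define c where "c \<omega> x = sqrt (2 * real (k (fst x))) * (if snd x then Re (z \<omega> (fst x)) else Im (z \<omega> (fst x)))" for \<omega> and x :: "(nat \<times> nat) \<times> bool"
  define f where "f \<omega> h = cis (\<Sum>x\<in>halves. c \<omega> x * h x)" for \<omega> and h :: "(nat \<times> nat) \<times> bool \<Rightarrow> real"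
  interpret g: prob_space gauss by (intro prob_space_PiM prob_space_std_normal)
  interpret P: pair_sigma_finite M gauss ..
  interpret PP: prob_space "M \<Otimes>\<^sub>M gauss" by (rule prob_space_pair) unfold_locales
  have f_eq: "cis (Re (\<Sum>p\<in>entries. gcoef h p * (complex_of_real (sqrt N) * U \<omega> $$ p))) = f \<omega> h" for h \<omega>
    unfolding f_def sum_halves z_def[symmetric] Re_sum
    by (intro arg_cong[where f = cis] sum.cong refl) (simp add: c_def algebra_simps)
  have zm: "(\<lambda>\<omega>. z \<omega> p) \<in> borel_measurable M" if "p \<in> entries" for p
    unfolding z_def using that rs U_entry_measurable[of "fst p" "snd p"]
    by (intro borel_measurable_times borel_measurable_const) auto
  have cm: "(\<lambda>\<omega>. c \<omega> x) \<in> borel_measurable M" if "x \<in> halves" for x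
  proof -
    have [measurable]: "(\<lambda>\<omega>. z \<omega> (fst x)) \<in> borel_measurable M" using that zm by auto
    show ?thesis unfolding c_def by (cases "snd x") simp_all
  qed
  have fm: "(\<lambda>(\<omega>, h). f \<omega> h) \<in> borel_measurable (M \<Otimes>\<^sub>M gauss)"
    unfolding f_def split_beta'
  proof (intro borel_measurable_cis borel_measurable_sum borel_measurable_times)
    fix x assume x: "x \<in> halves"
    show "(\<lambda>y. c (fst y) x) \<in> borel_measurable (M \<Otimes>\<^sub>M gauss)"
      by (rule measurable_compose[OF measurable_fst cm[OF x]])
    have "(\<lambda>h. h x) \<in> borel_measurable gauss" using measurable_component_singleton[OF x, of "\<lambda>_. std_normal_distribution"] by simp
    then show "(\<lambda>y. snd y x) \<in> borel_measurable (M \<Otimes>\<^sub>M gauss)" by (rule measurable_compose[OF measurable_snd])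
  qed
  have fi: "integrable (M \<Otimes>\<^sub>M gauss) (\<lambda>(\<omega>, h). f \<omega> h)"
    using fm by (intro PP.integrable_const_bound[of _ 1]) (auto simp: f_def)
  have "complex_of_real (expectation (\<lambda>\<omega>. exp (- (\<Sum>p\<in>entries. real (k p) * (cmod (z \<omega> p))\<^sup>2)))) =
      (\<integral>\<omega>. complex_of_real (exp (- (\<Sum>p\<in>entries. real (k p) * (cmod (z \<omega> p))\<^sup>2))) \<partial>M)"
    by (rule integral_complex_of_real[symmetric])
  also have "\<dots> = (\<integral>\<omega>. (\<integral>h. f \<omega> h \<partial>gauss) \<partial>M)"
  proof (intro Bochner_Integration.integral_cong refl)
    fix \<omega>
    have "(\<Sum>x\<in>halves. (c \<omega> x)\<^sup>2) = (\<Sum>p\<in>entries. 2 * (real (k p) * (cmod (z \<omega> p))\<^sup>2))"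
      unfolding sum_halves by (intro sum.cong refl) (simp add: c_def power_mult_distrib cmod_power2 algebra_simps)
    then have "- (\<Sum>x\<in>halves. (c \<omega> x)\<^sup>2) / 2 = - (\<Sum>p\<in>entries. real (k p) * (cmod (z \<omega> p))\<^sup>2)"
      by (simp add: sum_distrib_left[symmetric])
    then show "complex_of_real (exp (- (\<Sum>p\<in>entries. real (k p) * (cmod (z \<omega> p))\<^sup>2))) = (\<integral>h. f \<omega> h \<partial>gauss)"
      unfolding f_def by (subst integral_gauss_cis) auto
  qed
  also have "\<dots> = (\<integral>h. (\<integral>\<omega>. f \<omega> h \<partial>M) \<partial>gauss)"
    by (rule P.Fubini_integral[OF fi, symmetric])
  finally show "complex_of_real (expectation (\<lambda>\<omega>. exp (- (\<Sum>p\<in>entries. real (k p) * (cmod (complex_of_real (sqrt N) * U \<omega> $$ p))\<^sup>2)))) =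
    (\<integral>h. (\<integral>\<omega>. cis (Re (\<Sum>p\<in>entries. gcoef h p * (complex_of_real (sqrt N) * U \<omega> $$ p))) \<partial>M) \<partial>gauss)"
    unfolding f_eq z_def .
  have "(\<lambda>h. \<integral>\<omega>. f \<omega> h \<partial>M) \<in> borel_measurable gauss"
    using measurable_pair_swap[OF fm] by (intro borel_measurable_lebesgue_integral) (simp add: split_beta')
  then show "(\<lambda>h. \<integral>\<omega>. cis (Re (\<Sum>p\<in>entries. gcoef h p * (complex_of_real (sqrt N) * U \<omega> $$ p))) \<partial>M) \<in> borel_measurable gauss"
    unfolding f_eq .
qed

end

end

text \<open>In the mixture, the characteristic functions converge pointwise to those of complex Gaussians. The
  two variables of the entry \<open>p\<close> then contribute \<open>1 / sqrt (1 + k p)\<close> each, which multiply to the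
  Laplace transform \<open>1 / (1 + k p)\<close> of an exponential variable.\<close>

lemma haar_laplace_limit:
  fixes k :: "nat \<times> nat \<Rightarrow> nat"
  assumes H: "\<And>n. n \<ge> 1 \<Longrightarrow> haar_matrix M n (U n)"
  shows "(\<lambda>n. \<integral>\<omega>. exp (- (\<Sum>p\<in>{..<r} \<times> {..<s}. real (k p) * (cmod (complex_of_real (sqrt n) * U n \<omega> $$ p))\<^sup>2)) \<partial>M)
    \<longlonglongrightarrow> (\<Prod>p\<in>{..<r} \<times> {..<s}. 1 / (1 + real (k p)))"
proof -
  let ?I = "{..<r} \<times> {..<s}" and ?n0 = "Suc (max r s)"
  let ?J = "?I \<times> (UNIV :: bool set)"
  let ?G = "Pi\<^sub>M ?J (\<lambda>_. std_normal_distribution)"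
  define t where "t h p = complex_of_real (sqrt (2 * real (k p))) * Complex (h (p, True)) (- h (p, False))" for h :: "(nat \<times> nat) \<times> bool \<Rightarrow> real" and p
  define c where "c n h = (\<integral>\<omega>. cis (Re (\<Sum>p\<in>?I. t h p * (complex_of_real (sqrt n) * U n \<omega> $$ p))) \<partial>M)" for n h
  define e where "e n = (\<integral>\<omega>. exp (- (\<Sum>p\<in>?I. real (k p) * (cmod (complex_of_real (sqrt n) * U n \<omega> $$ p))\<^sup>2)) \<partial>M)" for n
  have hm: "haar_matrix M (n + ?n0) (U (n + ?n0))" and rs: "r \<le> n + ?n0" "s \<le> n + ?n0" for n
    by (rule H) auto
  interpret M: prob_space M using hm[of 0] by (simp add: haar_matrix_def)
  interpret g: prob_space ?G by (intro prob_space_PiM prob_space_std_normal)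
  have mix: "complex_of_real (e (n + ?n0)) = (\<integral>h. c (n + ?n0) h \<partial>?G)" "c (n + ?n0) \<in> borel_measurable ?G" for n
    unfolding e_def c_def[abs_def] t_def
    by (rule haar_matrix.laplace_mixture[OF hm rs] haar_matrix.char_gauss_measurable[OF hm rs])+
  have sumJ: "(\<Sum>x\<in>?J. real (k (fst x)) * (h x)\<^sup>2 / 2) = (\<Sum>p\<in>?I. (cmod (t h p))\<^sup>2) / 4" for h
  proof -
    have "(\<Sum>x\<in>?J. real (k (fst x)) * (h x)\<^sup>2 / 2) = (\<Sum>p\<in>?I. \<Sum>b\<in>UNIV. real (k p) * (h (p, b))\<^sup>2 / 2)"
      by (subst sum.cartesian_product) (simp add: split_beta')
    also have "\<dots> = (\<Sum>p\<in>?I. (cmod (t h p))\<^sup>2 / 4)"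
      by (intro sum.cong refl) (simp add: UNIV_bool t_def norm_mult power_mult_distrib cmod_power2 algebra_simps)
    finally show ?thesis by (simp add: sum_divide_distrib)
  qed
  have pointwise: "(\<lambda>n. c (n + ?n0) h) \<longlonglongrightarrow> complex_of_real (exp (- (\<Sum>x\<in>?J. real (k (fst x)) * (h x)\<^sup>2 / 2)))" for h
  proof -
    let ?C = "2 * (\<Sum>p\<in>?I. cmod (t h p)) ^ 4 * real s ^ 5 + (\<Sum>p\<in>?I. cmod (t h p))\<^sup>2"
    have "(\<lambda>n. ?C / sqrt (real n)) \<longlonglongrightarrow> 0"
      by (rule real_tendsto_divide_at_top[OF tendsto_const]) (rule filterlim_compose[OF sqrt_at_top filterlim_real_sequentially])
    then have lim: "(\<lambda>n. ?C / sqrt (real (n + ?n0))) \<longlonglongrightarrow> 0" by (rule LIMSEQ_ignore_initial_segment)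
    have "norm (c (n + ?n0) h - complex_of_real (exp (- ((\<Sum>p\<in>?I. (cmod (t h p))\<^sup>2) / 4)))) \<le> ?C / sqrt (real (n + ?n0))" for n
      unfolding c_def using haar_matrix.char_bound[OF hm rs, of "t h"] by simp
    then have "(\<lambda>n. c (n + ?n0) h - complex_of_real (exp (- ((\<Sum>p\<in>?I. (cmod (t h p))\<^sup>2) / 4)))) \<longlonglongrightarrow> 0"
      by (intro Lim_null_comparison[OF always_eventually lim]) auto
    then show ?thesis unfolding sumJ by (simp add: LIM_zero_iff)
  qed
  have bound: "norm (c n h) \<le> 1" for n h
  proof -
    have "norm (c n h) \<le> (\<integral>\<omega>. norm (cis (Re (\<Sum>p\<in>?I. t h p * (complex_of_real (sqrt n) * U n \<omega> $$ p)))) \<partial>M)"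
      unfolding c_def by (rule integral_norm_bound)
    then show ?thesis using M.prob_space by simp
  qed
  have "(\<lambda>n. \<integral>h. c (n + ?n0) h \<partial>?G) \<longlonglongrightarrow> (\<integral>h. complex_of_real (exp (- (\<Sum>x\<in>?J. real (k (fst x)) * (h x)\<^sup>2 / 2))) \<partial>?G)"
  proof (rule integral_dominated_convergence[where w = "\<lambda>_. 1"])
    show "(\<lambda>h. complex_of_real (exp (- (\<Sum>x\<in>?J. real (k (fst x)) * (h x)\<^sup>2 / 2)))) \<in> borel_measurable ?G"
      by (rule borel_measurable_LIMSEQ_metric[OF mix(2) pointwise])
  qed (use mix pointwise bound in auto)
  also have "(\<integral>h. complex_of_real (exp (- (\<Sum>x\<in>?J. real (k (fst x)) * (h x)\<^sup>2 / 2))) \<partial>?G) =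
      complex_of_real (\<Prod>x\<in>?J. 1 / sqrt (1 + real (k (fst x))))"
    by (subst integral_complex_of_real) (subst integral_gauss_exp_squares, auto)
  also have "(\<Prod>x\<in>?J. 1 / sqrt (1 + real (k (fst x)))) = (\<Prod>p\<in>?I. \<Prod>b\<in>(UNIV :: bool set). 1 / sqrt (1 + real (k p)))"
    by (subst prod.cartesian_product) (simp add: split_beta')
  also have "\<dots> = (\<Prod>p\<in>?I. 1 / (1 + real (k p)))"
    by (intro prod.cong refl) (simp add: UNIV_bool flip: real_sqrt_mult)
  finally have "(\<lambda>n. complex_of_real (e (n + ?n0))) \<longlonglongrightarrow> complex_of_real (\<Prod>p\<in>?I. 1 / (1 + real (k p)))"
    by (simp only: mix(1))
  then have "(\<lambda>n. e (n + ?n0)) \<longlonglongrightarrow> (\<Prod>p\<in>?I. 1 / (1 + real (k p)))"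
    by (simp only: tendsto_of_real_iff)
  then show ?thesis unfolding e_def by (rule LIMSEQ_offset)
qed

section \<open>Eigenvalues of the random matrix\<close>

lemma conv_in_law_of_conv_in_probability:
  fixes X :: "nat \<Rightarrow> 'w \<Rightarrow> complex"
  assumes M: "prob_space M" and meas: "\<And>n. n \<ge> n0 \<Longrightarrow> X n \<in> borel_measurable M"
    and conv: "\<And>\<delta>. \<delta> > 0 \<Longrightarrow> (\<lambda>n. measure M {\<omega> \<in> space M. \<delta> \<le> cmod (X n \<omega>)}) \<longlonglongrightarrow> 0"
  shows "conv_in_law euclidean (\<lambda>n. distr M borel (X n)) (return borel 0)"
  unfolding conv_in_law_def
proof (intro allI impI)
  fix f :: "complex \<Rightarrow> real"
  assume c: "continuous_map euclidean euclideanreal f" and b: "bounded (f ` topspace euclidean)"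
  interpret prob_space M by (rule M)
  have cont: "continuous_on UNIV f" using c by simp
  have fm: "f \<in> borel_measurable borel" by (rule borel_measurable_continuous_onI[OF cont])
  obtain B where B: "\<And>x. \<bar>f x\<bar> \<le> B" using b by (auto simp: bounded_iff)
  have B0: "0 \<le> B" using B[of 0] by linarith
  have "integral\<^sup>L (return borel 0) f = f 0" using fm by (subst integral_return) auto
  moreover have "(\<lambda>n. integral\<^sup>L (distr M borel (X n)) f) \<longlonglongrightarrow> f 0"
  proof (rule LIMSEQ_I)
    fix e :: real assume e: "0 < e"
    obtain \<delta> where \<delta>: "\<delta> > 0" "\<And>x. dist x 0 < \<delta> \<Longrightarrow> dist (f x) (f 0) < e / 2"
      using cont e by (metis continuous_on_iff UNIV_I half_gt_zero)
    have "(\<lambda>n. 2 * B * measure M {\<omega> \<in> space M. \<delta> \<le> cmod (X n \<omega>)}) \<longlonglongrightarrow> 2 * B * 0"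
      by (intro tendsto_intros conv \<delta>)
    then have "eventually (\<lambda>n. 2 * B * measure M {\<omega> \<in> space M. \<delta> \<le> cmod (X n \<omega>)} < e / 2) sequentially"
      using e by (intro order_tendstoD) auto
    then obtain n1 where n1: "\<And>n. n \<ge> n1 \<Longrightarrow> 2 * B * measure M {\<omega> \<in> space M. \<delta> \<le> cmod (X n \<omega>)} < e / 2"
      by (auto simp: eventually_sequentially)
    show "\<exists>no. \<forall>n\<ge>no. norm (integral\<^sup>L (distr M borel (X n)) f - f 0) < e"
    proof (intro exI allI impI)
      fix n assume n: "n \<ge> max n0 n1"
      have Xm [measurable]: "X n \<in> borel_measurable M" using n by (intro meas) simp
      define A where "A = {\<omega> \<in> space M. \<delta> \<le> cmod (X n \<omega>)}"
      have Am [measurable]: "A \<in> sets M" unfolding A_def by measurable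
      have intA: "integrable M (indicator A :: 'w \<Rightarrow> real)"
        by (rule integrable_const_bound[of _ 1]) auto
      have fX: "(\<lambda>\<omega>. f (X n \<omega>)) \<in> borel_measurable M" by (rule measurable_compose[OF Xm fm])
      have int: "integrable M (\<lambda>\<omega>. f (X n \<omega>))"
        using B by (intro integrable_const_bound[of _ B] fX) auto
      have "integral\<^sup>L (distr M borel (X n)) f - f 0 = expectation (\<lambda>\<omega>. f (X n \<omega>) - f 0)"
        using fm int prob_space by (subst integral_distr) auto
      also have "norm \<dots> \<le> expectation (\<lambda>\<omega>. norm (f (X n \<omega>) - f 0))" by (rule integral_norm_bound)
      also have "\<dots> \<le> expectation (\<lambda>\<omega>. e / 2 + 2 * B * indicator A \<omega>)"
      proof (rule integral_mono)
        fix \<omega> assume w: "\<omega> \<in> space M"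
        show "norm (f (X n \<omega>) - f 0) \<le> e / 2 + 2 * B * indicator A \<omega>"
        proof (cases "\<omega> \<in> A")
          case True
          then show ?thesis using B[of "X n \<omega>"] B[of 0] e by simp
        next
          case False
          then have "cmod (X n \<omega>) < \<delta>" using w by (auto simp: A_def)
          then have "dist (f (X n \<omega>)) (f 0) < e / 2" by (intro \<delta>(2)) simp
          then show ?thesis using False by (simp add: dist_real_def)
        qed
      next
        show "integrable M (\<lambda>\<omega>. e / 2 + 2 * B * indicator A \<omega>)"
          by (intro integrable_const_bound[of _ "e / 2 + 2 * B"]) (use e B0 in \<open>auto simp: indicator_def\<close>)
      qed (use int in auto)
      also have "\<dots> = e / 2 + 2 * B * measure M A"
        using intA by (simp add: prob_space)
      also have "\<dots> < e" using n1[of n] n by (simp add: A_def)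
      finally show "norm (integral\<^sup>L (distr M borel (X n)) f - f 0) < e" .
    qed
  qed
  ultimately show "(\<lambda>n. integral\<^sup>L (distr M borel (X n)) f) \<longlonglongrightarrow> integral\<^sup>L (return borel 0) f" by simp
qed

lemma corner_norm_power4_le:
  "corner_norm r s X ^ 4 \<le> (real r * real s) ^ 4 * (\<Sum>i<r. \<Sum>j<s. cmod (X i j) ^ 4)"
proof -
  have "corner_norm r s X ^ 4 \<le> real r ^ 4 * (\<Sum>i<r. (\<Sum>j<s. cmod (X i j)) ^ 4)"
    unfolding corner_norm_def by (intro sum_power4_le sum_nonneg) auto
  also have "\<dots> \<le> real r ^ 4 * (\<Sum>i<r. real s ^ 4 * (\<Sum>j<s. cmod (X i j) ^ 4))"
    by (intro mult_left_mono sum_mono sum_power4_le) auto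
  also have "\<dots> = (real r * real s) ^ 4 * (\<Sum>i<r. \<Sum>j<s. cmod (X i j) ^ 4)"
    by (simp add: sum_distrib_left[symmetric] power_mult_distrib)
  finally show ?thesis .
qed

lemma (in haar_matrix) corner_norm_moment:
  assumes "r \<le> N" "s \<le> N"
  shows "integrable M (\<lambda>\<omega>. corner_norm r s (\<lambda>i j. U \<omega> $$ (i, j)) ^ 4)"
    and "expectation (\<lambda>\<omega>. corner_norm r s (\<lambda>i j. U \<omega> $$ (i, j)) ^ 4) \<le> 2 * (real r * real s) ^ 5 / (real N)\<^sup>2"
proof -
  let ?X = "\<lambda>\<omega> i j. U \<omega> $$ (i, j)"
  have le: "corner_norm r s (?X \<omega>) ^ 4 \<le> (real r * real s) ^ 4 * (\<Sum>i<r. \<Sum>j<s. cmod (?X \<omega> i j) ^ 4)" for \<omega>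
    by (rule corner_norm_power4_le)
  have int: "integrable M (\<lambda>\<omega>. cmod (?X \<omega> i j) ^ 4)" if "i < r" "j < s" for i j
    using that assms by (intro integrable_U_pow) auto
  have intS: "integrable M (\<lambda>\<omega>. (real r * real s) ^ 4 * (\<Sum>i<r. \<Sum>j<s. cmod (?X \<omega> i j) ^ 4))"
    using int by (intro integrable_mult_right Bochner_Integration.integrable_sum) auto
  have m: "(\<lambda>\<omega>. corner_norm r s (?X \<omega>) ^ 4) \<in> borel_measurable M"
    unfolding corner_norm_def using assms
    by (intro borel_measurable_power borel_measurable_sum measurable_compose[OF U_entry_measurable borel_measurable_norm]) auto
  show i4: "integrable M (\<lambda>\<omega>. corner_norm r s (?X \<omega>) ^ 4)"
    by (rule Bochner_Integration.integrable_bound[OF intS m])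
      (use le corner_norm_nonneg in \<open>auto intro!: AE_I2 order_trans[OF _ abs_ge_self] simp: corner_norm_nonneg\<close>)
  have "expectation (\<lambda>\<omega>. corner_norm r s (?X \<omega>) ^ 4)
      \<le> expectation (\<lambda>\<omega>. (real r * real s) ^ 4 * (\<Sum>i<r. \<Sum>j<s. cmod (?X \<omega> i j) ^ 4))"
    using i4 intS le by (rule integral_mono)
  also have "\<dots> = (real r * real s) ^ 4 * (\<Sum>i<r. \<Sum>j<s. expectation (\<lambda>\<omega>. cmod (?X \<omega> i j) ^ 4))"
  proof -
    have "expectation (\<lambda>\<omega>. \<Sum>i<r. \<Sum>j<s. cmod (?X \<omega> i j) ^ 4) = (\<Sum>i<r. expectation (\<lambda>\<omega>. \<Sum>j<s. cmod (?X \<omega> i j) ^ 4))"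
      using int by (intro Bochner_Integration.integral_sum Bochner_Integration.integrable_sum) auto
    also have "\<dots> = (\<Sum>i<r. \<Sum>j<s. expectation (\<lambda>\<omega>. cmod (?X \<omega> i j) ^ 4))"
      using int by (intro sum.cong refl Bochner_Integration.integral_sum) auto
    finally show ?thesis by simp
  qed
  also have "\<dots> = (real r * real s) ^ 4 * (\<Sum>i<r. \<Sum>j<s. 2 / (real N * (real N + 1)))"
    using assms by (simp add: fourth_moment)
  also have "\<dots> = (real r * real s) ^ 5 * (2 / (real N * (real N + 1)))" by (simp add: eval_nat_numeral)
  also have "\<dots> \<le> (real r * real s) ^ 5 * (2 / (real N)\<^sup>2)"
    using N by (intro mult_left_mono divide_left_mono) (auto simp: power2_eq_square)
  finally show "expectation (\<lambda>\<omega>. corner_norm r s (?X \<omega>) ^ 4) \<le> 2 * (real r * real s) ^ 5 / (real N)\<^sup>2" by (simp add: mult.commute)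
qed

lemma (in prob_space) markov_power4:
  assumes "integrable M (\<lambda>\<omega>. Z \<omega> ^ 4)" "c > 0"
  shows "prob {\<omega> \<in> space M. c \<le> Z \<omega> ^ 4} \<le> expectation (\<lambda>\<omega>. Z \<omega> ^ 4) / (c :: real)"
  using integral_Markov_inequality_measure[OF assms(1), of "{}" c] assms(2) by simp

text \<open>On the event that the corner is small, \<open>G\<close> is bounded by \<open>C e\<^sup>4\<close>, where \<open>e\<close> is the norm of the
  corner and \<open>E e\<^sup>4\<close> is of order \<open>N\<^bsup>-2\<^esup>\<close>. Both the probability that \<open>e \<ge> \<eta>\<close> and the probability that
  \<open>N\<^bsup>3/2\<^esup> C e\<^sup>4 \<ge> \<delta>\<close> are bounded by Markov's inequality.\<close>

lemma remainder_in_probability: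
  fixes G :: "(nat \<Rightarrow> nat \<Rightarrow> complex) \<Rightarrow> complex"
  assumes H: "\<And>n. n \<ge> 1 \<Longrightarrow> haar_matrix M n (U n)"
    and O: "G \<in> O[corner_filter r s](\<lambda>X. complex_of_real (corner_norm r s X ^ 4))"
    and \<delta>: "\<delta> > 0"
  shows "(\<lambda>n. measure M {\<omega> \<in> space M. \<delta> \<le> cmod (G (\<lambda>i j. U n \<omega> $$ (i, j)) * complex_of_real (real n powr (3 / 2)))}) \<longlonglongrightarrow> 0"
proof -
  interpret prob_space M using H[of 1] by (simp add: haar_matrix_def)
  obtain C where C: "C > 0" "eventually (\<lambda>X. norm (G X) \<le> C * norm (complex_of_real (corner_norm r s X ^ 4))) (corner_filter r s)"
    using O by (auto elim!: landau_o.bigE)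
  then obtain \<eta> where \<eta>: "\<eta> > 0" "\<And>X. corner_norm r s X < \<eta> \<Longrightarrow> norm (G X) \<le> C * corner_norm r s X ^ 4"
    using corner_norm_nonneg by (auto simp: eventually_corner_filter norm_power)
  let ?Z = "\<lambda>n \<omega>. corner_norm r s (\<lambda>i j. U n \<omega> $$ (i, j))"
  let ?K = "2 * (real r * real s) ^ 5"
  have bound: "measure M {\<omega> \<in> space M. \<delta> \<le> cmod (G (\<lambda>i j. U n \<omega> $$ (i, j)) * complex_of_real (real n powr (3 / 2)))}
      \<le> ?K / \<eta> ^ 4 * (1 / (real n)\<^sup>2) + ?K * C / \<delta> * (1 / real n powr (1 / 2))"
    if n: "n \<ge> Suc (max r s)" for n
  proof -
    interpret h: haar_matrix M n "U n" using n by (intro H) simp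
    have rs: "r \<le> n" "s \<le> n" using n by auto
    let ?c = "\<delta> / (C * real n powr (3 / 2))"
    have n0: "real n > 0" using n by simp
    have c0: "?c > 0" using C \<delta> n by simp
    note int = h.corner_norm_moment(1)[OF rs] and mom = h.corner_norm_moment(2)[OF rs]
    have mZ [measurable]: "(\<lambda>\<omega>. ?Z n \<omega> ^ 4) \<in> borel_measurable M" by (rule borel_measurable_integrable[OF int])
    have "prob {\<omega> \<in> space M. \<delta> \<le> cmod (G (\<lambda>i j. U n \<omega> $$ (i, j)) * complex_of_real (real n powr (3 / 2)))}
        \<le> prob ({\<omega> \<in> space M. \<eta> ^ 4 \<le> ?Z n \<omega> ^ 4} \<union> {\<omega> \<in> space M. ?c \<le> ?Z n \<omega> ^ 4})"
    proof (rule finite_measure_mono)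
      show "{\<omega> \<in> space M. \<delta> \<le> cmod (G (\<lambda>i j. U n \<omega> $$ (i, j)) * complex_of_real (real n powr (3 / 2)))}
        \<subseteq> {\<omega> \<in> space M. \<eta> ^ 4 \<le> ?Z n \<omega> ^ 4} \<union> {\<omega> \<in> space M. ?c \<le> ?Z n \<omega> ^ 4}"
      proof safe
        fix \<omega> assume w: "\<delta> \<le> cmod (G (\<lambda>i j. U n \<omega> $$ (i, j)) * complex_of_real (real n powr (3 / 2)))"
          and not: "\<not> ?c \<le> ?Z n \<omega> ^ 4"
        show "\<eta> ^ 4 \<le> ?Z n \<omega> ^ 4"
        proof (cases "?Z n \<omega> < \<eta>")
          case True
          have "\<delta> \<le> cmod (G (\<lambda>i j. U n \<omega> $$ (i, j))) * real n powr (3 / 2)" using w by (simp add: norm_mult)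
          also have "\<dots> \<le> (C * ?Z n \<omega> ^ 4) * real n powr (3 / 2)" by (intro mult_right_mono \<eta>(2)[OF True]) simp
          finally have "?c \<le> ?Z n \<omega> ^ 4" using C n0 by (simp add: field_simps)
          then show ?thesis using not by simp
        next
          case False
          then show ?thesis using \<eta>(1) by (intro power_mono) auto
        qed
      qed
    qed measurable
    also have "\<dots> \<le> prob {\<omega> \<in> space M. \<eta> ^ 4 \<le> ?Z n \<omega> ^ 4} + prob {\<omega> \<in> space M. ?c \<le> ?Z n \<omega> ^ 4}"
      by (intro measure_Un_le) measurable
    also have "\<dots> \<le> expectation (\<lambda>\<omega>. ?Z n \<omega> ^ 4) / \<eta> ^ 4 + expectation (\<lambda>\<omega>. ?Z n \<omega> ^ 4) / ?c"
      using int c0 \<eta>(1) by (intro add_mono markov_power4) auto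
    also have "\<dots> \<le> (?K / (real n)\<^sup>2) / \<eta> ^ 4 + (?K / (real n)\<^sup>2) / ?c"
      using c0 \<eta>(1) by (intro add_mono divide_right_mono mom) auto
    also have "(?K / (real n)\<^sup>2) / ?c = ?K * C / \<delta> * (real n powr (3 / 2) / (real n)\<^sup>2)" by (simp add: mult_ac)
    also have "real n powr (3 / 2) / (real n)\<^sup>2 = 1 / real n powr (1 / 2)"
    proof -
      have "real n powr (3 / 2) * real n powr (1 / 2) = (real n)\<^sup>2" using n0 by (simp add: powr_add[symmetric] powr_numeral)
      then show ?thesis using n0 by (simp add: field_simps)
    qed
    finally show ?thesis by (simp add: mult.commute)
  qed
  have "(\<lambda>n. ?K / \<eta> ^ 4 * (1 / (real n)\<^sup>2) + ?K * C / \<delta> * (1 / real n powr (1 / 2))) \<longlonglongrightarrow> ?K / \<eta> ^ 4 * 0 + ?K * C / \<delta> * 0"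
    by (intro tendsto_intros) real_asymp+
  then have lim: "(\<lambda>n. ?K / \<eta> ^ 4 * (1 / (real n)\<^sup>2) + ?K * C / \<delta> * (1 / real n powr (1 / 2))) \<longlonglongrightarrow> 0" by simp
  show ?thesis
    by (rule Lim_null_comparison[OF _ lim])
      (use bound in \<open>auto simp: eventually_sequentially intro!: exI[of _ "Suc (max r s)"]\<close>)
qed

lemma conv_in_law_offset:
  "conv_in_law T (\<lambda>n. \<mu> (n + k)) \<nu> \<Longrightarrow> conv_in_law T \<mu> \<nu>"
  unfolding conv_in_law_def by (blast intro: LIMSEQ_offset[of _ k])

lemma haar_squared_moduli_conv_in_law:
  fixes U :: "nat \<Rightarrow> 'w \<Rightarrow> complex mat"
  assumes H: "\<And>n. n \<ge> 1 \<Longrightarrow> haar_matrix M n (U n)"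
  shows "conv_in_law (product_topology (\<lambda>_. euclideanreal) ({..<r} \<times> {..<s}))
       (\<lambda>N. distr M (Pi\<^sub>M ({..<r} \<times> {..<s}) (\<lambda>_. borel))
          (\<lambda>\<omega>. \<lambda>(i, j)\<in>{..<r} \<times> {..<s}.
             (cmod (complex_of_real (sqrt (real N)) * U N \<omega> $$ (i, j)))\<^sup>2))
       (Pi\<^sub>M ({..<r} \<times> {..<s}) (\<lambda>_. exponential_law))"
proof (rule conv_in_law_offset)
  let ?I = "{..<r} \<times> {..<s}" and ?n0 = "Suc (max r s)"
  let ?B = "Pi\<^sub>M ?I (\<lambda>_. borel :: real measure)"
  define V where "V n \<omega> = (\<lambda>(i, j)\<in>?I. (cmod (complex_of_real (sqrt (real (n + ?n0))) * U (n + ?n0) \<omega> $$ (i, j)))\<^sup>2)" for n \<omega>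
  let ?\<nu> = "Pi\<^sub>M ?I (\<lambda>_. exponential_law)"
  interpret M: prob_space M using H[of 1] by (simp add: haar_matrix_def)
  have V_eq: "V n \<omega> p = (cmod (complex_of_real (sqrt (real (n + ?n0))) * U (n + ?n0) \<omega> $$ p))\<^sup>2" if "p \<in> ?I" for n \<omega> p
    using that by (cases p) (simp add: V_def)
  have Vm: "V n \<in> M \<rightarrow>\<^sub>M ?B" for n
  proof (rule measurable_PiM_single')
    fix p assume p: "p \<in> ?I"
    interpret h: haar_matrix M "n + ?n0" "U (n + ?n0)" by (rule H) simp
    have m: "(\<lambda>\<omega>. U (n + ?n0) \<omega> $$ p) \<in> borel_measurable M"
      using p h.U_entry_measurable[of "fst p" "snd p"] by auto
    have "(\<lambda>\<omega>. (cmod (complex_of_real (sqrt (real (n + ?n0))) * U (n + ?n0) \<omega> $$ p))\<^sup>2) \<in> borel_measurable M"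
      by (intro borel_measurable_power measurable_compose[OF _ borel_measurable_norm] borel_measurable_times borel_measurable_const m)
    then show "(\<lambda>\<omega>. V n \<omega> p) \<in> borel_measurable M" by (simp only: V_eq[OF p])
  next
    have "V n \<omega> \<in> extensional ?I" for \<omega> by (simp only: V_def restrict_extensional)
    then show "V n \<in> space M \<rightarrow> (\<Pi>\<^sub>E p\<in>?I. space borel)" by (simp only: PiE_def space_borel Pi_UNIV Int_UNIV_left Pi_iff ball_simps simp_thms) simp
  qed
  have sexp: "sets exponential_law = sets borel" by (simp add: exponential_law_def)
  have sB: "sets ?\<nu> = sets ?B" by (intro sets_PiM_cong refl sexp)
  interpret e: prob_space exponential_law by (rule prob_space_exponential_law)
  have lim: "(\<lambda>n. \<integral>\<omega>. exp (- (\<Sum>p\<in>?I. real (k p) * (cmod (complex_of_real (sqrt (n + ?n0)) * U (n + ?n0) \<omega> $$ p))\<^sup>2)) \<partial>M)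
    \<longlonglongrightarrow> (\<Prod>p\<in>?I. 1 / (1 + real (k p)))" for k :: "nat \<times> nat \<Rightarrow> nat"
    by (rule LIMSEQ_ignore_initial_segment[OF haar_laplace_limit[OF H]])
  have expm: "(\<lambda>x. exp (- (\<Sum>i\<in>?I. real (k i) * x i))) \<in> borel_measurable ?B" for k :: "nat \<times> nat \<Rightarrow> nat"
    by measurable
  interpret L: laplace_convergence ?I "\<lambda>n. distr M ?B (V n)" ?\<nu>
  proof (rule laplace_convergence.intro, goal_cases)
    case 1 show ?case by simp
  next
    case (4 n) show ?case by simp
  next
    case 5 show ?case by (rule sB)
  next
    case (2 n) show ?case by (rule M.prob_space_distr[OF Vm])
  next
    case 3 show ?case by (intro prob_space_PiM e.prob_space_axioms)
  next
    case (6 n) show ?case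
    proof (subst AE_distr_iff[OF Vm])
      show "AE \<omega> in M. \<forall>i\<in>?I. 0 \<le> V n \<omega> i" by (auto simp: V_eq)
      show "{x \<in> space ?B. \<forall>i\<in>?I. 0 \<le> x i} \<in> sets ?B" by measurable
    qed
  next
    case 7 show ?case
      by (intro AE_finite_allI AE_PiM_component e.prob_space_axioms AE_exponential_law_nonneg) auto
  next
    case (8 k) show ?case
      using lim[of k] by (simp add: integral_distr[OF Vm expm] V_eq integral_exponential_law_product)
  qed
  show "conv_in_law (product_topology (\<lambda>_. euclideanreal) ?I)
       (\<lambda>n. distr M ?B (\<lambda>\<omega>. \<lambda>(i, j)\<in>?I. (cmod (complex_of_real (sqrt (real (n + ?n0))) * U (n + ?n0) \<omega> $$ (i, j)))\<^sup>2)) ?\<nu>"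
    using L.conv_in_law_laplace unfolding V_def[abs_def] .
qed

lemma haar_corner_eigenvalues:
  fixes U :: "nat \<Rightarrow> 'w \<Rightarrow> complex mat"
  assumes H: "\<And>n. n \<ge> 1 \<Longrightarrow> haar_matrix M n (U n)" and P0: "nc_eval P 0 0 = 0"
  shows "AE \<omega> in M. \<forall>N\<ge>r + s. nontrivial_eigenvalues P r s \<alpha> \<beta> N (U N \<omega>) =
      proots (corner_char_poly P r s \<alpha> \<beta> (\<lambda>i j. U N \<omega> $$ (i, j)))"
    and "AE \<omega> in M. \<forall>k<r + s. (\<lambda>N. corner_eigenvalue P r s \<alpha> \<beta> k (\<lambda>i j. U N \<omega> $$ (i, j)))
      \<longlonglongrightarrow> limit_eigenvalues P r s \<alpha> \<beta> ! k"
proof -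
  interpret M: prob_space M using H[of 1] by (simp add: haar_matrix_def)
  have "AE \<omega> in M. N \<ge> r + s \<longrightarrow> nontrivial_eigenvalues P r s \<alpha> \<beta> N (U N \<omega>) =
      proots (corner_char_poly P r s \<alpha> \<beta> (\<lambda>i j. U N \<omega> $$ (i, j)))" for N
  proof (cases "r + s \<le> N \<and> N \<ge> 1")
    case True
    then interpret h: haar_matrix M N "U N" by (intro H) simp
    have "AE \<omega> in M. Determinant.det (Matrix.mat s s (\<lambda>(i, j). U N \<omega> $$ (N - s + i, j))) \<noteq> 0"
      using True by (intro h.AE_minor_nonzero) (auto simp: inj_on_def)
    then show ?thesis
      using AE_space
      by eventually_elim (use True h.U_unitary in \<open>auto intro!: nontrivial_eigenvalues_eq_proots_corner\<close>)
  next
    case False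
    \<comment> \<open>For \<open>N = 0\<close>, where \<open>U 0\<close> is arbitrary, \<open>r + s \<le> N\<close> forces \<open>r + s = 0\<close>, and both polynomials are \<open>1\<close>.\<close>
    have deg0: "proots p = {#}" if "degree p = 0" "lead_coeff p = 1" for p :: "complex poly"
      using that by (auto elim!: degree_eq_zeroE)
    have "r + s = 0 \<or> \<not> r + s \<le> N" using False by linarith
    then show ?thesis
    proof
      assume 0: "r + s = 0"
      have "upper_left_block (r + s) T \<in> carrier_mat 0 0" for T
        using 0 by (simp add: upper_left_block_def)
      from degree_monic_char_poly[OF this]
      have cp: "degree (char_poly (upper_left_block (r + s) T)) = 0" "lead_coeff (char_poly (upper_left_block (r + s) T)) = 1" for T
        by simp_all
      have "nontrivial_eigenvalues P r s \<alpha> \<beta> N (U N \<omega>) = {#}" for \<omega>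
        unfolding nontrivial_eigenvalues_def by (rule deg0[OF cp])
      moreover have "proots (corner_char_poly P r s \<alpha> \<beta> X) = {#}" for X
        by (rule deg0) (use corner_char_poly_monic[of P r s \<alpha> \<beta> X] 0 in simp_all)
      ultimately show ?thesis by simp
    qed auto
  qed
  then show "AE \<omega> in M. \<forall>N\<ge>r + s. nontrivial_eigenvalues P r s \<alpha> \<beta> N (U N \<omega>) =
      proots (corner_char_poly P r s \<alpha> \<beta> (\<lambda>i j. U N \<omega> $$ (i, j)))"
    by (simp add: AE_all_countable)
  have "AE \<omega> in M. \<forall>i j. (\<lambda>N. U N \<omega> $$ (i, j)) \<longlonglongrightarrow> 0"
    using AE_haar_entry_tendsto_0[OF H] by (simp add: AE_all_countable)
  then show "AE \<omega> in M. \<forall>k<r + s. (\<lambda>N. corner_eigenvalue P r s \<alpha> \<beta> k (\<lambda>i j. U N \<omega> $$ (i, j)))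
      \<longlonglongrightarrow> limit_eigenvalues P r s \<alpha> \<beta> ! k"
  proof eventually_elim
    case (elim \<omega>)
    have "filterlim (\<lambda>N i j. U N \<omega> $$ (i, j)) (corner_filter r s) sequentially"
      using elim by (intro filterlim_corner_filter) auto
    then show ?case by (intro allI impI filterlim_compose[OF corner_eigenvalue_tendsto[OF P0]])
  qed
qed

lemma second_order_remainder:
  fixes U :: "nat \<Rightarrow> 'w \<Rightarrow> complex mat"
  assumes H: "\<And>n. n \<ge> 1 \<Longrightarrow> haar_matrix M n (U n)" and P0: "nc_eval P 0 0 = 0"
    and dist: "distinct (limit_eigenvalues P r s \<alpha> \<beta>)" and k: "k < r + s"
  defines "\<xi> \<equiv> \<lambda>N \<omega>. (corner_eigenvalue P r s \<alpha> \<beta> k (\<lambda>i j. U N \<omega> $$ (i, j)) -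
      (limit_eigenvalues P r s \<alpha> \<beta> ! k + second_order_shift P r s \<alpha> \<beta> k (\<lambda>i j. U N \<omega> $$ (i, j)))) *
      complex_of_real (real N powr (3 / 2))"
  shows "\<And>N. N \<ge> r + s \<Longrightarrow> \<xi> N \<in> borel_measurable M"
    and "conv_in_law euclidean (\<lambda>N. distr M borel (\<xi> N)) (return borel 0)"
proof -
  show m: "\<xi> N \<in> borel_measurable M" if "N \<ge> r + s" for N
  proof -
    interpret h: haar_matrix M N "U N" using that k by (intro H) simp
    have e: "(\<lambda>\<omega>. U N \<omega> $$ (i, j)) \<in> borel_measurable M" if "i < r" "j < s" for i j
      using that \<open>N \<ge> r + s\<close> by (intro h.U_entry_measurable) auto
    have c: "(\<lambda>\<omega>. complex_of_real ((cmod (U N \<omega> $$ (i, j)))\<^sup>2)) \<in> borel_measurable M" if "i < r" "j < s" for i j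
      by (rule measurable_compose[OF e[OF that]]) (intro borel_measurable_continuous_onI continuous_intros)
    have "(\<lambda>\<omega>. second_order_shift P r s \<alpha> \<beta> k (\<lambda>i j. U N \<omega> $$ (i, j))) \<in> borel_measurable M"
      unfolding second_order_shift_def
      by (cases "k < r"; simp only: if_True if_False)
        (intro borel_measurable_sum borel_measurable_times borel_measurable_const c; use k in auto)+
    then show ?thesis
      unfolding \<xi>_def using e k
      by (intro borel_measurable_times borel_measurable_diff borel_measurable_add borel_measurable_const
          corner_eigenvalue_measurable) auto
  qed
  show "conv_in_law euclidean (\<lambda>N. distr M borel (\<xi> N)) (return borel 0)"
  proof (rule conv_in_law_of_conv_in_probability)
    show "prob_space M" using H[of 1] by (simp add: haar_matrix_def)
    show "(\<lambda>n. measure M {\<omega> \<in> space M. \<delta> \<le> cmod (\<xi> n \<omega>)}) \<longlonglongrightarrow> 0" if "\<delta> > 0" for \<delta>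
      unfolding \<xi>_def
      by (rule remainder_in_probability[OF H corner_eigenvalue_second_order[OF P0 dist k] that])
  qed (rule m)
qed

theorem theorem1p3:
  fixes P :: nc_poly
    and r s :: nat
    and \<alpha> \<beta> :: "nat \<Rightarrow> complex"
    and M :: "'w measure"
    and U :: "nat \<Rightarrow> 'w \<Rightarrow> complex mat"
  assumes P0: "nc_eval P 0 0 = 0"
    and alpha: "\<And>i. i < r \<Longrightarrow> \<alpha> i \<noteq> 0"
    and beta: "\<And>j. j < s \<Longrightarrow> \<beta> j \<noteq> 0"
    and M: "prob_space M"
    and U: "\<And>N. N \<ge> 1 \<Longrightarrow> haar_unitary M N (U N)"
  shows
    "\<exists>lam mu :: nat \<Rightarrow> nat \<Rightarrow> 'w \<Rightarrow> complex.
       (\<forall>N\<ge>r + s. (\<forall>i<r. lam i N \<in> borel_measurable M) \<and> (\<forall>j<s. mu j N \<in> borel_measurable M)) \<and>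
       (AE \<omega> in M.
          (\<forall>N\<ge>r + s. nontrivial_eigenvalues P r s \<alpha> \<beta> N (U N \<omega>) =
             image_mset (\<lambda>i. lam i N \<omega>) (mset_set {..<r}) +
             image_mset (\<lambda>j. mu j N \<omega>) (mset_set {..<s})) \<and>
          (\<forall>i<r. (\<lambda>N. lam i N \<omega>) \<longlonglongrightarrow> nc_P1 P (\<alpha> i)) \<and>
          (\<forall>j<s. (\<lambda>N. mu j N \<omega>) \<longlonglongrightarrow> nc_Q1 P (\<beta> j))) \<and>
       (inj_on (\<lambda>i. nc_P1 P (\<alpha> i)) {..<r} \<and> inj_on (\<lambda>j. nc_Q1 P (\<beta> j)) {..<s} \<and>
        (\<forall>i<r. \<forall>j<s. nc_P1 P (\<alpha> i) \<noteq> nc_Q1 P (\<beta> j)) \<longrightarrow>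
        (\<exists>\<xi> \<zeta> :: nat \<Rightarrow> nat \<Rightarrow> 'w \<Rightarrow> complex.
           (\<forall>N\<ge>r + s. (\<forall>i<r. \<xi> i N \<in> borel_measurable M) \<and> (\<forall>j<s. \<zeta> j N \<in> borel_measurable M)) \<and>
           (AE \<omega> in M. \<forall>N\<ge>r + s.
              (\<forall>i<r. lam i N \<omega> = nc_P1 P (\<alpha> i)
                 + 1 / of_nat N * (\<Sum>j<s. coef_p P (\<alpha> i) (\<beta> j) *
                     complex_of_real ((cmod (complex_of_real (sqrt (real N)) * U N \<omega> $$ (i, j)))\<^sup>2))
                 + \<xi> i N \<omega> / complex_of_real (real N powr (3 / 2))) \<and>
              (\<forall>j<s. mu j N \<omega> = nc_Q1 P (\<beta> j)
                 + 1 / of_nat N * (\<Sum>i<r. coef_q P (\<alpha> i) (\<beta> j) *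
                     complex_of_real ((cmod (complex_of_real (sqrt (real N)) * U N \<omega> $$ (i, j)))\<^sup>2))
                 + \<zeta> j N \<omega> / complex_of_real (real N powr (3 / 2)))) \<and>
           (\<forall>i<r. \<exists>\<nu> :: complex measure. prob_space \<nu> \<and> sets \<nu> = sets borel \<and>
              conv_in_law euclidean (\<lambda>N. distr M borel (\<xi> i N)) \<nu>) \<and>
           (\<forall>j<s. \<exists>\<nu> :: complex measure. prob_space \<nu> \<and> sets \<nu> = sets borel \<and>
              conv_in_law euclidean (\<lambda>N. distr M borel (\<zeta> j N)) \<nu>))) \<and>
     conv_in_law (product_topology (\<lambda>_. euclideanreal) ({..<r} \<times> {..<s}))
       (\<lambda>N. distr M (Pi\<^sub>M ({..<r} \<times> {..<s}) (\<lambda>_. borel))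
          (\<lambda>\<omega>. \<lambda>(i, j)\<in>{..<r} \<times> {..<s}.
             (cmod (complex_of_real (sqrt (real N)) * U N \<omega> $$ (i, j)))\<^sup>2))
       (Pi\<^sub>M ({..<r} \<times> {..<s}) (\<lambda>_. exponential_law))"
proof -
  have H: "haar_matrix M n (U n)" if "n \<ge> 1" for n
    using that M U by (simp add: haar_matrix_def haar_matrix_axioms_def)
  let ?X = "\<lambda>N \<omega> i j. U N \<omega> $$ (i, j)"
  let ?t = "limit_eigenvalues P r s \<alpha> \<beta>"
  define lam where "lam i N \<omega> = corner_eigenvalue P r s \<alpha> \<beta> i (?X N \<omega>)" for i N \<omega>
  define mu where "mu j N \<omega> = corner_eigenvalue P r s \<alpha> \<beta> (r + j) (?X N \<omega>)" for j N \<omega>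
  have meas: "(\<lambda>\<omega>. corner_eigenvalue P r s \<alpha> \<beta> k (?X N \<omega>)) \<in> borel_measurable M" if "N \<ge> r + s" "k < r + s" for N k
  proof -
    interpret h: haar_matrix M N "U N" using that by (intro H) simp
    show ?thesis using that by (intro corner_eigenvalue_measurable h.U_entry_measurable) auto
  qed
  have part1: "\<forall>N\<ge>r + s. (\<forall>i<r. lam i N \<in> borel_measurable M) \<and> (\<forall>j<s. mu j N \<in> borel_measurable M)"
    unfolding lam_def[abs_def] mu_def[abs_def] by (auto intro!: meas)
  have part2: "AE \<omega> in M.
          (\<forall>N\<ge>r + s. nontrivial_eigenvalues P r s \<alpha> \<beta> N (U N \<omega>) =
             image_mset (\<lambda>i. lam i N \<omega>) (mset_set {..<r}) +
             image_mset (\<lambda>j. mu j N \<omega>) (mset_set {..<s})) \<and>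
          (\<forall>i<r. (\<lambda>N. lam i N \<omega>) \<longlonglongrightarrow> nc_P1 P (\<alpha> i)) \<and>
          (\<forall>j<s. (\<lambda>N. mu j N \<omega>) \<longlonglongrightarrow> nc_Q1 P (\<beta> j))"
  proof -
    have "AE \<omega> in M. \<forall>N\<ge>r + s. nontrivial_eigenvalues P r s \<alpha> \<beta> N (U N \<omega>) =
        proots (corner_char_poly P r s \<alpha> \<beta> (?X N \<omega>))"
      by (rule haar_corner_eigenvalues(1)[OF H P0])
    moreover have "AE \<omega> in M. \<forall>k<r + s. (\<lambda>N. corner_eigenvalue P r s \<alpha> \<beta> k (?X N \<omega>)) \<longlonglongrightarrow> ?t ! k"
      by (rule haar_corner_eigenvalues(2)[OF H P0])
    ultimately show ?thesis
  proof eventually_elim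
    case (elim \<omega>)
    have "(\<lambda>N. lam i N \<omega>) \<longlonglongrightarrow> nc_P1 P (\<alpha> i)" if "i < r" for i
      using elim(2)[rule_format, of i] that by (simp add: lam_def nth_limit_eigenvalues)
    moreover have "(\<lambda>N. mu j N \<omega>) \<longlonglongrightarrow> nc_Q1 P (\<beta> j)" if "j < s" for j
      using elim(2)[rule_format, of "r + j"] that by (simp add: mu_def nth_limit_eigenvalues)
    moreover have "nontrivial_eigenvalues P r s \<alpha> \<beta> N (U N \<omega>) =
        image_mset (\<lambda>i. lam i N \<omega>) (mset_set {..<r}) + image_mset (\<lambda>j. mu j N \<omega>) (mset_set {..<s})"
      if "N \<ge> r + s" for N
      using elim(1) that proots_corner_char_poly by (simp add: lam_def mu_def)
    ultimately show ?case by blast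
  qed
  qed
  have part3: "\<exists>\<xi> \<zeta> :: nat \<Rightarrow> nat \<Rightarrow> 'w \<Rightarrow> complex.
           (\<forall>N\<ge>r + s. (\<forall>i<r. \<xi> i N \<in> borel_measurable M) \<and> (\<forall>j<s. \<zeta> j N \<in> borel_measurable M)) \<and>
           (AE \<omega> in M. \<forall>N\<ge>r + s.
              (\<forall>i<r. lam i N \<omega> = nc_P1 P (\<alpha> i)
                 + 1 / of_nat N * (\<Sum>j<s. coef_p P (\<alpha> i) (\<beta> j) *
                     complex_of_real ((cmod (complex_of_real (sqrt (real N)) * U N \<omega> $$ (i, j)))\<^sup>2))
                 + \<xi> i N \<omega> / complex_of_real (real N powr (3 / 2))) \<and>
              (\<forall>j<s. mu j N \<omega> = nc_Q1 P (\<beta> j)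
                 + 1 / of_nat N * (\<Sum>i<r. coef_q P (\<alpha> i) (\<beta> j) *
                     complex_of_real ((cmod (complex_of_real (sqrt (real N)) * U N \<omega> $$ (i, j)))\<^sup>2))
                 + \<zeta> j N \<omega> / complex_of_real (real N powr (3 / 2)))) \<and>
           (\<forall>i<r. \<exists>\<nu> :: complex measure. prob_space \<nu> \<and> sets \<nu> = sets borel \<and>
              conv_in_law euclidean (\<lambda>N. distr M borel (\<xi> i N)) \<nu>) \<and>
           (\<forall>j<s. \<exists>\<nu> :: complex measure. prob_space \<nu> \<and> sets \<nu> = sets borel \<and>
              conv_in_law euclidean (\<lambda>N. distr M borel (\<zeta> j N)) \<nu>)"
    if inj: "inj_on (\<lambda>i. nc_P1 P (\<alpha> i)) {..<r} \<and> inj_on (\<lambda>j. nc_Q1 P (\<beta> j)) {..<s} \<and>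
        (\<forall>i<r. \<forall>j<s. nc_P1 P (\<alpha> i) \<noteq> nc_Q1 P (\<beta> j))"
  proof -
    have dist: "distinct ?t"
      using inj by (auto simp: limit_eigenvalues_def distinct_map lessThan_atLeast0)
    define \<Xi> where "\<Xi> k N \<omega> = (corner_eigenvalue P r s \<alpha> \<beta> k (?X N \<omega>) -
      (?t ! k + second_order_shift P r s \<alpha> \<beta> k (?X N \<omega>))) * complex_of_real (real N powr (3 / 2))" for k N \<omega>
    have Xm: "\<Xi> k N \<in> borel_measurable M" if "N \<ge> r + s" "k < r + s" for k N
      unfolding \<Xi>_def[abs_def] by (rule second_order_remainder(1)[OF H P0 dist that(2,1)])
    have Xc: "conv_in_law euclidean (\<lambda>N. distr M borel (\<Xi> k N)) (return borel 0)" if "k < r + s" for k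
      unfolding \<Xi>_def[abs_def] by (rule second_order_remainder(2)[OF H P0 dist that])
    have scale: "1 / of_nat N * (\<Sum>j<m. c j * complex_of_real ((cmod (complex_of_real (sqrt (real N)) * u j))\<^sup>2)) =
        (\<Sum>j<m. c j * complex_of_real ((cmod (u j))\<^sup>2))" if "N \<ge> 1" for N m and c u :: "nat \<Rightarrow> complex"
      using that by (simp add: sum_distrib_left norm_mult power_mult_distrib)
    have ev: "corner_eigenvalue P r s \<alpha> \<beta> k (?X N \<omega>) = ?t ! k + second_order_shift P r s \<alpha> \<beta> k (?X N \<omega>)
        + \<Xi> k N \<omega> / complex_of_real (real N powr (3 / 2))" if "N \<ge> 1" for k N \<omega>
      using that by (simp add: \<Xi>_def)
    have "lam i N \<omega> = nc_P1 P (\<alpha> i)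
                 + 1 / of_nat N * (\<Sum>j<s. coef_p P (\<alpha> i) (\<beta> j) *
                     complex_of_real ((cmod (complex_of_real (sqrt (real N)) * U N \<omega> $$ (i, j)))\<^sup>2))
                 + \<Xi> i N \<omega> / complex_of_real (real N powr (3 / 2))" if "N \<ge> r + s" "i < r" for i N \<omega>
    proof -
      have N: "N \<ge> 1" using that by simp
      show ?thesis unfolding lam_def scale[OF N]
        by (subst ev[OF N]) (use that in \<open>simp add: nth_limit_eigenvalues second_order_shift_def\<close>)
    qed
    moreover have "mu j N \<omega> = nc_Q1 P (\<beta> j)
                 + 1 / of_nat N * (\<Sum>i<r. coef_q P (\<alpha> i) (\<beta> j) *
                     complex_of_real ((cmod (complex_of_real (sqrt (real N)) * U N \<omega> $$ (i, j)))\<^sup>2))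
                 + \<Xi> (r + j) N \<omega> / complex_of_real (real N powr (3 / 2))" if "N \<ge> r + s" "j < s" for j N \<omega>
    proof -
      have N: "N \<ge> 1" using that by simp
      show ?thesis unfolding mu_def scale[OF N]
        by (subst ev[OF N]) (use that in \<open>simp add: nth_limit_eigenvalues second_order_shift_def\<close>)
    qed
    moreover have "\<exists>\<nu> :: complex measure. prob_space \<nu> \<and> sets \<nu> = sets borel \<and>
        conv_in_law euclidean (\<lambda>N. distr M borel (\<Xi> k N)) \<nu>" if "k < r + s" for k
      using Xc[OF that] by (intro exI[of _ "return borel 0"]) (simp add: prob_space_return)
    ultimately show ?thesis
      using Xm by (intro exI[of _ \<Xi>] exI[of _ "\<lambda>j. \<Xi> (r + j)"]) auto
  qed
  show ?thesis
    by (rule exI[of _ lam], rule exI[of _ mu], intro conjI[OF part1 conjI[OF part2 conjI]] impI)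
      (erule part3, rule haar_squared_moduli_conv_in_law[OF H])
qed

end
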